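(* The inclusion 2-functor $j\colon\mathbf{Cat}\text{-}\mathbf{Multicat}\to\mathbf{Cat}\text{-}\mathbf{Multicat}^{\mathbf{ps}}$ admits a left 2-adjoint $\psi\colon\mathbf{Cat}\text{-}\mathbf{Multicat}^{\mathbf{ps}}\to\mathbf{Cat}\text{-}\mathbf{Multicat}$ with $\psi(\mathcal{M})=\mathcal{M}\times E\Sigma_*$ for every $\mathbf{Cat}$-multicategory $\mathcal{M}$. In particular, for all $\mathbf{Cat}$-multicategories $\mathcal{M}$ and $\mathcal{N}$ there is an isomorphism of categories $$\mathbf{Cat}\text{-}\mathbf{Multicat}^{\mathbf{ps}}(\mathcal{M},\mathcal{N})\cong\mathbf{Cat}\text{-}\mathbf{Multicat}(\mathcal{M}\times E\Sigma_*,\mathcal{N}).$$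
   Context: **Permutations.** $\Sigma_n$ is the symmetric group, with $\sigma\tau=\sigma\circ\tau$. For a sequence $\langle a\rangle=\langle a_1,\dots,a_n\rangle$ put $\langle a\rangle\sigma=\langle a_{\sigma(1)},\dots,a_{\sigma(n)}\rangle$. For $\sigma\in\Sigma_n$ and $\tau_i\in\Sigma_{k_i}$, $\sigma\langle\tau_1,\dots,\tau_n\rangle\in\Sigma_{k_1+\cdots+k_n}$ permutes the $n$ blocks of lengths $k_1,\dots,k_n$ according to $\sigma$ and each block according to $\tau_i$: it sends the $p$-th element of the $i$-th block (block lengths $k_1,\dots,k_n$) to the $\tau_i(p)$-th element of the $\sigma(i)$-th block (block lengths $k_{\sigma^{-1}(1)},\dots,k_{\sigma^{-1}(n)}$). **$\mathbf{Cat}$-multicategories** ($\mathbf{Cat}$ has the monoidal structure given by products). A $\mathbf{Cat}$-multicategory $\mathcal{M}$ has: a class of objects $\mathrm{Ob}(\mathcal{M})$; for all $n\ge 0$, $\langle a\rangle\in \mathrm{Ob}(\mathcal{M})^n$, $b\in\mathrm{Ob}(\mathcal{M})$ a category $\mathcal{M}(\langle a\rangle;b)$, whose objects $f\colon\langle a\rangle\to b$ are called ($n$-ary) 1-cells and whose morphisms are called ($n$-ary) 2-cells; for $\sigma\in\Sigma_n$ an isomorphism of categories $\mathcal{M}(\langle a\rangle;b)\to\mathcal{M}(\langle a\rangle\sigma;b)$, $f\mapsto f\sigma$ (and similarly on 2-cells); units $1_a\in\mathcal{M}(a;a)$; and composition functors $\gamma\colon\mathcal{M}(\langle b\rangle;c)\times\prod_{j=1}^n\mathcal{M}(\langle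 a_j\rangle;b_j)\to\mathcal{M}(\langle a_1\rangle,\dots,\langle a_n\rangle;c)$, where $\langle a_j\rangle$ has length $k_j\ge 0$ and the inputs are concatenated. These satisfy: $(f\sigma)\tau=f(\sigma\tau)$ and $f\,\mathrm{id}_n=f$; $\gamma$ is associative and unital; top equivariance $\gamma(f\sigma;\langle g_{\sigma(j)}\rangle)=\gamma(f;\langle g_j\rangle)\,\sigma\langle\mathrm{id}_{k_{\sigma(1)}},\dots,\mathrm{id}_{k_{\sigma(n)}}\rangle$; bottom equivariance $\gamma(f;\langle g_j\tau_j\rangle)=\gamma(f;\langle g_j\rangle)\,\mathrm{id}_n\langle\tau_1,\dots,\tau_n\rangle$ for $\tau_j\in\Sigma_{k_j}$ (all axioms on both 1-cells and 2-cells). A $\mathbf{Cat}$-operad is a $\mathbf{Cat}$-multicategory with one object $*$. **Symmetric $\mathbf{Cat}$-multifunctors.** A symmetric $\mathbf{Cat}$-multifunctor $F\colon\mathcal{M}\to\mathcal{N}$ is a function on objects together with functors $F\colon\mathcal{M}(\langle a\rangle;b)\to\mathcal{N}(\langle Fa\rangle;Fb)$ strictly preserving units, $\gamma$ and the symmetric group action. Composition is the evident one. **Pseudo symmetric $\mathbf{Cat}$-multifunctors.** A pseudo symmetric $\mathbf{Cat}$-multifunctor $F\colon\mathcal{M}\to\mathcal{N}$ is a function on objects together with functors $F\colon\mathcal{M}(\langle a\rangle;b)\to\mathcal{N}(\langle Fa\rangle;Fb)$ strictly preserving units and $\gamma$, and, for each $\sigma\in\Sigma_n$, $\langle a\rangle\in\mathrm{Ob}(\mathcal{M})^n$,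 $b\in\mathrm{Ob}(\mathcal{M})$, a natural isomorphism with components $F_{\sigma;f}\colon F(f\sigma)\to F(f)\sigma$ for $f\colon\langle a\rangle\to b$, such that: (1) $F_{\mathrm{id}_n;f}=1_{Ff}$; (2) $F_{\sigma\tau;f}=(F_{\sigma;f})\tau\circ F_{\tau;f\sigma}$; (3) $F_{\sigma\langle\mathrm{id}_{k_{\sigma(1)}},\dots,\mathrm{id}_{k_{\sigma(n)}}\rangle;\,\gamma(f;\langle g_j\rangle)}=\gamma(F_{\sigma;f};\langle 1_{Fg_{\sigma(j)}}\rangle_{j=1}^n)$ for $f\colon\langle b\rangle\to c$, $g_j\colon\langle a_j\rangle\to b_j$, where $k_j$ is the length of $\langle a_j\rangle$; (4) $F_{\mathrm{id}_n\langle\tau_1,\dots,\tau_n\rangle;\,\gamma(f;\langle g_j\rangle)}=\gamma(1_{Ff};\langle F_{\tau_j;g_j}\rangle)$ for $\tau_j\in\Sigma_{k_j}$. The composite $GF$ is given by composition on objects and component functors, with $(GF)_{\sigma;f}=G_{\sigma;Ff}\circ G(F_{\sigma;f})$. **Transformations.** For symmetric $F,G\colon\mathcal{M}\to\mathcal{N}$, a $\mathbf{Cat}$-multinatural transformation $\theta\colon F\Rightarrow G$ consists of 1-cells $\theta_a\colon Fa\to Ga$ in $\mathcal{N}$ for $a\in\mathrm{Ob}(\mathcal{M})$ such that $\gamma(Gf;\langle\theta_{a_j}\rangle)=\gamma(\theta_b;Ff)$ for all 1-cells $f\colon\langle a\rangle\to b$ and $\gamma(G\alpha;\langle1_{\theta_{a_j}}\rangle)=\gamma(1_{\theta_b};F\alpha)$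 for all 2-cells $\alpha$ of $\mathcal{M}(\langle a\rangle;b)$. For pseudo symmetric $F,G$, a pseudo symmetric $\mathbf{Cat}$-multinatural transformation is such data satisfying the same two conditions and, in addition, $\gamma(1_{\theta_b};F_{\sigma;f})=\gamma(G_{\sigma;f};\langle1_{\theta_{a_{\sigma(j)}}}\rangle)$ for all $f\colon\langle a\rangle\to b$ and $\sigma\in\Sigma_n$. In both cases vertical composition is $(\zeta\theta)_a=\gamma(\zeta_a;\theta_a)$, and for $\theta\colon F\Rightarrow G\colon\mathcal{M}\to\mathcal{N}$ and $\zeta\colon F'\Rightarrow G'\colon\mathcal{N}\to\mathcal{Q}$ horizontal composition is $(\zeta*\theta)_a=\gamma(\zeta_{Ga};F'\theta_a)$. **2-categories.** $\mathbf{Cat}\text{-}\mathbf{Multicat}$ has $\mathbf{Cat}$-multicategories as 0-cells, symmetric $\mathbf{Cat}$-multifunctors as 1-cells and $\mathbf{Cat}$-multinatural transformations as 2-cells. $\mathbf{Cat}\text{-}\mathbf{Multicat}^{\mathbf{ps}}$ has the same 0-cells, pseudo symmetric $\mathbf{Cat}$-multifunctors as 1-cells and pseudo symmetric $\mathbf{Cat}$-multinatural transformations as 2-cells. The inclusion $j$ is the identity on 0-cells, regards a symmetric $\mathbf{Cat}$-multifunctor as pseudo symmetric with identity isomorphisms $F_{\sigma;f}$, and is the identity on data of 2-cells. "Left 2-adjoint" is meant in the strict ($\mathbf{Cat}$-enriched) sense. **$E\Sigma_*$ and $\mathcal{M}\times E\Sigma_*$.** $E\Sigma_*$ (the Barratt–Eccles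 operad) is the $\mathbf{Cat}$-operad whose $n$-th category $E\Sigma_n$ has object set $\Sigma_n$ and exactly one morphism between any two objects; on objects the right $\Sigma_n$-action is right multiplication, $\gamma(\sigma;\langle\rho_i\rangle)=\sigma\langle\rho_1,\dots,\rho_n\rangle$, and the unit is $\mathrm{id}_1$. $\mathcal{M}\times E\Sigma_*$ is the product $\mathbf{Cat}$-multicategory: objects $(a,* )$ with $a\in\mathrm{Ob}(\mathcal{M})$, hom categories $\mathcal{M}(\langle a\rangle;b)\times E\Sigma_n$ for $\langle a\rangle$ of length $n$, and units, symmetric group action and $\gamma$ defined componentwise. *)

theory Defs
  imports "HOL-Combinatorics.Permutations" "HOL-Library.FuncSet"
begin

section \<open>Categories\<close>

record ('x, 'y) cat =
  Obj :: "'x set"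
  Arr :: "'y set"
  Dom :: "'y \<Rightarrow> 'x"
  Cod :: "'y \<Rightarrow> 'x"
  Idn :: "'x \<Rightarrow> 'y"
  Cmp :: "'y \<Rightarrow> 'y \<Rightarrow> 'y"  \<comment> \<open>\<open>Cmp C g f\<close> is \<open>g\<close> after \<open>f\<close>\<close>

locale category =
  fixes C :: "('x, 'y) cat"
  assumes Dom_Obj: "t \<in> Arr C \<Longrightarrow> Dom C t \<in> Obj C"
    and Cod_Obj: "t \<in> Arr C \<Longrightarrow> Cod C t \<in> Obj C"
    and Idn_Arr: "x \<in> Obj C \<Longrightarrow> Idn C x \<in> Arr C"
    and Dom_Idn: "x \<in> Obj C \<Longrightarrow> Dom C (Idn C x) = x"
    and Cod_Idn: "x \<in> Obj C \<Longrightarrow> Cod C (Idn C x) = x"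
    and Cmp_Arr: "\<lbrakk>s \<in> Arr C; t \<in> Arr C; Dom C s = Cod C t\<rbrakk> \<Longrightarrow> Cmp C s t \<in> Arr C"
    and Dom_Cmp: "\<lbrakk>s \<in> Arr C; t \<in> Arr C; Dom C s = Cod C t\<rbrakk> \<Longrightarrow> Dom C (Cmp C s t) = Dom C t"
    and Cod_Cmp: "\<lbrakk>s \<in> Arr C; t \<in> Arr C; Dom C s = Cod C t\<rbrakk> \<Longrightarrow> Cod C (Cmp C s t) = Cod C s"
    and Cmp_assoc: "\<lbrakk>r \<in> Arr C; s \<in> Arr C; t \<in> Arr C; Dom C r = Cod C s; Dom C s = Cod C t\<rbrakk>
      \<Longrightarrow> Cmp C (Cmp C r s) t = Cmp C r (Cmp C s t)"
    and Cmp_Idn_left: "t \<in> Arr C \<Longrightarrow> Cmp C (Idn C (Cod C t)) t = t"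
    and Cmp_Idn_right: "t \<in> Arr C \<Longrightarrow> Cmp C t (Idn C (Dom C t)) = t"

definition iso_arr :: "('x, 'y) cat \<Rightarrow> 'x \<Rightarrow> 'x \<Rightarrow> 'y \<Rightarrow> bool" where
  "iso_arr C x y t \<longleftrightarrow> t \<in> Arr C \<and> Dom C t = x \<and> Cod C t = y \<and>
     (\<exists>s\<in>Arr C. Dom C s = y \<and> Cod C s = x \<and> Cmp C s t = Idn C x \<and> Cmp C t s = Idn C y)"

locale cat_functor = C: category C + D: category D
  for C :: "('x, 'y) cat" and D :: "('u, 'v) cat" +
  fixes F :: "'x \<Rightarrow> 'u" and F' :: "'y \<Rightarrow> 'v"
  assumes map_Obj: "x \<in> Obj C \<Longrightarrow> F x \<in> Obj D"
    and map_Arr: "t \<in> Arr C \<Longrightarrow> F' t \<in> Arr D"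
    and map_Dom: "t \<in> Arr C \<Longrightarrow> Dom D (F' t) = F (Dom C t)"
    and map_Cod: "t \<in> Arr C \<Longrightarrow> Cod D (F' t) = F (Cod C t)"
    and map_Idn: "x \<in> Obj C \<Longrightarrow> F' (Idn C x) = Idn D (F x)"
    and map_Cmp: "\<lbrakk>s \<in> Arr C; t \<in> Arr C; Dom C s = Cod C t\<rbrakk>
      \<Longrightarrow> F' (Cmp C s t) = Cmp D (F' s) (F' t)"

definition cat_isomorphism ::
  "('x, 'y) cat \<Rightarrow> ('u, 'v) cat \<Rightarrow> ('x \<Rightarrow> 'u) \<Rightarrow> ('y \<Rightarrow> 'v) \<Rightarrow> bool" where
  "cat_isomorphism C D F F' \<longleftrightarrow> cat_functor C D F F' \<and>
     (\<exists>G G'. cat_functor D C G G' \<and>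
        (\<forall>x\<in>Obj C. G (F x) = x) \<and> (\<forall>t\<in>Arr C. G' (F' t) = t) \<and>
        (\<forall>u\<in>Obj D. F (G u) = u) \<and> (\<forall>v\<in>Arr D. F' (G' v) = v))"

definition isomorphic_cats :: "('x, 'y) cat \<Rightarrow> ('u, 'v) cat \<Rightarrow> bool" where
  "isomorphic_cats C D \<longleftrightarrow> (\<exists>F F'. cat_isomorphism C D F F')"

definition prod_cat :: "('x, 'y) cat \<Rightarrow> ('u, 'v) cat \<Rightarrow> ('x \<times> 'u, 'y \<times> 'v) cat" where
  "prod_cat C D = \<lparr>
     Obj = Obj C \<times> Obj D,
     Arr = Arr C \<times> Arr D,
     Dom = map_prod (Dom C) (Dom D),
     Cod = map_prod (Cod C) (Cod D),
     Idn = map_prod (Idn C) (Idn D),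
     Cmp = (\<lambda>(s, s') (t, t'). (Cmp C s t, Cmp D s' t'))\<rparr>"

definition list_prod_cat :: "('x, 'y) cat list \<Rightarrow> ('x list, 'y list) cat" where
  "list_prod_cat Cs = \<lparr>
     Obj = {xs. list_all2 (\<lambda>C x. x \<in> Obj C) Cs xs},
     Arr = {ts. list_all2 (\<lambda>C t. t \<in> Arr C) Cs ts},
     Dom = (\<lambda>ts. map2 Dom Cs ts),
     Cod = (\<lambda>ts. map2 Cod Cs ts),
     Idn = (\<lambda>xs. map2 Idn Cs xs),
     Cmp = (\<lambda>ss ts. map2 (\<lambda>C (s, t). Cmp C s t) Cs (zip ss ts))\<rparr>"


section \<open>Strict 2-categories, 2-functors and 2-adjunctions\<close>

text \<open>A 2-category is given as a Cat-enriched category: \<open>Hom\<close> assigns hom categories, and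
  \<open>Comp1 B A1 A2 A3\<close>, \<open>Comp2 B A1 A2 A3\<close> are the object and arrow parts of the composition functor
  \<open>Hom A2 A3 \<times> Hom A1 A2 \<rightarrow> Hom A1 A3\<close>.  Vertical composition of 2-cells is composition in \<open>Hom\<close>,
  horizontal composition is \<open>Comp2\<close>.\<close>

record ('a, 'f, 't) two_cat =
  Obj0 :: "'a set"
  Hom :: "'a \<Rightarrow> 'a \<Rightarrow> ('f, 't) cat"
  Unit1 :: "'a \<Rightarrow> 'f"
  Comp1 :: "'a \<Rightarrow> 'a \<Rightarrow> 'a \<Rightarrow> 'f \<Rightarrow> 'f \<Rightarrow> 'f"
  Comp2 :: "'a \<Rightarrow> 'a \<Rightarrow> 'a \<Rightarrow> 't \<Rightarrow> 't \<Rightarrow> 't"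

locale two_category =
  fixes B :: "('a, 'f, 't) two_cat"
  assumes Hom_category: "\<lbrakk>x \<in> Obj0 B; y \<in> Obj0 B\<rbrakk> \<Longrightarrow> category (Hom B x y)"
    and Unit1_Hom: "x \<in> Obj0 B \<Longrightarrow> Unit1 B x \<in> Obj (Hom B x x)"
    and Comp_functor: "\<lbrakk>x \<in> Obj0 B; y \<in> Obj0 B; z \<in> Obj0 B\<rbrakk> \<Longrightarrow>
      cat_functor (prod_cat (Hom B y z) (Hom B x y)) (Hom B x z)
        (\<lambda>(g, f). Comp1 B x y z g f) (\<lambda>(s, t). Comp2 B x y z s t)"
    and Comp1_assoc: "\<lbrakk>w \<in> Obj0 B; x \<in> Obj0 B; y \<in> Obj0 B; z \<in> Obj0 B;
        f \<in> Obj (Hom B w x); g \<in> Obj (Hom B x y); h \<in> Obj (Hom B y z)\<rbrakk> \<Longrightarrow>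
      Comp1 B w x z (Comp1 B x y z h g) f = Comp1 B w y z h (Comp1 B w x y g f)"
    and Comp2_assoc: "\<lbrakk>w \<in> Obj0 B; x \<in> Obj0 B; y \<in> Obj0 B; z \<in> Obj0 B;
        r \<in> Arr (Hom B w x); s \<in> Arr (Hom B x y); t \<in> Arr (Hom B y z)\<rbrakk> \<Longrightarrow>
      Comp2 B w x z (Comp2 B x y z t s) r = Comp2 B w y z t (Comp2 B w x y s r)"
    and Comp1_unit_left: "\<lbrakk>x \<in> Obj0 B; y \<in> Obj0 B; f \<in> Obj (Hom B x y)\<rbrakk> \<Longrightarrow>
      Comp1 B x y y (Unit1 B y) f = f"
    and Comp1_unit_right: "\<lbrakk>x \<in> Obj0 B; y \<in> Obj0 B; f \<in> Obj (Hom B x y)\<rbrakk> \<Longrightarrow>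
      Comp1 B x x y f (Unit1 B x) = f"
    and Comp2_unit_left: "\<lbrakk>x \<in> Obj0 B; y \<in> Obj0 B; t \<in> Arr (Hom B x y)\<rbrakk> \<Longrightarrow>
      Comp2 B x y y (Idn (Hom B y y) (Unit1 B y)) t = t"
    and Comp2_unit_right: "\<lbrakk>x \<in> Obj0 B; y \<in> Obj0 B; t \<in> Arr (Hom B x y)\<rbrakk> \<Longrightarrow>
      Comp2 B x x y t (Idn (Hom B x x) (Unit1 B x)) = t"

record ('a, 'f, 't, 'b, 'g, 's) two_fun =
  on0 :: "'a \<Rightarrow> 'b"
  on1 :: "'a \<Rightarrow> 'a \<Rightarrow> 'f \<Rightarrow> 'g"
  on2 :: "'a \<Rightarrow> 'a \<Rightarrow> 't \<Rightarrow> 's"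

locale two_functor = C: two_category C + D: two_category D
  for C :: "('a, 'f, 't) two_cat" and D :: "('b, 'g, 's) two_cat" +
  fixes F :: "('a, 'f, 't, 'b, 'g, 's) two_fun"
  assumes on0_Obj: "x \<in> Obj0 C \<Longrightarrow> on0 F x \<in> Obj0 D"
    and Hom_functor: "\<lbrakk>x \<in> Obj0 C; y \<in> Obj0 C\<rbrakk> \<Longrightarrow>
      cat_functor (Hom C x y) (Hom D (on0 F x) (on0 F y)) (on1 F x y) (on2 F x y)"
    and on1_Unit: "x \<in> Obj0 C \<Longrightarrow> on1 F x x (Unit1 C x) = Unit1 D (on0 F x)"
    and on1_Comp: "\<lbrakk>x \<in> Obj0 C; y \<in> Obj0 C; z \<in> Obj0 C;
        f \<in> Obj (Hom C x y); g \<in> Obj (Hom C y z)\<rbrakk> \<Longrightarrow>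
      on1 F x z (Comp1 C x y z g f)
        = Comp1 D (on0 F x) (on0 F y) (on0 F z) (on1 F y z g) (on1 F x y f)"
    and on2_Comp: "\<lbrakk>x \<in> Obj0 C; y \<in> Obj0 C; z \<in> Obj0 C;
        t \<in> Arr (Hom C x y); s \<in> Arr (Hom C y z)\<rbrakk> \<Longrightarrow>
      on2 F x z (Comp2 C x y z s t)
        = Comp2 D (on0 F x) (on0 F y) (on0 F z) (on2 F y z s) (on2 F x y t)"

text \<open>\<open>L : C \<rightarrow> D\<close> is left 2-adjoint to \<open>R : D \<rightarrow> C\<close>: there are isomorphisms of categories
  \<open>D(L x, y) \<cong> C(x, R y)\<close> that are 2-natural in \<open>x\<close> and \<open>y\<close>.\<close>

definition left_two_adjoint ::
  "('a, 'f, 't) two_cat \<Rightarrow> ('b, 'g, 's) two_cat \<Rightarrow>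
   ('a, 'f, 't, 'b, 'g, 's) two_fun \<Rightarrow> ('b, 'g, 's, 'a, 'f, 't) two_fun \<Rightarrow> bool" where
  "left_two_adjoint C D L R \<longleftrightarrow> two_functor C D L \<and> two_functor D C R \<and>
    (\<exists>\<Phi> \<Phi>'.
      (\<forall>x\<in>Obj0 C. \<forall>y\<in>Obj0 D.
         cat_isomorphism (Hom D (on0 L x) y) (Hom C x (on0 R y)) (\<Phi> x y) (\<Phi>' x y)) \<and>
      (\<forall>x\<in>Obj0 C. \<forall>x'\<in>Obj0 C. \<forall>y\<in>Obj0 D. \<forall>y'\<in>Obj0 D.
         (\<forall>u\<in>Obj (Hom C x' x). \<forall>h\<in>Obj (Hom D (on0 L x) y). \<forall>v\<in>Obj (Hom D y y').
            \<Phi> x' y' (Comp1 D (on0 L x') y y' v (Comp1 D (on0 L x') (on0 L x) y h (on1 L x' x u)))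
            = Comp1 C x' (on0 R y) (on0 R y') (on1 R y y' v) (Comp1 C x' x (on0 R y) (\<Phi> x y h) u)) \<and>
         (\<forall>u\<in>Arr (Hom C x' x). \<forall>h\<in>Arr (Hom D (on0 L x) y). \<forall>v\<in>Arr (Hom D y y').
            \<Phi>' x' y' (Comp2 D (on0 L x') y y' v (Comp2 D (on0 L x') (on0 L x) y h (on2 L x' x u)))
            = Comp2 C x' (on0 R y) (on0 R y') (on2 R y y' v) (Comp2 C x' x (on0 R y) (\<Phi>' x y h) u))))"


section \<open>Block permutations\<close>

text \<open>Positions are counted from 0, and the symmetric group on \<open>n\<close> letters consists of the
  \<open>\<sigma>\<close> with \<open>\<sigma> permutes {..<n}\<close>, multiplied by \<open>\<circ>\<close>.  The action on sequences is the library's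
  \<open>permute_list\<close>.\<close>

definition block_index :: "nat list \<Rightarrow> nat \<Rightarrow> nat" where
  "block_index ks x = (LEAST i. x < sum_list (take (Suc i) ks))"

text \<open>\<open>block_perm \<sigma> ks \<tau>s\<close> is the permutation \<open>\<sigma>\<langle>\<tau>\<^sub>1, \<dots>, \<tau>\<^sub>n\<rangle>\<close>, where \<open>ks\<close> lists the degrees of the \<open>\<tau>s\<close>.\<close>

definition block_perm :: "(nat \<Rightarrow> nat) \<Rightarrow> nat list \<Rightarrow> (nat \<Rightarrow> nat) list \<Rightarrow> nat \<Rightarrow> nat" where
  "block_perm \<sigma> ks \<tau>s x =
     (if x < sum_list ks then
        (let i = block_index ks x; p = x - sum_list (take i ks)
         in sum_list (take (\<sigma> i) (permute_list (inv \<sigma>) ks)) + (\<tau>s ! i) p)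
      else x)"


section \<open>Cat-multicategories\<close>

text \<open>Every 1-cell knows its inputs and output, and every 2-cell its source and target 1-cell, so
  the hom categories are disjoint and are recovered by \<open>hom_cat\<close>.  A number at the end of
  a name is the dimension of the cells that an operation acts on.\<close>

record ('o, 'm, 'c) multicat =
  Ob :: "'o set"
  Cell1 :: "'m set"
  Cell2 :: "'c set"
  src :: "'m \<Rightarrow> 'o list"
  tgt :: "'m \<Rightarrow> 'o"
  dom2 :: "'c \<Rightarrow> 'm"
  cod2 :: "'c \<Rightarrow> 'm"
  id2 :: "'m \<Rightarrow> 'c"
  vcomp :: "'c \<Rightarrow> 'c \<Rightarrow> 'c"
  act1 :: "'m \<Rightarrow> (nat \<Rightarrow> nat) \<Rightarrow> 'm"
  act2 :: "'c \<Rightarrow> (nat \<Rightarrow> nat) \<Rightarrow> 'c"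
  unit1 :: "'o \<Rightarrow> 'm"
  gamma1 :: "'m \<Rightarrow> 'm list \<Rightarrow> 'm"
  gamma2 :: "'c \<Rightarrow> 'c list \<Rightarrow> 'c"

definition hom_cat :: "('o, 'm, 'c) multicat \<Rightarrow> 'o list \<Rightarrow> 'o \<Rightarrow> ('m, 'c) cat" where
  "hom_cat M as b = \<lparr>
     Obj = {f \<in> Cell1 M. src M f = as \<and> tgt M f = b},
     Arr = {\<alpha> \<in> Cell2 M. src M (dom2 M \<alpha>) = as \<and> tgt M (dom2 M \<alpha>) = b},
     Dom = dom2 M, Cod = cod2 M, Idn = id2 M, Cmp = vcomp M\<rparr>"

abbreviation arity :: "('o, 'm, 'c) multicat \<Rightarrow> 'm \<Rightarrow> nat" where
  "arity M f \<equiv> length (src M f)"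

definition composable1 :: "('o, 'm, 'c) multicat \<Rightarrow> 'm \<Rightarrow> 'm list \<Rightarrow> bool" where
  "composable1 M f gs \<longleftrightarrow> f \<in> Cell1 M \<and> set gs \<subseteq> Cell1 M \<and> map (tgt M) gs = src M f"

definition composable2 :: "('o, 'm, 'c) multicat \<Rightarrow> 'c \<Rightarrow> 'c list \<Rightarrow> bool" where
  "composable2 M \<alpha> \<beta>s \<longleftrightarrow> \<alpha> \<in> Cell2 M \<and> set \<beta>s \<subseteq> Cell2 M \<and>
     map (\<lambda>\<beta>. tgt M (dom2 M \<beta>)) \<beta>s = src M (dom2 M \<alpha>)"

text \<open>The permutation \<open>\<sigma>\<langle>id, \<dots>, id\<rangle>\<close> with identities of degrees \<open>k\<^bsub>\<sigma>(1)\<^esub>, \<dots>, k\<^bsub>\<sigma>(n)\<^esub>\<close>,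
  where \<open>ks\<close> is \<open>k\<^sub>1, \<dots>, k\<^sub>n\<close>.\<close>

definition outer_perm :: "(nat \<Rightarrow> nat) \<Rightarrow> nat list \<Rightarrow> nat \<Rightarrow> nat" where
  "outer_perm \<sigma> ks = block_perm \<sigma> (permute_list \<sigma> ks) (replicate (length ks) id)"

definition inner_perm :: "nat list \<Rightarrow> (nat \<Rightarrow> nat) list \<Rightarrow> nat \<Rightarrow> nat" where
  "inner_perm ks \<tau>s = block_perm id ks \<tau>s"

locale cat_multicategory =
  fixes M :: "('o, 'm, 'c) multicat"
  assumes src_Ob: "f \<in> Cell1 M \<Longrightarrow> set (src M f) \<subseteq> Ob M"
    and tgt_Ob: "f \<in> Cell1 M \<Longrightarrow> tgt M f \<in> Ob M"
    and dom2_Cell1: "\<alpha> \<in> Cell2 M \<Longrightarrow> dom2 M \<alpha> \<in> Cell1 M"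
    and hom_category: "\<lbrakk>set as \<subseteq> Ob M; b \<in> Ob M\<rbrakk> \<Longrightarrow> category (hom_cat M as b)"
    and act_isomorphism: "\<lbrakk>set as \<subseteq> Ob M; b \<in> Ob M; \<sigma> permutes {..<length as}\<rbrakk> \<Longrightarrow>
      cat_isomorphism (hom_cat M as b) (hom_cat M (permute_list \<sigma> as) b)
        (\<lambda>f. act1 M f \<sigma>) (\<lambda>\<alpha>. act2 M \<alpha> \<sigma>)"
    and act1_comp: "\<lbrakk>f \<in> Cell1 M; \<sigma> permutes {..<arity M f}; \<tau> permutes {..<arity M f}\<rbrakk> \<Longrightarrow>
      act1 M (act1 M f \<sigma>) \<tau> = act1 M f (\<sigma> \<circ> \<tau>)"
    and act1_id: "f \<in> Cell1 M \<Longrightarrow> act1 M f id = f"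
    and act2_comp: "\<lbrakk>\<alpha> \<in> Cell2 M; \<sigma> permutes {..<arity M (dom2 M \<alpha>)};
        \<tau> permutes {..<arity M (dom2 M \<alpha>)}\<rbrakk> \<Longrightarrow>
      act2 M (act2 M \<alpha> \<sigma>) \<tau> = act2 M \<alpha> (\<sigma> \<circ> \<tau>)"
    and act2_id: "\<alpha> \<in> Cell2 M \<Longrightarrow> act2 M \<alpha> id = \<alpha>"
    and unit1_hom: "a \<in> Ob M \<Longrightarrow> unit1 M a \<in> Obj (hom_cat M [a] a)"
    and gamma_functor: "\<lbrakk>set bs \<subseteq> Ob M; c \<in> Ob M; length ass = length bs;
        \<forall>as\<in>set ass. set as \<subseteq> Ob M\<rbrakk> \<Longrightarrow>
      cat_functor (prod_cat (hom_cat M bs c) (list_prod_cat (map2 (hom_cat M) ass bs)))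
        (hom_cat M (concat ass) c)
        (\<lambda>(f, gs). gamma1 M f gs) (\<lambda>(\<alpha>, \<beta>s). gamma2 M \<alpha> \<beta>s)"
    and gamma1_assoc: "\<lbrakk>composable1 M f gs; list_all2 (composable1 M) gs hss\<rbrakk> \<Longrightarrow>
      gamma1 M (gamma1 M f gs) (concat hss) = gamma1 M f (map2 (gamma1 M) gs hss)"
    and gamma2_assoc: "\<lbrakk>composable2 M \<alpha> \<beta>s; list_all2 (composable2 M) \<beta>s \<delta>ss\<rbrakk> \<Longrightarrow>
      gamma2 M (gamma2 M \<alpha> \<beta>s) (concat \<delta>ss) = gamma2 M \<alpha> (map2 (gamma2 M) \<beta>s \<delta>ss)"
    and gamma1_unit_left: "f \<in> Cell1 M \<Longrightarrow> gamma1 M (unit1 M (tgt M f)) [f] = f"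
    and gamma1_unit_right: "f \<in> Cell1 M \<Longrightarrow> gamma1 M f (map (unit1 M) (src M f)) = f"
    and gamma2_unit_left: "\<alpha> \<in> Cell2 M \<Longrightarrow>
      gamma2 M (id2 M (unit1 M (tgt M (dom2 M \<alpha>)))) [\<alpha>] = \<alpha>"
    and gamma2_unit_right: "\<alpha> \<in> Cell2 M \<Longrightarrow>
      gamma2 M \<alpha> (map (\<lambda>a. id2 M (unit1 M a)) (src M (dom2 M \<alpha>))) = \<alpha>"
    and gamma1_top: "\<lbrakk>composable1 M f gs; \<sigma> permutes {..<length gs}\<rbrakk> \<Longrightarrow>
      gamma1 M (act1 M f \<sigma>) (permute_list \<sigma> gs)
        = act1 M (gamma1 M f gs) (outer_perm \<sigma> (map (arity M) gs))"
    and gamma2_top: "\<lbrakk>composable2 M \<alpha> \<beta>s; \<sigma> permutes {..<length \<beta>s}\<rbrakk> \<Longrightarrow>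
      gamma2 M (act2 M \<alpha> \<sigma>) (permute_list \<sigma> \<beta>s)
        = act2 M (gamma2 M \<alpha> \<beta>s) (outer_perm \<sigma> (map (\<lambda>\<beta>. arity M (dom2 M \<beta>)) \<beta>s))"
    and gamma1_bottom: "\<lbrakk>composable1 M f gs; list_all2 (\<lambda>g \<tau>. \<tau> permutes {..<arity M g}) gs \<tau>s\<rbrakk> \<Longrightarrow>
      gamma1 M f (map2 (act1 M) gs \<tau>s)
        = act1 M (gamma1 M f gs) (inner_perm (map (arity M) gs) \<tau>s)"
    and gamma2_bottom: "\<lbrakk>composable2 M \<alpha> \<beta>s;
        list_all2 (\<lambda>\<beta> \<tau>. \<tau> permutes {..<arity M (dom2 M \<beta>)}) \<beta>s \<tau>s\<rbrakk> \<Longrightarrow>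
      gamma2 M \<alpha> (map2 (act2 M) \<beta>s \<tau>s)
        = act2 M (gamma2 M \<alpha> \<beta>s) (inner_perm (map (\<lambda>\<beta>. arity M (dom2 M \<beta>)) \<beta>s) \<tau>s)"


section \<open>Symmetric and pseudo symmetric Cat-multifunctors\<close>

record ('o, 'm, 'c, 'p, 'n, 'd) mfun =
  fob :: "'o \<Rightarrow> 'p"
  fc1 :: "'m \<Rightarrow> 'n"
  fc2 :: "'c \<Rightarrow> 'd"

record ('o, 'm, 'c, 'p, 'n, 'd) psfun = "('o, 'm, 'c, 'p, 'n, 'd) mfun" +
  fsym :: "(nat \<Rightarrow> nat) \<Rightarrow> 'm \<Rightarrow> 'd"

text \<open>The part of the structure common to both notions: functors strictly preserving units and
  \<open>\<gamma>\<close>.  All functions are extensional (\<open>undefined\<close> off the cells of \<open>M\<close>), so that two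
  multifunctors are equal iff they agree on cells.\<close>

locale nonsym_multifunctor = M: cat_multicategory M + N: cat_multicategory N
  for M :: "('o, 'm, 'c) multicat" and N :: "('p, 'n, 'd) multicat" +
  fixes F :: "('o, 'm, 'c, 'p, 'n, 'd, 'z) mfun_scheme"
  assumes fob_ext: "fob F \<in> Ob M \<rightarrow>\<^sub>E Ob N"
    and fc1_ext: "fc1 F \<in> extensional (Cell1 M)"
    and fc2_ext: "fc2 F \<in> extensional (Cell2 M)"
    and hom_functor: "\<lbrakk>set as \<subseteq> Ob M; b \<in> Ob M\<rbrakk> \<Longrightarrow>
      cat_functor (hom_cat M as b) (hom_cat N (map (fob F) as) (fob F b)) (fc1 F) (fc2 F)"
    and map_unit1: "a \<in> Ob M \<Longrightarrow> fc1 F (unit1 M a) = unit1 N (fob F a)"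
    and map_gamma1: "composable1 M f gs \<Longrightarrow>
      fc1 F (gamma1 M f gs) = gamma1 N (fc1 F f) (map (fc1 F) gs)"
    and map_gamma2: "composable2 M \<alpha> \<beta>s \<Longrightarrow>
      fc2 F (gamma2 M \<alpha> \<beta>s) = gamma2 N (fc2 F \<alpha>) (map (fc2 F) \<beta>s)"

locale sym_multifunctor = nonsym_multifunctor M N F
  for M :: "('o, 'm, 'c) multicat" and N :: "('p, 'n, 'd) multicat"
    and F :: "('o, 'm, 'c, 'p, 'n, 'd) mfun" +
  assumes map_act1: "\<lbrakk>f \<in> Cell1 M; \<sigma> permutes {..<arity M f}\<rbrakk> \<Longrightarrow>
      fc1 F (act1 M f \<sigma>) = act1 N (fc1 F f) \<sigma>"
    and map_act2: "\<lbrakk>\<alpha> \<in> Cell2 M; \<sigma> permutes {..<arity M (dom2 M \<alpha>)}\<rbrakk> \<Longrightarrow>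
      fc2 F (act2 M \<alpha> \<sigma>) = act2 N (fc2 F \<alpha>) \<sigma>"

locale ps_multifunctor = nonsym_multifunctor M N F
  for M :: "('o, 'm, 'c) multicat" and N :: "('p, 'n, 'd) multicat"
    and F :: "('o, 'm, 'c, 'p, 'n, 'd) psfun" +
  assumes fsym_ext: "\<not> (f \<in> Cell1 M \<and> \<sigma> permutes {..<arity M f}) \<Longrightarrow> fsym F \<sigma> f = undefined"
    and fsym_iso: "\<lbrakk>f \<in> Cell1 M; \<sigma> permutes {..<arity M f}\<rbrakk> \<Longrightarrow>
      iso_arr (hom_cat N (permute_list \<sigma> (map (fob F) (src M f))) (fob F (tgt M f)))
        (fc1 F (act1 M f \<sigma>)) (act1 N (fc1 F f) \<sigma>) (fsym F \<sigma> f)"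
    and fsym_natural: "\<lbrakk>\<alpha> \<in> Cell2 M; \<sigma> permutes {..<arity M (dom2 M \<alpha>)}\<rbrakk> \<Longrightarrow>
      vcomp N (act2 N (fc2 F \<alpha>) \<sigma>) (fsym F \<sigma> (dom2 M \<alpha>))
        = vcomp N (fsym F \<sigma> (cod2 M \<alpha>)) (fc2 F (act2 M \<alpha> \<sigma>))"
    and fsym_id: "f \<in> Cell1 M \<Longrightarrow> fsym F id f = id2 N (fc1 F f)"
    and fsym_comp: "\<lbrakk>f \<in> Cell1 M; \<sigma> permutes {..<arity M f}; \<tau> permutes {..<arity M f}\<rbrakk> \<Longrightarrow>
      fsym F (\<sigma> \<circ> \<tau>) f = vcomp N (act2 N (fsym F \<sigma> f) \<tau>) (fsym F \<tau> (act1 M f \<sigma>))"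
    and fsym_top: "\<lbrakk>composable1 M f gs; \<sigma> permutes {..<length gs}\<rbrakk> \<Longrightarrow>
      fsym F (outer_perm \<sigma> (map (arity M) gs)) (gamma1 M f gs)
        = gamma2 N (fsym F \<sigma> f) (map (\<lambda>g. id2 N (fc1 F g)) (permute_list \<sigma> gs))"
    and fsym_bottom: "\<lbrakk>composable1 M f gs; list_all2 (\<lambda>g \<tau>. \<tau> permutes {..<arity M g}) gs \<tau>s\<rbrakk> \<Longrightarrow>
      fsym F (inner_perm (map (arity M) gs) \<tau>s) (gamma1 M f gs)
        = gamma2 N (id2 N (fc1 F f)) (map2 (\<lambda>g \<tau>. fsym F \<tau> g) gs \<tau>s)"

definition sym_id :: "('o, 'm, 'c) multicat \<Rightarrow> ('o, 'm, 'c, 'o, 'm, 'c) mfun" where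
  "sym_id M = \<lparr>fob = (\<lambda>a\<in>Ob M. a), fc1 = (\<lambda>f\<in>Cell1 M. f), fc2 = (\<lambda>\<alpha>\<in>Cell2 M. \<alpha>)\<rparr>"

definition sym_comp :: "('o, 'm, 'c) multicat \<Rightarrow>
    ('p, 'n, 'd, 'q, 'k, 'e) mfun \<Rightarrow> ('o, 'm, 'c, 'p, 'n, 'd) mfun \<Rightarrow>
    ('o, 'm, 'c, 'q, 'k, 'e) mfun" where
  "sym_comp M G F = \<lparr>
     fob = compose (Ob M) (fob G) (fob F),
     fc1 = compose (Cell1 M) (fc1 G) (fc1 F),
     fc2 = compose (Cell2 M) (fc2 G) (fc2 F)\<rparr>"

definition ps_comp :: "('o, 'm, 'c) multicat \<Rightarrow> ('q, 'k, 'e) multicat \<Rightarrow>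
    ('p, 'n, 'd, 'q, 'k, 'e) psfun \<Rightarrow> ('o, 'm, 'c, 'p, 'n, 'd) psfun \<Rightarrow>
    ('o, 'm, 'c, 'q, 'k, 'e) psfun" where
  "ps_comp M Q G F = \<lparr>
     fob = compose (Ob M) (fob G) (fob F),
     fc1 = compose (Cell1 M) (fc1 G) (fc1 F),
     fc2 = compose (Cell2 M) (fc2 G) (fc2 F),
     fsym = (\<lambda>\<sigma> f. if f \<in> Cell1 M \<and> \<sigma> permutes {..<arity M f}
              then vcomp Q (fsym G \<sigma> (fc1 F f)) (fc2 G (fsym F \<sigma> f)) else undefined)\<rparr>"

definition sym_to_ps :: "('o, 'm, 'c) multicat \<Rightarrow> ('p, 'n, 'd) multicat \<Rightarrow>
    ('o, 'm, 'c, 'p, 'n, 'd) mfun \<Rightarrow> ('o, 'm, 'c, 'p, 'n, 'd) psfun" where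
  "sym_to_ps M N F = \<lparr>
     fob = fob F, fc1 = fc1 F, fc2 = fc2 F,
     fsym = (\<lambda>\<sigma> f. if f \<in> Cell1 M \<and> \<sigma> permutes {..<arity M f}
              then id2 N (fc1 F (act1 M f \<sigma>)) else undefined)\<rparr>"

definition ps_id :: "('o, 'm, 'c) multicat \<Rightarrow> ('o, 'm, 'c, 'o, 'm, 'c) psfun" where
  "ps_id M = sym_to_ps M M (sym_id M)"


section \<open>Transformations\<close>

text \<open>A transformation carries its source and target, so that transformations form the arrows
  of a category; \<open>'f\<close> is the type of symmetric or of pseudo symmetric multifunctors.\<close>

record ('f, 'o, 'n) mtrans =
  tdom :: 'f
  tcod :: 'f
  tcomp :: "'o \<Rightarrow> 'n"

locale multinatural =
  fixes M :: "('o, 'm, 'c) multicat" and N :: "('p, 'n, 'd) multicat"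
    and F G :: "('o, 'm, 'c, 'p, 'n, 'd, 'z) mfun_scheme"
    and \<theta> :: "'o \<Rightarrow> 'n"
  assumes comp_ext: "\<theta> \<in> extensional (Ob M)"
    and comp_hom: "a \<in> Ob M \<Longrightarrow> \<theta> a \<in> Obj (hom_cat N [fob F a] (fob G a))"
    and natural1: "f \<in> Cell1 M \<Longrightarrow>
      gamma1 N (fc1 G f) (map \<theta> (src M f)) = gamma1 N (\<theta> (tgt M f)) [fc1 F f]"
    and natural2: "\<alpha> \<in> Cell2 M \<Longrightarrow>
      gamma2 N (fc2 G \<alpha>) (map (\<lambda>a. id2 N (\<theta> a)) (src M (dom2 M \<alpha>)))
        = gamma2 N (id2 N (\<theta> (tgt M (dom2 M \<alpha>)))) [fc2 F \<alpha>]"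

definition sym_multinatural :: "('o, 'm, 'c) multicat \<Rightarrow> ('p, 'n, 'd) multicat \<Rightarrow>
    (('o, 'm, 'c, 'p, 'n, 'd) mfun, 'o, 'n) mtrans \<Rightarrow> bool" where
  "sym_multinatural M N \<theta> \<longleftrightarrow>
     sym_multifunctor M N (tdom \<theta>) \<and> sym_multifunctor M N (tcod \<theta>) \<and>
     multinatural M N (tdom \<theta>) (tcod \<theta>) (tcomp \<theta>)"

definition ps_multinatural :: "('o, 'm, 'c) multicat \<Rightarrow> ('p, 'n, 'd) multicat \<Rightarrow>
    (('o, 'm, 'c, 'p, 'n, 'd) psfun, 'o, 'n) mtrans \<Rightarrow> bool" where
  "ps_multinatural M N \<theta> \<longleftrightarrow>
     ps_multifunctor M N (tdom \<theta>) \<and> ps_multifunctor M N (tcod \<theta>) \<and>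
     multinatural M N (tdom \<theta>) (tcod \<theta>) (tcomp \<theta>) \<and>
     (\<forall>f\<in>Cell1 M. \<forall>\<sigma>. \<sigma> permutes {..<arity M f} \<longrightarrow>
        gamma2 N (id2 N (tcomp \<theta> (tgt M f))) [fsym (tdom \<theta>) \<sigma> f]
        = gamma2 N (fsym (tcod \<theta>) \<sigma> f)
            (map (\<lambda>a. id2 N (tcomp \<theta> a)) (permute_list \<sigma> (src M f))))"

definition trans_id :: "('o, 'm, 'c) multicat \<Rightarrow> ('p, 'n, 'd) multicat \<Rightarrow>
    ('o, 'm, 'c, 'p, 'n, 'd, 'z) mfun_scheme \<Rightarrow>
    (('o, 'm, 'c, 'p, 'n, 'd, 'z) mfun_scheme, 'o, 'n) mtrans" where
  "trans_id M N F = \<lparr>tdom = F, tcod = F, tcomp = (\<lambda>a\<in>Ob M. unit1 N (fob F a))\<rparr>"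

definition trans_vcomp :: "('o, 'm, 'c) multicat \<Rightarrow> ('p, 'n, 'd) multicat \<Rightarrow>
    ('f, 'o, 'n) mtrans \<Rightarrow> ('f, 'o, 'n) mtrans \<Rightarrow> ('f, 'o, 'n) mtrans" where
  "trans_vcomp M N \<zeta> \<theta> = \<lparr>tdom = tdom \<theta>, tcod = tcod \<zeta>,
     tcomp = (\<lambda>a\<in>Ob M. gamma1 N (tcomp \<zeta> a) [tcomp \<theta> a])\<rparr>"

text \<open>The components of the horizontal composite \<open>\<zeta> * \<theta>\<close>, where \<open>\<theta> : F \<Rightarrow> G : M \<rightarrow> N\<close> and
  \<open>\<zeta> : F' \<Rightarrow> G' : N \<rightarrow> Q\<close>.\<close>

definition hcomp_components :: "('o, 'm, 'c) multicat \<Rightarrow> ('q, 'k, 'e) multicat \<Rightarrow>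
    (('p, 'n, 'd, 'q, 'k, 'e, 'y) mfun_scheme, 'p, 'k) mtrans \<Rightarrow>
    (('o, 'm, 'c, 'p, 'n, 'd, 'z) mfun_scheme, 'o, 'n) mtrans \<Rightarrow> 'o \<Rightarrow> 'k" where
  "hcomp_components M Q \<zeta> \<theta> =
     (\<lambda>a\<in>Ob M. gamma1 Q (tcomp \<zeta> (fob (tcod \<theta>) a)) [fc1 (tdom \<zeta>) (tcomp \<theta> a)])"


section \<open>The 2-categories of Cat-multicategories\<close>

definition sym_hom :: "('o, 'm, 'c) multicat \<Rightarrow> ('p, 'n, 'd) multicat \<Rightarrow>
    (('o, 'm, 'c, 'p, 'n, 'd) mfun, (('o, 'm, 'c, 'p, 'n, 'd) mfun, 'o, 'n) mtrans) cat" where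
  "sym_hom M N = \<lparr>
     Obj = {F. sym_multifunctor M N F},
     Arr = {\<theta>. sym_multinatural M N \<theta>},
     Dom = tdom, Cod = tcod, Idn = trans_id M N, Cmp = trans_vcomp M N\<rparr>"

definition ps_hom :: "('o, 'm, 'c) multicat \<Rightarrow> ('p, 'n, 'd) multicat \<Rightarrow>
    (('o, 'm, 'c, 'p, 'n, 'd) psfun, (('o, 'm, 'c, 'p, 'n, 'd) psfun, 'o, 'n) mtrans) cat" where
  "ps_hom M N = \<lparr>
     Obj = {F. ps_multifunctor M N F},
     Arr = {\<theta>. ps_multinatural M N \<theta>},
     Dom = tdom, Cod = tcod, Idn = trans_id M N, Cmp = trans_vcomp M N\<rparr>"

text \<open>The types \<open>'o\<close>, \<open>'m\<close>, \<open>'c\<close> play the role of the universe from which objects, 1-cells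
  and 2-cells are taken.\<close>

definition Cat_Multicat ::
  "(('o, 'm, 'c) multicat, ('o, 'm, 'c, 'o, 'm, 'c) mfun,
    (('o, 'm, 'c, 'o, 'm, 'c) mfun, 'o, 'm) mtrans) two_cat" where
  "Cat_Multicat = \<lparr>
     Obj0 = {M. cat_multicategory M},
     Hom = sym_hom,
     Unit1 = sym_id,
     Comp1 = (\<lambda>M N Q G F. sym_comp M G F),
     Comp2 = (\<lambda>M N Q \<zeta> \<theta>. \<lparr>tdom = sym_comp M (tdom \<zeta>) (tdom \<theta>),
        tcod = sym_comp M (tcod \<zeta>) (tcod \<theta>), tcomp = hcomp_components M Q \<zeta> \<theta>\<rparr>)\<rparr>"

definition Cat_Multicat_ps ::
  "(('o, 'm, 'c) multicat, ('o, 'm, 'c, 'o, 'm, 'c) psfun,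
    (('o, 'm, 'c, 'o, 'm, 'c) psfun, 'o, 'm) mtrans) two_cat" where
  "Cat_Multicat_ps = \<lparr>
     Obj0 = {M. cat_multicategory M},
     Hom = ps_hom,
     Unit1 = ps_id,
     Comp1 = (\<lambda>M N Q G F. ps_comp M Q G F),
     Comp2 = (\<lambda>M N Q \<zeta> \<theta>. \<lparr>tdom = ps_comp M Q (tdom \<zeta>) (tdom \<theta>),
        tcod = ps_comp M Q (tcod \<zeta>) (tcod \<theta>), tcomp = hcomp_components M Q \<zeta> \<theta>\<rparr>)\<rparr>"

definition inclusion_j ::
  "(('o, 'm, 'c) multicat, ('o, 'm, 'c, 'o, 'm, 'c) mfun,
    (('o, 'm, 'c, 'o, 'm, 'c) mfun, 'o, 'm) mtrans,
    ('o, 'm, 'c) multicat, ('o, 'm, 'c, 'o, 'm, 'c) psfun,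
    (('o, 'm, 'c, 'o, 'm, 'c) psfun, 'o, 'm) mtrans) two_fun" where
  "inclusion_j = \<lparr>
     on0 = (\<lambda>M. M),
     on1 = sym_to_ps,
     on2 = (\<lambda>M N \<theta>. \<lparr>tdom = sym_to_ps M N (tdom \<theta>), tcod = sym_to_ps M N (tcod \<theta>),
        tcomp = tcomp \<theta>\<rparr>)\<rparr>"


section \<open>The Barratt-Eccles operad and products\<close>

definition prod_multicat :: "('o, 'm, 'c) multicat \<Rightarrow> ('p, 'n, 'd) multicat \<Rightarrow>
    ('o \<times> 'p, 'm \<times> 'n, 'c \<times> 'd) multicat" where
  "prod_multicat M N = \<lparr>
     Ob = Ob M \<times> Ob N,
     Cell1 = {(f, g). f \<in> Cell1 M \<and> g \<in> Cell1 N \<and> arity M f = arity N g},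
     Cell2 = {(\<alpha>, \<beta>). \<alpha> \<in> Cell2 M \<and> \<beta> \<in> Cell2 N \<and> arity M (dom2 M \<alpha>) = arity N (dom2 N \<beta>)},
     src = (\<lambda>(f, g). zip (src M f) (src N g)),
     tgt = map_prod (tgt M) (tgt N),
     dom2 = map_prod (dom2 M) (dom2 N),
     cod2 = map_prod (cod2 M) (cod2 N),
     id2 = map_prod (id2 M) (id2 N),
     vcomp = (\<lambda>(\<alpha>, \<beta>) (\<alpha>', \<beta>'). (vcomp M \<alpha> \<alpha>', vcomp N \<beta> \<beta>')),
     act1 = (\<lambda>(f, g) \<sigma>. (act1 M f \<sigma>, act1 N g \<sigma>)),
     act2 = (\<lambda>(\<alpha>, \<beta>) \<sigma>. (act2 M \<alpha> \<sigma>, act2 N \<beta> \<sigma>)),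
     unit1 = map_prod (unit1 M) (unit1 N),
     gamma1 = (\<lambda>(f, g) hs. (gamma1 M f (map fst hs), gamma1 N g (map snd hs))),
     gamma2 = (\<lambda>(\<alpha>, \<beta>) \<delta>s. (gamma2 M \<alpha> (map fst \<delta>s), gamma2 N \<beta> (map snd \<delta>s)))\<rparr>"

text \<open>A 1-cell of the Barratt-Eccles operad is a pair \<open>(n, \<sigma>)\<close> with \<open>\<sigma>\<close> in the \<open>n\<close>-th symmetric
  group (the arity has to be recorded since \<open>\<sigma>\<close> alone does not determine it), and the unique
  2-cell \<open>x \<rightarrow> y\<close> is the pair \<open>(x, y)\<close>.\<close>

type_synonym perm1 = "nat \<times> (nat \<Rightarrow> nat)"

definition ES_gamma :: "perm1 \<Rightarrow> perm1 list \<Rightarrow> perm1" where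
  "ES_gamma x ys = (sum_list (map fst ys), block_perm (snd x) (map fst ys) (map snd ys))"

definition ES :: "(unit, perm1, perm1 \<times> perm1) multicat" where
  "ES = \<lparr>
     Ob = UNIV,
     Cell1 = {(n, \<sigma>). \<sigma> permutes {..<n}},
     Cell2 = {((m, \<sigma>), (n, \<tau>)). m = n \<and> \<sigma> permutes {..<n} \<and> \<tau> permutes {..<n}},
     src = (\<lambda>x. replicate (fst x) ()),
     tgt = (\<lambda>x. ()),
     dom2 = fst,
     cod2 = snd,
     id2 = (\<lambda>x. (x, x)),
     vcomp = (\<lambda>s t. (fst t, snd s)),
     act1 = (\<lambda>(n, \<sigma>) \<tau>. (n, \<sigma> \<circ> \<tau>)),
     act2 = (\<lambda>((m, \<sigma>), (n, \<sigma>')) \<tau>. ((m, \<sigma> \<circ> \<tau>), (n, \<sigma>' \<circ> \<tau>))),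
     unit1 = (\<lambda>a. (1, id)),
     gamma1 = ES_gamma,
     gamma2 = (\<lambda>s ts. (ES_gamma (fst s) (map fst ts), ES_gamma (snd s) (map snd ts)))\<rparr>"

text \<open>Renaming of cells along maps that are injective on the cells of \<open>M\<close>.  It brings the product
  with \<open>ES\<close>, whose cells have product types, back into the universe \<open>'o\<close>, \<open>'m\<close>, \<open>'c\<close>: the
  injections play the role of the universe's pairing operation.\<close>

definition rename_multicat :: "('o \<Rightarrow> 'p) \<Rightarrow> ('m \<Rightarrow> 'n) \<Rightarrow> ('c \<Rightarrow> 'd) \<Rightarrow>
    ('o, 'm, 'c) multicat \<Rightarrow> ('p, 'n, 'd) multicat" where
  "rename_multicat eo em ec M =
     (let do = inv_into (Ob M) eo; dm = inv_into (Cell1 M) em; dc = inv_into (Cell2 M) ec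
      in \<lparr>
       Ob = eo ` Ob M,
       Cell1 = em ` Cell1 M,
       Cell2 = ec ` Cell2 M,
       src = (\<lambda>f. map eo (src M (dm f))),
       tgt = (\<lambda>f. eo (tgt M (dm f))),
       dom2 = (\<lambda>\<alpha>. em (dom2 M (dc \<alpha>))),
       cod2 = (\<lambda>\<alpha>. em (cod2 M (dc \<alpha>))),
       id2 = (\<lambda>f. ec (id2 M (dm f))),
       vcomp = (\<lambda>\<alpha> \<beta>. ec (vcomp M (dc \<alpha>) (dc \<beta>))),
       act1 = (\<lambda>f \<sigma>. em (act1 M (dm f) \<sigma>)),
       act2 = (\<lambda>\<alpha> \<sigma>. ec (act2 M (dc \<alpha>) \<sigma>)),
       unit1 = (\<lambda>a. em (unit1 M (do a))),
       gamma1 = (\<lambda>f gs. em (gamma1 M (dm f) (map dm gs))),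
       gamma2 = (\<lambda>\<alpha> \<beta>s. ec (gamma2 M (dc \<alpha>) (map dc \<beta>s)))\<rparr>)"

end

theory Submission
  imports Defs
begin

text \<open>Let \<open>\<eta> : M \<rightarrow> M \<times> E\<Sigma>\<close> be the pseudo symmetric multifunctor \<open>f \<mapsto> (f, id)\<close> whose structure isomorphism
  \<open>\<eta>\<^bsub>\<sigma>;f\<^esub>\<close> is the unique 2-cell \<open>(f\<sigma>, id) \<rightarrow> (f\<sigma>, \<sigma>)\<close> over the identity.  Every 1-cell of \<open>M \<times> E\<Sigma>\<close> is
  \<open>(f, \<sigma>) = \<eta>(f\<sigma>')\<sigma>\<close> with \<open>\<sigma>'\<close> the inverse of \<open>\<sigma>\<close>, and every 2-cell \<open>(\<alpha>, \<sigma> \<rightarrow> \<tau>)\<close> with \<open>\<alpha> : f \<rightarrow> g\<close> is the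
  composite of \<open>\<eta>(\<alpha>\<sigma>')\<sigma>\<close> and \<open>\<eta>\<^bsub>\<tau>\<sigma>';g\<tau>'\<^esub>\<sigma>\<close>.  Hence a symmetric multifunctor on \<open>M \<times> E\<Sigma>\<close>, and a transformation
  of such, is determined by its restriction along \<open>\<eta>\<close>.  Conversely the same formulas with \<open>F\<close> in place of
  \<open>\<eta>\<close> extend a pseudo symmetric \<open>F\<close>: the cocycle condition on \<open>F\<^bsub>\<sigma>\<tau>;f\<^esub>\<close> makes the extension functorial, and
  the two compatibilities with \<open>\<gamma>\<close> combine to \<open>F\<^bsub>\<sigma>\<langle>\<tau>\<rangle>;\<gamma>(f;g)\<^esub> = \<gamma>(F\<^bsub>\<sigma>;f\<^esub>; F\<^bsub>\<tau>;g\<^esub>)\<close>, which makes it preserve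
  \<open>\<gamma>\<close>.  So precomposition with \<open>\<eta>\<close> is an isomorphism of hom categories, and a 2-functor that has such
  universal arrows has a left 2-adjoint.\<close>

section \<open>Block permutations\<close>

text \<open>All 0-cells of the 2-categories share one type, while the cells of M \<times> E\<Sigma>
  are pairs. The left adjoint therefore takes values in a copy of the product, transported along
  \<open>eo\<close>, \<open>em\<close>, \<open>ec\<close>. Injectivity of \<open>em\<close> and
  \<open>ec\<close> is asked only on pairs whose second entry is a cell of \<open>ES\<close>: there
  are countably many permutations of finite degree but uncountably many functions on the naturals,
  so any infinite type of cells admits such maps. The isomorphism of hom categories is proved for
  the product itself, at arbitrary types, and the copy is reached through an isomorphism of
  multicategories.

  For precomposition with \<eta> no inverse functor is written down: the extension gives
  surjectivity, recovery from the restriction gives injectivity, and a functor bijective on objects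
  and arrows is invertible.

  The combinatorial obstacle is the order of blocks. A block permutation lists its lengths in source
  order and lays out its target by the inverse permutation; equivariance is brought to this
  convention, so that the composition and associativity laws of \<open>block_perm\<close> carry the
  argument.\<close>

definition block_pos :: "nat list \<Rightarrow> nat \<Rightarrow> nat \<Rightarrow> nat" where
  "block_pos ks i p = sum_list (take i ks) + p"

abbreviation perms :: "nat list \<Rightarrow> (nat \<Rightarrow> nat) list \<Rightarrow> bool" where
  "perms \<equiv> list_all2 (\<lambda>k \<tau>. \<tau> permutes {..<k})"

lemma sum_list_take_mono:
  fixes ks :: "nat list"
  shows "i \<le> j \<Longrightarrow> sum_list (take i ks) \<le> sum_list (take j ks)"
  by (metis le_add1 le_Suc_ex sum_list_append take_add)

lemma sum_list_take_Suc:
  fixes ks :: "nat list"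
  shows "i < length ks \<Longrightarrow> sum_list (take (Suc i) ks) = sum_list (take i ks) + ks ! i"
  by (simp add: take_Suc_conv_app_nth)

lemma block_pos_less:
  assumes "i < length ks" "p < ks ! i"
  shows "block_pos ks i p < sum_list ks"
proof -
  have "block_pos ks i p < sum_list (take (Suc i) ks)"
    using assms by (simp add: block_pos_def sum_list_take_Suc)
  also have "\<dots> \<le> sum_list (take (length ks) ks)"
    by (rule sum_list_take_mono) (use assms in simp)
  finally show ?thesis by simp
qed

text \<open>Blocks may be empty. The bound \<open>p < ks ! i\<close> makes the partial sum increase
  strictly at block i, and monotonicity of the partial sums rules out every earlier index, so the
  \<open>LEAST\<close> in \<open>block_index\<close> skips empty blocks correctly.\<close>

lemma block_index_pos:
  assumes "i < length ks" "p < ks ! i"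
  shows "block_index ks (block_pos ks i p) = i"
  unfolding block_index_def
proof (rule Least_equality)
  show "block_pos ks i p < sum_list (take (Suc i) ks)"
    using assms by (simp add: block_pos_def sum_list_take_Suc)
  fix j assume *: "block_pos ks i p < sum_list (take (Suc j) ks)"
  show "i \<le> j"
  proof (rule ccontr)
    assume "\<not> i \<le> j"
    then have "sum_list (take (Suc j) ks) \<le> sum_list (take i ks)"
      by (intro sum_list_take_mono) simp
    with * show False by (simp add: block_pos_def)
  qed
qed

lemma block_pos_cases:
  assumes "x < sum_list ks"
  obtains i p where "i < length ks" "p < ks ! i" "x = block_pos ks i p"
  using assms
proof (induction ks arbitrary: x thesis)
  case (Cons k ks)
  show ?case
  proof (cases "x < k")
    case True
    then show ?thesis by (intro Cons.prems(1)[of 0 x]) (auto simp: block_pos_def)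
  next
    case False
    then obtain i p where "i < length ks" "p < ks ! i" "x - k = block_pos ks i p"
      using Cons.prems(2) Cons.IH[of "x - k"] by (metis add.commute less_diff_conv2 not_less sum_list.Cons)
    then show ?thesis using False
      by (intro Cons.prems(1)[of "Suc i" p]) (auto simp: block_pos_def)
  qed
qed simp

text \<open>In the coordinates (block, offset) the permutation is (i, p) \<mapsto> (\<sigma> i,
  \<open>(\<tau>s ! i) p\<close>). Below the total length it is evaluated only through this rule,
  with coordinates supplied by \<open>block_pos_cases\<close>.\<close>

lemma block_perm_pos:
  assumes "i < length ks" "p < ks ! i"
  shows "block_perm \<sigma> ks \<tau>s (block_pos ks i p) =
    block_pos (permute_list (inv \<sigma>) ks) (\<sigma> i) ((\<tau>s ! i) p)"
  using block_pos_less[OF assms] block_index_pos[OF assms]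
  by (simp add: block_perm_def Let_def block_pos_def)

lemma block_perm_outside: "\<not> x < sum_list ks \<Longrightarrow> block_perm \<sigma> ks \<tau>s x = x"
  by (simp add: block_perm_def)

lemma sum_list_permute_list:
  fixes ks :: "nat list"
  assumes "\<sigma> permutes {..<length ks}"
  shows "sum_list (permute_list \<sigma> ks) = sum_list ks"
  by (metis assms mset_permute_list sum_mset_sum_list)

lemma permutes_lt: "\<sigma> permutes {..<n} \<Longrightarrow> i < n \<Longrightarrow> \<sigma> i < n"
  by (metis lessThan_iff permutes_in_image)

lemma permutes_nth_inv: "\<sigma> permutes {..<length xs} \<Longrightarrow> i < length xs \<Longrightarrow>
    permute_list (inv \<sigma>) xs ! \<sigma> i = xs ! i"
  by (simp add: permute_list_nth permutes_inv permutes_inverses permutes_lt)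

lemma permute_list_inv [simp]:
  assumes "\<sigma> permutes {..<length xs}"
  shows "permute_list (inv \<sigma>) (permute_list \<sigma> xs) = xs"
    and "permute_list \<sigma> (permute_list (inv \<sigma>) xs) = xs"
  using assms permute_list_compose[of "inv \<sigma>" xs \<sigma>] permute_list_compose[of \<sigma> xs "inv \<sigma>"]
  by (simp_all add: permutes_inv permutes_inv_o)

lemma perms_nth: "perms ks \<tau>s \<Longrightarrow> i < length ks \<Longrightarrow> (\<tau>s ! i) permutes {..<ks ! i}"
  by (simp add: list_all2_conv_all_nth)

lemma block_perm_pos_cases:
  assumes "\<sigma> permutes {..<length ks}" "perms ks \<tau>s" "i < length ks" "p < ks ! i"
  shows "\<sigma> i < length ks" "(\<tau>s ! i) p < ks ! i" "permute_list (inv \<sigma>) ks ! \<sigma> i = ks ! i"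
  using assms by (simp_all add: permutes_lt permutes_nth_inv permutes_lt[OF perms_nth])

lemma block_perm_less:
  assumes "\<sigma> permutes {..<length ks}" "perms ks \<tau>s" "x < sum_list ks"
  shows "block_perm \<sigma> ks \<tau>s x < sum_list ks"
proof -
  obtain i p where ip: "i < length ks" "p < ks ! i" "x = block_pos ks i p"
    using block_pos_cases[OF assms(3)] .
  note c = block_perm_pos_cases[OF assms(1,2) ip(1,2)]
  have "block_pos (permute_list (inv \<sigma>) ks) (\<sigma> i) ((\<tau>s ! i) p) < sum_list (permute_list (inv \<sigma>) ks)"
    by (rule block_pos_less) (simp_all add: c)
  then show ?thesis
    using assms(1) by (simp add: ip block_perm_pos sum_list_permute_list permutes_inv)
qed

text \<open>Both sides send block i to block \<sigma> (\<tau> i) and act inside it by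
  \<open>as ! i \<circ> bs ! i\<close>. The list \<open>as\<close> is indexed by the source blocks
  of the whole composite, so it is moved into the order of the intermediate blocks by
  \<open>inv \<tau>\<close>; there its entry number \<tau> i is \<open>as ! i\<close>.\<close>

lemma block_perm_comp:
  assumes \<sigma>: "\<sigma> permutes {..<length ks}" and \<tau>: "\<tau> permutes {..<length ks}"
    and as: "perms ks as" and bs: "perms ks bs"
  shows "block_perm \<sigma> (permute_list (inv \<tau>) ks) (permute_list (inv \<tau>) as) \<circ> block_perm \<tau> ks bs
    = block_perm (\<sigma> \<circ> \<tau>) ks (map2 (\<circ>) as bs)"
proof
  fix x
  have [simp]: "length as = length ks" "length bs = length ks"
    using as bs by (auto dest: list_all2_lengthD)
  show "(block_perm \<sigma> (permute_list (inv \<tau>) ks) (permute_list (inv \<tau>) as) \<circ> block_perm \<tau> ks bs) x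
    = block_perm (\<sigma> \<circ> \<tau>) ks (map2 (\<circ>) as bs) x"
  proof (cases "x < sum_list ks")
    case False
    then show ?thesis using \<tau>
      by (simp add: block_perm_outside sum_list_permute_list permutes_inv)
  next
    case True
    obtain i p where ip: "i < length ks" "p < ks ! i" "x = block_pos ks i p"
      using block_pos_cases[OF True] .
    note c = block_perm_pos_cases[OF \<tau> bs ip(1,2)]
    have "permute_list (inv (\<sigma> \<circ> \<tau>)) ks = permute_list (inv \<sigma>) (permute_list (inv \<tau>) ks)"
      using \<sigma> \<tau> by (simp add: o_inv_distrib permutes_bij permute_list_compose permutes_inv)
    moreover have "permute_list (inv \<tau>) as ! \<tau> i = as ! i"
      using \<tau> ip(1) permutes_nth_inv[of \<tau> as i] by simp
    ultimately show ?thesis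
      using ip(1,2) c by (simp add: ip(3) block_perm_pos)
  qed
qed

lemma perms_permute_list:
  assumes "perms ks \<tau>s" "\<sigma> permutes {..<length ks}"
  shows "perms (permute_list \<sigma> ks) (permute_list \<sigma> \<tau>s)"
  using assms by (subst list_all2_permute_list_iff) (auto dest: list_all2_lengthD)

lemma perms_id: "perms ks (replicate (length ks) id)"
  by (simp add: list_all2_conv_all_nth permutes_id)

lemma perms_inv: "perms ks \<tau>s \<Longrightarrow> perms ks (map inv \<tau>s)"
  by (simp add: list_all2_conv_all_nth permutes_inv)

lemma perms_comp: "perms ks as \<Longrightarrow> perms ks bs \<Longrightarrow> perms ks (map2 (\<circ>) as bs)"
  by (simp add: list_all2_conv_all_nth permutes_compose)

lemma block_perm_id: "block_perm id ks (replicate (length ks) id) = id"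
proof
  fix x
  show "block_perm id ks (replicate (length ks) id) x = id x"
  proof (cases "x < sum_list ks")
    case True
    then obtain i p where "i < length ks" "p < ks ! i" "x = block_pos ks i p"
      by (rule block_pos_cases)
    then show ?thesis by (simp add: block_perm_pos inv_id[unfolded id_def] id_def)
  qed (simp add: block_perm_outside)
qed

lemma map2_comp_inv:
  assumes "perms ks \<tau>s"
  shows "map2 (\<circ>) (map inv \<tau>s) \<tau>s = replicate (length ks) id"
    and "map2 (\<circ>) \<tau>s (map inv \<tau>s) = replicate (length ks) id"
  using assms
  by (auto simp: list_all2_conv_all_nth permutes_inv_o intro!: nth_equalityI)

lemma block_perm_left_inv:
  assumes "\<sigma> permutes {..<length ks}" "perms ks \<tau>s"
  shows "block_perm (inv \<sigma>) (permute_list (inv \<sigma>) ks) (permute_list (inv \<sigma>) (map inv \<tau>s))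
    \<circ> block_perm \<sigma> ks \<tau>s = id"
  using assms
  by (simp add: block_perm_comp permutes_inv perms_inv map2_comp_inv block_perm_id permutes_inv_o)

text \<open>The composition law provides a left inverse and hence injectivity. An injective map of
  the finite set of positions into itself is onto, so one side suffices.\<close>

lemma block_perm_permutes:
  assumes "\<sigma> permutes {..<length ks}" "perms ks \<tau>s"
  shows "block_perm \<sigma> ks \<tau>s permutes {..<sum_list ks}"
proof (rule bij_imp_permutes)
  have "inj (block_perm \<sigma> ks \<tau>s)"
    using block_perm_left_inv[OF assms] by (rule inj_on_inverseI[OF pointfree_idE])
  then have "inj_on (block_perm \<sigma> ks \<tau>s) {..<sum_list ks}"
    by (rule inj_on_subset) simp
  moreover have "block_perm \<sigma> ks \<tau>s ` {..<sum_list ks} \<subseteq> {..<sum_list ks}"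
    using block_perm_less[OF assms] by auto
  ultimately show "bij_betw (block_perm \<sigma> ks \<tau>s) {..<sum_list ks} {..<sum_list ks}"
    by (simp add: bij_betw_def endo_inj_surj)
qed (simp add: block_perm_outside)

lemma block_perm_single: "\<sigma> permutes {..<k} \<Longrightarrow> block_perm id [k] [\<sigma>] = \<sigma>"
proof
  fix x assume "\<sigma> permutes {..<k}"
  show "block_perm id [k] [\<sigma>] x = \<sigma> x"
  proof (cases "x < k")
    case True
    then show ?thesis
      using block_perm_pos[of 0 "[k]" x id "[\<sigma>]"] by (simp add: block_pos_def)
  next
    case False
    then show ?thesis using \<open>\<sigma> permutes {..<k}\<close>
      by (simp add: block_perm_outside permutes_def)
  qed
qed

lemma permute_list_replicate: "\<sigma> permutes {..<n} \<Longrightarrow> permute_list \<sigma> (replicate n x) = replicate n x"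
  by (rule nth_equalityI) (simp_all add: permute_list_nth permutes_lt)

text \<open>Blocks of length one have the coordinates (x, 0). This becomes the right unit law of
  \<open>ES\<close>, as \<open>block_perm_single\<close> becomes the left one; the two also let an
  action be moved across unary cells.\<close>

lemma block_perm_ones:
  assumes "\<sigma> permutes {..<n}"
  shows "block_perm \<sigma> (replicate n 1) (replicate n id) = \<sigma>"
proof
  fix x
  show "block_perm \<sigma> (replicate n 1) (replicate n id) x = \<sigma> x"
  proof (cases "x < n")
    case True
    then have "\<sigma> x < n" using assms by (simp add: permutes_lt)
    with True show ?thesis
      using block_perm_pos[of x "replicate n 1" 0 \<sigma> "replicate n id"]
      by (simp add: block_pos_def sum_list_replicate permute_list_replicate permutes_inv assms)
  next
    case False
    then show ?thesis using assms
      by (simp add: block_perm_outside permutes_def sum_list_replicate)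
  qed
qed

section \<open>Nested blocks and associativity\<close>

lemma nth_concat_block_pos:
  "i < length xss \<Longrightarrow> j < length (xss ! i) \<Longrightarrow>
    concat xss ! block_pos (map length xss) i j = xss ! i ! j"
proof (induction xss arbitrary: i)
  case (Cons xs xss)
  then show ?case by (cases i) (simp_all add: block_pos_def nth_append)
qed simp

lemma take_concat_block_pos:
  "i < length xss \<Longrightarrow> j \<le> length (xss ! i) \<Longrightarrow>
    take (block_pos (map length xss) i j) (concat xss) = concat (take i xss) @ take j (xss ! i)"
proof (induction xss arbitrary: i)
  case (Cons xs xss)
  then show ?case by (cases i) (simp_all add: block_pos_def)
qed simp

lemma sum_list_concat: "sum_list (concat xss) = sum_list (map sum_list xss)"
  for xss :: "nat list list"
  by (induction xss) simp_all

text \<open>Three coordinates are flattened in two ways: block j of row i has number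
  \<open>block_pos (map length kss) i j\<close> in \<open>concat kss\<close>, and what precedes it
  is the earlier rows together with the earlier blocks of row i.\<close>

lemma block_pos_block_pos:
  assumes "i < length kss" "j < length (kss ! i)"
  shows "block_pos (concat kss) (block_pos (map length kss) i j) p
    = block_pos (map sum_list kss) i (block_pos (kss ! i) j p)"
  using take_concat_block_pos[of i kss j] assms
  unfolding block_pos_def by (simp add: sum_list_concat take_map)

lemma length_concat_block: "length (concat xss) = sum_list (map length xss)"
  by (simp add: length_concat)

text \<open>The target of a block permutation is laid out by permuting its lengths with the inverse
  of the outer permutation. In the associativity law the outer permutation is itself a block
  permutation, and this lemma regroups the resulting target into rows.\<close>

lemma permute_list_block_perm:
  assumes \<sigma>: "\<sigma> permutes {..<length xss}" and \<tau>s: "perms (map length xss) \<tau>s"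
  shows "permute_list (inv (block_perm \<sigma> (map length xss) \<tau>s)) (concat xss)
    = concat (permute_list (inv \<sigma>) (map2 (\<lambda>\<tau> xs. permute_list (inv \<tau>) xs) \<tau>s xss))"
    (is "permute_list (inv ?b) _ = concat ?yss")
proof (rule nth_equalityI)
  have [simp]: "length \<tau>s = length xss" using \<tau>s by (simp add: list_all2_conv_all_nth)
  have b: "?b permutes {..<length (concat xss)}"
    using block_perm_permutes[of \<sigma> "map length xss" \<tau>s] \<sigma> \<tau>s by (simp add: length_concat_block)
  have lens: "map length ?yss = permute_list (inv \<sigma>) (map length xss)"
  proof -
    have "map length (map2 (\<lambda>\<tau> xs. permute_list (inv \<tau>) xs) \<tau>s xss) = map length xss"
      by (rule nth_equalityI) simp_all
    then show ?thesis
      using \<sigma> by (simp add: permute_list_map[symmetric] permutes_inv)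
  qed
  then show len: "length (permute_list (inv ?b) (concat xss)) = length (concat ?yss)"
    using \<sigma> by (simp only: length_concat lens) (simp add: length_concat sum_list_permute_list permutes_inv)
  fix y assume "y < length (permute_list (inv ?b) (concat xss))"
  then have y: "y < length (concat xss)" by simp
  \<comment> \<open>The position y is treated through its preimage, because the coordinate rule
    evaluates \<open>?b\<close> but not its inverse.\<close>
  define x where "x = inv ?b y"
  have x: "x < sum_list (map length xss)" "y = ?b x"
    using y b by (simp_all add: x_def permutes_lt permutes_inv permutes_inverses flip: length_concat_block)
  obtain i j where ij: "i < length xss" "j < length (xss ! i)" "x = block_pos (map length xss) i j"
    using block_pos_cases[OF x(1)] by auto
  have c: "\<sigma> i < length xss" "(\<tau>s ! i) j < length (xss ! i)"
    using block_perm_pos_cases[OF _ \<tau>s, of \<sigma> i j] \<sigma> ij by simp_all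
  have \<tau>i: "(\<tau>s ! i) permutes {..<length (xss ! i)}"
    using perms_nth[OF \<tau>s] ij by simp
  have yi: "?yss ! \<sigma> i = permute_list (inv (\<tau>s ! i)) (xss ! i)"
    using \<sigma> ij permutes_nth_inv[of \<sigma> "map2 (\<lambda>\<tau> xs. permute_list (inv \<tau>) xs) \<tau>s xss" i] by simp
  have "permute_list (inv ?b) (concat xss) ! y = concat xss ! x"
    using b y by (simp add: permute_list_nth permutes_inv x_def)
  also have "\<dots> = xss ! i ! j" using ij by (simp add: nth_concat_block_pos)
  also have "\<dots> = ?yss ! \<sigma> i ! (\<tau>s ! i) j"
    using \<tau>i ij by (simp add: yi permutes_nth_inv)
  also have "\<dots> = concat ?yss ! block_pos (map length ?yss) (\<sigma> i) ((\<tau>s ! i) j)"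
    using c yi by (simp add: nth_concat_block_pos)
  also have "block_pos (map length ?yss) (\<sigma> i) ((\<tau>s ! i) j) = y"
    unfolding lens x(2) ij(3) using ij by (simp add: block_perm_pos)
  finally show "permute_list (inv ?b) (concat xss) ! y = concat ?yss ! y" .
qed

text \<open>In three coordinates both sides are (i, j, p) \<mapsto> (\<sigma> i,
  \<open>(\<tau>s ! i) j\<close>, \<open>(\<rho>ss ! i ! j) p\<close>). On the left the target
  layout is regrouped into rows by \<open>permute_list_block_perm\<close>; on the right it consists
  of row sums, which are unaffected by permuting inside a row.\<close>

lemma block_perm_assoc:
  assumes \<sigma>: "\<sigma> permutes {..<length kss}" and \<tau>s: "perms (map length kss) \<tau>s"
    and \<rho>ss: "list_all2 perms kss \<rho>ss"
  shows "block_perm (block_perm \<sigma> (map length kss) \<tau>s) (concat kss) (concat \<rho>ss)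
    = block_perm \<sigma> (map sum_list kss) (map (\<lambda>(\<tau>, ks, \<rho>s). block_perm \<tau> ks \<rho>s) (zip \<tau>s (zip kss \<rho>ss)))"
    (is "block_perm ?b _ _ = block_perm _ _ ?cs")
proof
  fix x
  have [simp]: "length \<tau>s = length kss" "length \<rho>ss = length kss"
    using \<tau>s \<rho>ss by (simp_all add: list_all2_conv_all_nth)
  show "block_perm ?b (concat kss) (concat \<rho>ss) x = block_perm \<sigma> (map sum_list kss) ?cs x"
  proof (cases "x < sum_list (map sum_list kss)")
    case False
    then show ?thesis by (simp add: block_perm_outside sum_list_concat)
  next
    case True
    then obtain i q where i: "i < length kss" "q < sum_list (kss ! i)" "x = block_pos (map sum_list kss) i q"
      by (rule block_pos_cases) auto
    obtain j p where j: "j < length (kss ! i)" "p < kss ! i ! j" "q = block_pos (kss ! i) j p"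
      using block_pos_cases[OF i(2)] .
    have \<tau>i: "(\<tau>s ! i) permutes {..<length (kss ! i)}"
      using perms_nth[OF \<tau>s] i by simp
    have \<rho>i: "perms (kss ! i) (\<rho>ss ! i)"
      using \<rho>ss i by (simp add: list_all2_conv_all_nth)
    let ?y = "block_pos (map length kss) i j"
    have y: "?y < length (concat kss)" "concat kss ! ?y = kss ! i ! j"
      using block_pos_less[of i "map length kss" j] i j
      by (simp_all add: length_concat nth_concat_block_pos)
    have lens: "map length kss = map length \<rho>ss"
      using \<rho>ss by (auto simp: list_all2_conv_all_nth intro!: nth_equalityI)
    have \<rho>y: "concat \<rho>ss ! ?y = \<rho>ss ! i ! j"
      unfolding lens using i j list_all2_lengthD[OF \<rho>i] by (simp add: nth_concat_block_pos)
    let ?kss = "permute_list (inv \<sigma>) (map2 (\<lambda>\<tau> xs. permute_list (inv \<tau>) xs) \<tau>s kss)"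
    have b_y: "?b ?y = block_pos (permute_list (inv \<sigma>) (map length kss)) (\<sigma> i) ((\<tau>s ! i) j)"
      using i j by (simp add: block_perm_pos)
    have lens2: "permute_list (inv \<sigma>) (map length kss) = map length ?kss"
    proof -
      have "map length (map2 (\<lambda>\<tau> xs. permute_list (inv \<tau>) xs) \<tau>s kss) = map length kss"
        by (rule nth_equalityI) simp_all
      then show ?thesis using \<sigma> by (simp add: permute_list_map[symmetric] permutes_inv)
    qed
    have sums: "permute_list (inv \<sigma>) (map sum_list kss) = map sum_list ?kss"
    proof -
      have "map sum_list (map2 (\<lambda>\<tau> xs. permute_list (inv \<tau>) xs) \<tau>s kss) = map sum_list kss"
        by (rule nth_equalityI) (use perms_nth[OF \<tau>s] in \<open>simp_all add: sum_list_permute_list permutes_inv\<close>)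
      then show ?thesis using \<sigma> by (simp add: permute_list_map[symmetric] permutes_inv)
    qed
    have c: "\<sigma> i < length kss" "(\<tau>s ! i) j < length (kss ! i)"
      using \<sigma> \<tau>i i j by (simp_all add: permutes_lt)
    have ki: "?kss ! \<sigma> i = permute_list (inv (\<tau>s ! i)) (kss ! i)"
      using \<sigma> i permutes_nth_inv[of \<sigma> "map2 (\<lambda>\<tau> xs. permute_list (inv \<tau>) xs) \<tau>s kss" i] by simp
    have "block_perm ?b (concat kss) (concat \<rho>ss) x
      = block_perm ?b (concat kss) (concat \<rho>ss) (block_pos (concat kss) ?y p)"
      using i j by (simp add: block_pos_block_pos)
    also have "\<dots> = block_pos (permute_list (inv ?b) (concat kss)) (?b ?y) ((\<rho>ss ! i ! j) p)"
      using y j \<rho>y by (simp add: block_perm_pos)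
    also have "\<dots> = block_pos (concat ?kss) (block_pos (map length ?kss) (\<sigma> i) ((\<tau>s ! i) j)) ((\<rho>ss ! i ! j) p)"
      by (simp only: permute_list_block_perm[OF \<sigma> \<tau>s] b_y lens2)
    also have "\<dots> = block_pos (map sum_list ?kss) (\<sigma> i) (block_pos (?kss ! \<sigma> i) ((\<tau>s ! i) j) ((\<rho>ss ! i ! j) p))"
      using c ki by (simp add: block_pos_block_pos)
    also have "\<dots> = block_pos (permute_list (inv \<sigma>) (map sum_list kss)) (\<sigma> i) ((?cs ! i) q)"
      using i j by (simp add: sums ki block_perm_pos)
    also have "\<dots> = block_perm \<sigma> (map sum_list kss) ?cs x"
      using i by (simp add: block_perm_pos)
    finally show ?thesis .
  qed
qed

section \<open>Splitting a block permutation into outer and inner part\<close>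

lemma outer_perm_permutes:
  assumes "\<sigma> permutes {..<length ks}"
  shows "outer_perm \<sigma> ks permutes {..<sum_list ks}"
  using block_perm_permutes[of \<sigma> "permute_list \<sigma> ks" "replicate (length ks) id"] assms
    perms_id[of "permute_list \<sigma> ks"]
  by (simp add: outer_perm_def sum_list_permute_list)

lemma inner_perm_permutes: "perms ks \<tau>s \<Longrightarrow> inner_perm ks \<tau>s permutes {..<sum_list ks}"
  by (simp add: inner_perm_def block_perm_permutes permutes_id)

text \<open>This is \<open>block_perm_comp\<close> with identities inside the left factor and the
  identity outside the right one. \<open>outer_perm\<close> expects the lengths in its target order
  and permutes them itself, so it is given \<open>permute_list (inv \<sigma>) ks\<close>.\<close>

lemma outer_perm_inner_perm:
  assumes "\<sigma> permutes {..<length ks}" "perms ks \<tau>s"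
  shows "outer_perm \<sigma> (permute_list (inv \<sigma>) ks) \<circ> inner_perm ks \<tau>s = block_perm \<sigma> ks \<tau>s"
proof -
  have "map2 (\<circ>) (replicate (length ks) id) \<tau>s = \<tau>s"
    using assms(2) by (intro nth_equalityI) (auto simp: list_all2_conv_all_nth)
  then show ?thesis
    using block_perm_comp[OF assms(1) permutes_id perms_id assms(2)] assms(1)
    by (simp add: outer_perm_def inner_perm_def)
qed

lemma outer_perm_ones: "\<sigma> permutes {..<n} \<Longrightarrow> outer_perm \<sigma> (replicate n 1) = \<sigma>"
  using block_perm_ones[of \<sigma> n] by (simp add: outer_perm_def permute_list_replicate)

lemma inner_perm_single: "\<sigma> permutes {..<n} \<Longrightarrow> inner_perm [n] [\<sigma>] = \<sigma>"
  by (simp add: inner_perm_def block_perm_single)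

lemma map_eq_replicate: "(\<And>x. x \<in> set xs \<Longrightarrow> f x = c) \<Longrightarrow> map f xs = replicate (length xs) c"
  by (simp add: map_replicate_const[symmetric] cong: map_cong)

section \<open>Elementary form of the axioms\<close>

lemma hom_cat_simps [simp]:
  "Obj (hom_cat M as b) = {f \<in> Cell1 M. src M f = as \<and> tgt M f = b}"
  "Arr (hom_cat M as b) = {\<alpha> \<in> Cell2 M. src M (dom2 M \<alpha>) = as \<and> tgt M (dom2 M \<alpha>) = b}"
  "Dom (hom_cat M as b) = dom2 M" "Cod (hom_cat M as b) = cod2 M"
  "Idn (hom_cat M as b) = id2 M" "Cmp (hom_cat M as b) = vcomp M"
  by (simp_all add: hom_cat_def)

lemma prod_cat_simps [simp]:
  "Obj (prod_cat C D) = Obj C \<times> Obj D" "Arr (prod_cat C D) = Arr C \<times> Arr D"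
  "Dom (prod_cat C D) (x, y) = (Dom C x, Dom D y)" "Cod (prod_cat C D) (x, y) = (Cod C x, Cod D y)"
  "Idn (prod_cat C D) (a, b) = (Idn C a, Idn D b)"
  "Cmp (prod_cat C D) (x, y) (x', y') = (Cmp C x x', Cmp D y y')"
  by (simp_all add: prod_cat_def)

lemma list_prod_hom_cat:
  assumes "length ass = length bs"
  shows "Obj (list_prod_cat (map2 (hom_cat M) ass bs))
      = {gs. set gs \<subseteq> Cell1 M \<and> map (src M) gs = ass \<and> map (tgt M) gs = bs}"
    and "Arr (list_prod_cat (map2 (hom_cat M) ass bs))
      = {\<beta>s. set \<beta>s \<subseteq> Cell2 M \<and> map (\<lambda>\<beta>. src M (dom2 M \<beta>)) \<beta>s = ass \<and> map (\<lambda>\<beta>. tgt M (dom2 M \<beta>)) \<beta>s = bs}"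
    and "length \<beta>s = length bs \<Longrightarrow> Dom (list_prod_cat (map2 (hom_cat M) ass bs)) \<beta>s = map (dom2 M) \<beta>s"
    and "length \<beta>s = length bs \<Longrightarrow> Cod (list_prod_cat (map2 (hom_cat M) ass bs)) \<beta>s = map (cod2 M) \<beta>s"
    and "length gs = length bs \<Longrightarrow> Idn (list_prod_cat (map2 (hom_cat M) ass bs)) gs = map (id2 M) gs"
    and "length \<beta>s = length bs \<Longrightarrow> length \<beta>s' = length bs \<Longrightarrow>
      Cmp (list_prod_cat (map2 (hom_cat M) ass bs)) \<beta>s \<beta>s' = map2 (vcomp M) \<beta>s \<beta>s'"
  using assms
  by (auto simp: list_prod_cat_def list_all2_conv_all_nth in_set_conv_nth intro!: nth_equalityI)
    (auto simp: list_eq_iff_nth_eq)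

lemma prod_category: "category C \<Longrightarrow> category D \<Longrightarrow> category (prod_cat C D)"
  unfolding category_def by (simp add: prod_cat_def split_paired_all)

lemma list_prod_category:
  assumes "\<And>C. C \<in> set Cs \<Longrightarrow> category C"
  shows "category (list_prod_cat Cs)"
proof -
  have c: "category (Cs ! i)" if "i < length Cs" for i
    using assms that by simp
  have eq: "Dom (Cs ! i) (ss ! i) = Cod (Cs ! i) (ts ! i)"
    if "map2 Dom Cs ss = map2 Cod Cs ts" "length ss = length Cs" "length ts = length Cs" "i < length Cs"
    for ss ts i
    using that by (auto simp: list_eq_iff_nth_eq)
  show ?thesis
    by unfold_locales
      (auto simp: list_prod_cat_def list_all2_conv_all_nth category.Dom_Obj[OF c] category.Cod_Obj[OF c]
        category.Idn_Arr[OF c] category.Dom_Idn[OF c] category.Cod_Idn[OF c] category.Cmp_Arr[OF c _ _ eq]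
        category.Dom_Cmp[OF c _ _ eq] category.Cod_Cmp[OF c _ _ eq] category.Cmp_Idn_left[OF c]
        category.Cmp_Idn_right[OF c] category.Cmp_assoc[OF c _ _ _ eq eq] intro!: nth_equalityI)
qed

lemma composable1_length: "composable1 M f gs \<Longrightarrow> length gs = arity M f"
  by (metis composable1_def length_map)

lemma composable2_length: "composable2 M \<alpha> \<beta>s \<Longrightarrow> length \<beta>s = arity M (dom2 M \<alpha>)"
  by (metis composable2_def length_map)

lemma composable1_Cell1: "composable1 M f gs \<Longrightarrow> f \<in> Cell1 M" "composable1 M f gs \<Longrightarrow> set gs \<subseteq> Cell1 M"
  by (simp_all add: composable1_def)

lemma composable2_Cell2: "composable2 M \<alpha> \<beta>s \<Longrightarrow> \<alpha> \<in> Cell2 M" "composable2 M \<alpha> \<beta>s \<Longrightarrow> set \<beta>s \<subseteq> Cell2 M"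
  by (simp_all add: composable2_def)

text \<open>Functoriality of the action and of \<open>\<gamma>\<close> is spelled out on cells; invertibility of the action follows
  from \<open>act1_comp\<close>, \<open>act1_id\<close> and their analogues on 2-cells.\<close>

locale elementary_multicategory =
  fixes M :: "('o, 'm, 'c) multicat"
  assumes src_Ob: "f \<in> Cell1 M \<Longrightarrow> set (src M f) \<subseteq> Ob M"
    and tgt_Ob: "f \<in> Cell1 M \<Longrightarrow> tgt M f \<in> Ob M"
    and dom2_Cell1: "\<alpha> \<in> Cell2 M \<Longrightarrow> dom2 M \<alpha> \<in> Cell1 M"
    and cod2_Cell1: "\<alpha> \<in> Cell2 M \<Longrightarrow> cod2 M \<alpha> \<in> Cell1 M"
    and src_cod2: "\<alpha> \<in> Cell2 M \<Longrightarrow> src M (cod2 M \<alpha>) = src M (dom2 M \<alpha>)"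
    and tgt_cod2: "\<alpha> \<in> Cell2 M \<Longrightarrow> tgt M (cod2 M \<alpha>) = tgt M (dom2 M \<alpha>)"
    and id2_Cell2: "f \<in> Cell1 M \<Longrightarrow> id2 M f \<in> Cell2 M"
    and dom2_id2: "f \<in> Cell1 M \<Longrightarrow> dom2 M (id2 M f) = f"
    and cod2_id2: "f \<in> Cell1 M \<Longrightarrow> cod2 M (id2 M f) = f"
    and vcomp_Cell2: "\<lbrakk>\<alpha> \<in> Cell2 M; \<beta> \<in> Cell2 M; dom2 M \<beta> = cod2 M \<alpha>\<rbrakk> \<Longrightarrow> vcomp M \<beta> \<alpha> \<in> Cell2 M"
    and dom2_vcomp: "\<lbrakk>\<alpha> \<in> Cell2 M; \<beta> \<in> Cell2 M; dom2 M \<beta> = cod2 M \<alpha>\<rbrakk> \<Longrightarrow>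
      dom2 M (vcomp M \<beta> \<alpha>) = dom2 M \<alpha>"
    and cod2_vcomp: "\<lbrakk>\<alpha> \<in> Cell2 M; \<beta> \<in> Cell2 M; dom2 M \<beta> = cod2 M \<alpha>\<rbrakk> \<Longrightarrow>
      cod2 M (vcomp M \<beta> \<alpha>) = cod2 M \<beta>"
    and vcomp_assoc: "\<lbrakk>\<alpha> \<in> Cell2 M; \<beta> \<in> Cell2 M; \<delta> \<in> Cell2 M; dom2 M \<beta> = cod2 M \<alpha>; dom2 M \<delta> = cod2 M \<beta>\<rbrakk>
      \<Longrightarrow> vcomp M (vcomp M \<delta> \<beta>) \<alpha> = vcomp M \<delta> (vcomp M \<beta> \<alpha>)"
    and vcomp_id2_left: "\<alpha> \<in> Cell2 M \<Longrightarrow> vcomp M (id2 M (cod2 M \<alpha>)) \<alpha> = \<alpha>"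
    and vcomp_id2_right: "\<alpha> \<in> Cell2 M \<Longrightarrow> vcomp M \<alpha> (id2 M (dom2 M \<alpha>)) = \<alpha>"
    and act1_Cell1: "\<lbrakk>f \<in> Cell1 M; \<sigma> permutes {..<arity M f}\<rbrakk> \<Longrightarrow> act1 M f \<sigma> \<in> Cell1 M"
    and src_act1: "\<lbrakk>f \<in> Cell1 M; \<sigma> permutes {..<arity M f}\<rbrakk> \<Longrightarrow>
      src M (act1 M f \<sigma>) = permute_list \<sigma> (src M f)"
    and tgt_act1: "\<lbrakk>f \<in> Cell1 M; \<sigma> permutes {..<arity M f}\<rbrakk> \<Longrightarrow> tgt M (act1 M f \<sigma>) = tgt M f"
    and act2_Cell2: "\<lbrakk>\<alpha> \<in> Cell2 M; \<sigma> permutes {..<arity M (dom2 M \<alpha>)}\<rbrakk> \<Longrightarrow> act2 M \<alpha> \<sigma> \<in> Cell2 M"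
    and dom2_act2: "\<lbrakk>\<alpha> \<in> Cell2 M; \<sigma> permutes {..<arity M (dom2 M \<alpha>)}\<rbrakk> \<Longrightarrow>
      dom2 M (act2 M \<alpha> \<sigma>) = act1 M (dom2 M \<alpha>) \<sigma>"
    and cod2_act2: "\<lbrakk>\<alpha> \<in> Cell2 M; \<sigma> permutes {..<arity M (dom2 M \<alpha>)}\<rbrakk> \<Longrightarrow>
      cod2 M (act2 M \<alpha> \<sigma>) = act1 M (cod2 M \<alpha>) \<sigma>"
    and act2_id2: "\<lbrakk>f \<in> Cell1 M; \<sigma> permutes {..<arity M f}\<rbrakk> \<Longrightarrow>
      act2 M (id2 M f) \<sigma> = id2 M (act1 M f \<sigma>)"
    and act2_vcomp: "\<lbrakk>\<alpha> \<in> Cell2 M; \<beta> \<in> Cell2 M; dom2 M \<beta> = cod2 M \<alpha>; \<sigma> permutes {..<arity M (dom2 M \<alpha>)}\<rbrakk>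
      \<Longrightarrow> act2 M (vcomp M \<beta> \<alpha>) \<sigma> = vcomp M (act2 M \<beta> \<sigma>) (act2 M \<alpha> \<sigma>)"
    and act1_comp: "\<lbrakk>f \<in> Cell1 M; \<sigma> permutes {..<arity M f}; \<tau> permutes {..<arity M f}\<rbrakk> \<Longrightarrow>
      act1 M (act1 M f \<sigma>) \<tau> = act1 M f (\<sigma> \<circ> \<tau>)"
    and act1_id: "f \<in> Cell1 M \<Longrightarrow> act1 M f id = f"
    and act2_comp: "\<lbrakk>\<alpha> \<in> Cell2 M; \<sigma> permutes {..<arity M (dom2 M \<alpha>)};
        \<tau> permutes {..<arity M (dom2 M \<alpha>)}\<rbrakk> \<Longrightarrow>
      act2 M (act2 M \<alpha> \<sigma>) \<tau> = act2 M \<alpha> (\<sigma> \<circ> \<tau>)"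
    and act2_id: "\<alpha> \<in> Cell2 M \<Longrightarrow> act2 M \<alpha> id = \<alpha>"
    and unit1_Cell1: "a \<in> Ob M \<Longrightarrow> unit1 M a \<in> Cell1 M"
    and src_unit1: "a \<in> Ob M \<Longrightarrow> src M (unit1 M a) = [a]"
    and tgt_unit1: "a \<in> Ob M \<Longrightarrow> tgt M (unit1 M a) = a"
    and gamma1_Cell1: "composable1 M f gs \<Longrightarrow> gamma1 M f gs \<in> Cell1 M"
    and src_gamma1: "composable1 M f gs \<Longrightarrow> src M (gamma1 M f gs) = concat (map (src M) gs)"
    and tgt_gamma1: "composable1 M f gs \<Longrightarrow> tgt M (gamma1 M f gs) = tgt M f"
    and gamma2_Cell2: "composable2 M \<alpha> \<beta>s \<Longrightarrow> gamma2 M \<alpha> \<beta>s \<in> Cell2 M"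
    and dom2_gamma2: "composable2 M \<alpha> \<beta>s \<Longrightarrow>
      dom2 M (gamma2 M \<alpha> \<beta>s) = gamma1 M (dom2 M \<alpha>) (map (dom2 M) \<beta>s)"
    and cod2_gamma2: "composable2 M \<alpha> \<beta>s \<Longrightarrow>
      cod2 M (gamma2 M \<alpha> \<beta>s) = gamma1 M (cod2 M \<alpha>) (map (cod2 M) \<beta>s)"
    and gamma2_id2: "composable1 M f gs \<Longrightarrow>
      gamma2 M (id2 M f) (map (id2 M) gs) = id2 M (gamma1 M f gs)"
    and gamma2_vcomp: "\<lbrakk>composable2 M \<alpha> \<beta>s; composable2 M \<alpha>' \<beta>s'; dom2 M \<alpha>' = cod2 M \<alpha>;
        map (dom2 M) \<beta>s' = map (cod2 M) \<beta>s\<rbrakk> \<Longrightarrow>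
      gamma2 M (vcomp M \<alpha>' \<alpha>) (map2 (vcomp M) \<beta>s' \<beta>s) = vcomp M (gamma2 M \<alpha>' \<beta>s') (gamma2 M \<alpha> \<beta>s)"
    and gamma1_assoc: "\<lbrakk>composable1 M f gs; list_all2 (composable1 M) gs hss\<rbrakk> \<Longrightarrow>
      gamma1 M (gamma1 M f gs) (concat hss) = gamma1 M f (map2 (gamma1 M) gs hss)"
    and gamma2_assoc: "\<lbrakk>composable2 M \<alpha> \<beta>s; list_all2 (composable2 M) \<beta>s \<delta>ss\<rbrakk> \<Longrightarrow>
      gamma2 M (gamma2 M \<alpha> \<beta>s) (concat \<delta>ss) = gamma2 M \<alpha> (map2 (gamma2 M) \<beta>s \<delta>ss)"
    and gamma1_unit_left: "f \<in> Cell1 M \<Longrightarrow> gamma1 M (unit1 M (tgt M f)) [f] = f"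
    and gamma1_unit_right: "f \<in> Cell1 M \<Longrightarrow> gamma1 M f (map (unit1 M) (src M f)) = f"
    and gamma2_unit_left: "\<alpha> \<in> Cell2 M \<Longrightarrow>
      gamma2 M (id2 M (unit1 M (tgt M (dom2 M \<alpha>)))) [\<alpha>] = \<alpha>"
    and gamma2_unit_right: "\<alpha> \<in> Cell2 M \<Longrightarrow>
      gamma2 M \<alpha> (map (\<lambda>a. id2 M (unit1 M a)) (src M (dom2 M \<alpha>))) = \<alpha>"
    and gamma1_top: "\<lbrakk>composable1 M f gs; \<sigma> permutes {..<length gs}\<rbrakk> \<Longrightarrow>
      gamma1 M (act1 M f \<sigma>) (permute_list \<sigma> gs)
        = act1 M (gamma1 M f gs) (outer_perm \<sigma> (map (arity M) gs))"
    and gamma2_top: "\<lbrakk>composable2 M \<alpha> \<beta>s; \<sigma> permutes {..<length \<beta>s}\<rbrakk> \<Longrightarrow>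
      gamma2 M (act2 M \<alpha> \<sigma>) (permute_list \<sigma> \<beta>s)
        = act2 M (gamma2 M \<alpha> \<beta>s) (outer_perm \<sigma> (map (\<lambda>\<beta>. arity M (dom2 M \<beta>)) \<beta>s))"
    and gamma1_bottom: "\<lbrakk>composable1 M f gs; list_all2 (\<lambda>g \<tau>. \<tau> permutes {..<arity M g}) gs \<tau>s\<rbrakk> \<Longrightarrow>
      gamma1 M f (map2 (act1 M) gs \<tau>s)
        = act1 M (gamma1 M f gs) (inner_perm (map (arity M) gs) \<tau>s)"
    and gamma2_bottom: "\<lbrakk>composable2 M \<alpha> \<beta>s;
        list_all2 (\<lambda>\<beta> \<tau>. \<tau> permutes {..<arity M (dom2 M \<beta>)}) \<beta>s \<tau>s\<rbrakk> \<Longrightarrow>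
      gamma2 M \<alpha> (map2 (act2 M) \<beta>s \<tau>s)
        = act2 M (gamma2 M \<alpha> \<beta>s) (inner_perm (map (\<lambda>\<beta>. arity M (dom2 M \<beta>)) \<beta>s) \<tau>s)"
begin

lemma elementary_category: "category (hom_cat M as b)"
  by unfold_locales
    (auto simp: dom2_Cell1 cod2_Cell1 src_cod2 tgt_cod2 id2_Cell2 dom2_id2 cod2_id2
      vcomp_Cell2 dom2_vcomp cod2_vcomp vcomp_assoc vcomp_id2_left vcomp_id2_right)

lemma elementary_act_functor:
  assumes "\<sigma> permutes {..<length as}"
  shows "cat_functor (hom_cat M as b) (hom_cat M (permute_list \<sigma> as) b)
    (\<lambda>f. act1 M f \<sigma>) (\<lambda>\<alpha>. act2 M \<alpha> \<sigma>)"
  unfolding cat_functor_def cat_functor_axioms_def using assms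
  by (auto simp: elementary_category dom2_Cell1 src_cod2 act1_Cell1 src_act1 tgt_act1 act2_Cell2
      dom2_act2 cod2_act2 act2_id2 act2_vcomp)

lemma cat_multicategory: "cat_multicategory M"
proof (rule cat_multicategory.intro)
  fix as :: "'o list" and b :: 'o and \<sigma>
  assume \<sigma>: "\<sigma> permutes {..<length as}"
  have "cat_functor (hom_cat M (permute_list \<sigma> as) b) (hom_cat M as b)
      (\<lambda>f. act1 M f (inv \<sigma>)) (\<lambda>\<alpha>. act2 M \<alpha> (inv \<sigma>))"
    using elementary_act_functor[of "inv \<sigma>" "permute_list \<sigma> as" b] \<sigma>
    by (simp add: permutes_inv)
  with \<sigma> show "cat_isomorphism (hom_cat M as b) (hom_cat M (permute_list \<sigma> as) b)
      (\<lambda>f. act1 M f \<sigma>) (\<lambda>\<alpha>. act2 M \<alpha> \<sigma>)"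
    unfolding cat_isomorphism_def
    by (intro conjI exI[of _ "\<lambda>f. act1 M f (inv \<sigma>)"] exI[of _ "\<lambda>f. act2 M f (inv \<sigma>)"])
      (auto simp: elementary_act_functor act1_comp act2_comp permutes_inv permutes_inv_o act1_id act2_id)
next
  fix bs :: "'o list" and c :: 'o and ass :: "'o list list"
  assume len: "length ass = length bs"
  show "cat_functor (prod_cat (hom_cat M bs c) (list_prod_cat (map2 (hom_cat M) ass bs)))
      (hom_cat M (concat ass) c)
      (\<lambda>(f, gs). gamma1 M f gs) (\<lambda>(\<alpha>, \<beta>s). gamma2 M \<alpha> \<beta>s)"
  proof -
    let ?C = "prod_cat (hom_cat M bs c) (list_prod_cat (map2 (hom_cat M) ass bs))"
    \<comment> \<open>The objects of the product category are composable pairs with prescribed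
      sources. The equality of lengths is what allows the operations of \<open>list_prod_cat\<close>
      to be read as plain maps over lists.\<close>
    have 1: "composable1 M f gs \<and> map (src M) gs = ass \<and> src M f = bs \<and> tgt M f = c \<and> length gs = length bs"
      if "(f, gs) \<in> Obj ?C" for f gs
      using that len by (auto simp: list_prod_hom_cat composable1_def dest: arg_cong[where f = length])
    have 2: "composable2 M \<alpha> \<beta>s \<and> composable1 M (dom2 M \<alpha>) (map (dom2 M) \<beta>s)
        \<and> map (\<lambda>\<beta>. src M (dom2 M \<beta>)) \<beta>s = ass \<and> src M (dom2 M \<alpha>) = bs
        \<and> tgt M (dom2 M \<alpha>) = c \<and> length \<beta>s = length bs"
      if "(\<alpha>, \<beta>s) \<in> Arr ?C" for \<alpha> \<beta>s
      using that len
      by (auto simp: list_prod_hom_cat composable1_def composable2_def dom2_Cell1 o_def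
          dest: arg_cong[where f = length])
    show ?thesis
    proof (intro cat_functor.intro cat_functor_axioms.intro)
      show "category ?C"
        by (intro prod_category elementary_category list_prod_category) (auto simp: elementary_category)
      show "category (hom_cat M (concat ass) c)"
        by (rule elementary_category)
    next
      fix x assume x: "x \<in> Obj ?C"
      obtain f gs where [simp]: "x = (f, gs)" by fastforce
      show "(case x of (f, gs) \<Rightarrow> gamma1 M f gs) \<in> Obj (hom_cat M (concat ass) c)"
        using 1[of f gs] x by (auto simp: gamma1_Cell1 src_gamma1 tgt_gamma1)
      show "(case Idn ?C x of (\<alpha>, \<beta>s) \<Rightarrow> gamma2 M \<alpha> \<beta>s)
          = Idn (hom_cat M (concat ass) c) (case x of (f, gs) \<Rightarrow> gamma1 M f gs)"
        using 1[of f gs] x len by (auto simp: gamma2_id2 list_prod_hom_cat(5))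
    next
      fix t assume t: "t \<in> Arr ?C"
      obtain \<alpha> \<beta>s where [simp]: "t = (\<alpha>, \<beta>s)" by fastforce
      show "(case t of (\<alpha>, \<beta>s) \<Rightarrow> gamma2 M \<alpha> \<beta>s) \<in> Arr (hom_cat M (concat ass) c)"
        using 2[of \<alpha> \<beta>s] t by (auto simp: gamma2_Cell2 dom2_gamma2 src_gamma1 tgt_gamma1 o_def)
      show "Dom (hom_cat M (concat ass) c) (case t of (\<alpha>, \<beta>s) \<Rightarrow> gamma2 M \<alpha> \<beta>s)
          = (case Dom ?C t of (f, gs) \<Rightarrow> gamma1 M f gs)"
        using 2[of \<alpha> \<beta>s] t len by (auto simp: dom2_gamma2 list_prod_hom_cat(3))
      show "Cod (hom_cat M (concat ass) c) (case t of (\<alpha>, \<beta>s) \<Rightarrow> gamma2 M \<alpha> \<beta>s)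
          = (case Cod ?C t of (f, gs) \<Rightarrow> gamma1 M f gs)"
        using 2[of \<alpha> \<beta>s] t len by (auto simp: cod2_gamma2 list_prod_hom_cat(4))
    next
      fix s t assume s: "s \<in> Arr ?C" and t: "t \<in> Arr ?C" and eq: "Dom ?C s = Cod ?C t"
      obtain \<alpha> \<beta>s where [simp]: "t = (\<alpha>, \<beta>s)" by fastforce
      obtain \<alpha>' \<beta>s' where [simp]: "s = (\<alpha>', \<beta>s')" by fastforce
      note s' = 2[of \<alpha>' \<beta>s'] and t' = 2[of \<alpha> \<beta>s]
      have "dom2 M \<alpha>' = cod2 M \<alpha>" "map (dom2 M) \<beta>s' = map (cod2 M) \<beta>s"
        using s' t' s t eq len by (auto simp: list_prod_hom_cat(3,4))
      then show "(case Cmp ?C s t of (\<alpha>, \<beta>s) \<Rightarrow> gamma2 M \<alpha> \<beta>s)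
          = Cmp (hom_cat M (concat ass) c) (case s of (\<alpha>, \<beta>s) \<Rightarrow> gamma2 M \<alpha> \<beta>s)
              (case t of (\<alpha>, \<beta>s) \<Rightarrow> gamma2 M \<alpha> \<beta>s)"
        using s' t' s t len by (auto simp: list_prod_hom_cat(6) gamma2_vcomp)
    qed
  qed
qed (use src_Ob tgt_Ob dom2_Cell1 act1_comp act1_id act2_comp act2_id gamma1_assoc gamma2_assoc
    gamma1_unit_left gamma1_unit_right gamma2_unit_left gamma2_unit_right gamma1_top gamma2_top
    gamma1_bottom gamma2_bottom elementary_category unit1_Cell1 src_unit1 tgt_unit1 in
    \<open>simp_all only: hom_cat_simps mem_Collect_eq simp_thms\<close>)

end

section \<open>The axioms of a Cat-multicategory on single cells\<close>

context cat_multicategory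
begin

text \<open>A cell determines its hom category, so the axioms about hom categories can be used cell
  by cell, with the conditions on objects coming from \<open>src_Ob\<close> and
  \<open>tgt_Ob\<close>.\<close>

lemma category_cell: "f \<in> Cell1 M \<Longrightarrow> category (hom_cat M (src M f) (tgt M f))"
  by (simp add: hom_category src_Ob tgt_Ob)

lemma cod2_cell:
  assumes "\<alpha> \<in> Cell2 M"
  shows "cod2 M \<alpha> \<in> Cell1 M" "src M (cod2 M \<alpha>) = src M (dom2 M \<alpha>)" "tgt M (cod2 M \<alpha>) = tgt M (dom2 M \<alpha>)"
  using category.Cod_Obj[OF category_cell[OF dom2_Cell1[OF assms]], of \<alpha>] assms by simp_all

lemma id2_cell:
  assumes "f \<in> Cell1 M"
  shows "id2 M f \<in> Cell2 M" "dom2 M (id2 M f) = f" "cod2 M (id2 M f) = f"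
  using category.Idn_Arr[OF category_cell[OF assms], of f] category.Dom_Idn[OF category_cell[OF assms], of f]
    category.Cod_Idn[OF category_cell[OF assms], of f] assms by simp_all

lemma vcomp_cell:
  assumes "\<alpha> \<in> Cell2 M" "\<beta> \<in> Cell2 M" "dom2 M \<beta> = cod2 M \<alpha>"
  shows "vcomp M \<beta> \<alpha> \<in> Cell2 M" "dom2 M (vcomp M \<beta> \<alpha>) = dom2 M \<alpha>" "cod2 M (vcomp M \<beta> \<alpha>) = cod2 M \<beta>"
proof -
  note c = category_cell[OF dom2_Cell1[OF assms(1)]]
  show "vcomp M \<beta> \<alpha> \<in> Cell2 M" "dom2 M (vcomp M \<beta> \<alpha>) = dom2 M \<alpha>" "cod2 M (vcomp M \<beta> \<alpha>) = cod2 M \<beta>"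
    using category.Cmp_Arr[OF c, of \<beta> \<alpha>] category.Dom_Cmp[OF c, of \<beta> \<alpha>] category.Cod_Cmp[OF c, of \<beta> \<alpha>]
      assms cod2_cell[of \<alpha>] cod2_cell[of \<beta>] by simp_all
qed

lemma vcomp_assoc:
  assumes "\<alpha> \<in> Cell2 M" "\<beta> \<in> Cell2 M" "\<delta> \<in> Cell2 M" "dom2 M \<beta> = cod2 M \<alpha>" "dom2 M \<delta> = cod2 M \<beta>"
  shows "vcomp M (vcomp M \<delta> \<beta>) \<alpha> = vcomp M \<delta> (vcomp M \<beta> \<alpha>)"
  using category.Cmp_assoc[OF category_cell[OF dom2_Cell1[OF assms(1)]], of \<delta> \<beta> \<alpha>] assms
    cod2_cell[of \<alpha>] cod2_cell[of \<beta>] by simp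

lemma vcomp_id2:
  assumes "\<alpha> \<in> Cell2 M"
  shows "vcomp M (id2 M (cod2 M \<alpha>)) \<alpha> = \<alpha>" "vcomp M \<alpha> (id2 M (dom2 M \<alpha>)) = \<alpha>"
  using category.Cmp_Idn_left[OF category_cell[OF dom2_Cell1[OF assms]], of \<alpha>]
    category.Cmp_Idn_right[OF category_cell[OF dom2_Cell1[OF assms]], of \<alpha>] assms by simp_all

lemma act_functor:
  assumes "f \<in> Cell1 M" "\<sigma> permutes {..<arity M f}"
  shows "cat_functor (hom_cat M (src M f) (tgt M f)) (hom_cat M (permute_list \<sigma> (src M f)) (tgt M f))
    (\<lambda>f. act1 M f \<sigma>) (\<lambda>\<alpha>. act2 M \<alpha> \<sigma>)"
  using act_isomorphism[of "src M f" "tgt M f" \<sigma>] assms by (simp add: cat_isomorphism_def src_Ob tgt_Ob)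

lemma act1_cell:
  assumes "f \<in> Cell1 M" "\<sigma> permutes {..<arity M f}"
  shows "act1 M f \<sigma> \<in> Cell1 M" "src M (act1 M f \<sigma>) = permute_list \<sigma> (src M f)"
    "tgt M (act1 M f \<sigma>) = tgt M f"
  using cat_functor.map_Obj[OF act_functor[OF assms], of f] assms by simp_all

lemma act2_cell:
  assumes "\<alpha> \<in> Cell2 M" "\<sigma> permutes {..<arity M (dom2 M \<alpha>)}"
  shows "act2 M \<alpha> \<sigma> \<in> Cell2 M" "dom2 M (act2 M \<alpha> \<sigma>) = act1 M (dom2 M \<alpha>) \<sigma>"
    "cod2 M (act2 M \<alpha> \<sigma>) = act1 M (cod2 M \<alpha>) \<sigma>"
proof -
  note c = act_functor[OF dom2_Cell1[OF assms(1)] assms(2)]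
  show "act2 M \<alpha> \<sigma> \<in> Cell2 M" "dom2 M (act2 M \<alpha> \<sigma>) = act1 M (dom2 M \<alpha>) \<sigma>"
    "cod2 M (act2 M \<alpha> \<sigma>) = act1 M (cod2 M \<alpha>) \<sigma>"
    using cat_functor.map_Arr[OF c, of \<alpha>] cat_functor.map_Dom[OF c, of \<alpha>] cat_functor.map_Cod[OF c, of \<alpha>] assms
    by simp_all
qed

lemma act2_id2:
  assumes "f \<in> Cell1 M" "\<sigma> permutes {..<arity M f}"
  shows "act2 M (id2 M f) \<sigma> = id2 M (act1 M f \<sigma>)"
  using cat_functor.map_Idn[OF act_functor[OF assms], of f] assms by simp

lemma act2_vcomp:
  assumes "\<alpha> \<in> Cell2 M" "\<beta> \<in> Cell2 M" "dom2 M \<beta> = cod2 M \<alpha>" "\<sigma> permutes {..<arity M (dom2 M \<alpha>)}"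
  shows "act2 M (vcomp M \<beta> \<alpha>) \<sigma> = vcomp M (act2 M \<beta> \<sigma>) (act2 M \<alpha> \<sigma>)"
  using cat_functor.map_Cmp[OF act_functor[OF dom2_Cell1[OF assms(1)] assms(4)], of \<beta> \<alpha>] assms
    cod2_cell[of \<alpha>] by simp

lemma unit1_cell:
  assumes "a \<in> Ob M"
  shows "unit1 M a \<in> Cell1 M" "src M (unit1 M a) = [a]" "tgt M (unit1 M a) = a"
  using unit1_hom[OF assms] by simp_all

lemmas cell_simps = dom2_Cell1 cod2_cell id2_cell vcomp_cell vcomp_assoc vcomp_id2
  act1_cell act2_cell act2_id2 unit1_cell

lemma gamma_functor_cell:
  assumes "composable1 M f gs"
  shows "cat_functor
    (prod_cat (hom_cat M (src M f) (tgt M f)) (list_prod_cat (map2 (hom_cat M) (map (src M) gs) (src M f))))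
    (hom_cat M (concat (map (src M) gs)) (tgt M f))
    (\<lambda>(f, gs). gamma1 M f gs) (\<lambda>(\<alpha>, \<beta>s). gamma2 M \<alpha> \<beta>s)"
  using assms src_Ob by (intro gamma_functor)
    (auto simp: composable1_length composable1_def tgt_Ob subset_iff)

lemma gamma1_cell:
  assumes "composable1 M f gs"
  shows "gamma1 M f gs \<in> Cell1 M" "src M (gamma1 M f gs) = concat (map (src M) gs)"
    "tgt M (gamma1 M f gs) = tgt M f"
  using cat_functor.map_Obj[OF gamma_functor_cell[OF assms], of "(f, gs)"] assms
  by (simp_all add: list_prod_hom_cat composable1_length composable1_def)

lemma composable2_dom2: "composable2 M \<alpha> \<beta>s \<Longrightarrow> composable1 M (dom2 M \<alpha>) (map (dom2 M) \<beta>s)"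
  by (auto simp: composable1_def composable2_def dom2_Cell1 o_def)

lemma composable2_cod2: "composable2 M \<alpha> \<beta>s \<Longrightarrow> composable1 M (cod2 M \<alpha>) (map (cod2 M) \<beta>s)"
  by (auto simp: composable1_def composable2_def cod2_cell subset_iff o_def cong: map_cong)

lemma composable1_id2: "composable1 M f gs \<Longrightarrow> composable2 M (id2 M f) (map (id2 M) gs)"
  by (auto simp: composable1_def composable2_def id2_cell subset_iff o_def cong: map_cong)

lemma gamma2_cell:
  assumes "composable2 M \<alpha> \<beta>s"
  shows "gamma2 M \<alpha> \<beta>s \<in> Cell2 M"
    "dom2 M (gamma2 M \<alpha> \<beta>s) = gamma1 M (dom2 M \<alpha>) (map (dom2 M) \<beta>s)"
    "cod2 M (gamma2 M \<alpha> \<beta>s) = gamma1 M (cod2 M \<alpha>) (map (cod2 M) \<beta>s)"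
proof -
  note c = gamma_functor_cell[OF composable2_dom2[OF assms]]
  show "gamma2 M \<alpha> \<beta>s \<in> Cell2 M"
    "dom2 M (gamma2 M \<alpha> \<beta>s) = gamma1 M (dom2 M \<alpha>) (map (dom2 M) \<beta>s)"
    "cod2 M (gamma2 M \<alpha> \<beta>s) = gamma1 M (cod2 M \<alpha>) (map (cod2 M) \<beta>s)"
    using cat_functor.map_Arr[OF c, of "(\<alpha>, \<beta>s)"] cat_functor.map_Dom[OF c, of "(\<alpha>, \<beta>s)"]
      cat_functor.map_Cod[OF c, of "(\<alpha>, \<beta>s)"] assms composable2_length[OF assms]
    by (simp_all add: list_prod_hom_cat composable2_def o_def)
qed

lemma gamma2_id2:
  assumes "composable1 M f gs"
  shows "gamma2 M (id2 M f) (map (id2 M) gs) = id2 M (gamma1 M f gs)"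
  using cat_functor.map_Idn[OF gamma_functor_cell[OF assms], of "(f, gs)"] assms
  by (simp add: list_prod_hom_cat composable1_length composable1_def)

lemma gamma2_vcomp:
  assumes "composable2 M \<alpha> \<beta>s" "composable2 M \<alpha>' \<beta>s'" "dom2 M \<alpha>' = cod2 M \<alpha>"
    "map (dom2 M) \<beta>s' = map (cod2 M) \<beta>s"
  shows "gamma2 M (vcomp M \<alpha>' \<alpha>) (map2 (vcomp M) \<beta>s' \<beta>s) = vcomp M (gamma2 M \<alpha>' \<beta>s') (gamma2 M \<alpha> \<beta>s)"
proof -
  have "map (src M) (map (dom2 M) \<beta>s') = map (src M) (map (dom2 M) \<beta>s)"
    unfolding assms(4) using assms(1) by (auto simp: composable2_def cod2_cell)
  then have \<beta>: "map (\<lambda>\<beta>. src M (dom2 M \<beta>)) \<beta>s' = map (\<lambda>\<beta>. src M (dom2 M \<beta>)) \<beta>s"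
    by (simp only: map_map o_def)
  note c = gamma_functor_cell[OF composable2_dom2[OF assms(1)]]
  show ?thesis
    using cat_functor.map_Cmp[OF c, of "(\<alpha>', \<beta>s')" "(\<alpha>, \<beta>s)"] assms composable2_length[OF assms(1)]
      composable2_length[OF assms(2)] \<beta>
    by (simp add: list_prod_hom_cat composable2_def o_def cod2_cell)
qed

text \<open>The convention for all equivariance statements is fixed here: \<open>gs\<close> is
  listed in the order of the inputs of \<open>act1 M f \<sigma>\<close>, and f itself receives the
  list permuted by \<open>inv \<sigma>\<close>. In this way the degrees of \<open>gs\<close> are the
  source lengths of the block permutation.\<close>

lemma composable1_act_top:
  assumes "composable1 M f (permute_list (inv \<sigma>) gs)" "\<sigma> permutes {..<length gs}"
  shows "composable1 M (act1 M f \<sigma>) gs"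
proof -
  have "permute_list \<sigma> (map (tgt M) (permute_list (inv \<sigma>) gs)) = map (tgt M) gs"
    using assms(2) by (simp add: permute_list_map permutes_inv)
  with assms composable1_length[OF assms(1)] show ?thesis
    by (simp add: composable1_def act1_cell permutes_inv)
qed

lemma composable2_act_top:
  assumes "composable2 M \<alpha> (permute_list (inv \<sigma>) \<beta>s)" "\<sigma> permutes {..<length \<beta>s}"
  shows "composable2 M (act2 M \<alpha> \<sigma>) \<beta>s"
proof -
  have "permute_list \<sigma> (map (\<lambda>\<beta>. tgt M (dom2 M \<beta>)) (permute_list (inv \<sigma>) \<beta>s)) = map (\<lambda>\<beta>. tgt M (dom2 M \<beta>)) \<beta>s"
    using assms(2) by (simp add: permute_list_map permutes_inv)
  with assms composable2_length[OF assms(1)] show ?thesis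
    by (simp add: composable2_def act1_cell act2_cell dom2_Cell1 permutes_inv)
qed

lemma arity_gamma1: "composable1 M f gs \<Longrightarrow> arity M (gamma1 M f gs) = sum_list (map (arity M) gs)"
  by (simp add: gamma1_cell length_concat o_def)

lemma perms_list_all2:
  "perms (map (arity M) gs) \<tau>s \<longleftrightarrow> list_all2 (\<lambda>g \<tau>. \<tau> permutes {..<arity M g}) gs \<tau>s"
  "perms (map (\<lambda>\<beta>. arity M (dom2 M \<beta>)) \<beta>s) \<tau>s
    \<longleftrightarrow> list_all2 (\<lambda>\<beta> \<tau>. \<tau> permutes {..<arity M (dom2 M \<beta>)}) \<beta>s \<tau>s"
  by (simp_all add: list_all2_map1)

text \<open>Bottom equivariance removes the \<tau>s, top equivariance removes \<sigma>, and the two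
  permutations multiply to \<sigma>\<langle>\<tau>s\<rangle> by
  \<open>outer_perm_inner_perm\<close>.\<close>

lemma gamma1_equivariant:
  assumes f: "composable1 M f (permute_list (inv \<sigma>) gs)" and \<sigma>: "\<sigma> permutes {..<length gs}"
    and \<tau>s: "perms (map (arity M) gs) \<tau>s"
  shows "gamma1 M (act1 M f \<sigma>) (map2 (act1 M) gs \<tau>s)
    = act1 M (gamma1 M f (permute_list (inv \<sigma>) gs)) (block_perm \<sigma> (map (arity M) gs) \<tau>s)"
proof -
  let ?ks = "map (arity M) gs"
  have ks: "map (arity M) (permute_list (inv \<sigma>) gs) = permute_list (inv \<sigma>) ?ks"
    using \<sigma> by (simp add: permute_list_map permutes_inv)
  have ar: "arity M (gamma1 M f (permute_list (inv \<sigma>) gs)) = sum_list ?ks"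
    using \<sigma> by (simp only: arity_gamma1[OF f] ks) (simp add: sum_list_permute_list permutes_inv)
  have 1: "gamma1 M (act1 M f \<sigma>) gs
      = act1 M (gamma1 M f (permute_list (inv \<sigma>) gs)) (outer_perm \<sigma> (permute_list (inv \<sigma>) ?ks))"
    using gamma1_top[OF f, of \<sigma>] \<sigma> by (simp add: ks)
  have "gamma1 M (act1 M f \<sigma>) (map2 (act1 M) gs \<tau>s)
      = act1 M (gamma1 M (act1 M f \<sigma>) gs) (inner_perm ?ks \<tau>s)"
    using composable1_act_top[OF f \<sigma>] \<tau>s by (simp add: gamma1_bottom perms_list_all2)
  also have "\<dots> = act1 M (gamma1 M f (permute_list (inv \<sigma>) gs))
      (outer_perm \<sigma> (permute_list (inv \<sigma>) ?ks) \<circ> inner_perm ?ks \<tau>s)"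
    unfolding 1 using \<sigma> \<tau>s outer_perm_permutes[of \<sigma> "permute_list (inv \<sigma>) ?ks"]
    by (intro act1_comp gamma1_cell f)
      (simp_all add: ar inner_perm_permutes sum_list_permute_list permutes_inv)
  finally show ?thesis using \<sigma> \<tau>s by (simp add: outer_perm_inner_perm)
qed

lemma gamma2_equivariant:
  assumes \<alpha>: "composable2 M \<alpha> (permute_list (inv \<sigma>) \<beta>s)" and \<sigma>: "\<sigma> permutes {..<length \<beta>s}"
    and \<tau>s: "perms (map (\<lambda>\<beta>. arity M (dom2 M \<beta>)) \<beta>s) \<tau>s"
  shows "gamma2 M (act2 M \<alpha> \<sigma>) (map2 (act2 M) \<beta>s \<tau>s)
    = act2 M (gamma2 M \<alpha> (permute_list (inv \<sigma>) \<beta>s)) (block_perm \<sigma> (map (\<lambda>\<beta>. arity M (dom2 M \<beta>)) \<beta>s) \<tau>s)"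
proof -
  let ?ks = "map (\<lambda>\<beta>. arity M (dom2 M \<beta>)) \<beta>s"
  have ks: "map (\<lambda>\<beta>. arity M (dom2 M \<beta>)) (permute_list (inv \<sigma>) \<beta>s) = permute_list (inv \<sigma>) ?ks"
    using \<sigma> by (simp add: permute_list_map permutes_inv)
  have ar: "arity M (dom2 M (gamma2 M \<alpha> (permute_list (inv \<sigma>) \<beta>s))) = sum_list ?ks"
  proof -
    have "arity M (dom2 M (gamma2 M \<alpha> (permute_list (inv \<sigma>) \<beta>s)))
      = sum_list (map (\<lambda>\<beta>. arity M (dom2 M \<beta>)) (permute_list (inv \<sigma>) \<beta>s))"
      using \<alpha> by (simp add: gamma2_cell arity_gamma1 composable2_dom2 o_def)
    also have "\<dots> = sum_list ?ks"
      using \<sigma> by (simp only: ks) (simp add: sum_list_permute_list permutes_inv)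
    finally show ?thesis .
  qed
  have 1: "gamma2 M (act2 M \<alpha> \<sigma>) \<beta>s
      = act2 M (gamma2 M \<alpha> (permute_list (inv \<sigma>) \<beta>s)) (outer_perm \<sigma> (permute_list (inv \<sigma>) ?ks))"
    using gamma2_top[OF \<alpha>, of \<sigma>] \<sigma> by (simp add: ks)
  have "gamma2 M (act2 M \<alpha> \<sigma>) (map2 (act2 M) \<beta>s \<tau>s)
      = act2 M (gamma2 M (act2 M \<alpha> \<sigma>) \<beta>s) (inner_perm ?ks \<tau>s)"
    using composable2_act_top[OF \<alpha> \<sigma>] \<tau>s by (simp add: gamma2_bottom perms_list_all2)
  also have "\<dots> = act2 M (gamma2 M \<alpha> (permute_list (inv \<sigma>) \<beta>s))
      (outer_perm \<sigma> (permute_list (inv \<sigma>) ?ks) \<circ> inner_perm ?ks \<tau>s)"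
    unfolding 1 using \<sigma> \<tau>s outer_perm_permutes[of \<sigma> "permute_list (inv \<sigma>) ?ks"]
    by (intro act2_comp gamma2_cell \<alpha>)
      (simp_all add: ar inner_perm_permutes sum_list_permute_list permutes_inv)
  finally show ?thesis using \<sigma> \<tau>s by (simp add: outer_perm_inner_perm)
qed

end

lemma nonsym_multifunctorI:
  fixes F :: "('o, 'm, 'c, 'p, 'n, 'd, 'z) mfun_scheme"
  assumes "cat_multicategory M" "cat_multicategory N"
    and "fob F \<in> Ob M \<rightarrow>\<^sub>E Ob N" "fc1 F \<in> extensional (Cell1 M)" "fc2 F \<in> extensional (Cell2 M)"
    and "\<And>f. f \<in> Cell1 M \<Longrightarrow> fc1 F f \<in> Cell1 N"
    and "\<And>f. f \<in> Cell1 M \<Longrightarrow> src N (fc1 F f) = map (fob F) (src M f)"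
    and "\<And>f. f \<in> Cell1 M \<Longrightarrow> tgt N (fc1 F f) = fob F (tgt M f)"
    and "\<And>\<alpha>. \<alpha> \<in> Cell2 M \<Longrightarrow> fc2 F \<alpha> \<in> Cell2 N"
    and "\<And>\<alpha>. \<alpha> \<in> Cell2 M \<Longrightarrow> dom2 N (fc2 F \<alpha>) = fc1 F (dom2 M \<alpha>)"
    and "\<And>\<alpha>. \<alpha> \<in> Cell2 M \<Longrightarrow> cod2 N (fc2 F \<alpha>) = fc1 F (cod2 M \<alpha>)"
    and "\<And>f. f \<in> Cell1 M \<Longrightarrow> fc2 F (id2 M f) = id2 N (fc1 F f)"
    and "\<And>\<alpha> \<beta>. \<alpha> \<in> Cell2 M \<Longrightarrow> \<beta> \<in> Cell2 M \<Longrightarrow> dom2 M \<beta> = cod2 M \<alpha> \<Longrightarrow>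
      fc2 F (vcomp M \<beta> \<alpha>) = vcomp N (fc2 F \<beta>) (fc2 F \<alpha>)"
    and "\<And>a. a \<in> Ob M \<Longrightarrow> fc1 F (unit1 M a) = unit1 N (fob F a)"
    and "\<And>f gs. composable1 M f gs \<Longrightarrow> fc1 F (gamma1 M f gs) = gamma1 N (fc1 F f) (map (fc1 F) gs)"
    and "\<And>\<alpha> \<beta>s. composable2 M \<alpha> \<beta>s \<Longrightarrow> fc2 F (gamma2 M \<alpha> \<beta>s) = gamma2 N (fc2 F \<alpha>) (map (fc2 F) \<beta>s)"
  shows "nonsym_multifunctor M N F"
  using assms PiE_mem[OF assms(3)]
  by (auto intro!: nonsym_multifunctor.intro nonsym_multifunctor_axioms.intro cat_functor.intro
      cat_functor_axioms.intro cat_multicategory.hom_category[of M] cat_multicategory.hom_category[of N]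
      simp: cat_multicategory.dom2_Cell1 subset_iff)

context nonsym_multifunctor
begin

lemma fob_Ob: "a \<in> Ob M \<Longrightarrow> fob F a \<in> Ob N"
  using fob_ext by auto

lemma hom_functor_cell:
  "f \<in> Cell1 M \<Longrightarrow> cat_functor (hom_cat M (src M f) (tgt M f))
    (hom_cat N (map (fob F) (src M f)) (fob F (tgt M f))) (fc1 F) (fc2 F)"
  by (simp add: hom_functor M.src_Ob M.tgt_Ob)

lemma fc1_cell:
  assumes "f \<in> Cell1 M"
  shows "fc1 F f \<in> Cell1 N" "src N (fc1 F f) = map (fob F) (src M f)" "tgt N (fc1 F f) = fob F (tgt M f)"
  using cat_functor.map_Obj[OF hom_functor_cell[OF assms], of f] assms by simp_all

lemma fc2_cell:
  assumes "\<alpha> \<in> Cell2 M"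
  shows "fc2 F \<alpha> \<in> Cell2 N" "dom2 N (fc2 F \<alpha>) = fc1 F (dom2 M \<alpha>)" "cod2 N (fc2 F \<alpha>) = fc1 F (cod2 M \<alpha>)"
proof -
  note c = hom_functor_cell[OF M.dom2_Cell1[OF assms]]
  show "fc2 F \<alpha> \<in> Cell2 N" "dom2 N (fc2 F \<alpha>) = fc1 F (dom2 M \<alpha>)" "cod2 N (fc2 F \<alpha>) = fc1 F (cod2 M \<alpha>)"
    using cat_functor.map_Arr[OF c, of \<alpha>] cat_functor.map_Dom[OF c, of \<alpha>] cat_functor.map_Cod[OF c, of \<alpha>] assms
    by simp_all
qed

lemma fc2_id2: "f \<in> Cell1 M \<Longrightarrow> fc2 F (id2 M f) = id2 N (fc1 F f)"
  using cat_functor.map_Idn[OF hom_functor_cell, of f f] by simp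

lemma fc2_vcomp:
  assumes "\<alpha> \<in> Cell2 M" "\<beta> \<in> Cell2 M" "dom2 M \<beta> = cod2 M \<alpha>"
  shows "fc2 F (vcomp M \<beta> \<alpha>) = vcomp N (fc2 F \<beta>) (fc2 F \<alpha>)"
  using cat_functor.map_Cmp[OF hom_functor_cell[OF M.dom2_Cell1[OF assms(1)]], of \<beta> \<alpha>] assms
  by (simp add: M.cod2_cell)

lemma composable1_map:
  assumes "composable1 M f gs"
  shows "composable1 N (fc1 F f) (map (fc1 F) gs)"
proof -
  have "map (fob F) (map (tgt M) gs) = map (fob F) (src M f)"
    using assms by (simp only: composable1_def)
  then have "map (\<lambda>g. fob F (tgt M g)) gs = map (fob F) (src M f)"
    by (simp only: map_map o_def)
  with assms show ?thesis
    by (auto simp: composable1_def fc1_cell subset_iff o_def cong: map_cong)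
qed

lemma composable2_map:
  assumes "composable2 M \<alpha> \<beta>s"
  shows "composable2 N (fc2 F \<alpha>) (map (fc2 F) \<beta>s)"
proof -
  have "map (fob F) (map (\<lambda>\<beta>. tgt M (dom2 M \<beta>)) \<beta>s) = map (fob F) (src M (dom2 M \<alpha>))"
    using assms by (simp only: composable2_def)
  then have "map (\<lambda>\<beta>. fob F (tgt M (dom2 M \<beta>))) \<beta>s = map (fob F) (src M (dom2 M \<alpha>))"
    by (simp only: map_map o_def)
  with assms show ?thesis
    by (auto simp: composable2_def fc1_cell fc2_cell M.dom2_Cell1 subset_iff o_def cong: map_cong)
qed

end

section \<open>The Barratt-Eccles operad is a Cat-multicategory\<close>

text \<open>Projections take the place of the pattern matching in the definition, so that the
  equations apply to variables of pair type.\<close>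

lemma ES_simps [simp]:
  "Ob ES = UNIV" "x \<in> Cell1 ES \<longleftrightarrow> snd x permutes {..<fst x}"
  "s \<in> Cell2 ES \<longleftrightarrow> fst s \<in> Cell1 ES \<and> snd s \<in> Cell1 ES \<and> fst (fst s) = fst (snd s)"
  "src ES = (\<lambda>x. replicate (fst x) ())" "tgt ES = (\<lambda>x. ())" "dom2 ES = fst" "cod2 ES = snd"
  "id2 ES = (\<lambda>x. (x, x))" "vcomp ES = (\<lambda>s t. (fst t, snd s))" "act1 ES = (\<lambda>x \<tau>. (fst x, snd x \<circ> \<tau>))"
  "act2 ES = (\<lambda>s \<tau>. (act1 ES (fst s) \<tau>, act1 ES (snd s) \<tau>))" "unit1 ES = (\<lambda>a. (1, id))"
  "gamma1 ES = ES_gamma" "gamma2 ES = (\<lambda>s ts. (ES_gamma (fst s) (map fst ts), ES_gamma (snd s) (map snd ts)))"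
  by (auto simp: ES_def fun_eq_iff split: prod.splits)

lemma composable1_ES:
  "composable1 ES x ys \<longleftrightarrow> x \<in> Cell1 ES \<and> set ys \<subseteq> Cell1 ES \<and> length ys = fst x"
  by (auto simp: composable1_def list_eq_iff_nth_eq)

lemma composable2_ES:
  "composable2 ES s ts \<longleftrightarrow> composable1 ES (fst s) (map fst ts) \<and> composable1 ES (snd s) (map snd ts)
    \<and> s \<in> Cell2 ES \<and> set ts \<subseteq> Cell2 ES"
  by (auto simp: composable1_ES composable2_def list_eq_iff_nth_eq)

lemma perms_ES: "set ys \<subseteq> Cell1 ES \<Longrightarrow> perms (map fst ys) (map snd ys)"
  using nth_mem by (fastforce simp: list_all2_conv_all_nth)

lemma fst_ES_gamma [simp]: "fst (ES_gamma x ys) = sum_list (map fst ys)"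
  by (simp add: ES_gamma_def)

lemma snd_ES_gamma_permutes:
  "snd x permutes {..<length ys} \<Longrightarrow> set ys \<subseteq> Cell1 ES \<Longrightarrow> snd (ES_gamma x ys) permutes {..<sum_list (map fst ys)}"
  by (simp add: ES_gamma_def block_perm_permutes perms_ES)

lemma unit_list_eq: "(xs :: unit list) = ys \<longleftrightarrow> length xs = length ys"
  by (auto simp: list_eq_iff_nth_eq)

text \<open>Composability says that the degrees of \<open>ys\<close> are the lengths of the rows of
  \<open>zss\<close>. With the degrees of the entries of \<open>zss\<close> as the matrix of block
  lengths the claim is \<open>block_perm_assoc\<close>.\<close>

lemma ES_gamma_assoc:
  assumes x: "composable1 ES x ys" and ys: "list_all2 (composable1 ES) ys zss"
  shows "ES_gamma (ES_gamma x ys) (concat zss) = ES_gamma x (map2 ES_gamma ys zss)"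
proof -
  let ?kss = "map (map fst) zss" and ?\<rho>ss = "map (map snd) zss"
  have len [simp]: "length zss = length ys" using ys by (auto dest: list_all2_lengthD)
  have ks: "map fst ys = map length ?kss"
    using ys by (auto simp: list_all2_conv_all_nth composable1_ES intro!: nth_equalityI)
  have \<tau>s: "perms (map length ?kss) (map snd ys)"
    unfolding ks[symmetric] using x by (simp add: perms_ES composable1_ES del: ES_simps(2))
  have \<rho>ss: "list_all2 perms ?kss ?\<rho>ss"
    using ys by (auto simp: list_all2_conv_all_nth composable1_ES subset_iff)
  have "map fst (map2 ES_gamma ys zss) = map sum_list ?kss"
    by (auto simp: ES_gamma_def intro!: nth_equalityI)
  moreover have "map snd (map2 ES_gamma ys zss)
      = map (\<lambda>(\<tau>, ks, \<rho>s). block_perm \<tau> ks \<rho>s) (zip (map snd ys) (zip ?kss ?\<rho>ss))"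
    by (auto simp: ES_gamma_def intro!: nth_equalityI)
  moreover have "block_perm (block_perm (snd x) (map fst ys) (map snd ys)) (concat ?kss) (concat ?\<rho>ss)
      = block_perm (snd x) (map sum_list ?kss) (map (\<lambda>(\<tau>, ks, \<rho>s). block_perm \<tau> ks \<rho>s) (zip (map snd ys) (zip ?kss ?\<rho>ss)))"
    unfolding ks using x by (intro block_perm_assoc \<tau>s \<rho>ss) (simp add: composable1_ES)
  ultimately show ?thesis
    by (simp add: ES_gamma_def map_concat sum_list_concat)
qed

text \<open>The action is right multiplication, so both equivariance axioms are cases of
  \<open>block_perm_comp\<close>: here the right factor has identities inside its blocks, in
  \<open>ES_gamma_bottom\<close> it has the identity outside.\<close>

lemma ES_gamma_top:
  assumes x: "composable1 ES x ys" and \<sigma>: "\<sigma> permutes {..<length ys}"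
  shows "ES_gamma (fst x, snd x \<circ> \<sigma>) (permute_list \<sigma> ys)
    = (fst (ES_gamma x ys), snd (ES_gamma x ys) \<circ> outer_perm \<sigma> (map fst ys))"
proof -
  let ?ks = "permute_list \<sigma> (map fst ys)" and ?\<tau>s = "permute_list \<sigma> (map snd ys)"
  have p: "perms ?ks ?\<tau>s"
    using x \<sigma> by (intro perms_permute_list perms_ES) (simp_all add: composable1_ES)
  have "snd x permutes {..<length ?ks}" "\<sigma> permutes {..<length ?ks}"
    using x \<sigma> by (simp_all add: composable1_ES)
  from block_perm_comp[OF this p perms_id]
  have "block_perm (snd x) (map fst ys) (map snd ys) \<circ> outer_perm \<sigma> (map fst ys)
      = block_perm (snd x \<circ> \<sigma>) ?ks (map2 (\<circ>) ?\<tau>s (replicate (length ?ks) id))"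
    using \<sigma> by (simp add: outer_perm_def)
  also have "map2 (\<circ>) ?\<tau>s (replicate (length ?ks) id) = ?\<tau>s"
    by (rule nth_equalityI) simp_all
  finally show ?thesis
    using \<sigma> by (simp add: ES_gamma_def permute_list_map[symmetric] sum_list_permute_list o_def)
qed

lemma ES_gamma_bottom:
  assumes x: "composable1 ES x ys" and \<tau>s: "perms (map fst ys) \<tau>s"
  shows "ES_gamma x (map2 (act1 ES) ys \<tau>s)
    = (fst (ES_gamma x ys), snd (ES_gamma x ys) \<circ> inner_perm (map fst ys) \<tau>s)"
proof -
  have len: "length \<tau>s = length ys" using \<tau>s by (simp add: list_all2_conv_all_nth)
  have p: "perms (map fst ys) (map snd ys)"
    using x by (simp add: perms_ES composable1_ES del: ES_simps(2))
  have "snd x permutes {..<length (map fst ys)}"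
    using x by (simp add: composable1_ES)
  from block_perm_comp[OF this permutes_id p \<tau>s]
  have "block_perm (snd x) (map fst ys) (map snd ys) \<circ> inner_perm (map fst ys) \<tau>s
      = block_perm (snd x) (map fst ys) (map2 (\<circ>) (map snd ys) \<tau>s)"
    by (simp add: inner_perm_def)
  moreover have "map snd (map2 (act1 ES) ys \<tau>s) = map2 (\<circ>) (map snd ys) \<tau>s"
    "map fst (map2 (act1 ES) ys \<tau>s) = map fst ys"
    using len by (auto intro!: nth_equalityI)
  ultimately show ?thesis by (simp add: ES_gamma_def)
qed

lemma ES_gamma_units:
  "snd x permutes {..<fst x} \<Longrightarrow> ES_gamma (1, id) [x] = x"
  "snd x permutes {..<fst x} \<Longrightarrow> ES_gamma x (replicate (fst x) (1, id)) = x"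
  by (cases x; simp add: ES_gamma_def block_perm_single sum_list_replicate block_perm_ones[simplified])+

text \<open>The case numbers below are the positions of the axioms in \<open>elementary_multicategory\<close>.\<close>

lemma cat_multicategory_ES: "cat_multicategory ES"
proof -
  \<comment> \<open>The two ends of a 2-cell have the same degree, so both ends of
    \<open>gamma2\<close> use the same block lengths.\<close>
  have degrees: "map fst (map snd ss) = map fst (map fst ss)" if "set ss \<subseteq> Cell2 ES" for ss
    using that by (induction ss) auto
  show ?thesis
  proof (rule elementary_multicategory.cat_multicategory, unfold_locales, goal_cases)
    case (32 f gs)
    then show ?case by (simp add: unit_list_eq length_concat o_def)
  next
    case (34 \<alpha> \<beta>s)
    then show ?case
      using snd_ES_gamma_permutes[of "fst \<alpha>" "map fst \<beta>s"] snd_ES_gamma_permutes[of "snd \<alpha>" "map snd \<beta>s"]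
        degrees[of \<beta>s]
      by (auto simp add: composable2_ES composable1_ES simp del: map_map)
  next
    case (38 \<alpha> \<beta>s \<alpha>' \<beta>s')
    then have "length \<beta>s' = length \<beta>s" by (metis length_map)
    then have "map fst (map2 (vcomp ES) \<beta>s' \<beta>s) = map fst \<beta>s" "map snd (map2 (vcomp ES) \<beta>s' \<beta>s) = map snd \<beta>s'"
      by (auto intro!: nth_equalityI)
    then show ?case by simp
  next
    case (39 f gs hss)
    then show ?case by (simp add: ES_gamma_assoc)
  next
    case (40 \<alpha> \<beta>s \<delta>ss)
    have "list_all2 (composable1 ES) (map fst \<beta>s) (map (map fst) \<delta>ss)"
      "list_all2 (composable1 ES) (map snd \<beta>s) (map (map snd) \<delta>ss)"
      using 40(2) by (auto simp: list_all2_conv_all_nth composable2_ES)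
    with 40(1) show ?case
      by (simp add: composable2_ES ES_gamma_assoc map_concat)
        (auto simp: list_all2_lengthD[OF 40(2)] intro!: arg_cong2[where f = ES_gamma] nth_equalityI)
  next
    case (45 f gs \<sigma>)
    then show ?case using ES_gamma_top[OF 45] by simp
  next
    case (46 \<alpha> \<beta>s \<sigma>)
    then have "map (fst \<circ> snd) \<beta>s = map (\<lambda>\<beta>. fst (fst \<beta>)) \<beta>s"
      using degrees[of \<beta>s] by (simp add: composable2_ES o_def)
    then show ?case
      using 46 ES_gamma_top[of "fst \<alpha>" "map fst \<beta>s" \<sigma>] ES_gamma_top[of "snd \<alpha>" "map snd \<beta>s" \<sigma>] degrees[of \<beta>s]
      by (simp add: composable2_ES permute_list_map o_def[of fst] cong: map_cong)
  next
    case (47 f gs \<tau>s)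
    then show ?case using ES_gamma_bottom[of f gs \<tau>s] by (simp add: list_all2_map1)
  next
    case (48 \<alpha> \<beta>s \<tau>s)
    have "map fst (map2 (act2 ES) \<beta>s \<tau>s) = map2 (act1 ES) (map fst \<beta>s) \<tau>s"
      "map snd (map2 (act2 ES) \<beta>s \<tau>s) = map2 (act1 ES) (map snd \<beta>s) \<tau>s"
      by (auto intro!: nth_equalityI)
    moreover have "perms (map fst (map fst \<beta>s)) \<tau>s"
      using 48(2) by (simp add: list_all2_map1)
    ultimately show ?case
      using 48 ES_gamma_bottom[of "fst \<alpha>" "map fst \<beta>s" \<tau>s] ES_gamma_bottom[of "snd \<alpha>" "map snd \<beta>s" \<tau>s]
        degrees[of \<beta>s]
      by (simp add: composable2_ES del: ES_simps(10) map_map) (simp add: o_def cong: map_cong)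
  qed (auto simp: composable1_ES composable2_ES permutes_compose unit_list_eq snd_ES_gamma_permutes
      permutes_id comp_assoc ES_gamma_units[simplified]
      ES_gamma_units(2)[of "(a, b)" for a b, simplified] map_replicate_const o_def[of fst] o_def[of snd])
qed

section \<open>Products and renamings\<close>

lemma prod_multicat_simps [simp]:
  "Ob (prod_multicat M N) = Ob M \<times> Ob N"
  "fg \<in> Cell1 (prod_multicat M N) \<longleftrightarrow> fst fg \<in> Cell1 M \<and> snd fg \<in> Cell1 N \<and> arity M (fst fg) = arity N (snd fg)"
  "\<alpha>\<beta> \<in> Cell2 (prod_multicat M N) \<longleftrightarrow> fst \<alpha>\<beta> \<in> Cell2 M \<and> snd \<alpha>\<beta> \<in> Cell2 N
    \<and> arity M (dom2 M (fst \<alpha>\<beta>)) = arity N (dom2 N (snd \<alpha>\<beta>))"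
  "src (prod_multicat M N) = (\<lambda>fg. zip (src M (fst fg)) (src N (snd fg)))"
  "tgt (prod_multicat M N) = (\<lambda>fg. (tgt M (fst fg), tgt N (snd fg)))"
  "dom2 (prod_multicat M N) = (\<lambda>\<alpha>\<beta>. (dom2 M (fst \<alpha>\<beta>), dom2 N (snd \<alpha>\<beta>)))"
  "cod2 (prod_multicat M N) = (\<lambda>\<alpha>\<beta>. (cod2 M (fst \<alpha>\<beta>), cod2 N (snd \<alpha>\<beta>)))"
  "id2 (prod_multicat M N) = (\<lambda>fg. (id2 M (fst fg), id2 N (snd fg)))"
  "vcomp (prod_multicat M N) = (\<lambda>\<alpha>\<beta> \<alpha>\<beta>'. (vcomp M (fst \<alpha>\<beta>) (fst \<alpha>\<beta>'), vcomp N (snd \<alpha>\<beta>) (snd \<alpha>\<beta>')))"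
  "act1 (prod_multicat M N) = (\<lambda>fg \<sigma>. (act1 M (fst fg) \<sigma>, act1 N (snd fg) \<sigma>))"
  "act2 (prod_multicat M N) = (\<lambda>\<alpha>\<beta> \<sigma>. (act2 M (fst \<alpha>\<beta>) \<sigma>, act2 N (snd \<alpha>\<beta>) \<sigma>))"
  "unit1 (prod_multicat M N) = (\<lambda>ab. (unit1 M (fst ab), unit1 N (snd ab)))"
  "gamma1 (prod_multicat M N) = (\<lambda>fg hs. (gamma1 M (fst fg) (map fst hs), gamma1 N (snd fg) (map snd hs)))"
  "gamma2 (prod_multicat M N) = (\<lambda>\<alpha>\<beta> \<delta>s. (gamma2 M (fst \<alpha>\<beta>) (map fst \<delta>s), gamma2 N (snd \<alpha>\<beta>) (map snd \<delta>s)))"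
  by (auto simp: prod_multicat_def fun_eq_iff split: prod.splits)

lemma map_eq_zip_iff:
  assumes "length as = length bs"
  shows "map (\<lambda>x. (f x, g x)) xs = zip as bs \<longleftrightarrow> map f xs = as \<and> map g xs = bs"
  using assms by (auto simp: list_eq_iff_nth_eq)

lemma composable1_prod:
  "composable1 (prod_multicat M N) fg hs \<longleftrightarrow> fg \<in> Cell1 (prod_multicat M N) \<and> set hs \<subseteq> Cell1 (prod_multicat M N)
    \<and> composable1 M (fst fg) (map fst hs) \<and> composable1 N (snd fg) (map snd hs)"
  by (auto simp: composable1_def map_eq_zip_iff o_def)

lemma composable2_prod:
  "composable2 (prod_multicat M N) \<alpha>\<beta> \<delta>s \<longleftrightarrow> \<alpha>\<beta> \<in> Cell2 (prod_multicat M N) \<and> set \<delta>s \<subseteq> Cell2 (prod_multicat M N)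
    \<and> composable2 M (fst \<alpha>\<beta>) (map fst \<delta>s) \<and> composable2 N (snd \<alpha>\<beta>) (map snd \<delta>s)"
  by (auto simp: composable2_def map_eq_zip_iff o_def)

lemma zip_concat_map:
  "(\<And>x. x \<in> set xs \<Longrightarrow> length (f x) = length (g x)) \<Longrightarrow>
    zip (concat (map f xs)) (concat (map g xs)) = concat (map (\<lambda>x. zip (f x) (g x)) xs)"
  by (induction xs) simp_all

text \<open>The axioms hold in each component. The components interact only through the equality of
  their arities, which makes zipping the two lists of inputs lossless and provides the same
  permutations on both sides of the equivariance axioms.\<close>

lemma cat_multicategory_prod:
  assumes "cat_multicategory M" "cat_multicategory N"
  shows "cat_multicategory (prod_multicat M N)"
proof -
  interpret M: cat_multicategory M by fact
  interpret N: cat_multicategory N by fact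
  let ?P = "prod_multicat M N"
  have arity1: "map (arity ?P) hs = map (arity M) (map fst hs)" "map (arity ?P) hs = map (arity N) (map snd hs)"
    if "set hs \<subseteq> Cell1 ?P" for hs
    using that by (auto simp: subset_iff)
  have arity2: "map (\<lambda>\<beta>. arity ?P (dom2 ?P \<beta>)) \<delta>s = map (\<lambda>\<beta>. arity M (dom2 M \<beta>)) (map fst \<delta>s)"
    "map (\<lambda>\<beta>. arity ?P (dom2 ?P \<beta>)) \<delta>s = map (\<lambda>\<beta>. arity N (dom2 N \<beta>)) (map snd \<delta>s)"
    if "set \<delta>s \<subseteq> Cell2 ?P" for \<delta>s
    using that by (auto simp: subset_iff)
  have proj: "map fst (map2 (\<lambda>x y. (f x y, g x y)) xs ys) = map2 f xs ys"
    "map snd (map2 (\<lambda>x y. (f x y, g x y)) xs ys) = map2 g xs ys" for f g and xs :: "'x list" and ys :: "'y list"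
    by (auto intro!: nth_equalityI)
  have map2_fst: "map2 (\<lambda>x y. f (fst x) y) xs ys = map2 f (map fst xs) ys"
    and map2_snd: "map2 (\<lambda>x y. g (snd x) y) xs ys = map2 g (map snd xs) ys"
    for f g and xs :: "('x1 \<times> 'x2) list" and ys :: "'y list"
    by (simp_all add: zip_map1 o_def case_prod_unfold)
  have map2_fst2: "map2 (\<lambda>x y. f (fst x) (fst y)) xs ys = map2 f (map fst xs) (map fst ys)"
    and map2_snd2: "map2 (\<lambda>x y. g (snd x) (snd y)) xs ys = map2 g (map snd xs) (map snd ys)"
    for f g and xs :: "('x1 \<times> 'x2) list" and ys :: "('y1 \<times> 'y2) list"
    by (simp_all add: zip_map1 zip_map2 o_def case_prod_unfold)
  have map2_fsts: "map2 (\<lambda>x y. f (fst x) (map fst y)) xs ys = map2 f (map fst xs) (map (map fst) ys)"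
    and map2_snds: "map2 (\<lambda>x y. g (snd x) (map snd y)) xs ys = map2 g (map snd xs) (map (map snd) ys)"
    for f g and xs :: "('x1 \<times> 'x2) list" and ys :: "('y1 \<times> 'y2) list list"
    by (simp_all add: zip_map1 zip_map2 o_def case_prod_unfold)
  have all2: "list_all2 (composable1 M) (map fst gs) (map (map fst) hss)"
    "list_all2 (composable1 N) (map snd gs) (map (map snd) hss)"
    if "list_all2 (composable1 ?P) gs hss" for gs hss
    using that by (auto simp: list_all2_conv_all_nth composable1_prod)
  have all2': "list_all2 (composable2 M) (map fst gs) (map (map fst) hss)"
    "list_all2 (composable2 N) (map snd gs) (map (map snd) hss)"
    if "list_all2 (composable2 ?P) gs hss" for gs hss
    using that by (auto simp: list_all2_conv_all_nth composable2_prod)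
  have len: "length (concat (map (\<lambda>x. src M (fst x)) hs)) = length (concat (map (\<lambda>x. src N (snd x)) hs))"
    if "set hs \<subseteq> Cell1 ?P" for hs
    using that by (induction hs) auto
  have len': "length (concat (map (\<lambda>x. src M (dom2 M (fst x))) hs)) = length (concat (map (\<lambda>x. src N (dom2 N (snd x))) hs))"
    if "set hs \<subseteq> Cell2 ?P" for hs
    using that by (induction hs) auto
  have units: "map (\<lambda>x. f (fst x)) (zip as bs) = map f as" "map (\<lambda>x. g (snd x)) (zip as bs) = map g bs"
    if "length as = length bs" for f g and as :: "'x list" and bs :: "'y list"
    using that by (auto simp: list_eq_iff_nth_eq)
  show ?thesis
  \<comment> \<open>As for \<open>ES\<close>, the case numbers are the positions of the axioms in
    \<open>elementary_multicategory\<close>.\<close>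
  proof (rule elementary_multicategory.cat_multicategory, unfold_locales, goal_cases)
    case (1 fg)
    then show ?case
      using M.src_Ob[of "fst fg"] N.src_Ob[of "snd fg"]
      by (auto dest: set_zip_leftD set_zip_rightD)
  next
    case (34 \<alpha> \<beta>s)
    then show ?case
      using len'[of \<beta>s] M.composable2_dom2[of "fst \<alpha>" "map fst \<beta>s"] N.composable2_dom2[of "snd \<alpha>" "map snd \<beta>s"]
      by (simp add: composable2_prod M.gamma2_cell N.gamma2_cell M.gamma1_cell N.gamma1_cell o_def)
  next
    case (44 \<alpha>)
    then show ?case
      using units(1)[of "src M (dom2 M (fst \<alpha>))" "src N (dom2 N (snd \<alpha>))" "\<lambda>x. id2 M (unit1 M x)"]
        units(2)[of "src M (dom2 M (fst \<alpha>))" "src N (dom2 N (snd \<alpha>))" "\<lambda>x. id2 N (unit1 N x)"]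
      by (simp add: o_def M.gamma2_unit_right N.gamma2_unit_right)
  next
    case (32 fg hs)
    then show ?case
      by (auto simp: composable1_prod M.gamma1_cell N.gamma1_cell composable1_length length_concat o_def subset_iff
          intro!: zip_concat_map)
  next
    case (38 \<alpha> \<beta>s \<alpha>' \<beta>s')
    then have "map (dom2 M) (map fst \<beta>s') = map (cod2 M) (map fst \<beta>s)"
      "map (dom2 N) (map snd \<beta>s') = map (cod2 N) (map snd \<beta>s)"
      by (auto simp: list_eq_iff_nth_eq)
    with 38 show ?case
      by (simp add: composable2_prod proj map2_fst2 map2_snd2 M.gamma2_vcomp N.gamma2_vcomp del: map_map)
  next
    case (39 fg gs hss)
    then show ?case
      using all2[OF 39(2)] by (simp add: composable1_prod proj map2_fsts map2_snds M.gamma1_assoc N.gamma1_assoc map_concat del: map_map)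
  next
    case (40 \<alpha> \<beta>s \<delta>ss)
    then show ?case
      using all2'[OF 40(2)] by (simp add: composable2_prod proj map2_fsts map2_snds M.gamma2_assoc N.gamma2_assoc map_concat del: map_map)
  next
    case (45 fg gs \<sigma>)
    then have gs: "set gs \<subseteq> Cell1 ?P" by (simp add: composable1_prod)
    have "map fst (permute_list \<sigma> gs) = permute_list \<sigma> (map fst gs)"
      "map snd (permute_list \<sigma> gs) = permute_list \<sigma> (map snd gs)"
      using 45 by (simp_all add: permute_list_map)
    with 45 arity1[OF gs] show ?case
      by (simp add: composable1_prod M.gamma1_top N.gamma1_top del: map_map length_zip prod_multicat_simps(4))
  next
    case (46 \<alpha> \<beta>s \<sigma>)
    then have \<beta>s: "set \<beta>s \<subseteq> Cell2 ?P" by (simp add: composable2_prod)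
    have "map fst (permute_list \<sigma> \<beta>s) = permute_list \<sigma> (map fst \<beta>s)"
      "map snd (permute_list \<sigma> \<beta>s) = permute_list \<sigma> (map snd \<beta>s)"
      using 46 by (simp_all add: permute_list_map)
    with 46 arity2[OF \<beta>s] show ?case
      by (simp add: composable2_prod M.gamma2_top N.gamma2_top del: map_map length_zip prod_multicat_simps(4,6))
  next
    case (47 fg gs \<tau>s)
    then have gs: "set gs \<subseteq> Cell1 ?P" by (simp add: composable1_prod)
    have "list_all2 (\<lambda>g \<tau>. \<tau> permutes {..<arity M g}) (map fst gs) \<tau>s"
      "list_all2 (\<lambda>g \<tau>. \<tau> permutes {..<arity N g}) (map snd gs) \<tau>s"
      using 47(2) M.perms_list_all2(1) N.perms_list_all2(1) arity1[OF gs]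
        list_all2_map1[of "\<lambda>k \<tau>. \<tau> permutes {..<k}" "arity ?P" gs \<tau>s] by (metis (no_types, lifting))+
    with 47(1) arity1[OF gs] show ?case
      by (simp add: composable1_prod proj map2_fst map2_snd M.gamma1_bottom N.gamma1_bottom
          del: map_map length_zip prod_multicat_simps(4))
  next
    case (48 \<alpha> \<beta>s \<tau>s)
    then have \<beta>s: "set \<beta>s \<subseteq> Cell2 ?P" by (simp add: composable2_prod)
    have "list_all2 (\<lambda>\<beta> \<tau>. \<tau> permutes {..<arity M (dom2 M \<beta>)}) (map fst \<beta>s) \<tau>s"
      "list_all2 (\<lambda>\<beta> \<tau>. \<tau> permutes {..<arity N (dom2 N \<beta>)}) (map snd \<beta>s) \<tau>s"
      using 48(2) M.perms_list_all2(2) N.perms_list_all2(2) arity2[OF \<beta>s]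
        list_all2_map1[of "\<lambda>k \<tau>. \<tau> permutes {..<k}" "\<lambda>\<beta>. arity ?P (dom2 ?P \<beta>)" \<beta>s \<tau>s]
      by (metis (no_types, lifting))+
    with 48(1) arity2[OF \<beta>s] show ?case
      by (simp add: composable2_prod proj map2_fst map2_snd M.gamma2_bottom N.gamma2_bottom
          del: map_map length_zip prod_multicat_simps(4,6))
  qed (use M.src_Ob N.src_Ob in \<open>auto simp: composable1_prod composable2_prod M.cell_simps N.cell_simps
    M.gamma1_cell N.gamma1_cell M.gamma2_cell N.gamma2_cell o_def M.tgt_Ob N.tgt_Ob len len'
    M.act2_vcomp N.act2_vcomp M.act1_comp N.act1_comp M.act2_comp N.act2_comp M.act1_id N.act1_id
    M.act2_id N.act2_id M.gamma1_unit_left N.gamma1_unit_left M.gamma2_unit_left N.gamma2_unit_left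
    M.gamma1_unit_right N.gamma1_unit_right M.gamma2_unit_right[unfolded o_def] N.gamma2_unit_right units permute_list_zip
    M.composable2_dom2[unfolded o_def] N.composable2_dom2[unfolded o_def]
    M.gamma2_id2[symmetric] N.gamma2_id2[symmetric]
    dest: set_zip_leftD set_zip_rightD\<close>)
qed

section \<open>Composability under the operations\<close>

context cat_multicategory
begin

lemma composable1_map2_act:
  assumes "composable1 M f gs" "list_all2 (\<lambda>g \<tau>. \<tau> permutes {..<arity M g}) gs \<tau>s"
  shows "composable1 M f (map2 (act1 M) gs \<tau>s)"
proof -
  from assms(2) have "set gs \<subseteq> Cell1 M \<Longrightarrow>
      set (map2 (act1 M) gs \<tau>s) \<subseteq> Cell1 M \<and> map (tgt M) (map2 (act1 M) gs \<tau>s) = map (tgt M) gs"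
    by (induction rule: list_all2_induct) (auto simp: act1_cell)
  with assms(1) show ?thesis by (simp add: composable1_def)
qed

lemma composable2_map2_act:
  assumes "composable2 M \<alpha> \<beta>s" "list_all2 (\<lambda>\<beta> \<tau>. \<tau> permutes {..<arity M (dom2 M \<beta>)}) \<beta>s \<tau>s"
  shows "composable2 M \<alpha> (map2 (act2 M) \<beta>s \<tau>s)"
proof -
  from assms(2) have "set \<beta>s \<subseteq> Cell2 M \<Longrightarrow> set (map2 (act2 M) \<beta>s \<tau>s) \<subseteq> Cell2 M
      \<and> map (\<lambda>\<beta>. tgt M (dom2 M \<beta>)) (map2 (act2 M) \<beta>s \<tau>s) = map (\<lambda>\<beta>. tgt M (dom2 M \<beta>)) \<beta>s"
    by (induction rule: list_all2_induct) (auto simp: act1_cell act2_cell dom2_Cell1)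
  with assms(1) show ?thesis by (simp add: composable2_def)
qed

lemma composable1_map2_gamma:
  assumes "composable1 M f gs" "list_all2 (composable1 M) gs hss"
  shows "composable1 M f (map2 (gamma1 M) gs hss)" "composable1 M (gamma1 M f gs) (concat hss)"
proof -
  from assms(2) have "set (map2 (gamma1 M) gs hss) \<subseteq> Cell1 M \<and> map (tgt M) (map2 (gamma1 M) gs hss) = map (tgt M) gs
      \<and> map (tgt M) (concat hss) = concat (map (src M) gs) \<and> set (concat hss) \<subseteq> Cell1 M"
    by (induction rule: list_all2_induct) (auto simp: gamma1_cell composable1_def)
  with assms(1) show "composable1 M f (map2 (gamma1 M) gs hss)" "composable1 M (gamma1 M f gs) (concat hss)"
    by (simp_all add: composable1_def[of M f] composable1_def[of M "gamma1 M f gs"] gamma1_cell del: set_concat)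
qed

lemma composable2_map2_gamma:
  assumes "composable2 M \<alpha> \<beta>s" "list_all2 (composable2 M) \<beta>s \<delta>ss"
  shows "composable2 M \<alpha> (map2 (gamma2 M) \<beta>s \<delta>ss)" "composable2 M (gamma2 M \<alpha> \<beta>s) (concat \<delta>ss)"
proof -
  from assms(2) have "set (map2 (gamma2 M) \<beta>s \<delta>ss) \<subseteq> Cell2 M
      \<and> map (\<lambda>\<beta>. tgt M (dom2 M \<beta>)) (map2 (gamma2 M) \<beta>s \<delta>ss) = map (\<lambda>\<beta>. tgt M (dom2 M \<beta>)) \<beta>s
      \<and> map (\<lambda>\<beta>. tgt M (dom2 M \<beta>)) (concat \<delta>ss) = concat (map (src M) (map (dom2 M) \<beta>s)) \<and> set (concat \<delta>ss) \<subseteq> Cell2 M"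
    by (induction rule: list_all2_induct) (auto simp: gamma2_cell gamma1_cell composable2_dom2 composable2_def)
  with assms(1) show "composable2 M \<alpha> (map2 (gamma2 M) \<beta>s \<delta>ss)" "composable2 M (gamma2 M \<alpha> \<beta>s) (concat \<delta>ss)"
    by (simp_all add: composable2_def[of M \<alpha>] composable2_def[of M "gamma2 M \<alpha> \<beta>s"] gamma2_cell gamma1_cell
        composable2_dom2 del: set_concat)
qed

lemma composable1_permute_act:
  assumes "composable1 M f gs" "\<sigma> permutes {..<length gs}"
  shows "composable1 M (act1 M f \<sigma>) (permute_list \<sigma> gs)"
  using composable1_act_top[of f \<sigma> "permute_list \<sigma> gs"] assms by simp

lemma composable2_permute_act:
  assumes "composable2 M \<alpha> \<beta>s" "\<sigma> permutes {..<length \<beta>s}"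
  shows "composable2 M (act2 M \<alpha> \<sigma>) (permute_list \<sigma> \<beta>s)"
  using composable2_act_top[of \<alpha> \<sigma> "permute_list \<sigma> \<beta>s"] assms by simp

lemma composable1_unit_left: "f \<in> Cell1 M \<Longrightarrow> composable1 M (unit1 M (tgt M f)) [f]"
  by (simp add: composable1_def unit1_cell tgt_Ob)

lemma composable1_unit_right: "f \<in> Cell1 M \<Longrightarrow> composable1 M f (map (unit1 M) (src M f))"
  using src_Ob[of f] by (auto simp: composable1_def unit1_cell intro!: map_idI)

lemma composable2_unit_left: "\<alpha> \<in> Cell2 M \<Longrightarrow> composable2 M (id2 M (unit1 M (tgt M (dom2 M \<alpha>)))) [\<alpha>]"
  by (simp add: composable2_def unit1_cell tgt_Ob id2_cell dom2_Cell1)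

lemma composable2_unit_right: "\<alpha> \<in> Cell2 M \<Longrightarrow> composable2 M \<alpha> (map (\<lambda>a. id2 M (unit1 M a)) (src M (dom2 M \<alpha>)))"
  using src_Ob[of "dom2 M \<alpha>"] by (auto simp: composable2_def unit1_cell id2_cell dom2_Cell1 intro!: map_idI)

lemma composable2_vcomp:
  assumes "composable2 M \<alpha> \<beta>s" "composable2 M \<alpha>' \<beta>s'" "dom2 M \<alpha>' = cod2 M \<alpha>"
    "map (dom2 M) \<beta>s' = map (cod2 M) \<beta>s"
  shows "composable2 M (vcomp M \<alpha>' \<alpha>) (map2 (vcomp M) \<beta>s' \<beta>s)"
proof -
  have "list_all2 (\<lambda>\<beta>' \<beta>. dom2 M \<beta>' = cod2 M \<beta>) \<beta>s' \<beta>s"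
    using assms(4) by (auto simp: list_eq_iff_nth_eq list_all2_conv_all_nth)
  then have "set \<beta>s \<subseteq> Cell2 M \<Longrightarrow> set \<beta>s' \<subseteq> Cell2 M \<Longrightarrow> set (map2 (vcomp M) \<beta>s' \<beta>s) \<subseteq> Cell2 M
      \<and> map (\<lambda>\<beta>. tgt M (dom2 M \<beta>)) (map2 (vcomp M) \<beta>s' \<beta>s) = map (\<lambda>\<beta>. tgt M (dom2 M \<beta>)) \<beta>s"
    by (induction rule: list_all2_induct) (auto simp: vcomp_cell)
  with assms show ?thesis by (simp add: composable2_def vcomp_cell)
qed

end

section \<open>Transport along injective renamings\<close>

lemma subset_image_map:
  "set ys \<subseteq> f ` A \<Longrightarrow> \<exists>xs. ys = map f xs \<and> set xs \<subseteq> A"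
proof (induction ys)
  case (Cons y ys)
  then obtain x xs where "y = f x" "x \<in> A" "ys = map f xs" "set xs \<subseteq> A" by auto
  then show ?case by (intro exI[of _ "x # xs"]) simp
qed simp

locale renaming = cat_multicategory M for M :: "('o, 'm, 'c) multicat" +
  fixes eo :: "'o \<Rightarrow> 'p" and em :: "'m \<Rightarrow> 'n" and ec :: "'c \<Rightarrow> 'd"
  assumes inj_eo: "inj_on eo (Ob M)" and inj_em: "inj_on em (Cell1 M)" and inj_ec: "inj_on ec (Cell2 M)"
begin

abbreviation R :: "('p, 'n, 'd) multicat" where
  "R \<equiv> rename_multicat eo em ec M"

lemma map_decode:
  "set gs \<subseteq> Cell1 M \<Longrightarrow> map (inv_into (Cell1 M) em) (map em gs) = gs"
  "set \<beta>s \<subseteq> Cell2 M \<Longrightarrow> map (inv_into (Cell2 M) ec) (map ec \<beta>s) = \<beta>s"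
  using inj_em inj_ec by (auto intro!: map_idI simp: subset_iff)

lemma R_carriers:
  "Ob R = eo ` Ob M" "Cell1 R = em ` Cell1 M" "Cell2 R = ec ` Cell2 M"
  by (simp_all add: rename_multicat_def Let_def)

lemma R_simps:
  "f \<in> Cell1 M \<Longrightarrow> src R (em f) = map eo (src M f)"
  "f \<in> Cell1 M \<Longrightarrow> tgt R (em f) = eo (tgt M f)"
  "\<alpha> \<in> Cell2 M \<Longrightarrow> dom2 R (ec \<alpha>) = em (dom2 M \<alpha>)"
  "\<alpha> \<in> Cell2 M \<Longrightarrow> cod2 R (ec \<alpha>) = em (cod2 M \<alpha>)"
  "f \<in> Cell1 M \<Longrightarrow> id2 R (em f) = ec (id2 M f)"
  "\<alpha> \<in> Cell2 M \<Longrightarrow> \<beta> \<in> Cell2 M \<Longrightarrow> vcomp R (ec \<alpha>) (ec \<beta>) = ec (vcomp M \<alpha> \<beta>)"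
  "f \<in> Cell1 M \<Longrightarrow> act1 R (em f) \<sigma> = em (act1 M f \<sigma>)"
  "\<alpha> \<in> Cell2 M \<Longrightarrow> act2 R (ec \<alpha>) \<sigma> = ec (act2 M \<alpha> \<sigma>)"
  "a \<in> Ob M \<Longrightarrow> unit1 R (eo a) = em (unit1 M a)"
  using inj_eo inj_em inj_ec by (simp_all add: rename_multicat_def Let_def)

lemma R_gamma:
  "composable1 M f gs \<Longrightarrow> gamma1 R (em f) (map em gs) = em (gamma1 M f gs)"
  "composable2 M \<alpha> \<beta>s \<Longrightarrow> gamma2 R (ec \<alpha>) (map ec \<beta>s) = ec (gamma2 M \<alpha> \<beta>s)"
  using inj_em inj_ec
  by (simp_all add: rename_multicat_def Let_def composable1_def composable2_def map_decode del: map_map)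

lemma em_eq_iff: "f \<in> Cell1 M \<Longrightarrow> g \<in> Cell1 M \<Longrightarrow> em f = em g \<longleftrightarrow> f = g"
  using inj_em by (auto dest: inj_onD)

lemma map_em_eq_iff: "set fs \<subseteq> Cell1 M \<Longrightarrow> set gs \<subseteq> Cell1 M \<Longrightarrow> map em fs = map em gs \<longleftrightarrow> fs = gs"
  using map_inj_on[of em fs gs] inj_on_subset[OF inj_em, of "set fs \<union> set gs"] by auto

lemma map_eo_eq_iff: "set as \<subseteq> Ob M \<Longrightarrow> set bs \<subseteq> Ob M \<Longrightarrow> map eo as = map eo bs \<longleftrightarrow> as = bs"
  using map_inj_on[of eo as bs] inj_on_subset[OF inj_eo, of "set as \<union> set bs"] by auto

lemma composable1_R_iff:
  assumes "f \<in> Cell1 M" "set gs \<subseteq> Cell1 M"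
  shows "composable1 R (em f) (map em gs) \<longleftrightarrow> composable1 M f gs"
proof -
  have "map (tgt R) (map em gs) = map eo (map (tgt M) gs)"
    using assms by (auto simp: R_simps)
  moreover have "set (map (tgt M) gs) \<subseteq> Ob M"
    using assms tgt_Ob by auto
  ultimately show ?thesis
    using assms map_eo_eq_iff[of "map (tgt M) gs" "src M f"] src_Ob[of f]
    by (auto simp: composable1_def R_simps R_carriers simp del: map_map)
qed

lemma composable2_R_iff:
  assumes "\<alpha> \<in> Cell2 M" "set \<beta>s \<subseteq> Cell2 M"
  shows "composable2 R (ec \<alpha>) (map ec \<beta>s) \<longleftrightarrow> composable2 M \<alpha> \<beta>s"
proof -
  have "map (\<lambda>\<beta>. tgt R (dom2 R \<beta>)) (map ec \<beta>s) = map eo (map (\<lambda>\<beta>. tgt M (dom2 M \<beta>)) \<beta>s)"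
    using assms by (auto simp: R_simps dom2_Cell1)
  moreover have "set (map (\<lambda>\<beta>. tgt M (dom2 M \<beta>)) \<beta>s) \<subseteq> Ob M"
    using assms tgt_Ob dom2_Cell1 by auto
  ultimately show ?thesis
    using assms map_eo_eq_iff[of "map (\<lambda>\<beta>. tgt M (dom2 M \<beta>)) \<beta>s" "src M (dom2 M \<alpha>)"] src_Ob[of "dom2 M \<alpha>"]
    by (auto simp: composable2_def R_simps R_carriers dom2_Cell1 simp del: map_map)
qed

text \<open>Composability in the renamed multicategory compares encoded objects, so injectivity of
  \<open>eo\<close> is what carries it back to M. Together with \<open>R_gamma\<close> this reduces
  statements about \<gamma> on \<open>R\<close> to statements on M.\<close>

lemma composable1_RE:
  assumes "composable1 R f' gs'"
  obtains f gs where "f' = em f" "gs' = map em gs" "composable1 M f gs"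
proof -
  obtain f where f: "f' = em f" "f \<in> Cell1 M"
    using assms by (auto simp: composable1_def R_carriers)
  moreover obtain gs where "gs' = map em gs" "set gs \<subseteq> Cell1 M"
    using assms subset_image_map[of gs' em "Cell1 M"] by (auto simp: composable1_def R_carriers)
  ultimately show thesis
    using that[of f gs] assms composable1_R_iff[of f gs] by simp
qed

lemma composable2_RE:
  assumes "composable2 R \<alpha>' \<beta>s'"
  obtains \<alpha> \<beta>s where "\<alpha>' = ec \<alpha>" "\<beta>s' = map ec \<beta>s" "composable2 M \<alpha> \<beta>s"
proof -
  obtain \<alpha> where \<alpha>: "\<alpha>' = ec \<alpha>" "\<alpha> \<in> Cell2 M"
    using assms by (auto simp: composable2_def R_carriers)
  moreover obtain \<beta>s where "\<beta>s' = map ec \<beta>s" "set \<beta>s \<subseteq> Cell2 M"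
    using assms subset_image_map[of \<beta>s' ec "Cell2 M"] by (auto simp: composable2_def R_carriers)
  ultimately show thesis
    using that[of \<alpha> \<beta>s] assms composable2_R_iff[of \<alpha> \<beta>s] by simp
qed

text \<open>For associativity the rows must fit cells that have been decoded before. Injectivity of
  \<open>em\<close> identifies the cell produced by \<open>composable1_RE\<close> with the given
  f.\<close>

lemma composable1_RE':
  assumes "composable1 R (em f) gs'" "f \<in> Cell1 M"
  obtains gs where "gs' = map em gs" "composable1 M f gs"
  using assms composable1_RE by (metis composable1_def em_eq_iff)

lemma composable2_RE':
  assumes "composable2 R (ec \<alpha>) \<beta>s'" "\<alpha> \<in> Cell2 M"
  obtains \<beta>s where "\<beta>s' = map ec \<beta>s" "composable2 M \<alpha> \<beta>s"
  using assms composable2_RE inj_ec by (metis composable2_def inj_onD)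

lemma list_all2_composable1_RE:
  assumes "list_all2 (composable1 R) (map em gs) hss'" "set gs \<subseteq> Cell1 M"
  shows "\<exists>hss. hss' = map (map em) hss \<and> list_all2 (composable1 M) gs hss"
  using assms
proof (induction gs arbitrary: hss')
  case (Cons g gs)
  then obtain hs' hss'' where 1: "hss' = hs' # hss''" "composable1 R (em g) hs'" "list_all2 (composable1 R) (map em gs) hss''"
    by (auto simp: list_all2_Cons1)
  obtain hs where "hs' = map em hs" "composable1 M g hs"
    using composable1_RE'[OF 1(2)] Cons.prems(2) by auto
  moreover obtain hss where "hss'' = map (map em) hss" "list_all2 (composable1 M) gs hss"
    using Cons.IH[OF 1(3)] Cons.prems(2) by auto
  ultimately show ?case
    by (intro exI[of _ "hs # hss"]) (simp add: 1)
qed simp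

lemma list_all2_composable2_RE:
  assumes "list_all2 (composable2 R) (map ec \<beta>s) \<delta>ss'" "set \<beta>s \<subseteq> Cell2 M"
  shows "\<exists>\<delta>ss. \<delta>ss' = map (map ec) \<delta>ss \<and> list_all2 (composable2 M) \<beta>s \<delta>ss"
  using assms
proof (induction \<beta>s arbitrary: \<delta>ss')
  case (Cons \<beta> \<beta>s)
  then obtain \<delta>s' \<delta>ss'' where 1: "\<delta>ss' = \<delta>s' # \<delta>ss''" "composable2 R (ec \<beta>) \<delta>s'" "list_all2 (composable2 R) (map ec \<beta>s) \<delta>ss''"
    by (auto simp: list_all2_Cons1)
  obtain \<delta>s where "\<delta>s' = map ec \<delta>s" "composable2 M \<beta> \<delta>s"
    using composable2_RE'[OF 1(2)] Cons.prems(2) by auto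
  moreover obtain \<delta>ss where "\<delta>ss'' = map (map ec) \<delta>ss" "list_all2 (composable2 M) \<beta>s \<delta>ss"
    using Cons.IH[OF 1(3)] Cons.prems(2) by auto
  ultimately show ?case
    by (intro exI[of _ "\<delta>s # \<delta>ss"]) (simp add: 1)
qed simp

lemma map_R_simps:
  "set gs \<subseteq> Cell1 M \<Longrightarrow> map (src R) (map em gs) = map (map eo) (map (src M) gs)"
  "set gs \<subseteq> Cell1 M \<Longrightarrow> map (arity R) (map em gs) = map (arity M) gs"
  "set gs \<subseteq> Cell1 M \<Longrightarrow> map (id2 R) (map em gs) = map ec (map (id2 M) gs)"
  "set \<beta>s \<subseteq> Cell2 M \<Longrightarrow> map (dom2 R) (map ec \<beta>s) = map em (map (dom2 M) \<beta>s)"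
  "set \<beta>s \<subseteq> Cell2 M \<Longrightarrow> map (cod2 R) (map ec \<beta>s) = map em (map (cod2 M) \<beta>s)"
  "set \<beta>s \<subseteq> Cell2 M \<Longrightarrow> map (\<lambda>\<beta>. arity R (dom2 R \<beta>)) (map ec \<beta>s) = map (\<lambda>\<beta>. arity M (dom2 M \<beta>)) \<beta>s"
  by (auto simp: R_simps dom2_Cell1 subset_iff)

lemma map2_act_R:
  "set gs \<subseteq> Cell1 M \<Longrightarrow> map2 (act1 R) (map em gs) \<tau>s = map em (map2 (act1 M) gs \<tau>s)"
  "set \<beta>s \<subseteq> Cell2 M \<Longrightarrow> map2 (act2 R) (map ec \<beta>s) \<tau>s = map ec (map2 (act2 M) \<beta>s \<tau>s)"
  by (auto simp: R_simps subset_iff dest!: set_zip_leftD intro!: nth_equalityI)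

lemma map2_gamma1_R:
  "list_all2 (composable1 M) gs hss \<Longrightarrow>
    map2 (gamma1 R) (map em gs) (map (map em) hss) = map em (map2 (gamma1 M) gs hss)"
  by (induction rule: list_all2_induct) (simp_all add: R_gamma)

lemma map2_gamma2_R:
  "list_all2 (composable2 M) \<beta>s \<delta>ss \<Longrightarrow>
    map2 (gamma2 R) (map ec \<beta>s) (map (map ec) \<delta>ss) = map ec (map2 (gamma2 M) \<beta>s \<delta>ss)"
  by (induction rule: list_all2_induct) (simp_all add: R_gamma)

lemma map2_vcomp_R:
  "set \<beta>s \<subseteq> Cell2 M \<Longrightarrow> set \<beta>s' \<subseteq> Cell2 M \<Longrightarrow>
    map2 (vcomp R) (map ec \<beta>s') (map ec \<beta>s) = map ec (map2 (vcomp M) \<beta>s' \<beta>s)"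
  by (auto simp: list_eq_iff_nth_eq R_simps subset_iff)

text \<open>Each axiom is read in M after decoding. Premises that equate encoded cells, such as
  \<open>dom2 R \<beta> = cod2 R \<alpha>\<close>, are carried back by injectivity. The case numbers
  are the positions of the axioms in \<open>elementary_multicategory\<close>.\<close>

lemma cat_multicategory_R: "cat_multicategory R"
proof (rule elementary_multicategory.cat_multicategory, unfold_locales, goal_cases)
  case (31 f gs)
  then show ?case by (elim composable1_RE) (auto simp: R_carriers R_gamma gamma1_cell)
next
  case (32 f gs)
  then show ?case
    by (elim composable1_RE)
      (simp add: R_gamma R_simps gamma1_cell map_R_simps composable1_Cell1 map_concat del: map_map)
next
  case (33 f gs)
  then show ?case by (elim composable1_RE) (simp add: R_gamma R_simps gamma1_cell composable1_Cell1)
next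
  case (34 \<alpha> \<beta>s)
  then show ?case by (elim composable2_RE) (auto simp: R_carriers R_gamma gamma2_cell)
next
  case (35 \<alpha> \<beta>s)
  then show ?case
    by (elim composable2_RE)
      (simp add: R_gamma R_simps gamma2_cell map_R_simps composable2_Cell2 composable2_dom2 del: map_map)
next
  case (36 \<alpha> \<beta>s)
  then show ?case
    by (elim composable2_RE)
      (simp add: R_gamma R_simps gamma2_cell map_R_simps composable2_Cell2 composable2_cod2 del: map_map)
next
  case (37 f gs)
  then show ?case
    by (elim composable1_RE)
      (simp add: R_gamma R_simps gamma1_cell map_R_simps composable1_Cell1 composable1_id2 gamma2_id2 del: map_map)
next
  case (38 \<alpha> \<beta>s \<alpha>' \<beta>s')
  obtain a bs where 1: "\<alpha> = ec a" "\<beta>s = map ec bs" "composable2 M a bs"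
    using composable2_RE[OF 38(1)] .
  obtain a' bs' where 2: "\<alpha>' = ec a'" "\<beta>s' = map ec bs'" "composable2 M a' bs'"
    using composable2_RE[OF 38(2)] .
  note c = composable2_Cell2[OF 1(3)] composable2_Cell2[OF 2(3)]
  have "dom2 M a' = cod2 M a"
    using 38(3) c by (simp add: 1 2 R_simps em_eq_iff dom2_Cell1 cod2_cell)
  moreover have "map (dom2 M) bs' = map (cod2 M) bs"
  proof -
    have "map em (map (dom2 M) bs') = map em (map (cod2 M) bs)"
      using 38(4) c by (simp add: 1 2 map_R_simps del: map_map)
    then show ?thesis
      using c by (subst (asm) map_em_eq_iff) (auto simp: dom2_Cell1 cod2_cell)
  qed
  ultimately show ?case
    using c 1(3) 2(3) composable2_vcomp[OF 1(3) 2(3)] gamma2_vcomp[OF 1(3) 2(3)]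
    by (simp add: 1(1,2) 2(1,2) R_simps map2_vcomp_R R_gamma gamma2_cell del: map_map)
next
  case (39 f gs hss)
  obtain f' gs' where 1: "f = em f'" "gs = map em gs'" "composable1 M f' gs'"
    using composable1_RE[OF 39(1)] .
  obtain hss' where "hss = map (map em) hss'" "list_all2 (composable1 M) gs' hss'"
    using list_all2_composable1_RE[OF 39(2)[unfolded 1(2)] composable1_Cell1(2)[OF 1(3)]] by auto
  with 1 show ?case
    by (simp add: R_gamma map2_gamma1_R composable1_map2_gamma gamma1_assoc del: map_map flip: map_concat)
next
  case (40 \<alpha> \<beta>s \<delta>ss)
  obtain a bs where 1: "\<alpha> = ec a" "\<beta>s = map ec bs" "composable2 M a bs"
    using composable2_RE[OF 40(1)] .
  obtain dss where "\<delta>ss = map (map ec) dss" "list_all2 (composable2 M) bs dss"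
    using list_all2_composable2_RE[OF 40(2)[unfolded 1(2)] composable2_Cell2(2)[OF 1(3)]] by auto
  with 1 show ?case
    by (simp add: R_gamma map2_gamma2_R composable2_map2_gamma gamma2_assoc del: map_map flip: map_concat)
next
  case (41 f)
  then obtain f' where "f = em f'" "f' \<in> Cell1 M" by (auto simp: R_carriers)
  then show ?case
    using R_gamma(1)[OF composable1_unit_left, of f'] by (simp add: R_simps tgt_Ob gamma1_unit_left)
next
  case (42 f)
  then obtain f' where f: "f = em f'" "f' \<in> Cell1 M" by (auto simp: R_carriers)
  then have "map (unit1 R) (src R f) = map em (map (unit1 M) (src M f'))"
    using src_Ob[of f'] by (auto simp: R_simps)
  with f show ?case
    using R_gamma(1)[OF composable1_unit_right, of f'] by (simp add: gamma1_unit_right del: map_map)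
next
  case (43 \<alpha>)
  then obtain a where "\<alpha> = ec a" "a \<in> Cell2 M" by (auto simp: R_carriers)
  then show ?case
    using R_gamma(2)[OF composable2_unit_left, of a]
    by (simp add: R_simps tgt_Ob gamma2_unit_left dom2_Cell1 unit1_cell)
next
  case (44 \<alpha>)
  then obtain a where a: "\<alpha> = ec a" "a \<in> Cell2 M" by (auto simp: R_carriers)
  then have "map (\<lambda>a. id2 R (unit1 R a)) (src R (dom2 R \<alpha>)) = map ec (map (\<lambda>a. id2 M (unit1 M a)) (src M (dom2 M a)))"
    using src_Ob[of "dom2 M a"] by (auto simp: R_simps dom2_Cell1 unit1_cell)
  with a show ?case
    using R_gamma(2)[OF composable2_unit_right, of a] by (simp add: gamma2_unit_right del: map_map)
next
  case (45 f gs \<sigma>)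
  obtain f' gs' where 1: "f = em f'" "gs = map em gs'" "composable1 M f' gs'"
    using composable1_RE[OF 45(1)] .
  with 45(2) show ?case
    using R_gamma(1)[OF composable1_permute_act[OF 1(3)], of \<sigma>]
    by (simp add: R_simps R_gamma gamma1_cell map_R_simps composable1_Cell1 permute_list_map gamma1_top del: map_map)
next
  case (46 \<alpha> \<beta>s \<sigma>)
  obtain a bs where 1: "\<alpha> = ec a" "\<beta>s = map ec bs" "composable2 M a bs"
    using composable2_RE[OF 46(1)] .
  with 46(2) show ?case
    using R_gamma(2)[OF composable2_permute_act[OF 1(3)], of \<sigma>]
    by (simp add: R_simps R_gamma gamma2_cell map_R_simps composable2_Cell2 permute_list_map gamma2_top del: map_map)
next
  case (47 f gs \<tau>s)
  obtain f' gs' where 1: "f = em f'" "gs = map em gs'" "composable1 M f' gs'"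
    using composable1_RE[OF 47(1)] .
  have "list_all2 (\<lambda>g \<tau>. \<tau> permutes {..<arity M g}) gs' \<tau>s"
    using 47(2) map_R_simps(2)[OF composable1_Cell1(2)[OF 1(3)]] unfolding 1
    by (simp only: list_all2_map1[of "\<lambda>k \<tau>. \<tau> permutes {..<k}" "arity M", symmetric]
        list_all2_map1[of "\<lambda>k \<tau>. \<tau> permutes {..<k}" "arity R", symmetric])
  with 1 show ?case
    by (simp add: R_simps R_gamma gamma1_cell map_R_simps composable1_Cell1 map2_act_R composable1_map2_act
        gamma1_bottom del: map_map)
next
  case (48 \<alpha> \<beta>s \<tau>s)
  obtain a bs where 1: "\<alpha> = ec a" "\<beta>s = map ec bs" "composable2 M a bs"
    using composable2_RE[OF 48(1)] .
  have "list_all2 (\<lambda>\<beta> \<tau>. \<tau> permutes {..<arity M (dom2 M \<beta>)}) bs \<tau>s"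
    using 48(2) map_R_simps(6)[OF composable2_Cell2(2)[OF 1(3)]] unfolding 1
    by (simp only: list_all2_map1[of "\<lambda>k \<tau>. \<tau> permutes {..<k}" "\<lambda>\<beta>. arity M (dom2 M \<beta>)", symmetric]
        list_all2_map1[of "\<lambda>k \<tau>. \<tau> permutes {..<k}" "\<lambda>\<beta>. arity R (dom2 R \<beta>)", symmetric])
  with 1 show ?case
    by (simp add: R_simps R_gamma gamma2_cell map_R_simps composable2_Cell2 map2_act_R composable2_map2_act
        gamma2_bottom del: map_map)
next
  case (10 \<alpha> \<beta>)
  then show ?case by (auto simp: R_carriers R_simps em_eq_iff dom2_Cell1 cod2_cell vcomp_cell)
next
  case (11 \<alpha> \<beta>)
  then show ?case by (auto simp: R_carriers R_simps em_eq_iff dom2_Cell1 cod2_cell vcomp_cell)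
next
  case (12 \<alpha> \<beta>)
  then show ?case by (auto simp: R_carriers R_simps em_eq_iff dom2_Cell1 cod2_cell vcomp_cell)
next
  case (13 \<alpha> \<beta>)
  then show ?case by (auto simp: R_carriers R_simps em_eq_iff dom2_Cell1 cod2_cell vcomp_cell vcomp_assoc)
next
  case (23 \<alpha> \<beta>)
  then show ?case by (auto simp: R_carriers R_simps em_eq_iff dom2_Cell1 cod2_cell vcomp_cell act2_vcomp act2_cell)
next
  case (1 f)
  then show ?case using src_Ob by (fastforce simp: R_carriers R_simps)
qed (auto simp: R_carriers R_simps tgt_Ob cell_simps permute_list_map act1_comp act2_comp act1_id act2_id)

end

section \<open>Intertwiners\<close>

text \<open>A naturality square for a single pair of 2-cells.  The condition \<open>natural2\<close> and the compatibility of a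
  pseudo symmetric transformation with the structure isomorphisms are both of this form, and the squares
  are closed under all the operations on 2-cells.\<close>

definition intertwines :: "('o, 'm, 'c) multicat \<Rightarrow> 'm list \<Rightarrow> 'm \<Rightarrow> 'c \<Rightarrow> 'c \<Rightarrow> bool" where
  "intertwines N \<theta>s \<theta> x y \<longleftrightarrow> set \<theta>s \<subseteq> Cell1 N \<and> \<theta> \<in> Cell1 N \<and>
     composable2 N y (map (id2 N) \<theta>s) \<and> composable2 N (id2 N \<theta>) [x] \<and>
     gamma2 N y (map (id2 N) \<theta>s) = gamma2 N (id2 N \<theta>) [x]"

context cat_multicategory
begin

lemma gamma1_assoc_unary:
  assumes "f \<in> Cell1 M" "g \<in> Cell1 M" "h \<in> Cell1 M" "src M f = [tgt M g]" "src M g = [tgt M h]"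
  shows "gamma1 M (gamma1 M f [g]) [h] = gamma1 M f [gamma1 M g [h]]"
  using gamma1_assoc[of f "[g]" "[[h]]"] assms by (simp add: composable1_def)

lemma gamma1_unary_cell:
  assumes "f \<in> Cell1 M" "g \<in> Cell1 M" "src M f = [tgt M g]"
  shows "gamma1 M f [g] \<in> Cell1 M" "src M (gamma1 M f [g]) = src M g" "tgt M (gamma1 M f [g]) = tgt M f"
  using gamma1_cell[of f "[g]"] assms by (simp_all add: composable1_def)

lemma gamma2_id2_unary:
  assumes "f \<in> Cell1 M" "g \<in> Cell1 M" "src M f = [tgt M g]"
  shows "gamma2 M (id2 M f) [id2 M g] = id2 M (gamma1 M f [g])"
  using gamma2_id2[of f "[g]"] assms by (simp add: composable1_def)

lemma intertwines_id:
  assumes "\<alpha> \<in> Cell2 M"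
  shows "intertwines M (map (unit1 M) (src M (dom2 M \<alpha>))) (unit1 M (tgt M (dom2 M \<alpha>))) \<alpha> \<alpha>"
  using assms src_Ob[of "dom2 M \<alpha>"] composable2_unit_left[OF assms] composable2_unit_right[OF assms]
  by (auto simp: intertwines_def o_def gamma2_unit_left gamma2_unit_right unit1_cell dom2_Cell1 tgt_Ob)

lemma composable2_id2_iff:
  "set \<theta>s \<subseteq> Cell1 M \<Longrightarrow> composable2 M y (map (id2 M) \<theta>s) \<longleftrightarrow> y \<in> Cell2 M \<and> map (tgt M) \<theta>s = src M (dom2 M y)"
  by (auto simp: composable2_def id2_cell subset_iff o_def cong: map_cong)

lemma composable2_id2_unary_iff:
  "\<theta> \<in> Cell1 M \<Longrightarrow> composable2 M (id2 M \<theta>) [x] \<longleftrightarrow> x \<in> Cell2 M \<and> src M \<theta> = [tgt M (dom2 M x)]"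
  by (auto simp: composable2_def id2_cell)

lemma vcomp_id2_id2: "f \<in> Cell1 M \<Longrightarrow> vcomp M (id2 M f) (id2 M f) = id2 M f"
  using vcomp_id2(2)[of "id2 M f"] by (simp add: id2_cell)

text \<open>Interchange of \<gamma> with vertical composition, where the identity 2-cells on the
  components are composed with themselves.\<close>

lemma intertwines_vcomp:
  assumes "intertwines M \<theta>s \<theta> x y" "intertwines M \<theta>s \<theta> x' y'" "dom2 M x' = cod2 M x" "dom2 M y' = cod2 M y"
  shows "intertwines M \<theta>s \<theta> (vcomp M x' x) (vcomp M y' y)"
proof -
  have \<theta>s: "set \<theta>s \<subseteq> Cell1 M" and \<theta>: "\<theta> \<in> Cell1 M" using assms by (simp_all add: intertwines_def)
  note t = assms(1,2)[unfolded intertwines_def]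
  have x: "x \<in> Cell2 M" "x' \<in> Cell2 M" "src M \<theta> = [tgt M (dom2 M x)]"
    using t \<theta> composable2_id2_unary_iff by auto
  have y: "y \<in> Cell2 M" "y' \<in> Cell2 M" "map (tgt M) \<theta>s = src M (dom2 M y)"
    using t \<theta>s composable2_id2_iff by auto
  have ids: "map2 (vcomp M) (map (id2 M) \<theta>s) (map (id2 M) \<theta>s) = map (id2 M) \<theta>s"
    using \<theta>s by (induction \<theta>s) (auto simp: vcomp_id2_id2)
  have id: "vcomp M (id2 M \<theta>) (id2 M \<theta>) = id2 M \<theta>"
    using \<theta> by (rule vcomp_id2_id2)
  have "gamma2 M (vcomp M y' y) (map (id2 M) \<theta>s) = vcomp M (gamma2 M y' (map (id2 M) \<theta>s)) (gamma2 M y (map (id2 M) \<theta>s))"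
    using gamma2_vcomp[of y "map (id2 M) \<theta>s" y' "map (id2 M) \<theta>s"] t assms(4) \<theta>s
    unfolding ids by (simp add: id2_cell subset_iff)
  also have "\<dots> = vcomp M (gamma2 M (id2 M \<theta>) [x']) (gamma2 M (id2 M \<theta>) [x])"
    using t by simp
  also have "\<dots> = gamma2 M (id2 M \<theta>) [vcomp M x' x]"
    using gamma2_vcomp[of "id2 M \<theta>" "[x]" "id2 M \<theta>" "[x']"] t assms(3) \<theta> by (simp add: id id2_cell)
  finally show ?thesis
    using \<theta>s \<theta> x y assms(3,4)
    by (simp add: intertwines_def composable2_id2_iff composable2_id2_unary_iff vcomp_cell)
qed

text \<open>Two squares are glued along the common 2-cell y. Associativity of \<gamma> brings each
  square into the form in which it can be applied, and \<open>gamma2_id2\<close> merges the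
  identities on \<zeta> and \<theta> into one.\<close>

lemma intertwines_stack:
  assumes "intertwines M \<theta>s \<theta> x y" "intertwines M \<zeta>s \<zeta> y z" "list_all2 (\<lambda>\<zeta> \<theta>. src M \<zeta> = [tgt M \<theta>]) \<zeta>s \<theta>s"
    and \<zeta>\<theta>: "src M \<zeta> = [tgt M \<theta>]"
  shows "intertwines M (map2 (\<lambda>\<zeta> \<theta>. gamma1 M \<zeta> [\<theta>]) \<zeta>s \<theta>s) (gamma1 M \<zeta> [\<theta>]) x z"
proof -
  have \<theta>s: "set \<theta>s \<subseteq> Cell1 M" and \<theta>: "\<theta> \<in> Cell1 M" and \<zeta>s: "set \<zeta>s \<subseteq> Cell1 M" and \<zeta>: "\<zeta> \<in> Cell1 M"
    using assms by (simp_all add: intertwines_def)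
  note t = assms(1,2)[unfolded intertwines_def]
  have x: "x \<in> Cell2 M" "src M \<theta> = [tgt M (dom2 M x)]"
    using t \<theta> composable2_id2_unary_iff by auto
  have y: "y \<in> Cell2 M" "map (tgt M) \<theta>s = src M (dom2 M y)" "src M \<zeta> = [tgt M (dom2 M y)]"
    using t \<theta>s \<zeta> composable2_id2_iff composable2_id2_unary_iff by auto
  have z: "z \<in> Cell2 M" "map (tgt M) \<zeta>s = src M (dom2 M z)"
    using t \<zeta>s composable2_id2_iff by auto
  let ?\<zeta>\<theta>s = "map2 (\<lambda>\<zeta> \<theta>. gamma1 M \<zeta> [\<theta>]) \<zeta>s \<theta>s"
  from assms(3) \<zeta>s \<theta>s have s: "set ?\<zeta>\<theta>s \<subseteq> Cell1 M \<and> map (tgt M) ?\<zeta>\<theta>s = map (tgt M) \<zeta>s \<and>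
      map (id2 M) ?\<zeta>\<theta>s = map2 (gamma2 M) (map (id2 M) \<zeta>s) (map (\<lambda>\<theta>. [id2 M \<theta>]) \<theta>s) \<and>
      list_all2 (composable2 M) (map (id2 M) \<zeta>s) (map (\<lambda>\<theta>. [id2 M \<theta>]) \<theta>s)"
    by (induction rule: list_all2_induct)
      (auto simp: gamma1_unary_cell gamma2_id2_unary composable2_id2_unary_iff id2_cell)
  have "gamma2 M z (map (id2 M) ?\<zeta>\<theta>s) = gamma2 M (gamma2 M z (map (id2 M) \<zeta>s)) (concat (map (\<lambda>\<theta>. [id2 M \<theta>]) \<theta>s))"
    using s gamma2_assoc[of z "map (id2 M) \<zeta>s" "map (\<lambda>\<theta>. [id2 M \<theta>]) \<theta>s"] t by (simp only: simp_thms)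
  also have "concat (map (\<lambda>\<theta>. [id2 M \<theta>]) \<theta>s) = map (id2 M) \<theta>s"
    by simp
  also have "gamma2 M z (map (id2 M) \<zeta>s) = gamma2 M (id2 M \<zeta>) [y]"
    using t by simp
  also have "gamma2 M (gamma2 M (id2 M \<zeta>) [y]) (map (id2 M) \<theta>s) = gamma2 M (id2 M \<zeta>) [gamma2 M y (map (id2 M) \<theta>s)]"
    using gamma2_assoc[of "id2 M \<zeta>" "[y]" "[map (id2 M) \<theta>s]"] t by simp
  also have "\<dots> = gamma2 M (id2 M \<zeta>) [gamma2 M (id2 M \<theta>) [x]]"
    using t by simp
  also have "\<dots> = gamma2 M (gamma2 M (id2 M \<zeta>) [id2 M \<theta>]) [x]"
    using gamma2_assoc[of "id2 M \<zeta>" "[id2 M \<theta>]" "[[x]]"] t \<zeta> \<theta> \<zeta>\<theta> by (simp add: composable2_id2_unary_iff id2_cell)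
  also have "\<dots> = gamma2 M (id2 M (gamma1 M \<zeta> [\<theta>])) [x]"
    using \<zeta> \<theta> \<zeta>\<theta> by (simp add: gamma2_id2_unary)
  moreover have "composable2 M z (map (id2 M) ?\<zeta>\<theta>s)"
    using s z composable2_id2_iff[of ?\<zeta>\<theta>s z] by metis
  ultimately show ?thesis
    using s x \<zeta> \<theta> \<zeta>\<theta>
    by (simp add: intertwines_def composable2_id2_unary_iff gamma1_unary_cell del: map_map set_map)
qed

text \<open>Acting on the side of y is top equivariance, acting on the side of x is bottom
  equivariance. Since the cells \<open>\<theta>s\<close> are unary, the permutations produced by the
  two axioms are both \<sigma> itself.\<close>

lemma intertwines_act:
  assumes "intertwines M \<theta>s \<theta> x y" "\<sigma> permutes {..<length \<theta>s}" "\<And>\<theta>. \<theta> \<in> set \<theta>s \<Longrightarrow> arity M \<theta> = 1"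
    and len: "arity M (dom2 M x) = length \<theta>s"
  shows "intertwines M (permute_list \<sigma> \<theta>s) \<theta> (act2 M x \<sigma>) (act2 M y \<sigma>)"
proof -
  have \<theta>s: "set \<theta>s \<subseteq> Cell1 M" and \<theta>: "\<theta> \<in> Cell1 M" using assms by (simp_all add: intertwines_def)
  note t = assms(1)[unfolded intertwines_def]
  have x: "x \<in> Cell2 M" "src M \<theta> = [tgt M (dom2 M x)]"
    using t \<theta> composable2_id2_unary_iff by auto
  have y: "y \<in> Cell2 M" "map (tgt M) \<theta>s = src M (dom2 M y)"
    using t \<theta>s composable2_id2_iff by auto
  then have len': "arity M (dom2 M y) = length \<theta>s" by (metis length_map)
  have "map (\<lambda>\<beta>. arity M (dom2 M \<beta>)) (map (id2 M) \<theta>s) = replicate (length \<theta>s) 1"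
    using \<theta>s assms(3) by (subst map_eq_replicate[where c = 1]) (auto simp: id2_cell subset_iff)
  then have "gamma2 M (act2 M y \<sigma>) (map (id2 M) (permute_list \<sigma> \<theta>s)) = act2 M (gamma2 M y (map (id2 M) \<theta>s)) \<sigma>"
    using gamma2_top[of y "map (id2 M) \<theta>s" \<sigma>] t assms(2) outer_perm_ones[OF assms(2)]
    by (simp add: permute_list_map del: map_map)
  also have "\<dots> = act2 M (gamma2 M (id2 M \<theta>) [x]) \<sigma>" using t by simp
  also have "\<dots> = gamma2 M (id2 M \<theta>) [act2 M x \<sigma>]"
    using gamma2_bottom[of "id2 M \<theta>" "[x]" "[\<sigma>]"] t len assms(2) inner_perm_single[OF assms(2)] by simp
  moreover have "permute_list \<sigma> (src M (dom2 M y)) = map (tgt M) (permute_list \<sigma> \<theta>s)"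
    using assms(2) by (simp add: y(2)[symmetric] permute_list_map)
  ultimately show ?thesis
    using \<theta>s \<theta> x y(1) assms(2) len len'
    by (simp add: intertwines_def composable2_id2_iff composable2_id2_unary_iff act2_cell act1_cell dom2_Cell1)
qed

lemma intertwines_dom2:
  assumes "intertwines M \<theta>s \<theta> x y"
  shows "gamma1 M (dom2 M y) \<theta>s = gamma1 M \<theta> [dom2 M x]"
proof -
  note t = assms[unfolded intertwines_def]
  have "dom2 M (gamma2 M (id2 M \<theta>) [x]) = gamma1 M \<theta> [dom2 M x]"
    using t by (simp add: gamma2_cell id2_cell)
  moreover have "dom2 M (gamma2 M y (map (id2 M) \<theta>s)) = gamma1 M (dom2 M y) (map (dom2 M) (map (id2 M) \<theta>s))"
    using t gamma2_cell(2)[of y "map (id2 M) \<theta>s"] by blast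
  moreover have "map (dom2 M) (map (id2 M) \<theta>s) = \<theta>s"
    using t by (auto simp: id2_cell subset_iff intro!: map_idI)
  ultimately show ?thesis using t by metis
qed

end

text \<open>Preservation of \<gamma> and of identities carries squares to squares. This gives the
  inner half of a horizontal composite of transformations.\<close>

lemma (in nonsym_multifunctor) intertwines_map:
  assumes "intertwines M \<theta>s \<theta> x y"
  shows "intertwines N (map (fc1 F) \<theta>s) (fc1 F \<theta>) (fc2 F x) (fc2 F y)"
proof -
  note t = assms[unfolded intertwines_def]
  have ids: "map (fc2 F) (map (id2 M) \<theta>s) = map (id2 N) (map (fc1 F) \<theta>s)"
    using t by (auto simp: fc2_id2)
  have "gamma2 N (fc2 F y) (map (id2 N) (map (fc1 F) \<theta>s)) = fc2 F (gamma2 M y (map (id2 M) \<theta>s))"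
    using t map_gamma2[of y "map (id2 M) \<theta>s"] by (simp only: ids)
  also have "\<dots> = gamma2 N (id2 N (fc1 F \<theta>)) [fc2 F x]"
    using t map_gamma2[of "id2 M \<theta>" "[x]"] by (simp add: fc2_id2)
  moreover have "set (map (fc1 F) \<theta>s) \<subseteq> Cell1 N"
    using t by (auto simp: fc1_cell)
  ultimately show ?thesis
    using t composable2_map[of y "map (id2 M) \<theta>s"] composable2_map[of "id2 M \<theta>" "[x]"]
    by (simp add: intertwines_def fc2_id2 fc1_cell ids del: map_map set_map)
qed

lemma (in ps_multifunctor) fsym_cell:
  assumes "f \<in> Cell1 M" "\<sigma> permutes {..<arity M f}"
  shows "fsym F \<sigma> f \<in> Cell2 N" "dom2 N (fsym F \<sigma> f) = fc1 F (act1 M f \<sigma>)" "cod2 N (fsym F \<sigma> f) = act1 N (fc1 F f) \<sigma>"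
  using fsym_iso[OF assms] by (simp_all add: iso_arr_def)

text \<open>Since \<open>\<sigma>\<langle>id, \<dots>, id\<rangle>\<close> (unary identities) and \<open>id\<langle>\<sigma>\<rangle>\<close> are both \<open>\<sigma>\<close>, the axioms \<open>fsym_top\<close> and \<open>fsym_bottom\<close>
  evaluate the same component of \<open>fsym\<close>.\<close>

lemma (in ps_multifunctor) intertwines_fsym:
  assumes g: "composable1 M g \<theta>s" and f: "composable1 M \<theta> [f]" and eq: "gamma1 M g \<theta>s = gamma1 M \<theta> [f]"
    and unary: "\<And>\<theta>. \<theta> \<in> set \<theta>s \<Longrightarrow> arity M \<theta> = 1" and \<sigma>: "\<sigma> permutes {..<length \<theta>s}"
    and len: "arity M f = length \<theta>s"
  shows "intertwines N (map (fc1 F) (permute_list \<sigma> \<theta>s)) (fc1 F \<theta>) (fsym F \<sigma> f) (fsym F \<sigma> g)"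
proof -
  have cells: "g \<in> Cell1 M" "f \<in> Cell1 M" "\<theta> \<in> Cell1 M" "set \<theta>s \<subseteq> Cell1 M" "src M \<theta> = [tgt M f]"
    and g': "map (tgt M) \<theta>s = src M g"
    using f g by (simp_all add: composable1_def)
  have len': "arity M g = length \<theta>s" using composable1_length[OF g] by simp
  have "map (arity M) \<theta>s = replicate (length \<theta>s) 1"
    using unary by (simp add: map_eq_replicate)
  then have "fsym F \<sigma> (gamma1 M g \<theta>s) = gamma2 N (fsym F \<sigma> g) (map (id2 N) (map (fc1 F) (permute_list \<sigma> \<theta>s)))"
    using fsym_top[OF g \<sigma>] outer_perm_ones[OF \<sigma>] by (simp add: o_def)
  moreover have "fsym F \<sigma> (gamma1 M \<theta> [f]) = gamma2 N (id2 N (fc1 F \<theta>)) [fsym F \<sigma> f]"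
    using fsym_bottom[OF f, of "[\<sigma>]"] \<sigma> len inner_perm_single[OF \<sigma>] by simp
  moreover have "map (tgt N) (map (fc1 F) (permute_list \<sigma> \<theta>s)) = permute_list \<sigma> (map (fob F) (src M g))"
    using \<sigma> cells(4) unfolding g'[symmetric]
    by (simp add: permute_list_map[symmetric] fc1_cell subset_iff o_def cong: map_cong)
  moreover have "set (map (fc1 F) (permute_list \<sigma> \<theta>s)) \<subseteq> Cell1 N"
    using \<sigma> cells(4) by (auto simp: fc1_cell)
  ultimately show ?thesis
    using eq \<sigma> cells len len'
    by (simp add: intertwines_def N.composable2_id2_iff N.composable2_id2_unary_iff fsym_cell fc1_cell
        M.act1_cell permute_list_map del: map_map set_map)
qed

section \<open>Multinatural transformations\<close>

lemma (in multinatural) component_cell: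
  assumes "a \<in> Ob M"
  shows "\<theta> a \<in> Cell1 N" "src N (\<theta> a) = [fob F a]" "tgt N (\<theta> a) = fob G a"
  using comp_hom[OF assms] by simp_all

lemma multinatural_intertwines:
  assumes F: "nonsym_multifunctor M N F" and G: "nonsym_multifunctor M N G"
    and \<theta>: "multinatural M N F G \<theta>" and \<alpha>: "\<alpha> \<in> Cell2 M"
  shows "intertwines N (map \<theta> (src M (dom2 M \<alpha>))) (\<theta> (tgt M (dom2 M \<alpha>))) (fc2 F \<alpha>) (fc2 G \<alpha>)"
proof -
  interpret F: nonsym_multifunctor M N F by fact
  interpret G: nonsym_multifunctor M N G by fact
  interpret \<theta>: multinatural M N F G \<theta> by fact
  note f = F.M.dom2_Cell1[OF \<alpha>]
  have "set (map \<theta> (src M (dom2 M \<alpha>))) \<subseteq> Cell1 N" "map (tgt N) (map \<theta> (src M (dom2 M \<alpha>))) = map (fob G) (src M (dom2 M \<alpha>))"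
    using F.M.src_Ob[OF f] by (auto simp: \<theta>.component_cell)
  moreover from this have "composable2 N (fc2 G \<alpha>) (map (id2 N) (map \<theta> (src M (dom2 M \<alpha>))))"
    using \<alpha> f by (simp add: F.N.composable2_id2_iff G.fc2_cell G.fc1_cell del: map_map set_map)
  ultimately show ?thesis
    using \<theta>.natural2[OF \<alpha>] \<alpha> f
    by (simp add: intertwines_def F.N.composable2_id2_iff F.N.composable2_id2_unary_iff F.M.tgt_Ob
        \<theta>.component_cell F.fc2_cell G.fc2_cell F.fc1_cell G.fc1_cell o_def del: set_map)
qed

text \<open>The condition \<open>natural1\<close> is the equation between the sources in \<open>natural2\<close> at an identity 2-cell.\<close>

lemma multinaturalI:
  assumes F: "nonsym_multifunctor M N F" and G: "nonsym_multifunctor M N G"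
    and "\<theta> \<in> extensional (Ob M)"
    and "\<And>a. a \<in> Ob M \<Longrightarrow> \<theta> a \<in> Cell1 N" "\<And>a. a \<in> Ob M \<Longrightarrow> src N (\<theta> a) = [fob F a]"
      "\<And>a. a \<in> Ob M \<Longrightarrow> tgt N (\<theta> a) = fob G a"
    and *: "\<And>\<alpha>. \<alpha> \<in> Cell2 M \<Longrightarrow>
      intertwines N (map \<theta> (src M (dom2 M \<alpha>))) (\<theta> (tgt M (dom2 M \<alpha>))) (fc2 F \<alpha>) (fc2 G \<alpha>)"
  shows "multinatural M N F G \<theta>"
proof
  interpret F: nonsym_multifunctor M N F by fact
  interpret G: nonsym_multifunctor M N G by fact
  show "\<theta> \<in> extensional (Ob M)" by fact
  show "\<theta> a \<in> Obj (hom_cat N [fob F a] (fob G a))" if "a \<in> Ob M" for a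
    using assms that by simp
  show "gamma2 N (fc2 G \<alpha>) (map (\<lambda>a. id2 N (\<theta> a)) (src M (dom2 M \<alpha>)))
      = gamma2 N (id2 N (\<theta> (tgt M (dom2 M \<alpha>)))) [fc2 F \<alpha>]" if "\<alpha> \<in> Cell2 M" for \<alpha>
    using *[OF that] by (simp add: intertwines_def o_def)
  show "gamma1 N (fc1 G f) (map \<theta> (src M f)) = gamma1 N (\<theta> (tgt M f)) [fc1 F f]" if "f \<in> Cell1 M" for f
    using F.N.intertwines_dom2[OF *[of "id2 M f"]] that
    by (simp add: F.M.id2_cell F.fc2_cell G.fc2_cell)
qed

section \<open>Composition of multifunctors\<close>

lemma iso_arr_functor:
  assumes "cat_functor C D F F'" "iso_arr C x y t"
  shows "iso_arr D (F x) (F y) (F' t)"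
proof -
  interpret cat_functor C D F F' by fact
  obtain s where s: "s \<in> Arr C" "Dom C s = y" "Cod C s = x" "Cmp C s t = Idn C x" "Cmp C t s = Idn C y"
    and t: "t \<in> Arr C" "Dom C t = x" "Cod C t = y"
    using assms(2) by (auto simp: iso_arr_def)
  have "x \<in> Obj C" "y \<in> Obj C" using t C.Dom_Obj C.Cod_Obj by auto
  with s t map_Cmp[of s t] map_Cmp[of t s] show ?thesis
    by (auto simp: iso_arr_def map_Arr map_Dom map_Cod map_Idn intro!: bexI[of _ "F' s"])
qed

lemma iso_arr_Cmp:
  assumes "category C" "iso_arr C x y s" "iso_arr C y z t"
  shows "iso_arr C x z (Cmp C t s)"
proof -
  interpret category C by fact
  obtain s' where s': "s' \<in> Arr C" "Dom C s' = y" "Cod C s' = x" "Cmp C s' s = Idn C x" "Cmp C s s' = Idn C y"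
    and s: "s \<in> Arr C" "Dom C s = x" "Cod C s = y"
    using assms(2) by (auto simp: iso_arr_def)
  obtain t' where t': "t' \<in> Arr C" "Dom C t' = z" "Cod C t' = y" "Cmp C t' t = Idn C y" "Cmp C t t' = Idn C z"
    and t: "t \<in> Arr C" "Dom C t = y" "Cod C t = z"
    using assms(3) by (auto simp: iso_arr_def)
  have "Cmp C t' (Cmp C t s) = s" "Cmp C s (Cmp C s' t') = t'"
    using s s' t t' Cmp_assoc[of t' t s] Cmp_assoc[of s s' t'] Cmp_Idn_left[of s] Cmp_Idn_left[of t'] by simp_all
  then have 1: "Cmp C (Cmp C s' t') (Cmp C t s) = Idn C x" and 2: "Cmp C (Cmp C t s) (Cmp C s' t') = Idn C z"
    using s s' t t' Cmp_assoc[of s' t' "Cmp C t s"] Cmp_assoc[of t s "Cmp C s' t'"]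
    by (simp_all add: Cmp_Arr Dom_Cmp Cod_Cmp)
  show ?thesis
    using s s' t t' 1 2 by (auto simp: iso_arr_def Cmp_Arr Dom_Cmp Cod_Cmp intro!: bexI[of _ "Cmp C s' t'"])
qed

lemma iso_arr_Idn: "category C \<Longrightarrow> x \<in> Obj C \<Longrightarrow> iso_arr C x x (Idn C x)"
  unfolding iso_arr_def
  using category.Cmp_Idn_left[of C "Idn C x"]
  by (auto simp: category.Idn_Arr category.Dom_Idn category.Cod_Idn intro!: bexI[of _ "Idn C x"])

text \<open>Interchange needs both rows of a vertical composite to be composable. This reads off the
  composability of the later row from that of the earlier one and the matching of ends.\<close>

lemma (in cat_multicategory) composable2_next:
  assumes "composable2 M \<alpha> \<beta>s" "\<alpha>' \<in> Cell2 M" "set \<beta>s' \<subseteq> Cell2 M" "dom2 M \<alpha>' = cod2 M \<alpha>"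
    "map (dom2 M) \<beta>s' = map (cod2 M) \<beta>s"
  shows "composable2 M \<alpha>' \<beta>s'"
proof -
  have "map (tgt M) (map (dom2 M) \<beta>s') = map (\<lambda>\<beta>. tgt M (dom2 M \<beta>)) \<beta>s"
    unfolding assms(5) using assms(1) by (simp add: composable2_def cod2_cell subset_iff cong: map_cong)
  then have "map (\<lambda>\<beta>. tgt M (dom2 M \<beta>)) \<beta>s' = map (\<lambda>\<beta>. tgt M (dom2 M \<beta>)) \<beta>s"
    by (simp only: map_map o_def)
  then show ?thesis using assms(1-4) by (simp add: composable2_def cod2_cell)
qed

context ps_multifunctor
begin

lemma composable2_fsym_top:
  assumes c: "composable1 M f gs" and \<sigma>: "\<sigma> permutes {..<length gs}"
  shows "composable2 N (fsym F \<sigma> f) (map (\<lambda>g. id2 N (fc1 F g)) (permute_list \<sigma> gs))"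
proof -
  have f: "f \<in> Cell1 M" and gs: "set (permute_list \<sigma> gs) \<subseteq> Cell1 M" "set gs \<subseteq> Cell1 M"
    using c \<sigma> by (simp_all add: composable1_def)
  have "map (tgt N) (map (fc1 F) (permute_list \<sigma> gs)) = permute_list \<sigma> (map (fob F) (map (tgt M) gs))"
    using \<sigma> gs by (auto simp: permute_list_map fc1_cell)
  also have "map (tgt M) gs = src M f" using c by (simp add: composable1_def)
  moreover have "fc1 F ` set gs \<subseteq> Cell1 N"
    using gs by (auto simp: fc1_cell)
  ultimately show ?thesis
    using N.composable2_id2_iff[of "map (fc1 F) (permute_list \<sigma> gs)"] gs f \<sigma> composable1_length[OF c]
    by (simp add: o_def fsym_cell fc1_cell M.act1_cell permute_list_map)
qed

lemma fsym_cells: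
  assumes "list_all2 (\<lambda>g \<tau>. \<tau> permutes {..<arity M g}) gs \<tau>s" "set gs \<subseteq> Cell1 M"
  shows "set (map2 (\<lambda>g \<tau>. fsym F \<tau> g) gs \<tau>s) \<subseteq> Cell2 N"
    "map (dom2 N) (map2 (\<lambda>g \<tau>. fsym F \<tau> g) gs \<tau>s) = map (fc1 F) (map2 (act1 M) gs \<tau>s)"
    "map (cod2 N) (map2 (\<lambda>g \<tau>. fsym F \<tau> g) gs \<tau>s) = map2 (act1 N) (map (fc1 F) gs) \<tau>s"
    "map (\<lambda>\<beta>. tgt N (dom2 N \<beta>)) (map2 (\<lambda>g \<tau>. fsym F \<tau> g) gs \<tau>s) = map (fob F) (map (tgt M) gs)"
proof -
  from assms have "set (map2 (\<lambda>g \<tau>. fsym F \<tau> g) gs \<tau>s) \<subseteq> Cell2 N \<and>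
    map (dom2 N) (map2 (\<lambda>g \<tau>. fsym F \<tau> g) gs \<tau>s) = map (fc1 F) (map2 (act1 M) gs \<tau>s) \<and>
    map (cod2 N) (map2 (\<lambda>g \<tau>. fsym F \<tau> g) gs \<tau>s) = map2 (act1 N) (map (fc1 F) gs) \<tau>s \<and>
    map (\<lambda>\<beta>. tgt N (dom2 N \<beta>)) (map2 (\<lambda>g \<tau>. fsym F \<tau> g) gs \<tau>s) = map (fob F) (map (tgt M) gs)"
    by (induction rule: list_all2_induct) (auto simp: fsym_cell fc1_cell M.act1_cell)
  then show "set (map2 (\<lambda>g \<tau>. fsym F \<tau> g) gs \<tau>s) \<subseteq> Cell2 N"
    "map (dom2 N) (map2 (\<lambda>g \<tau>. fsym F \<tau> g) gs \<tau>s) = map (fc1 F) (map2 (act1 M) gs \<tau>s)"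
    "map (cod2 N) (map2 (\<lambda>g \<tau>. fsym F \<tau> g) gs \<tau>s) = map2 (act1 N) (map (fc1 F) gs) \<tau>s"
    "map (\<lambda>\<beta>. tgt N (dom2 N \<beta>)) (map2 (\<lambda>g \<tau>. fsym F \<tau> g) gs \<tau>s) = map (fob F) (map (tgt M) gs)"
    by blast+
qed

lemma composable2_fsym_bottom:
  assumes c: "composable1 M f gs" and \<tau>s: "list_all2 (\<lambda>g \<tau>. \<tau> permutes {..<arity M g}) gs \<tau>s"
  shows "composable2 N (id2 N (fc1 F f)) (map2 (\<lambda>g \<tau>. fsym F \<tau> g) gs \<tau>s)"
  using c fsym_cells[OF \<tau>s] unfolding composable1_def composable2_def
  by (simp add: N.id2_cell fc1_cell del: map_map set_map)

end

text \<open>Symmetric and pseudo symmetric multifunctors are records of different types; the following relation lets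
  their composites share one treatment.\<close>

definition is_comp :: "('o, 'm, 'c) multicat \<Rightarrow> ('o, 'm, 'c, 'q, 'k, 'e, 'x) mfun_scheme \<Rightarrow>
    ('p, 'n, 'd, 'q, 'k, 'e, 'y) mfun_scheme \<Rightarrow> ('o, 'm, 'c, 'p, 'n, 'd, 'z) mfun_scheme \<Rightarrow> bool" where
  "is_comp M H G F \<longleftrightarrow> fob H = compose (Ob M) (fob G) (fob F) \<and>
     fc1 H = compose (Cell1 M) (fc1 G) (fc1 F) \<and> fc2 H = compose (Cell2 M) (fc2 G) (fc2 F)"

lemma is_comp_sym_comp: "is_comp M (sym_comp M G F) G F"
  by (simp add: is_comp_def sym_comp_def)

lemma is_comp_ps_comp: "is_comp M (ps_comp M Q G F) G F"
  by (simp add: is_comp_def ps_comp_def)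

lemma is_comp_simps:
  assumes "is_comp M H G F"
  shows "a \<in> Ob M \<Longrightarrow> fob H a = fob G (fob F a)" "f \<in> Cell1 M \<Longrightarrow> fc1 H f = fc1 G (fc1 F f)"
    "\<alpha> \<in> Cell2 M \<Longrightarrow> fc2 H \<alpha> = fc2 G (fc2 F \<alpha>)"
  using assms by (simp_all add: is_comp_def compose_def)

lemma nonsym_multifunctor_comp:
  assumes F: "nonsym_multifunctor M N F" and G: "nonsym_multifunctor N Q G" and H: "is_comp M H G F"
  shows "nonsym_multifunctor M Q H"
proof -
  interpret F: nonsym_multifunctor M N F by fact
  interpret G: nonsym_multifunctor N Q G by fact
  note H' = is_comp_simps[OF H]
  have maps: "set gs \<subseteq> Cell1 M \<Longrightarrow> map (fc1 H) gs = map (fc1 G) (map (fc1 F) gs)"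
    "set \<beta>s \<subseteq> Cell2 M \<Longrightarrow> map (fc2 H) \<beta>s = map (fc2 G) (map (fc2 F) \<beta>s)"
    "set as \<subseteq> Ob M \<Longrightarrow> map (fob H) as = map (fob G) (map (fob F) as)" for gs \<beta>s as
    by (auto simp: H' subset_iff)
  show ?thesis
  proof (rule nonsym_multifunctorI)
    show "fob H \<in> Ob M \<rightarrow>\<^sub>E Ob Q"
      using H F.fob_Ob G.fob_Ob by (auto simp: is_comp_def compose_def)
    show "fc1 H (gamma1 M f gs) = gamma1 Q (fc1 H f) (map (fc1 H) gs)" if "composable1 M f gs" for f gs
      using that F.composable1_map[OF that]
      by (simp add: maps H' composable1_def[of M] F.map_gamma1 G.map_gamma1 F.M.gamma1_cell del: map_map)
    show "fc2 H (gamma2 M \<alpha> \<beta>s) = gamma2 Q (fc2 H \<alpha>) (map (fc2 H) \<beta>s)" if "composable2 M \<alpha> \<beta>s" for \<alpha> \<beta>s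
      using that F.composable2_map[OF that]
      by (simp add: maps H' composable2_def[of M] F.map_gamma2 G.map_gamma2 F.M.gamma2_cell del: map_map)
    show "src Q (fc1 H f) = map (fob H) (src M f)" if "f \<in> Cell1 M" for f
      using that by (simp add: maps F.M.src_Ob H' F.fc1_cell G.fc1_cell del: map_map)
    show "fc1 H \<in> extensional (Cell1 M)" "fc2 H \<in> extensional (Cell2 M)"
      using H by (simp_all add: is_comp_def compose_def)
  qed (auto simp: H' F.fc1_cell G.fc1_cell F.fc2_cell G.fc2_cell F.fc2_id2 G.fc2_id2 F.fc2_vcomp G.fc2_vcomp
      F.M.cell_simps F.fob_Ob F.M.tgt_Ob F.map_unit1 G.map_unit1 F.M.cat_multicategory_axioms G.N.cat_multicategory_axioms)
qed

lemma sym_multifunctor_comp: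
  assumes F: "sym_multifunctor M N F" and G: "sym_multifunctor N Q G"
  shows "sym_multifunctor M Q (sym_comp M G F)"
proof -
  interpret F: sym_multifunctor M N F by fact
  interpret G: sym_multifunctor N Q G by fact
  show ?thesis
    by (intro sym_multifunctor.intro sym_multifunctor_axioms.intro
        nonsym_multifunctor_comp[OF F.nonsym_multifunctor_axioms G.nonsym_multifunctor_axioms is_comp_sym_comp])
      (simp_all add: is_comp_simps[OF is_comp_sym_comp] F.M.cell_simps F.map_act1 F.map_act2 G.map_act1 G.map_act2
        F.fc1_cell F.fc2_cell)
qed

lemma fsym_ps_comp:
  "f \<in> Cell1 M \<Longrightarrow> \<sigma> permutes {..<arity M f} \<Longrightarrow>
    fsym (ps_comp M Q G F) \<sigma> f = vcomp Q (fsym G \<sigma> (fc1 F f)) (fc2 G (fsym F \<sigma> f))"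
  by (simp add: ps_comp_def)

text \<open>The isomorphism of the composite is G applied to the one of F, followed by the one of G
  at Ff. The two compatibilities with \<gamma> come from interchange, and the cocycle condition
  rests on naturality of the isomorphisms of G at the 2-cell
  \<open>fsym F \<sigma> f\<close>.\<close>

lemma ps_multifunctor_comp:
  assumes F: "ps_multifunctor M N F" and G: "ps_multifunctor N Q G"
  shows "ps_multifunctor M Q (ps_comp M Q G F)"
proof -
  interpret F: ps_multifunctor M N F by fact
  interpret G: ps_multifunctor N Q G by fact
  let ?H = "ps_comp M Q G F"
  note H' = is_comp_simps[OF is_comp_ps_comp, of _ M Q G F]
  interpret H: nonsym_multifunctor M Q ?H
    by (rule nonsym_multifunctor_comp[OF F.nonsym_multifunctor_axioms G.nonsym_multifunctor_axioms is_comp_ps_comp])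
  have maps: "set as \<subseteq> Ob M \<Longrightarrow> map (fob ?H) as = map (fob G) (map (fob F) as)" for as
    by (auto simp: H' subset_iff)
  have ids: "set gs \<subseteq> Cell1 M \<Longrightarrow> map (\<lambda>g. id2 Q (fc1 ?H g)) gs = map (\<lambda>h. id2 Q (fc1 G h)) (map (fc1 F) gs)" for gs
    by (auto simp: H' subset_iff)
  have perm_ids: "map (fc2 G) (map (\<lambda>g. id2 N (fc1 F g)) gs) = map (\<lambda>g. id2 Q (fc1 ?H g)) gs" if "set gs \<subseteq> Cell1 M" for gs
    using that by (auto simp: H' G.fc2_id2 F.fc1_cell)
  show ?thesis
  proof (intro ps_multifunctor.intro ps_multifunctor_axioms.intro)
    show "nonsym_multifunctor M Q ?H" by (rule H.nonsym_multifunctor_axioms)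
    show "fsym ?H \<sigma> f = undefined" if "\<not> (f \<in> Cell1 M \<and> \<sigma> permutes {..<arity M f})" for f \<sigma>
      using that by (auto simp: ps_comp_def)
    show "fsym ?H id f = id2 Q (fc1 ?H f)" if "f \<in> Cell1 M" for f
      using that
      by (simp add: fsym_ps_comp permutes_id F.fsym_id G.fsym_id H' F.fc1_cell G.fc2_id2 G.fc1_cell G.N.vcomp_id2_id2)
  next
    fix f \<sigma> assume f: "f \<in> Cell1 M" and \<sigma>: "\<sigma> permutes {..<arity M f}"
    let ?as = "permute_list \<sigma> (map (fob F) (src M f))"
    have as: "set ?as \<subseteq> Ob N" "fob F (tgt M f) \<in> Ob N"
      using \<sigma> f F.M.src_Ob[OF f] by (auto simp: F.fob_Ob F.M.tgt_Ob)
    have 1: "iso_arr (hom_cat Q (map (fob G) ?as) (fob G (fob F (tgt M f))))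
        (fc1 G (fc1 F (act1 M f \<sigma>))) (fc1 G (act1 N (fc1 F f) \<sigma>)) (fc2 G (fsym F \<sigma> f))"
      by (rule iso_arr_functor[OF G.hom_functor[OF as] F.fsym_iso[OF f \<sigma>]])
    have 2: "iso_arr (hom_cat Q (map (fob G) ?as) (fob G (fob F (tgt M f))))
        (fc1 G (act1 N (fc1 F f) \<sigma>)) (act1 Q (fc1 G (fc1 F f)) \<sigma>) (fsym G \<sigma> (fc1 F f))"
      using G.fsym_iso[of "fc1 F f" \<sigma>] f \<sigma> by (simp add: F.fc1_cell permute_list_map)
    have "category (hom_cat Q (map (fob G) ?as) (fob G (fob F (tgt M f))))"
      using as by (intro G.N.hom_category) (auto simp: G.fob_Ob)
    from iso_arr_Cmp[OF this 1 2] f \<sigma>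
    show "iso_arr (hom_cat Q (permute_list \<sigma> (map (fob ?H) (src M f))) (fob ?H (tgt M f)))
        (fc1 ?H (act1 M f \<sigma>)) (act1 Q (fc1 ?H f) \<sigma>) (fsym ?H \<sigma> f)"
      by (simp add: fsym_ps_comp H' F.M.act1_cell F.M.tgt_Ob maps F.M.src_Ob permute_list_map)
  next
    fix \<alpha> \<sigma> assume \<alpha>: "\<alpha> \<in> Cell2 M" and \<sigma>: "\<sigma> permutes {..<arity M (dom2 M \<alpha>)}"
    let ?f = "dom2 M \<alpha>" and ?g = "cod2 M \<alpha>"
    note c = F.M.dom2_Cell1[OF \<alpha>] F.M.cod2_cell[OF \<alpha>]
    note f = F.fsym_cell[OF c(1) \<sigma>] and g = F.fsym_cell[OF c(2), of \<sigma>]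
    note Ff = G.fsym_cell[of "fc1 F ?f" \<sigma>] and Fg = G.fsym_cell[of "fc1 F ?g" \<sigma>]
    note cs = c f g Ff Fg F.fc1_cell F.fc2_cell G.fc1_cell G.fc2_cell F.M.act2_cell F.N.act2_cell G.N.act2_cell \<sigma> \<alpha>
    have "vcomp Q (act2 Q (fc2 G (fc2 F \<alpha>)) \<sigma>) (vcomp Q (fsym G \<sigma> (fc1 F ?f)) (fc2 G (fsym F \<sigma> ?f)))
      = vcomp Q (vcomp Q (act2 Q (fc2 G (fc2 F \<alpha>)) \<sigma>) (fsym G \<sigma> (fc1 F ?f))) (fc2 G (fsym F \<sigma> ?f))"
      by (rule G.N.vcomp_assoc[symmetric]) (simp_all add: cs)
    also have "vcomp Q (act2 Q (fc2 G (fc2 F \<alpha>)) \<sigma>) (fsym G \<sigma> (fc1 F ?f))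
      = vcomp Q (fsym G \<sigma> (fc1 F ?g)) (fc2 G (act2 N (fc2 F \<alpha>) \<sigma>))"
      using G.fsym_natural[of "fc2 F \<alpha>" \<sigma>] by (simp add: cs)
    also have "vcomp Q (vcomp Q (fsym G \<sigma> (fc1 F ?g)) (fc2 G (act2 N (fc2 F \<alpha>) \<sigma>))) (fc2 G (fsym F \<sigma> ?f))
      = vcomp Q (fsym G \<sigma> (fc1 F ?g)) (vcomp Q (fc2 G (act2 N (fc2 F \<alpha>) \<sigma>)) (fc2 G (fsym F \<sigma> ?f)))"
      by (rule G.N.vcomp_assoc) (simp_all add: cs)
    also have "vcomp Q (fc2 G (act2 N (fc2 F \<alpha>) \<sigma>)) (fc2 G (fsym F \<sigma> ?f)) = fc2 G (vcomp N (act2 N (fc2 F \<alpha>) \<sigma>) (fsym F \<sigma> ?f))"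
      by (rule G.fc2_vcomp[symmetric]) (simp_all add: cs)
    also have "vcomp N (act2 N (fc2 F \<alpha>) \<sigma>) (fsym F \<sigma> ?f) = vcomp N (fsym F \<sigma> ?g) (fc2 F (act2 M \<alpha> \<sigma>))"
      by (rule F.fsym_natural[OF \<alpha> \<sigma>])
    also have "fc2 G \<dots> = vcomp Q (fc2 G (fsym F \<sigma> ?g)) (fc2 G (fc2 F (act2 M \<alpha> \<sigma>)))"
      by (rule G.fc2_vcomp) (simp_all add: cs)
    also have "vcomp Q (fsym G \<sigma> (fc1 F ?g)) \<dots> = vcomp Q (vcomp Q (fsym G \<sigma> (fc1 F ?g)) (fc2 G (fsym F \<sigma> ?g))) (fc2 G (fc2 F (act2 M \<alpha> \<sigma>)))"
      by (rule G.N.vcomp_assoc[symmetric]) (simp_all add: cs)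
    finally show "vcomp Q (act2 Q (fc2 ?H \<alpha>) \<sigma>) (fsym ?H \<sigma> ?f) = vcomp Q (fsym ?H \<sigma> ?g) (fc2 ?H (act2 M \<alpha> \<sigma>))"
      by (simp add: fsym_ps_comp H' cs)
  next
    fix f \<sigma> \<tau> assume f: "f \<in> Cell1 M" and \<sigma>: "\<sigma> permutes {..<arity M f}" and \<tau>: "\<tau> permutes {..<arity M f}"
    note cs = f \<sigma> \<tau> F.M.act1_cell F.N.act1_cell F.fsym_cell G.fsym_cell F.fc1_cell G.fc1_cell G.fc2_cell
      F.N.act2_cell G.N.act2_cell G.N.act1_cell F.N.vcomp_cell G.N.vcomp_cell
    let ?Gs = "fsym G \<sigma> (fc1 F f)" and ?Gt = "fsym G \<tau> (act1 N (fc1 F f) \<sigma>)"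
    let ?Fs = "fsym F \<sigma> f" and ?Ft = "fsym F \<tau> (act1 M f \<sigma>)"
    have "fsym ?H (\<sigma> \<circ> \<tau>) f = vcomp Q (vcomp Q (act2 Q ?Gs \<tau>) ?Gt) (fc2 G (vcomp N (act2 N ?Fs \<tau>) ?Ft))"
      by (simp add: fsym_ps_comp permutes_compose F.fsym_comp G.fsym_comp cs)
    also have "\<dots> = vcomp Q (act2 Q ?Gs \<tau>) (vcomp Q (vcomp Q ?Gt (fc2 G (act2 N ?Fs \<tau>))) (fc2 G ?Ft))"
      by (simp add: G.fc2_vcomp G.N.vcomp_assoc cs)
    \<comment> \<open>Naturality of the isomorphism of G for \<tau> at the 2-cell \<open>?Fs\<close>
      exchanges the two middle factors, which brings the G-part and the F-part for \<sigma> next to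
      each other.\<close>
    also have "vcomp Q ?Gt (fc2 G (act2 N ?Fs \<tau>)) = vcomp Q (act2 Q (fc2 G ?Fs) \<tau>) (fsym G \<tau> (fc1 F (act1 M f \<sigma>)))"
      using G.fsym_natural[of ?Fs \<tau>] by (simp add: cs)
    also have "vcomp Q (act2 Q ?Gs \<tau>) (vcomp Q (vcomp Q (act2 Q (fc2 G ?Fs) \<tau>) (fsym G \<tau> (fc1 F (act1 M f \<sigma>)))) (fc2 G ?Ft))
      = vcomp Q (vcomp Q (act2 Q ?Gs \<tau>) (act2 Q (fc2 G ?Fs) \<tau>)) (vcomp Q (fsym G \<tau> (fc1 F (act1 M f \<sigma>))) (fc2 G ?Ft))"
      by (simp add: G.N.vcomp_assoc cs)
    finally show "fsym ?H (\<sigma> \<circ> \<tau>) f = vcomp Q (act2 Q (fsym ?H \<sigma> f) \<tau>) (fsym ?H \<tau> (act1 M f \<sigma>))"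
      by (simp add: fsym_ps_comp G.N.act2_vcomp cs o_def)
  next
    fix f gs \<sigma> assume c: "composable1 M f gs" and \<sigma>: "\<sigma> permutes {..<length gs}"
    note len = composable1_length[OF c]
    have f: "f \<in> Cell1 M" and gs: "set gs \<subseteq> Cell1 M" using c by (simp_all add: composable1_def)
    let ?p = "outer_perm \<sigma> (map (arity M) gs)"
    have p: "?p permutes {..<arity M (gamma1 M f gs)}"
      using \<sigma> outer_perm_permutes[of \<sigma> "map (arity M) gs"] by (simp add: F.M.arity_gamma1[OF c])
    have ar: "map (arity N) (map (fc1 F) gs) = map (arity M) gs"
      using gs by (auto simp: F.fc1_cell)
    have pgs: "set (permute_list \<sigma> gs) \<subseteq> Cell1 M" using gs \<sigma> by simp
    let ?ids = "map (\<lambda>g. id2 Q (fc1 ?H g)) (permute_list \<sigma> gs)"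
    let ?idsN = "map (\<lambda>g. id2 N (fc1 F g)) (permute_list \<sigma> gs)"
    note cF = F.composable2_fsym_top[OF c \<sigma>]
    have c1: "composable2 Q (fc2 G (fsym F \<sigma> f)) ?ids"
      using G.composable2_map[OF cF] by (simp only: perm_ids[OF pgs])
    have ids_cells: "set ?ids \<subseteq> Cell2 Q" "map (dom2 Q) ?ids = map (cod2 Q) ?ids"
      using pgs by (auto simp: G.N.id2_cell H.fc1_cell)
    have c2: "composable2 Q (fsym G \<sigma> (fc1 F f)) ?ids"
      by (rule G.N.composable2_next[OF c1])
        (use ids_cells f \<sigma> len in \<open>simp_all add: F.fsym_cell G.fsym_cell G.fc2_cell F.fc1_cell\<close>)
    have "fsym ?H ?p (gamma1 M f gs) = vcomp Q (fsym G ?p (gamma1 N (fc1 F f) (map (fc1 F) gs))) (fc2 G (fsym F ?p (gamma1 M f gs)))"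
      using c p by (simp add: fsym_ps_comp F.M.gamma1_cell F.map_gamma1)
    also have "fsym G ?p (gamma1 N (fc1 F f) (map (fc1 F) gs)) = gamma2 Q (fsym G \<sigma> (fc1 F f)) ?ids"
      using G.fsym_top[OF F.composable1_map[OF c], of \<sigma>] \<sigma> ids[OF pgs]
      by (simp add: ar permute_list_map del: map_map)
    also have "fc2 G (fsym F ?p (gamma1 M f gs)) = gamma2 Q (fc2 G (fsym F \<sigma> f)) ?ids"
      using F.fsym_top[OF c \<sigma>] G.map_gamma2[OF cF] by (simp only: perm_ids[OF pgs])
    also have "vcomp Q (gamma2 Q (fsym G \<sigma> (fc1 F f)) ?ids) (gamma2 Q (fc2 G (fsym F \<sigma> f)) ?ids)
      = gamma2 Q (vcomp Q (fsym G \<sigma> (fc1 F f)) (fc2 G (fsym F \<sigma> f))) (map2 (vcomp Q) ?ids ?ids)"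
      by (rule G.N.gamma2_vcomp[symmetric, OF c1 c2])
        (use ids_cells f \<sigma> len in \<open>simp_all add: F.fsym_cell G.fsym_cell G.fc2_cell F.fc1_cell\<close>)
    also have "map2 (vcomp Q) ?ids ?ids = ?ids"
      using pgs
      by (auto simp: zip_map_map zip_same_conv_map subset_iff G.N.vcomp_id2_id2 H.fc1_cell simp del: set_permute_list)
    finally show "fsym ?H ?p (gamma1 M f gs) = gamma2 Q (fsym ?H \<sigma> f) ?ids"
      using f \<sigma> len by (simp add: fsym_ps_comp)
  next
    fix f gs \<tau>s assume c: "composable1 M f gs" and \<tau>s: "list_all2 (\<lambda>g \<tau>. \<tau> permutes {..<arity M g}) gs \<tau>s"
    show "fsym ?H (inner_perm (map (arity M) gs) \<tau>s) (gamma1 M f gs)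
      = gamma2 Q (id2 Q (fc1 ?H f)) (map2 (\<lambda>g \<tau>. fsym ?H \<tau> g) gs \<tau>s)"
    proof -
      have f: "f \<in> Cell1 M" and gs: "set gs \<subseteq> Cell1 M" using c by (simp_all add: composable1_def)
      let ?p = "inner_perm (map (arity M) gs) \<tau>s"
      have p: "?p permutes {..<arity M (gamma1 M f gs)}"
        using \<tau>s by (simp add: F.M.arity_gamma1[OF c] inner_perm_permutes list_all2_map1)
      have ar: "map (arity N) (map (fc1 F) gs) = map (arity M) gs"
        using gs by (auto simp: F.fc1_cell)
      let ?Fs = "map2 (\<lambda>g \<tau>. fsym F \<tau> g) gs \<tau>s" and ?Gs = "map2 (\<lambda>g \<tau>. fsym G \<tau> g) (map (fc1 F) gs) \<tau>s"
      have \<tau>s': "list_all2 (\<lambda>g \<tau>. \<tau> permutes {..<arity N g}) (map (fc1 F) gs) \<tau>s"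
        using \<tau>s ar by (metis (no_types) F.N.perms_list_all2(1) F.M.perms_list_all2(1))
      have Fgs: "set (map (fc1 F) gs) \<subseteq> Cell1 N" using gs by (auto simp: F.fc1_cell)
      note cF = F.composable2_fsym_bottom[OF c \<tau>s]
      note cG = G.composable2_fsym_bottom[OF F.composable1_map[OF c] \<tau>s']
      have c1: "composable2 Q (id2 Q (fc1 ?H f)) (map (fc2 G) ?Fs)"
        using G.composable2_map[OF cF] f by (simp add: G.fc2_id2 F.fc1_cell H' del: map_map)
      have ds: "map (dom2 Q) ?Gs = map (cod2 Q) (map (fc2 G) ?Fs)"
      proof -
        have "map (cod2 Q) (map (fc2 G) ?Fs) = map (fc1 G) (map (cod2 N) ?Fs)"
          using F.fsym_cells(1)[OF \<tau>s gs] by (auto simp: G.fc2_cell)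
        then show ?thesis
          by (simp only: F.fsym_cells(3)[OF \<tau>s gs] G.fsym_cells(2)[OF \<tau>s' Fgs])
      qed
      have "fsym ?H ?p (gamma1 M f gs) = vcomp Q (fsym G ?p (gamma1 N (fc1 F f) (map (fc1 F) gs))) (fc2 G (fsym F ?p (gamma1 M f gs)))"
        using c p by (simp add: fsym_ps_comp F.M.gamma1_cell F.map_gamma1)
      also have "fsym G ?p (gamma1 N (fc1 F f) (map (fc1 F) gs)) = gamma2 Q (id2 Q (fc1 ?H f)) ?Gs"
        using G.fsym_bottom[OF F.composable1_map[OF c] \<tau>s'] f by (simp only: ar H')
      also have "fc2 G (fsym F ?p (gamma1 M f gs)) = gamma2 Q (id2 Q (fc1 ?H f)) (map (fc2 G) ?Fs)"
        using F.fsym_bottom[OF c \<tau>s] G.map_gamma2[OF cF] f by (simp add: G.fc2_id2 F.fc1_cell H' del: map_map)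
      also have "vcomp Q (gamma2 Q (id2 Q (fc1 ?H f)) ?Gs) (gamma2 Q (id2 Q (fc1 ?H f)) (map (fc2 G) ?Fs))
        = gamma2 Q (vcomp Q (id2 Q (fc1 ?H f)) (id2 Q (fc1 ?H f))) (map2 (vcomp Q) ?Gs (map (fc2 G) ?Fs))"
        by (rule G.N.gamma2_vcomp[symmetric, OF c1])
          (use cG ds f in \<open>simp_all add: H' G.N.id2_cell F.fc1_cell G.fc1_cell del: map_map\<close>)
      also have "map2 (vcomp Q) ?Gs (map (fc2 G) ?Fs) = map2 (\<lambda>g \<tau>. fsym ?H \<tau> g) gs \<tau>s"
        using \<tau>s gs by (auto simp: list_eq_iff_nth_eq list_all2_conv_all_nth fsym_ps_comp subset_iff)
      finally show ?thesis
        using f by (simp add: G.N.vcomp_id2_id2 H.fc1_cell)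
    qed
  qed
qed

text \<open>The axioms read only the three base fields, so they pass between the record types of
  symmetric and of pseudo symmetric multifunctors.\<close>

lemma nonsym_multifunctor_cong:
  assumes "nonsym_multifunctor M N F" "fob G = fob F" "fc1 G = fc1 F" "fc2 G = fc2 F"
  shows "nonsym_multifunctor M N G"
  using assms by (simp add: nonsym_multifunctor_def nonsym_multifunctor_axioms_def)

lemma sym_multifunctor_id:
  assumes "cat_multicategory M"
  shows "sym_multifunctor M M (sym_id M)"
proof -
  interpret M: cat_multicategory M by fact
  have maps: "set gs \<subseteq> Cell1 M \<Longrightarrow> map (restrict (\<lambda>f. f) (Cell1 M)) gs = gs"
    "set \<beta>s \<subseteq> Cell2 M \<Longrightarrow> map (restrict (\<lambda>f. f) (Cell2 M)) \<beta>s = \<beta>s"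
    "set as \<subseteq> Ob M \<Longrightarrow> map (restrict (\<lambda>f. f) (Ob M)) as = as" for gs \<beta>s as
    by (auto intro!: map_idI simp: subset_iff)
  have "nonsym_multifunctor M M (sym_id M)"
  proof (rule nonsym_multifunctorI)
    show "fc1 (sym_id M) (gamma1 M f gs) = gamma1 M (fc1 (sym_id M) f) (map (fc1 (sym_id M)) gs)" if "composable1 M f gs" for f gs
      using that M.gamma1_cell[OF that] by (simp add: sym_id_def composable1_def maps)
    show "fc2 (sym_id M) (gamma2 M \<alpha> \<beta>s) = gamma2 M (fc2 (sym_id M) \<alpha>) (map (fc2 (sym_id M)) \<beta>s)" if "composable2 M \<alpha> \<beta>s" for \<alpha> \<beta>s
      using that M.gamma2_cell[OF that] by (simp add: sym_id_def composable2_def maps)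
    show "src M (fc1 (sym_id M) f) = map (fob (sym_id M)) (src M f)" if "f \<in> Cell1 M" for f
      using that by (simp add: sym_id_def maps M.src_Ob)
  qed (auto simp: sym_id_def M.cell_simps M.tgt_Ob M.cat_multicategory_axioms)
  then show ?thesis
    by (intro sym_multifunctor.intro sym_multifunctor_axioms.intro) (auto simp: sym_id_def M.cell_simps)
qed

lemma sym_to_ps_simps [simp]:
  "fob (sym_to_ps M N F) = fob F" "fc1 (sym_to_ps M N F) = fc1 F" "fc2 (sym_to_ps M N F) = fc2 F"
  by (simp_all add: sym_to_ps_def)

lemma fsym_sym_to_ps:
  "f \<in> Cell1 M \<Longrightarrow> \<sigma> permutes {..<arity M f} \<Longrightarrow> fsym (sym_to_ps M N F) \<sigma> f = id2 N (fc1 F (act1 M f \<sigma>))"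
  by (simp add: sym_to_ps_def)

text \<open>The component at \<sigma> is the identity of F(f\<sigma>), so the axioms become
  statements about identity 2-cells. The two compatibilities with \<gamma> are the equivariance
  axioms of M, carried over by F and closed with \<open>gamma2_id2\<close>.\<close>

lemma ps_multifunctor_sym_to_ps:
  assumes "sym_multifunctor M N F"
  shows "ps_multifunctor M N (sym_to_ps M N F)"
proof -
  interpret F: sym_multifunctor M N F by fact
  let ?H = "sym_to_ps M N F"
  note cs = fsym_sym_to_ps F.M.cell_simps F.fc1_cell F.fc2_cell F.map_act1 F.map_act2
  show ?thesis
  proof (intro ps_multifunctor.intro ps_multifunctor_axioms.intro)
    show "nonsym_multifunctor M N ?H"
      by (rule nonsym_multifunctor_cong[OF F.nonsym_multifunctor_axioms]) simp_all
    show "fsym ?H \<sigma> f = undefined" if "\<not> (f \<in> Cell1 M \<and> \<sigma> permutes {..<arity M f})" for f \<sigma>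
      using that by (auto simp: sym_to_ps_def)
    show "fsym ?H id f = id2 N (fc1 ?H f)" if "f \<in> Cell1 M" for f
      using that by (simp add: fsym_sym_to_ps permutes_id F.M.act1_id)
  next
    fix f \<sigma> assume f: "f \<in> Cell1 M" and \<sigma>: "\<sigma> permutes {..<arity M f}"
    have "category (hom_cat N (permute_list \<sigma> (map (fob F) (src M f))) (fob F (tgt M f)))"
      using F.N.category_cell[of "fc1 F (act1 M f \<sigma>)"] f \<sigma>
      by (simp add: F.fc1_cell F.M.act1_cell permute_list_map)
    from iso_arr_Idn[OF this, of "fc1 F (act1 M f \<sigma>)"]
    show "iso_arr (hom_cat N (permute_list \<sigma> (map (fob ?H) (src M f))) (fob ?H (tgt M f)))
        (fc1 ?H (act1 M f \<sigma>)) (act1 N (fc1 ?H f) \<sigma>) (fsym ?H \<sigma> f)"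
      using f \<sigma> F.fc1_cell[OF F.M.act1_cell(1)[OF f \<sigma>]]
      by (simp add: fsym_sym_to_ps F.M.act1_cell permute_list_map flip: F.map_act1)
  next
    fix \<alpha> \<sigma> assume \<alpha>: "\<alpha> \<in> Cell2 M" and \<sigma>: "\<sigma> permutes {..<arity M (dom2 M \<alpha>)}"
    then show "vcomp N (act2 N (fc2 ?H \<alpha>) \<sigma>) (fsym ?H \<sigma> (dom2 M \<alpha>)) = vcomp N (fsym ?H \<sigma> (cod2 M \<alpha>)) (fc2 ?H (act2 M \<alpha> \<sigma>))"
      using F.N.vcomp_id2[of "fc2 F (act2 M \<alpha> \<sigma>)"]
      by (simp add: fsym_sym_to_ps F.M.cell_simps F.fc2_cell flip: F.map_act2)
  next
    fix f \<sigma> \<tau> assume f: "f \<in> Cell1 M" "\<sigma> permutes {..<arity M f}" "\<tau> permutes {..<arity M f}"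
    then show "fsym ?H (\<sigma> \<circ> \<tau>) f = vcomp N (act2 N (fsym ?H \<sigma> f) \<tau>) (fsym ?H \<tau> (act1 M f \<sigma>))"
      by (simp add: cs permutes_compose F.N.act1_cell F.N.act2_id2 F.N.act1_comp F.N.vcomp_id2_id2)
  next
    fix f gs \<sigma> assume c: "composable1 M f gs" and \<sigma>: "\<sigma> permutes {..<length gs}"
    have p: "outer_perm \<sigma> (map (arity M) gs) permutes {..<arity M (gamma1 M f gs)}"
      using \<sigma> outer_perm_permutes[of \<sigma> "map (arity M) gs"] by (simp add: F.M.arity_gamma1[OF c])
    have f: "f \<in> Cell1 M" "\<sigma> permutes {..<arity M f}"
      using c \<sigma> composable1_length[OF c] by (simp_all add: composable1_def)
    note c' = F.M.composable1_permute_act[OF c \<sigma>]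
    show "fsym ?H (outer_perm \<sigma> (map (arity M) gs)) (gamma1 M f gs)
        = gamma2 N (fsym ?H \<sigma> f) (map (\<lambda>g. id2 N (fc1 ?H g)) (permute_list \<sigma> gs))"
      using p c f F.M.gamma1_top[OF c \<sigma>] F.map_gamma1[OF c'] F.N.gamma2_id2[OF F.composable1_map[OF c']]
      by (simp add: fsym_sym_to_ps F.M.gamma1_cell o_def)
  next
    fix f gs \<tau>s assume c: "composable1 M f gs" and \<tau>s: "list_all2 (\<lambda>g \<tau>. \<tau> permutes {..<arity M g}) gs \<tau>s"
    have p: "inner_perm (map (arity M) gs) \<tau>s permutes {..<arity M (gamma1 M f gs)}"
      using \<tau>s by (simp add: F.M.arity_gamma1[OF c] inner_perm_permutes list_all2_map1)
    have f: "f \<in> Cell1 M" and gs: "set gs \<subseteq> Cell1 M" using c by (simp_all add: composable1_def)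
    note c' = F.M.composable1_map2_act[OF c \<tau>s]
    have "map2 (\<lambda>g \<tau>. fsym ?H \<tau> g) gs \<tau>s = map (id2 N) (map (fc1 F) (map2 (act1 M) gs \<tau>s))"
      using \<tau>s gs by (auto simp: list_eq_iff_nth_eq list_all2_conv_all_nth fsym_sym_to_ps subset_iff)
    then show "fsym ?H (inner_perm (map (arity M) gs) \<tau>s) (gamma1 M f gs)
        = gamma2 N (id2 N (fc1 ?H f)) (map2 (\<lambda>g \<tau>. fsym ?H \<tau> g) gs \<tau>s)"
      using p c f F.M.gamma1_bottom[OF c \<tau>s] F.map_gamma1[OF c'] F.N.gamma2_id2[OF F.composable1_map[OF c']]
      by (simp add: fsym_sym_to_ps F.M.gamma1_cell del: map_map)
  qed
qed

lemma ps_multifunctor_nonsym: "ps_multifunctor M N F \<Longrightarrow> nonsym_multifunctor M N F"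
  by (simp add: ps_multifunctor_def)

lemma sym_multifunctor_nonsym: "sym_multifunctor M N F \<Longrightarrow> nonsym_multifunctor M N F"
  by (simp add: sym_multifunctor_def)

section \<open>Composition of transformations\<close>

lemma map_restrict: "set xs \<subseteq> A \<Longrightarrow> map (restrict f A) xs = map f xs"
  by auto

lemma multinatural_id:
  assumes "nonsym_multifunctor M N F"
  shows "multinatural M N F F (\<lambda>a\<in>Ob M. unit1 N (fob F a))"
proof (rule multinaturalI[OF assms assms])
  interpret nonsym_multifunctor M N F by fact
  fix \<alpha> assume \<alpha>: "\<alpha> \<in> Cell2 M"
  have "map (unit1 N) (map (fob F) (src M (dom2 M \<alpha>))) = map (\<lambda>a\<in>Ob M. unit1 N (fob F a)) (src M (dom2 M \<alpha>))"
    using M.src_Ob[OF M.dom2_Cell1[OF \<alpha>]] by auto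
  then show "intertwines N (map (\<lambda>a\<in>Ob M. unit1 N (fob F a)) (src M (dom2 M \<alpha>)))
      ((\<lambda>a\<in>Ob M. unit1 N (fob F a)) (tgt M (dom2 M \<alpha>))) (fc2 F \<alpha>) (fc2 F \<alpha>)"
    using N.intertwines_id[of "fc2 F \<alpha>"] \<alpha>
    by (simp add: fc2_cell fc1_cell M.dom2_Cell1 M.tgt_Ob del: map_map)
next
  interpret nonsym_multifunctor M N F by fact
  show "a \<in> Ob M \<Longrightarrow> (\<lambda>a\<in>Ob M. unit1 N (fob F a)) a \<in> Cell1 N"
    "a \<in> Ob M \<Longrightarrow> src N ((\<lambda>a\<in>Ob M. unit1 N (fob F a)) a) = [fob F a]"
    "a \<in> Ob M \<Longrightarrow> tgt N ((\<lambda>a\<in>Ob M. unit1 N (fob F a)) a) = fob F a" for a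
    by (simp_all add: N.unit1_cell fob_Ob)
qed simp

text \<open>The version of \<open>intertwines_stack\<close> for families indexed by objects.
  Vertical and horizontal composites of transformations, and their compatibility with
  \<open>fsym\<close>, are all obtained from it.\<close>

lemma stack_components:
  assumes "cat_multicategory N"
    and "\<And>a. a \<in> set as \<Longrightarrow> src N (\<zeta> a) = [tgt N (\<theta> a)]"
    and "intertwines N (map \<theta> as) \<theta>b x y" "intertwines N (map \<zeta> as) \<zeta>b y z" "src N \<zeta>b = [tgt N \<theta>b]"
  shows "intertwines N (map (\<lambda>a. gamma1 N (\<zeta> a) [\<theta> a]) as) (gamma1 N \<zeta>b [\<theta>b]) x z"
proof -
  interpret N: cat_multicategory N by fact
  have "map2 (\<lambda>\<zeta> \<theta>. gamma1 N \<zeta> [\<theta>]) (map \<zeta> as) (map \<theta> as) = map (\<lambda>a. gamma1 N (\<zeta> a) [\<theta> a]) as"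
    by (simp add: zip_map_map o_def zip_same_conv_map)
  then show ?thesis
    using N.intertwines_stack[OF assms(3,4) _ assms(5)] assms(2)
    by (simp add: list_all2_conv_all_nth)
qed

lemma multinatural_vcomp:
  assumes F: "nonsym_multifunctor M N F" and G: "nonsym_multifunctor M N G" and H: "nonsym_multifunctor M N H"
    and \<theta>: "multinatural M N F G \<theta>" and \<zeta>: "multinatural M N G H \<zeta>"
  shows "multinatural M N F H (\<lambda>a\<in>Ob M. gamma1 N (\<zeta> a) [\<theta> a])"
proof (rule multinaturalI[OF F H])
  interpret F: nonsym_multifunctor M N F by fact
  interpret \<theta>: multinatural M N F G \<theta> by fact
  interpret \<zeta>: multinatural M N G H \<zeta> by fact
  note c = \<theta>.component_cell \<zeta>.component_cell F.N.gamma1_unary_cell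
  show "a \<in> Ob M \<Longrightarrow> (\<lambda>a\<in>Ob M. gamma1 N (\<zeta> a) [\<theta> a]) a \<in> Cell1 N"
    "a \<in> Ob M \<Longrightarrow> src N ((\<lambda>a\<in>Ob M. gamma1 N (\<zeta> a) [\<theta> a]) a) = [fob F a]"
    "a \<in> Ob M \<Longrightarrow> tgt N ((\<lambda>a\<in>Ob M. gamma1 N (\<zeta> a) [\<theta> a]) a) = fob H a" for a
    by (simp_all add: c)
  fix \<alpha> assume \<alpha>: "\<alpha> \<in> Cell2 M"
  let ?as = "src M (dom2 M \<alpha>)" and ?b = "tgt M (dom2 M \<alpha>)"
  have as: "set ?as \<subseteq> Ob M" "?b \<in> Ob M"
    using \<alpha> by (simp_all add: F.M.src_Ob F.M.tgt_Ob F.M.dom2_Cell1)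
  have "intertwines N (map (\<lambda>a. gamma1 N (\<zeta> a) [\<theta> a]) ?as) (gamma1 N (\<zeta> ?b) [\<theta> ?b]) (fc2 F \<alpha>) (fc2 H \<alpha>)"
    by (rule stack_components[OF F.N.cat_multicategory_axioms _ multinatural_intertwines[OF F G \<theta> \<alpha>]
          multinatural_intertwines[OF G H \<zeta> \<alpha>]]) (use as in \<open>auto simp: c subset_iff\<close>)
  then show "intertwines N (map (\<lambda>a\<in>Ob M. gamma1 N (\<zeta> a) [\<theta> a]) ?as)
      ((\<lambda>a\<in>Ob M. gamma1 N (\<zeta> a) [\<theta> a]) ?b) (fc2 F \<alpha>) (fc2 H \<alpha>)"
    using as by (simp add: map_restrict)
qed simp

text \<open>The square of \<zeta> * \<theta> at \<alpha> consists of the image under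
  \<open>tdom \<zeta>\<close> of the square of \<theta> at \<alpha>, with the square of \<zeta> at
  the image of \<alpha> under \<open>tcod \<theta>\<close> stacked on it.\<close>

lemma multinatural_hcomp:
  fixes \<theta> :: "(('o, 'm, 'c, 'p, 'n, 'd, 'z) mfun_scheme, 'o, 'n) mtrans"
    and \<zeta> :: "(('p, 'n, 'd, 'q, 'k, 'e, 'y) mfun_scheme, 'p, 'k) mtrans"
  assumes F: "nonsym_multifunctor M N (tdom \<theta>)" and G: "nonsym_multifunctor M N (tcod \<theta>)"
    and F': "nonsym_multifunctor N Q (tdom \<zeta>)" and G': "nonsym_multifunctor N Q (tcod \<zeta>)"
    and \<theta>: "multinatural M N (tdom \<theta>) (tcod \<theta>) (tcomp \<theta>)"
    and \<zeta>: "multinatural N Q (tdom \<zeta>) (tcod \<zeta>) (tcomp \<zeta>)"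
    and H: "is_comp M H (tdom \<zeta>) (tdom \<theta>)" and K: "is_comp M K (tcod \<zeta>) (tcod \<theta>)"
  shows "multinatural M Q H K (hcomp_components M Q \<zeta> \<theta>)"
proof (rule multinaturalI[OF nonsym_multifunctor_comp[OF F F' H] nonsym_multifunctor_comp[OF G G' K]])
  interpret F: nonsym_multifunctor M N "tdom \<theta>" by fact
  interpret G: nonsym_multifunctor M N "tcod \<theta>" by fact
  interpret F': nonsym_multifunctor N Q "tdom \<zeta>" by fact
  interpret \<theta>: multinatural M N "tdom \<theta>" "tcod \<theta>" "tcomp \<theta>" by fact
  interpret \<zeta>: multinatural N Q "tdom \<zeta>" "tcod \<zeta>" "tcomp \<zeta>" by fact
  note c = \<theta>.component_cell \<zeta>.component_cell F'.N.gamma1_unary_cell F'.fc1_cell G.fob_Ob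
  let ?h = "hcomp_components M Q \<zeta> \<theta>"
  note h = hcomp_components_def is_comp_simps[OF H] is_comp_simps[OF K]
  show "a \<in> Ob M \<Longrightarrow> ?h a \<in> Cell1 Q" "a \<in> Ob M \<Longrightarrow> src Q (?h a) = [fob H a]" "a \<in> Ob M \<Longrightarrow> tgt Q (?h a) = fob K a" for a
    by (simp_all add: c h)
  fix \<alpha> assume \<alpha>: "\<alpha> \<in> Cell2 M"
  let ?as = "src M (dom2 M \<alpha>)" and ?b = "tgt M (dom2 M \<alpha>)"
  have as: "set ?as \<subseteq> Ob M" "?b \<in> Ob M"
    using \<alpha> by (simp_all add: F.M.src_Ob F.M.tgt_Ob F.M.dom2_Cell1)
  have "intertwines Q (map (\<lambda>a. gamma1 Q (tcomp \<zeta> (fob (tcod \<theta>) a)) [fc1 (tdom \<zeta>) (tcomp \<theta> a)]) ?as)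
      (gamma1 Q (tcomp \<zeta> (fob (tcod \<theta>) ?b)) [fc1 (tdom \<zeta>) (tcomp \<theta> ?b)]) (fc2 H \<alpha>) (fc2 K \<alpha>)"
  proof (rule stack_components[OF F'.N.cat_multicategory_axioms])
    show "intertwines Q (map (\<lambda>a. fc1 (tdom \<zeta>) (tcomp \<theta> a)) ?as) (fc1 (tdom \<zeta>) (tcomp \<theta> ?b)) (fc2 H \<alpha>)
        (fc2 (tdom \<zeta>) (fc2 (tcod \<theta>) \<alpha>))"
      using F'.intertwines_map[OF multinatural_intertwines[OF F G \<theta> \<alpha>]] \<alpha> by (simp add: h o_def)
    show "intertwines Q (map (\<lambda>a. tcomp \<zeta> (fob (tcod \<theta>) a)) ?as) (tcomp \<zeta> (fob (tcod \<theta>) ?b))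
        (fc2 (tdom \<zeta>) (fc2 (tcod \<theta>) \<alpha>)) (fc2 K \<alpha>)"
      using multinatural_intertwines[OF F' G' \<zeta>, of "fc2 (tcod \<theta>) \<alpha>"] \<alpha>
      by (simp add: h o_def G.fc2_cell G.fc1_cell F.M.dom2_Cell1)
  qed (use as in \<open>auto simp: c subset_iff\<close>)
  then show "intertwines Q (map ?h ?as) (?h ?b) (fc2 H \<alpha>) (fc2 K \<alpha>)"
    using as by (simp add: hcomp_components_def map_restrict)
qed (simp add: hcomp_components_def)

text \<open>The additional condition on a pseudo symmetric transformation, in the form of squares
  and kept apart from \<open>multinatural\<close>, so that the two kinds of transformation can share
  their proofs.\<close>

definition respects_fsym :: "('o, 'm, 'c) multicat \<Rightarrow> ('p, 'n, 'd) multicat \<Rightarrow>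
    ('o, 'm, 'c, 'p, 'n, 'd) psfun \<Rightarrow> ('o, 'm, 'c, 'p, 'n, 'd) psfun \<Rightarrow> ('o \<Rightarrow> 'n) \<Rightarrow> bool" where
  "respects_fsym M N F G \<theta> \<longleftrightarrow> (\<forall>f\<in>Cell1 M. \<forall>\<sigma>. \<sigma> permutes {..<arity M f} \<longrightarrow>
     intertwines N (map \<theta> (permute_list \<sigma> (src M f))) (\<theta> (tgt M f)) (fsym F \<sigma> f) (fsym G \<sigma> f))"

text \<open>The composability conditions inside \<open>intertwines\<close> hold automatically for
  the components of a multinatural transformation, so the square says no more than the equation in
  \<open>ps_multinatural\<close>.\<close>

lemma ps_multinatural_iff:
  "ps_multinatural M N \<theta> \<longleftrightarrow> ps_multifunctor M N (tdom \<theta>) \<and> ps_multifunctor M N (tcod \<theta>) \<and>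
     multinatural M N (tdom \<theta>) (tcod \<theta>) (tcomp \<theta>) \<and> respects_fsym M N (tdom \<theta>) (tcod \<theta>) (tcomp \<theta>)"
proof -
  have "gamma2 N (id2 N (tcomp \<theta> (tgt M f))) [fsym (tdom \<theta>) \<sigma> f]
        = gamma2 N (fsym (tcod \<theta>) \<sigma> f) (map (\<lambda>a. id2 N (tcomp \<theta> a)) (permute_list \<sigma> (src M f)))
      \<longleftrightarrow> intertwines N (map (tcomp \<theta>) (permute_list \<sigma> (src M f))) (tcomp \<theta> (tgt M f))
        (fsym (tdom \<theta>) \<sigma> f) (fsym (tcod \<theta>) \<sigma> f)"
    if F: "ps_multifunctor M N (tdom \<theta>)" and G: "ps_multifunctor M N (tcod \<theta>)"
      and \<theta>: "multinatural M N (tdom \<theta>) (tcod \<theta>) (tcomp \<theta>)" and f: "f \<in> Cell1 M" "\<sigma> permutes {..<arity M f}" for f \<sigma>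
  proof -
    interpret F: ps_multifunctor M N "tdom \<theta>" by fact
    interpret G: ps_multifunctor M N "tcod \<theta>" by fact
    interpret \<theta>: multinatural M N "tdom \<theta>" "tcod \<theta>" "tcomp \<theta>" by fact
    have as: "set (permute_list \<sigma> (src M f)) \<subseteq> Ob M" "set (src M f) \<subseteq> Ob M" using f by (simp_all add: F.M.src_Ob)
    have cells: "set (map (tcomp \<theta>) (permute_list \<sigma> (src M f))) \<subseteq> Cell1 N"
      using as by (auto simp: \<theta>.component_cell)
    moreover have "map (tgt N) (map (tcomp \<theta>) (permute_list \<sigma> (src M f))) = map (fob (tcod \<theta>)) (permute_list \<sigma> (src M f))"
      using as by (auto simp: \<theta>.component_cell simp del: set_permute_list)
    ultimately have "composable2 N (fsym (tcod \<theta>) \<sigma> f) (map (id2 N) (map (tcomp \<theta>) (permute_list \<sigma> (src M f))))"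
      using f by (simp add: F.N.composable2_id2_iff G.fsym_cell F.M.act1_cell G.fc1_cell del: map_map set_map)
    then show ?thesis
      using f cells
      by (auto simp add: intertwines_def F.N.composable2_id2_unary_iff F.fsym_cell F.fc1_cell F.M.act1_cell
          F.M.tgt_Ob \<theta>.component_cell o_def simp del: set_map)
  qed
  then show ?thesis
    unfolding ps_multinatural_def respects_fsym_def by blast
qed

lemma respects_fsym_id:
  assumes "ps_multifunctor M N F"
  shows "respects_fsym M N F F (\<lambda>a\<in>Ob M. unit1 N (fob F a))"
  unfolding respects_fsym_def
proof (intro ballI allI impI)
  interpret ps_multifunctor M N F by fact
  fix f \<sigma> assume f: "f \<in> Cell1 M" "\<sigma> permutes {..<arity M f}"
  have "set (permute_list \<sigma> (src M f)) \<subseteq> Ob M" using f by (simp add: M.src_Ob)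
  then show "intertwines N (map (\<lambda>a\<in>Ob M. unit1 N (fob F a)) (permute_list \<sigma> (src M f)))
      ((\<lambda>a\<in>Ob M. unit1 N (fob F a)) (tgt M f)) (fsym F \<sigma> f) (fsym F \<sigma> f)"
    using N.intertwines_id[of "fsym F \<sigma> f"] f
    by (simp add: map_restrict M.tgt_Ob fsym_cell fc1_cell M.act1_cell o_def)
qed

lemma respects_fsym_vcomp:
  assumes F: "ps_multifunctor M N F" and \<theta>: "multinatural M N F G \<theta>" and \<zeta>: "multinatural M N G H \<zeta>"
    and \<theta>': "respects_fsym M N F G \<theta>" and \<zeta>': "respects_fsym M N G H \<zeta>"
  shows "respects_fsym M N F H (\<lambda>a\<in>Ob M. gamma1 N (\<zeta> a) [\<theta> a])"
  unfolding respects_fsym_def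
proof (intro ballI allI impI)
  interpret F: ps_multifunctor M N F by fact
  interpret \<theta>: multinatural M N F G \<theta> by fact
  interpret \<zeta>: multinatural M N G H \<zeta> by fact
  fix f \<sigma> assume f: "f \<in> Cell1 M" "\<sigma> permutes {..<arity M f}"
  let ?as = "permute_list \<sigma> (src M f)" and ?b = "tgt M f"
  have as: "set ?as \<subseteq> Ob M" "?b \<in> Ob M" using f by (simp_all add: F.M.src_Ob F.M.tgt_Ob)
  have "intertwines N (map (\<lambda>a. gamma1 N (\<zeta> a) [\<theta> a]) ?as) (gamma1 N (\<zeta> ?b) [\<theta> ?b]) (fsym F \<sigma> f) (fsym H \<sigma> f)"
    by (rule stack_components[OF F.N.cat_multicategory_axioms _ \<theta>'[unfolded respects_fsym_def, rule_format, OF f]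
          \<zeta>'[unfolded respects_fsym_def, rule_format, OF f]])
      (use as in \<open>auto simp: subset_iff \<theta>.component_cell \<zeta>.component_cell simp del: set_permute_list\<close>)
  then show "intertwines N (map (\<lambda>a\<in>Ob M. gamma1 N (\<zeta> a) [\<theta> a]) ?as)
      ((\<lambda>a\<in>Ob M. gamma1 N (\<zeta> a) [\<theta> a]) ?b) (fsym F \<sigma> f) (fsym H \<sigma> f)"
    using as by (simp add: map_restrict)
qed

text \<open>Write \<theta> : F \<Rightarrow> G and \<zeta> : F' \<Rightarrow> G'. The square from
  F'F to G'G is stacked from one between F'F and F'G, with components F'\<theta>, and one between
  F'G and G'G, with components \<zeta> at G. Each of these is a vertical composite of two squares,
  as the structure isomorphisms of the composites are.\<close>

lemma respects_fsym_hcomp: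
  fixes \<theta> :: "(('o, 'm, 'c, 'p, 'n, 'd) psfun, 'o, 'n) mtrans"
    and \<zeta> :: "(('p, 'n, 'd, 'q, 'k, 'e) psfun, 'p, 'k) mtrans"
  assumes \<theta>: "ps_multinatural M N \<theta>" and \<zeta>: "ps_multinatural N Q \<zeta>"
  shows "respects_fsym M Q (ps_comp M Q (tdom \<zeta>) (tdom \<theta>)) (ps_comp M Q (tcod \<zeta>) (tcod \<theta>)) (hcomp_components M Q \<zeta> \<theta>)"
  unfolding respects_fsym_def
proof (intro ballI allI impI)
  note \<theta>' = \<theta>[unfolded ps_multinatural_iff] and \<zeta>' = \<zeta>[unfolded ps_multinatural_iff]
  interpret F: ps_multifunctor M N "tdom \<theta>" using \<theta>' by simp
  interpret G: ps_multifunctor M N "tcod \<theta>" using \<theta>' by simp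
  interpret F': ps_multifunctor N Q "tdom \<zeta>" using \<zeta>' by simp
  interpret G': ps_multifunctor N Q "tcod \<zeta>" using \<zeta>' by simp
  interpret \<theta>: multinatural M N "tdom \<theta>" "tcod \<theta>" "tcomp \<theta>" using \<theta>' by simp
  interpret \<zeta>: multinatural N Q "tdom \<zeta>" "tcod \<zeta>" "tcomp \<zeta>" using \<zeta>' by simp
  fix f \<sigma> assume f: "f \<in> Cell1 M" and \<sigma>: "\<sigma> permutes {..<arity M f}"
  let ?F = "tdom \<theta>" and ?G = "tcod \<theta>" and ?F' = "tdom \<zeta>" and ?G' = "tcod \<zeta>"
  let ?as = "permute_list \<sigma> (src M f)" and ?b = "tgt M f"
  have as: "set (src M f) \<subseteq> Ob M" "set ?as \<subseteq> Ob M" "?b \<in> Ob M" using f \<sigma> by (simp_all add: F.M.src_Ob F.M.tgt_Ob)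
  have \<theta>f: "intertwines N (map (tcomp \<theta>) ?as) (tcomp \<theta> ?b) (fsym ?F \<sigma> f) (fsym ?G \<sigma> f)"
    using \<theta>' f \<sigma> by (simp add: respects_fsym_def)
  have nat: "gamma1 N (fc1 ?G f) (map (tcomp \<theta>) (src M f)) = gamma1 N (tcomp \<theta> ?b) [fc1 ?F f]"
    by (rule \<theta>.natural1[OF f])
  have c1: "composable1 N (fc1 ?G f) (map (tcomp \<theta>) (src M f))" "composable1 N (tcomp \<theta> ?b) [fc1 ?F f]"
    using as f by (auto simp: composable1_def F.fc1_cell G.fc1_cell \<theta>.component_cell)
  note cs = f \<sigma> F.fsym_cell G.fsym_cell F'.fsym_cell G'.fsym_cell F.fc1_cell G.fc1_cell F'.fc1_cell G'.fc1_cell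
    F.fc2_cell G.fc2_cell F'.fc2_cell G'.fc2_cell F.M.act1_cell F.N.act1_cell
  \<comment> \<open>Both sides of the naturality equation \<open>nat\<close> are the same 1-cell.
    Evaluating the isomorphism of F' at it in two ways gives the square.\<close>
  have "intertwines Q (map (fc1 ?F') (permute_list \<sigma> (map (tcomp \<theta>) (src M f)))) (fc1 ?F' (tcomp \<theta> ?b))
      (fsym ?F' \<sigma> (fc1 ?F f)) (fsym ?F' \<sigma> (fc1 ?G f))"
    by (rule F'.intertwines_fsym[OF c1 nat]) (use as in \<open>auto simp: cs \<theta>.component_cell\<close>)
  then have 1: "intertwines Q (map (fc1 ?F') (map (tcomp \<theta>) ?as)) (fc1 ?F' (tcomp \<theta> ?b))
      (fsym ?F' \<sigma> (fc1 ?F f)) (fsym ?F' \<sigma> (fc1 ?G f))"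
    using \<sigma> by (simp add: permute_list_map)
  have 2: "intertwines Q (map (fc1 ?F') (map (tcomp \<theta>) ?as)) (fc1 ?F' (tcomp \<theta> ?b))
      (vcomp Q (fsym ?F' \<sigma> (fc1 ?F f)) (fc2 ?F' (fsym ?F \<sigma> f)))
      (vcomp Q (fsym ?F' \<sigma> (fc1 ?G f)) (fc2 ?F' (fsym ?G \<sigma> f)))"
    by (rule F'.N.intertwines_vcomp[OF F'.intertwines_map[OF \<theta>f] 1]) (simp_all add: cs)
  \<comment> \<open>Naturality of \<zeta> at the 2-cell \<open>fsym ?G \<sigma> f\<close>, in
    contrast to the next square, which is its compatibility with the isomorphisms of F' and
    G'.\<close>
  have 3: "intertwines Q (map (tcomp \<zeta>) (map (fob ?G) ?as)) (tcomp \<zeta> (fob ?G ?b)) (fc2 ?F' (fsym ?G \<sigma> f)) (fc2 ?G' (fsym ?G \<sigma> f))"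
    using multinatural_intertwines[OF F'.nonsym_multifunctor_axioms G'.nonsym_multifunctor_axioms
        \<zeta>.multinatural_axioms, of "fsym ?G \<sigma> f"]
    by (simp add: cs permute_list_map)
  have 4: "intertwines Q (map (tcomp \<zeta>) (map (fob ?G) ?as)) (tcomp \<zeta> (fob ?G ?b)) (fsym ?F' \<sigma> (fc1 ?G f)) (fsym ?G' \<sigma> (fc1 ?G f))"
  proof -
    have "respects_fsym N Q ?F' ?G' (tcomp \<zeta>)" using \<zeta>' by simp
    from this[unfolded respects_fsym_def, rule_format, of "fc1 ?G f" \<sigma>] show ?thesis
      by (simp add: cs permute_list_map)
  qed
  have 5: "intertwines Q (map (tcomp \<zeta>) (map (fob ?G) ?as)) (tcomp \<zeta> (fob ?G ?b))
      (vcomp Q (fsym ?F' \<sigma> (fc1 ?G f)) (fc2 ?F' (fsym ?G \<sigma> f)))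
      (vcomp Q (fsym ?G' \<sigma> (fc1 ?G f)) (fc2 ?G' (fsym ?G \<sigma> f)))"
    by (rule F'.N.intertwines_vcomp[OF 3 4]) (simp_all add: cs)
  \<comment> \<open>The two squares meet in the isomorphism of the mixed composite F'G.\<close>
  have "intertwines Q (map (\<lambda>a. gamma1 Q (tcomp \<zeta> (fob ?G a)) [fc1 ?F' (tcomp \<theta> a)]) ?as)
      (gamma1 Q (tcomp \<zeta> (fob ?G ?b)) [fc1 ?F' (tcomp \<theta> ?b)])
      (vcomp Q (fsym ?F' \<sigma> (fc1 ?F f)) (fc2 ?F' (fsym ?F \<sigma> f))) (vcomp Q (fsym ?G' \<sigma> (fc1 ?G f)) (fc2 ?G' (fsym ?G \<sigma> f)))"
    by (rule stack_components[OF F'.N.cat_multicategory_axioms _ 2[unfolded map_map o_def] 5[unfolded map_map o_def]])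
      (use as in \<open>auto simp: cs \<theta>.component_cell \<zeta>.component_cell G.fob_Ob subset_iff simp del: set_permute_list\<close>)
  then show "intertwines Q (map (hcomp_components M Q \<zeta> \<theta>) ?as) (hcomp_components M Q \<zeta> \<theta> ?b)
      (fsym (ps_comp M Q ?F' ?F) \<sigma> f) (fsym (ps_comp M Q ?G' ?G) \<sigma> f)"
    using as f \<sigma> by (simp add: hcomp_components_def map_restrict fsym_ps_comp)
qed

section \<open>The 2-categories\<close>

lemma trans_vcomp_simps [simp]:
  "tdom (trans_vcomp M N \<zeta> \<theta>) = tdom \<theta>" "tcod (trans_vcomp M N \<zeta> \<theta>) = tcod \<zeta>"
  "tcomp (trans_vcomp M N \<zeta> \<theta>) = (\<lambda>a\<in>Ob M. gamma1 N (tcomp \<zeta> a) [tcomp \<theta> a])"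
  by (simp_all add: trans_vcomp_def)

lemma trans_id_simps [simp]:
  "tdom (trans_id M N F) = F" "tcod (trans_id M N F) = F"
  "tcomp (trans_id M N F) = (\<lambda>a\<in>Ob M. unit1 N (fob F a))"
  by (simp_all add: trans_id_def)

lemma trans_eqI:
  fixes \<theta> \<zeta> :: "('f, 'o, 'n) mtrans"
  assumes "tdom \<theta> = tdom \<zeta>" "tcod \<theta> = tcod \<zeta>" "tcomp \<theta> \<in> extensional A" "tcomp \<zeta> \<in> extensional A"
    "\<And>a. a \<in> A \<Longrightarrow> tcomp \<theta> a = tcomp \<zeta> a"
  shows "\<theta> = \<zeta>"
  using assms extensionalityI[of "tcomp \<theta>" A "tcomp \<zeta>"] by (simp add: mtrans.equality)

text \<open>P is the kind of multifunctor and R the extra condition on components. With R always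
  true this gives the hom categories of symmetric multifunctors, with \<open>respects_fsym\<close>
  those of pseudo symmetric ones.\<close>

lemma trans_category:
  fixes P :: "('o, 'm, 'c, 'p, 'n, 'd, 'z) mfun_scheme \<Rightarrow> bool"
  assumes M: "cat_multicategory M" and N: "cat_multicategory N"
    and P: "\<And>F. P F \<Longrightarrow> nonsym_multifunctor M N F"
    and R_id: "\<And>F. P F \<Longrightarrow> R F F (\<lambda>a\<in>Ob M. unit1 N (fob F a))"
    and R_vcomp: "\<And>F G H \<theta> \<zeta>. P F \<Longrightarrow> P G \<Longrightarrow> P H \<Longrightarrow> multinatural M N F G \<theta> \<Longrightarrow> multinatural M N G H \<zeta> \<Longrightarrow>
      R F G \<theta> \<Longrightarrow> R G H \<zeta> \<Longrightarrow> R F H (\<lambda>a\<in>Ob M. gamma1 N (\<zeta> a) [\<theta> a])"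
  shows "category \<lparr>Obj = {F. P F}, Arr = {\<theta>. P (tdom \<theta>) \<and> P (tcod \<theta>) \<and> multinatural M N (tdom \<theta>) (tcod \<theta>) (tcomp \<theta>) \<and>
      R (tdom \<theta>) (tcod \<theta>) (tcomp \<theta>)}, Dom = tdom, Cod = tcod, Idn = trans_id M N, Cmp = trans_vcomp M N\<rparr>"
proof -
  interpret N: cat_multicategory N by fact
  note c = multinatural.component_cell N.gamma1_unary_cell
  show ?thesis
  proof (unfold_locales, goal_cases)
    case (9 r s t)
    show ?case
      by (rule trans_eqI[where A = "Ob M"])
        (use 9 in \<open>auto simp: c intro!: N.gamma1_assoc_unary\<close>)
  next
    case (10 t)
    have "gamma1 N (unit1 N (fob (tcod t) a)) [tcomp t a] = tcomp t a" if "a \<in> Ob M" for a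
      using N.gamma1_unit_left[of "tcomp t a"] 10 that by (auto simp: c)
    then show ?case
      using 10 by (intro trans_eqI[where A = "Ob M"]) (auto simp: multinatural.comp_ext)
  next
    case (11 t)
    have "gamma1 N (tcomp t a) [unit1 N (fob (tdom t) a)] = tcomp t a" if "a \<in> Ob M" for a
      using N.gamma1_unit_right[of "tcomp t a"] 11 that by (auto simp: c)
    then show ?case
      using 11 by (intro trans_eqI[where A = "Ob M"]) (auto simp: multinatural.comp_ext)
  qed (auto simp: P R_id R_vcomp multinatural_id intro: multinatural_vcomp[OF P P P])
qed

lemma category_sym_hom:
  assumes "cat_multicategory M" "cat_multicategory N"
  shows "category (sym_hom M N)"
  using trans_category[OF assms, of "sym_multifunctor M N" "\<lambda>_ _ _. True"]
  by (simp add: sym_hom_def sym_multinatural_def sym_multifunctor_nonsym)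

lemma category_ps_hom:
  assumes "cat_multicategory M" "cat_multicategory N"
  shows "category (ps_hom M N)"
  unfolding ps_hom_def ps_multinatural_iff
  by (rule trans_category[OF assms]) (assumption | rule ps_multifunctor_nonsym respects_fsym_id respects_fsym_vcomp)+

text \<open>What both kinds of transformation have in common. It suffices for all laws of horizontal
  composition, since these are equations between component 1-cells.\<close>

definition transformation :: "('o, 'm, 'c) multicat \<Rightarrow> ('p, 'n, 'd) multicat \<Rightarrow>
    (('o, 'm, 'c, 'p, 'n, 'd, 'z) mfun_scheme, 'o, 'n) mtrans \<Rightarrow> bool" where
  "transformation M N \<theta> \<longleftrightarrow> nonsym_multifunctor M N (tdom \<theta>) \<and> nonsym_multifunctor M N (tcod \<theta>) \<and>
     multinatural M N (tdom \<theta>) (tcod \<theta>) (tcomp \<theta>)"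

lemma sym_multinatural_transformation: "sym_multinatural M N \<theta> \<Longrightarrow> transformation M N \<theta>"
  by (simp add: sym_multinatural_def transformation_def sym_multifunctor_nonsym)

lemma ps_multinatural_transformation: "ps_multinatural M N \<theta> \<Longrightarrow> transformation M N \<theta>"
  by (simp add: ps_multinatural_def transformation_def ps_multifunctor_nonsym)

lemma transformation_cell:
  assumes "transformation M N \<theta>" "a \<in> Ob M"
  shows "tcomp \<theta> a \<in> Cell1 N" "src N (tcomp \<theta> a) = [fob (tdom \<theta>) a]" "tgt N (tcomp \<theta> a) = fob (tcod \<theta>) a"
    "fob (tdom \<theta>) a \<in> Ob N" "fob (tcod \<theta>) a \<in> Ob N"
  using assms
  by (auto simp: transformation_def multinatural.component_cell nonsym_multifunctor.fob_Ob)

lemma hcomp_id: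
  assumes F: "nonsym_multifunctor M N F" and G: "nonsym_multifunctor N Q G" and a: "a \<in> Ob M"
  shows "hcomp_components M Q (trans_id N Q G) (trans_id M N F) a = unit1 Q (fob G (fob F a))"
proof -
  interpret F: nonsym_multifunctor M N F by fact
  interpret G: nonsym_multifunctor N Q G by fact
  show ?thesis
    using a G.N.gamma1_unit_left[of "unit1 Q (fob G (fob F a))"]
    by (simp add: hcomp_components_def F.fob_Ob G.fob_Ob G.map_unit1 G.N.unit1_cell)
qed

text \<open>After reassociation only the two inner factors stand in the wrong order; naturality of
  \<zeta> at the 1-cell \<open>tcomp \<theta>' a\<close> exchanges them.\<close>

lemma hcomp_vcomp:
  assumes \<theta>: "transformation M N \<theta>" and \<theta>': "transformation M N \<theta>'" and \<zeta>: "transformation N Q \<zeta>" and \<zeta>': "transformation N Q \<zeta>'"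
    and eq: "tdom \<theta>' = tcod \<theta>" "tdom \<zeta>' = tcod \<zeta>" and a: "a \<in> Ob M"
  shows "hcomp_components M Q (trans_vcomp N Q \<zeta>' \<zeta>) (trans_vcomp M N \<theta>' \<theta>) a
    = gamma1 Q (hcomp_components M Q \<zeta>' \<theta>' a) [hcomp_components M Q \<zeta> \<theta> a]"
proof -
  interpret F': nonsym_multifunctor N Q "tdom \<zeta>" using \<zeta> by (simp add: transformation_def)
  interpret G': nonsym_multifunctor N Q "tcod \<zeta>" using \<zeta> by (simp add: transformation_def)
  interpret \<zeta>: multinatural N Q "tdom \<zeta>" "tcod \<zeta>" "tcomp \<zeta>" using \<zeta> by (simp add: transformation_def)
  let ?Ha = "fob (tcod \<theta>') a" and ?Ga = "fob (tcod \<theta>) a"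
  note c = a eq transformation_cell[OF \<theta>] transformation_cell[OF \<theta>'] transformation_cell[OF \<zeta>] transformation_cell[OF \<zeta>']
    F'.fc1_cell G'.fc1_cell F'.N.gamma1_unary_cell F'.M.gamma1_unary_cell
  note assoc = F'.N.gamma1_assoc_unary
  have "gamma1 Q (fc1 (tcod \<zeta>) (tcomp \<theta>' a)) [tcomp \<zeta> ?Ga] = gamma1 Q (tcomp \<zeta> ?Ha) [fc1 (tdom \<zeta>) (tcomp \<theta>' a)]"
    using \<zeta>.natural1[of "tcomp \<theta>' a"] by (simp add: c)
  note nat = this
  have "gamma1 Q (gamma1 Q (tcomp \<zeta>' ?Ha) [fc1 (tcod \<zeta>) (tcomp \<theta>' a)]) [gamma1 Q (tcomp \<zeta> ?Ga) [fc1 (tdom \<zeta>) (tcomp \<theta> a)]]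
    = gamma1 Q (tcomp \<zeta>' ?Ha) [gamma1 Q (gamma1 Q (fc1 (tcod \<zeta>) (tcomp \<theta>' a)) [tcomp \<zeta> ?Ga]) [fc1 (tdom \<zeta>) (tcomp \<theta> a)]]"
    by (simp add: c assoc)
  also have "\<dots> = gamma1 Q (gamma1 Q (tcomp \<zeta>' ?Ha) [tcomp \<zeta> ?Ha])
      [gamma1 Q (fc1 (tdom \<zeta>) (tcomp \<theta>' a)) [fc1 (tdom \<zeta>) (tcomp \<theta> a)]]"
    unfolding nat by (simp add: c assoc)
  also have "gamma1 Q (fc1 (tdom \<zeta>) (tcomp \<theta>' a)) [fc1 (tdom \<zeta>) (tcomp \<theta> a)] = fc1 (tdom \<zeta>) (gamma1 N (tcomp \<theta>' a) [tcomp \<theta> a])"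
    using F'.map_gamma1[of "tcomp \<theta>' a" "[tcomp \<theta> a]"] by (simp add: composable1_def c)
  finally show ?thesis
    using a by (simp add: hcomp_components_def c)
qed

text \<open>\<open>hcomp_components\<close> reads the target of the inner and the source of the
  outer transformation, so these are the only ends of the composites \<open>sr\<close> and
  \<open>ts\<close> that have to be known. The claim is preservation of \<gamma> by
  \<open>tdom t\<close> and associativity.\<close>

lemma hcomp_assoc:
  assumes r: "transformation W X r" and s: "transformation X Y s" and t: "transformation Y Z t"
    and sr: "is_comp W (tcod sr) (tcod s) (tcod r)" "tcomp sr = hcomp_components W Y s r"
    and ts: "is_comp X (tdom ts) (tdom t) (tdom s)" "tcomp ts = hcomp_components X Z t s"
    and a: "a \<in> Ob W"
  shows "hcomp_components W Z ts r a = hcomp_components W Z t sr a"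
proof -
  interpret S: nonsym_multifunctor X Y "tdom s" using s by (simp add: transformation_def)
  interpret T: nonsym_multifunctor Y Z "tdom t" using t by (simp add: transformation_def)
  note c = a transformation_cell[OF r] transformation_cell[OF s] transformation_cell[OF t]
    is_comp_simps[OF sr(1)] is_comp_simps[OF ts(1)] S.fc1_cell T.fc1_cell
  have "fc1 (tdom t) (gamma1 Y (tcomp s (fob (tcod r) a)) [fc1 (tdom s) (tcomp r a)])
    = gamma1 Z (fc1 (tdom t) (tcomp s (fob (tcod r) a))) [fc1 (tdom t) (fc1 (tdom s) (tcomp r a))]"
    using T.map_gamma1[of "tcomp s (fob (tcod r) a)" "[fc1 (tdom s) (tcomp r a)]"] by (simp add: composable1_def c)
  then show ?thesis
    by (simp add: hcomp_components_def sr(2) ts(2) c T.N.gamma1_assoc_unary)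
qed

lemma hcomp_unit_left:
  assumes t: "transformation M N t" and I: "fob I = (\<lambda>a\<in>Ob N. a)" "fc1 I = (\<lambda>f\<in>Cell1 N. f)" and a: "a \<in> Ob M"
  shows "hcomp_components M N (trans_id N N I) t a = tcomp t a"
proof -
  interpret T: nonsym_multifunctor M N "tdom t" using t by (simp add: transformation_def)
  show ?thesis
    using a T.N.gamma1_unit_left[of "tcomp t a"] transformation_cell[OF t a] by (simp add: hcomp_components_def I)
qed

lemma hcomp_unit_right:
  assumes t: "transformation M N t" and I: "fob I = (\<lambda>a\<in>Ob M. a)" and a: "a \<in> Ob M"
  shows "hcomp_components M N t (trans_id M M I) a = tcomp t a"
proof -
  interpret T: nonsym_multifunctor M N "tdom t" using t by (simp add: transformation_def)
  show ?thesis
    using a T.N.gamma1_unit_right[of "tcomp t a"] transformation_cell[OF t a]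
    by (simp add: hcomp_components_def I T.map_unit1)
qed

section \<open>Associativity and units for multifunctors\<close>

lemma (in nonsym_multifunctor) funcsets:
  "fob F \<in> Ob M \<rightarrow> Ob N" "fc1 F \<in> Cell1 M \<rightarrow> Cell1 N" "fc2 F \<in> Cell2 M \<rightarrow> Cell2 N" "fob F \<in> extensional (Ob M)"
  using fob_ext by (auto simp: fc1_cell fc2_cell PiE_def)

lemma sym_comp_assoc:
  assumes "sym_multifunctor M N F"
  shows "sym_comp M (sym_comp N H G) F = sym_comp M H (sym_comp M G F)"
proof -
  interpret sym_multifunctor M N F by fact
  show ?thesis
    by (simp add: sym_comp_def compose_assoc[OF funcsets(1), symmetric] compose_assoc[OF funcsets(2), symmetric]
        compose_assoc[OF funcsets(3), symmetric])
qed

lemma sym_comp_id: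
  assumes "sym_multifunctor M N F"
  shows "sym_comp M (sym_id N) F = F" "sym_comp M F (sym_id M) = F"
proof -
  interpret sym_multifunctor M N F by fact
  show "sym_comp M (sym_id N) F = F" "sym_comp M F (sym_id M) = F"
    by (simp_all add: sym_comp_def sym_id_def Id_compose[OF funcsets(1,4)] Id_compose[OF funcsets(2) fc1_ext]
        Id_compose[OF funcsets(3) fc2_ext] compose_Id[OF funcsets(1,4)] compose_Id[OF funcsets(2) fc1_ext]
        compose_Id[OF funcsets(3) fc2_ext])
qed

lemma psfun_eqI:
  assumes "fob F = fob G" "fc1 F = fc1 G" "fc2 F = fc2 G"
    "\<And>\<sigma> f. f \<in> Cell1 M \<Longrightarrow> \<sigma> permutes {..<arity M f} \<Longrightarrow> fsym F \<sigma> f = fsym G \<sigma> f"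
    "\<And>\<sigma> f. \<not> (f \<in> Cell1 M \<and> \<sigma> permutes {..<arity M f}) \<Longrightarrow> fsym F \<sigma> f = undefined"
    "\<And>\<sigma> f. \<not> (f \<in> Cell1 M \<and> \<sigma> permutes {..<arity M f}) \<Longrightarrow> fsym G \<sigma> f = undefined"
  shows "(F :: ('o, 'm, 'c, 'p, 'n, 'd) psfun) = G"
proof -
  have "fsym F = fsym G" using assms(4-6) by (intro ext) metis
  with assms(1-3) show ?thesis by simp
qed

lemma ps_comp_fsym_undefined: "\<not> (f \<in> Cell1 M \<and> \<sigma> permutes {..<arity M f}) \<Longrightarrow> fsym (ps_comp M Q G F) \<sigma> f = undefined"
  by (auto simp: ps_comp_def)

lemma ps_comp_simps:
  "fob (ps_comp M Q G F) = compose (Ob M) (fob G) (fob F)"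
  "fc1 (ps_comp M Q G F) = compose (Cell1 M) (fc1 G) (fc1 F)"
  "fc2 (ps_comp M Q G F) = compose (Cell2 M) (fc2 G) (fc2 F)"
  by (simp_all add: ps_comp_def)

lemma ps_comp_assoc:
  assumes F: "ps_multifunctor M N F" and G: "ps_multifunctor N Q G" and H: "ps_multifunctor Q R H"
  shows "ps_comp M R (ps_comp N R H G) F = ps_comp M R H (ps_comp M Q G F)"
proof -
  interpret F: ps_multifunctor M N F by fact
  interpret G: ps_multifunctor N Q G by fact
  interpret H: ps_multifunctor Q R H by fact
  note cs = F.fsym_cell G.fsym_cell H.fsym_cell F.fc1_cell G.fc1_cell H.fc1_cell F.fc2_cell G.fc2_cell H.fc2_cell
    F.M.act1_cell F.N.act1_cell G.N.act1_cell
  show ?thesis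
  proof (rule psfun_eqI[where M = M])
    fix \<sigma> f assume "f \<in> Cell1 M" "\<sigma> permutes {..<arity M f}"
    then show "fsym (ps_comp M R (ps_comp N R H G) F) \<sigma> f = fsym (ps_comp M R H (ps_comp M Q G F)) \<sigma> f"
      by (simp add: fsym_ps_comp is_comp_simps[OF is_comp_ps_comp] cs H.fc2_vcomp H.N.vcomp_assoc)
  qed (simp_all add: ps_comp_simps ps_comp_fsym_undefined compose_assoc[OF F.funcsets(1), symmetric]
      compose_assoc[OF F.funcsets(2), symmetric] compose_assoc[OF F.funcsets(3), symmetric])
qed

lemma ps_id_simps:
  "fob (ps_id M) = (\<lambda>a\<in>Ob M. a)" "fc1 (ps_id M) = (\<lambda>f\<in>Cell1 M. f)" "fc2 (ps_id M) = (\<lambda>\<alpha>\<in>Cell2 M. \<alpha>)"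
  by (simp_all add: ps_id_def sym_id_def)

lemma ps_comp_id:
  assumes "ps_multifunctor M N F"
  shows "ps_comp M N (ps_id N) F = F" "ps_comp M N F (ps_id M) = F"
proof -
  interpret ps_multifunctor M N F by fact
  note ids = Id_compose[OF funcsets(1,4)] Id_compose[OF funcsets(2) fc1_ext]
    Id_compose[OF funcsets(3) fc2_ext] compose_Id[OF funcsets(1,4)] compose_Id[OF funcsets(2) fc1_ext]
    compose_Id[OF funcsets(3) fc2_ext]
  show "ps_comp M N (ps_id N) F = F"
  proof (rule psfun_eqI[where M = M])
    fix \<sigma> f assume f: "f \<in> Cell1 M" "\<sigma> permutes {..<arity M f}"
    then show "fsym (ps_comp M N (ps_id N) F) \<sigma> f = fsym F \<sigma> f"
      using N.vcomp_id2[of "fsym F \<sigma> f"]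
      by (simp add: fsym_ps_comp ps_id_def fsym_sym_to_ps sym_id_def fc1_cell fsym_cell N.act1_cell)
  qed (simp_all add: ps_comp_simps ps_id_simps ids ps_comp_fsym_undefined fsym_ext)
  show "ps_comp M N F (ps_id M) = F"
  proof (rule psfun_eqI[where M = M])
    fix \<sigma> f assume f: "f \<in> Cell1 M" "\<sigma> permutes {..<arity M f}"
    then show "fsym (ps_comp M N F (ps_id M)) \<sigma> f = fsym F \<sigma> f"
      using N.vcomp_id2[of "fsym F \<sigma> f"]
      by (simp add: fsym_ps_comp ps_id_def fsym_sym_to_ps sym_id_def fc1_cell fsym_cell M.cell_simps fc2_id2)
  qed (simp_all add: ps_comp_simps ps_id_simps ids ps_comp_fsym_undefined fsym_ext)
qed


lemma sym_hom_simps [simp]: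
  "Obj (sym_hom M N) = {F. sym_multifunctor M N F}" "Arr (sym_hom M N) = {\<theta>. sym_multinatural M N \<theta>}"
  "Dom (sym_hom M N) = tdom" "Cod (sym_hom M N) = tcod" "Idn (sym_hom M N) = trans_id M N"
  "Cmp (sym_hom M N) = trans_vcomp M N"
  by (simp_all add: sym_hom_def)

lemma ps_hom_simps [simp]:
  "Obj (ps_hom M N) = {F. ps_multifunctor M N F}" "Arr (ps_hom M N) = {\<theta>. ps_multinatural M N \<theta>}"
  "Dom (ps_hom M N) = tdom" "Cod (ps_hom M N) = tcod" "Idn (ps_hom M N) = trans_id M N"
  "Cmp (ps_hom M N) = trans_vcomp M N"
  by (simp_all add: ps_hom_def)

lemma hcomp_components_extensional [simp]: "hcomp_components M Q \<zeta> \<theta> \<in> extensional (Ob M)"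
  by (simp add: hcomp_components_def)

text \<open>The horizontal composition of \<open>Cat_Multicat\<close> with independent types for the
  three multicategories. The 2-category has one type for all of them, while M and its product with
  \<open>ES\<close> have different ones.\<close>

definition sym_hcomp :: "('o, 'm, 'c) multicat \<Rightarrow> ('q, 'k, 'e) multicat \<Rightarrow>
    (('p, 'n, 'd, 'q, 'k, 'e) mfun, 'p, 'k) mtrans \<Rightarrow> (('o, 'm, 'c, 'p, 'n, 'd) mfun, 'o, 'n) mtrans \<Rightarrow>
    (('o, 'm, 'c, 'q, 'k, 'e) mfun, 'o, 'k) mtrans" where
  "sym_hcomp M Q \<zeta> \<theta> = \<lparr>tdom = sym_comp M (tdom \<zeta>) (tdom \<theta>),
     tcod = sym_comp M (tcod \<zeta>) (tcod \<theta>), tcomp = hcomp_components M Q \<zeta> \<theta>\<rparr>"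

definition ps_hcomp :: "('o, 'm, 'c) multicat \<Rightarrow> ('q, 'k, 'e) multicat \<Rightarrow>
    (('p, 'n, 'd, 'q, 'k, 'e) psfun, 'p, 'k) mtrans \<Rightarrow> (('o, 'm, 'c, 'p, 'n, 'd) psfun, 'o, 'n) mtrans \<Rightarrow>
    (('o, 'm, 'c, 'q, 'k, 'e) psfun, 'o, 'k) mtrans" where
  "ps_hcomp M Q \<zeta> \<theta> = \<lparr>tdom = ps_comp M Q (tdom \<zeta>) (tdom \<theta>),
     tcod = ps_comp M Q (tcod \<zeta>) (tcod \<theta>), tcomp = hcomp_components M Q \<zeta> \<theta>\<rparr>"

lemma sym_hcomp_simps [simp]:
  "tdom (sym_hcomp M Q \<zeta> \<theta>) = sym_comp M (tdom \<zeta>) (tdom \<theta>)"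
  "tcod (sym_hcomp M Q \<zeta> \<theta>) = sym_comp M (tcod \<zeta>) (tcod \<theta>)"
  "tcomp (sym_hcomp M Q \<zeta> \<theta>) = hcomp_components M Q \<zeta> \<theta>"
  by (simp_all add: sym_hcomp_def)

lemma ps_hcomp_simps [simp]:
  "tdom (ps_hcomp M Q \<zeta> \<theta>) = ps_comp M Q (tdom \<zeta>) (tdom \<theta>)"
  "tcod (ps_hcomp M Q \<zeta> \<theta>) = ps_comp M Q (tcod \<zeta>) (tcod \<theta>)"
  "tcomp (ps_hcomp M Q \<zeta> \<theta>) = hcomp_components M Q \<zeta> \<theta>"
  by (simp_all add: ps_hcomp_def)

lemma sym_multinatural_hcomp:
  assumes "sym_multinatural M N \<theta>" "sym_multinatural N Q \<zeta>"
  shows "sym_multinatural M Q (sym_hcomp M Q \<zeta> \<theta>)"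
  using assms
  by (auto simp: sym_multinatural_def intro!: sym_multifunctor_comp multinatural_hcomp is_comp_sym_comp
      sym_multifunctor_nonsym)

lemma ps_multinatural_hcomp:
  assumes "ps_multinatural M N \<theta>" "ps_multinatural N Q \<zeta>"
  shows "ps_multinatural M Q (ps_hcomp M Q \<zeta> \<theta>)"
  using assms respects_fsym_hcomp[OF assms]
  by (auto simp: ps_multinatural_iff intro!: ps_multifunctor_comp multinatural_hcomp is_comp_ps_comp
      ps_multifunctor_nonsym)

lemma sym_comp_functor:
  assumes "cat_multicategory M" "cat_multicategory N" "cat_multicategory Q"
  shows "cat_functor (prod_cat (sym_hom N Q) (sym_hom M N)) (sym_hom M Q)
    (\<lambda>(G, F). sym_comp M G F) (\<lambda>(\<zeta>, \<theta>). sym_hcomp M Q \<zeta> \<theta>)"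
proof (intro cat_functor.intro cat_functor_axioms.intro prod_category category_sym_hom assms, goal_cases)
  case (5 x)
  obtain G F where [simp]: "x = (G, F)" by fastforce
  show ?case
    using 5
    by (auto intro!: trans_eqI[where A = "Ob M"]
        simp: hcomp_id[OF sym_multifunctor_nonsym sym_multifunctor_nonsym] is_comp_simps[OF is_comp_sym_comp])
next
  case (6 s t)
  obtain \<zeta>' \<theta>' \<zeta> \<theta> where [simp]: "s = (\<zeta>', \<theta>')" "t = (\<zeta>, \<theta>)" by fastforce
  show ?case
    using 6
    by (auto intro!: trans_eqI[where A = "Ob M"] simp: hcomp_vcomp[of M N _ _ Q] sym_multinatural_transformation)
qed (auto intro: sym_multifunctor_comp sym_multinatural_hcomp)

lemma ps_comp_functor:
  assumes "cat_multicategory M" "cat_multicategory N" "cat_multicategory Q"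
  shows "cat_functor (prod_cat (ps_hom N Q) (ps_hom M N)) (ps_hom M Q)
    (\<lambda>(G, F). ps_comp M Q G F) (\<lambda>(\<zeta>, \<theta>). ps_hcomp M Q \<zeta> \<theta>)"
proof (intro cat_functor.intro cat_functor_axioms.intro prod_category category_ps_hom assms, goal_cases)
  case (5 x)
  obtain G F where [simp]: "x = (G, F)" by fastforce
  show ?case
    using 5
    by (auto intro!: trans_eqI[where A = "Ob M"]
        simp: hcomp_id[OF ps_multifunctor_nonsym ps_multifunctor_nonsym] is_comp_simps[OF is_comp_ps_comp])
next
  case (6 s t)
  obtain \<zeta>' \<theta>' \<zeta> \<theta> where [simp]: "s = (\<zeta>', \<theta>')" "t = (\<zeta>, \<theta>)" by fastforce
  show ?case
    using 6
    by (auto intro!: trans_eqI[where A = "Ob M"] simp: hcomp_vcomp[of M N _ _ Q] ps_multinatural_transformation)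
qed (auto intro: ps_multifunctor_comp ps_multinatural_hcomp)

lemma Cat_Multicat_simps [simp]:
  "Obj0 Cat_Multicat = {M. cat_multicategory M}" "Hom Cat_Multicat = sym_hom" "Unit1 Cat_Multicat = sym_id"
  "Comp1 Cat_Multicat = (\<lambda>M N Q G F. sym_comp M G F)" "Comp2 Cat_Multicat = (\<lambda>M N Q. sym_hcomp M Q)"
  by (simp_all add: Cat_Multicat_def sym_hcomp_def fun_eq_iff)

lemma Cat_Multicat_ps_simps [simp]:
  "Obj0 Cat_Multicat_ps = {M. cat_multicategory M}" "Hom Cat_Multicat_ps = ps_hom" "Unit1 Cat_Multicat_ps = ps_id"
  "Comp1 Cat_Multicat_ps = (\<lambda>M N Q G F. ps_comp M Q G F)" "Comp2 Cat_Multicat_ps = (\<lambda>M N Q. ps_hcomp M Q)"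
  by (simp_all add: Cat_Multicat_ps_def ps_hcomp_def fun_eq_iff)

lemma sym_id_simps:
  "fob (sym_id M) = (\<lambda>a\<in>Ob M. a)" "fc1 (sym_id M) = (\<lambda>f\<in>Cell1 M. f)"
  by (simp_all add: sym_id_def)

lemma sym_hcomp_assoc:
  assumes r: "sym_multinatural W X r" and s: "sym_multinatural X Y s" and t: "sym_multinatural Y Z t"
  shows "sym_hcomp W Z (sym_hcomp X Z t s) r = sym_hcomp W Z t (sym_hcomp W Y s r)"
  using assms hcomp_assoc[OF assms[THEN sym_multinatural_transformation], of "sym_hcomp W Y s r" "sym_hcomp X Z t s"]
  by (intro trans_eqI[where A = "Ob W"]) (auto simp: sym_comp_assoc sym_multinatural_def is_comp_sym_comp)

lemma ps_hcomp_assoc: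
  assumes r: "ps_multinatural W X r" and s: "ps_multinatural X Y s" and t: "ps_multinatural Y Z t"
  shows "ps_hcomp W Z (ps_hcomp X Z t s) r = ps_hcomp W Z t (ps_hcomp W Y s r)"
  using assms hcomp_assoc[OF assms[THEN ps_multinatural_transformation], of "ps_hcomp W Y s r" "ps_hcomp X Z t s"]
  by (intro trans_eqI[where A = "Ob W"]) (auto simp: ps_comp_assoc ps_multinatural_def is_comp_ps_comp)

lemma two_category_Cat_Multicat: "two_category Cat_Multicat"
proof (rule two_category.intro, goal_cases)
  \<comment> \<open>Cases 8 and 9 are the unit laws on 2-cells, where the components have to be
    compared object by object.\<close>
  case (8 x y t)
  then show ?case
    by (intro trans_eqI[where A = "Ob x"])
      (auto simp: sym_comp_id sym_multinatural_def transformation_def sym_multifunctor_nonsym multinatural.comp_ext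
        intro!: hcomp_unit_left sym_id_simps)
next
  case (9 x y t)
  then show ?case
    by (intro trans_eqI[where A = "Ob x"])
      (auto simp: sym_comp_id sym_multinatural_def transformation_def sym_multifunctor_nonsym multinatural.comp_ext
        intro!: hcomp_unit_right sym_id_simps)
qed (use sym_comp_functor in \<open>auto simp: category_sym_hom sym_multifunctor_id sym_comp_assoc sym_hcomp_assoc sym_comp_id\<close>)

lemma two_category_Cat_Multicat_ps: "two_category Cat_Multicat_ps"
proof (rule two_category.intro, goal_cases)
  case (8 x y t)
  then show ?case
    by (intro trans_eqI[where A = "Ob x"])
      (auto simp: ps_comp_id ps_multinatural_def transformation_def ps_multifunctor_nonsym multinatural.comp_ext
        intro!: hcomp_unit_left ps_id_simps)
next
  case (9 x y t)
  then show ?case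
    by (intro trans_eqI[where A = "Ob x"])
      (auto simp: ps_comp_id ps_multinatural_def transformation_def ps_multifunctor_nonsym multinatural.comp_ext
        intro!: hcomp_unit_right ps_id_simps)
qed (use ps_comp_functor in \<open>auto simp: category_ps_hom ps_id_def ps_multifunctor_sym_to_ps sym_multifunctor_id
    ps_comp_assoc ps_hcomp_assoc ps_comp_id[unfolded ps_id_def]\<close>)

section \<open>The inclusion 2-functor\<close>

definition sym_to_ps_trans :: "('o, 'm, 'c) multicat \<Rightarrow> ('p, 'n, 'd) multicat \<Rightarrow>
    (('o, 'm, 'c, 'p, 'n, 'd) mfun, 'o, 'n) mtrans \<Rightarrow> (('o, 'm, 'c, 'p, 'n, 'd) psfun, 'o, 'n) mtrans" where
  "sym_to_ps_trans M N \<theta> = \<lparr>tdom = sym_to_ps M N (tdom \<theta>), tcod = sym_to_ps M N (tcod \<theta>), tcomp = tcomp \<theta>\<rparr>"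

lemma sym_to_ps_trans_simps [simp]:
  "tdom (sym_to_ps_trans M N \<theta>) = sym_to_ps M N (tdom \<theta>)" "tcod (sym_to_ps_trans M N \<theta>) = sym_to_ps M N (tcod \<theta>)"
  "tcomp (sym_to_ps_trans M N \<theta>) = tcomp \<theta>"
  by (simp_all add: sym_to_ps_trans_def)

lemma multinatural_sym_to_ps:
  "multinatural M N (sym_to_ps M N F) (sym_to_ps M N G) \<theta> \<longleftrightarrow> multinatural M N F G \<theta>"
  by (simp add: multinatural_def)

text \<open>The structure isomorphisms are images of identities, so the extra condition at f and
  \<sigma> is naturality at the identity 2-cell of \<open>act1 M f \<sigma>\<close>.\<close>

lemma ps_multinatural_sym_to_ps:
  assumes "sym_multinatural M N \<theta>"
  shows "ps_multinatural M N (sym_to_ps_trans M N \<theta>)"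
proof -
  interpret F: sym_multifunctor M N "tdom \<theta>" using assms by (simp add: sym_multinatural_def)
  interpret G: sym_multifunctor M N "tcod \<theta>" using assms by (simp add: sym_multinatural_def)
  have \<theta>: "multinatural M N (tdom \<theta>) (tcod \<theta>) (tcomp \<theta>)" using assms by (simp add: sym_multinatural_def)
  have "respects_fsym M N (sym_to_ps M N (tdom \<theta>)) (sym_to_ps M N (tcod \<theta>)) (tcomp \<theta>)"
    unfolding respects_fsym_def
  proof (intro ballI allI impI)
    fix f \<sigma> assume "f \<in> Cell1 M" "\<sigma> permutes {..<arity M f}"
    then show "intertwines N (map (tcomp \<theta>) (permute_list \<sigma> (src M f))) (tcomp \<theta> (tgt M f))
        (fsym (sym_to_ps M N (tdom \<theta>)) \<sigma> f) (fsym (sym_to_ps M N (tcod \<theta>)) \<sigma> f)"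
      using multinatural_intertwines[OF F.nonsym_multifunctor_axioms G.nonsym_multifunctor_axioms \<theta>, of "id2 M (act1 M f \<sigma>)"]
      by (simp add: fsym_sym_to_ps F.M.cell_simps F.fc2_id2 G.fc2_id2)
  qed
  then show ?thesis
    using \<theta> F.sym_multifunctor_axioms G.sym_multifunctor_axioms
    by (simp add: ps_multinatural_iff multinatural_sym_to_ps ps_multifunctor_sym_to_ps)
qed

lemma sym_to_ps_functor:
  assumes "cat_multicategory M" "cat_multicategory N"
  shows "cat_functor (sym_hom M N) (ps_hom M N) (sym_to_ps M N) (sym_to_ps_trans M N)"
  by (intro cat_functor.intro cat_functor_axioms.intro category_sym_hom category_ps_hom assms)
    (auto simp: ps_multifunctor_sym_to_ps ps_multinatural_sym_to_ps intro!: trans_eqI[where A = "Ob M"])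

lemma sym_to_ps_comp:
  assumes "sym_multifunctor M N F" "sym_multifunctor N Q G"
  shows "sym_to_ps M Q (sym_comp M G F) = ps_comp M Q (sym_to_ps N Q G) (sym_to_ps M N F)"
proof (rule psfun_eqI[where M = M])
  interpret F: sym_multifunctor M N F by fact
  interpret G: sym_multifunctor N Q G by fact
  fix \<sigma> f assume "f \<in> Cell1 M" "\<sigma> permutes {..<arity M f}"
  then show "fsym (sym_to_ps M Q (sym_comp M G F)) \<sigma> f = fsym (ps_comp M Q (sym_to_ps N Q G) (sym_to_ps M N F)) \<sigma> f"
    by (simp add: fsym_sym_to_ps fsym_ps_comp is_comp_simps[OF is_comp_sym_comp] F.fc1_cell F.M.act1_cell
        G.fc2_id2 F.map_act1 F.N.act1_cell G.fc1_cell G.N.vcomp_id2_id2 G.N.act1_cell G.map_act1)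
qed (auto simp: ps_comp_simps sym_comp_def ps_comp_fsym_undefined sym_to_ps_def)

lemma hcomp_components_cong:
  assumes "tcomp \<zeta> = tcomp \<zeta>'" "fc1 (tdom \<zeta>) = fc1 (tdom \<zeta>')" "tcomp \<theta> = tcomp \<theta>'" "fob (tcod \<theta>) = fob (tcod \<theta>')"
  shows "hcomp_components M Q \<zeta> \<theta> = hcomp_components M Q \<zeta>' \<theta>'"
  using assms by (simp add: hcomp_components_def)

lemma sym_to_ps_hcomp:
  assumes "sym_multinatural M N \<theta>" "sym_multinatural N Q \<zeta>"
  shows "sym_to_ps_trans M Q (sym_hcomp M Q \<zeta> \<theta>) = ps_hcomp M Q (sym_to_ps_trans N Q \<zeta>) (sym_to_ps_trans M N \<theta>)"
  using assms
  by (intro trans_eqI[where A = "Ob M"])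
    (auto simp: sym_to_ps_comp[of M N _ Q] sym_multinatural_def intro!: fun_cong[OF hcomp_components_cong])

lemma inclusion_j_simps [simp]:
  "on0 inclusion_j = (\<lambda>M. M)" "on1 inclusion_j = sym_to_ps" "on2 inclusion_j = sym_to_ps_trans"
  by (simp_all add: inclusion_j_def sym_to_ps_trans_def fun_eq_iff)

lemma two_functor_inclusion_j: "two_functor Cat_Multicat Cat_Multicat_ps inclusion_j"
  by (intro two_functor.intro two_functor_axioms.intro two_category_Cat_Multicat two_category_Cat_Multicat_ps)
    (auto simp: sym_to_ps_functor ps_id_def sym_to_ps_comp sym_to_ps_hcomp)

section \<open>Adjunctions from universal arrows\<close>

lemma cat_functor_comp:
  assumes "cat_functor C D F F'" "cat_functor D E G G'"
  shows "cat_functor C E (\<lambda>x. G (F x)) (\<lambda>t. G' (F' t))"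
proof -
  interpret F: cat_functor C D F F' by fact
  interpret G: cat_functor D E G G' by fact
  show ?thesis
    by unfold_locales
      (simp_all add: F.map_Obj F.map_Arr F.map_Dom F.map_Cod F.map_Idn F.map_Cmp
        G.map_Obj G.map_Arr G.map_Dom G.map_Cod G.map_Idn G.map_Cmp)
qed

text \<open>Whiskering: the second variable is frozen at b and at its identity. Functoriality in the
  first variable uses that this identity composed with itself is itself.\<close>

lemma cat_functor_fix_right:
  assumes "cat_functor (prod_cat A B) C (\<lambda>(a, b). F a b) (\<lambda>(s, t). F' s t)" "category A" "category B" and b: "b \<in> Obj B"
  shows "cat_functor A C (\<lambda>a. F a b) (\<lambda>s. F' s (Idn B b))"
proof -
  interpret F: cat_functor "prod_cat A B" C "\<lambda>(a, b). F a b" "\<lambda>(s, t). F' s t" by fact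
  interpret A: category A by fact
  interpret B: category B by fact
  have "Cmp B (Idn B b) (Idn B b) = Idn B b" using B.Cmp_Idn_left[OF B.Idn_Arr[OF b]] b by (simp add: B.Cod_Idn)
  then show ?thesis
    using F.map_Obj[of "(_, b)"] F.map_Arr[of "(_, Idn B b)"] F.map_Dom[of "(_, Idn B b)"] F.map_Cod[of "(_, Idn B b)"]
      F.map_Idn[of "(_, b)"] F.map_Cmp[of "(_, Idn B b)" "(_, Idn B b)"] b
    by unfold_locales (simp_all add: B.Idn_Arr B.Dom_Idn B.Cod_Idn)
qed

lemma cat_functor_fix_left:
  assumes "cat_functor (prod_cat A B) C (\<lambda>(a, b). F a b) (\<lambda>(s, t). F' s t)" "category A" "category B" and a: "a \<in> Obj A"
  shows "cat_functor B C (\<lambda>b. F a b) (\<lambda>t. F' (Idn A a) t)"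
proof -
  interpret F: cat_functor "prod_cat A B" C "\<lambda>(a, b). F a b" "\<lambda>(s, t). F' s t" by fact
  interpret A: category A by fact
  interpret B: category B by fact
  have "Cmp A (Idn A a) (Idn A a) = Idn A a" using A.Cmp_Idn_left[OF A.Idn_Arr[OF a]] a by (simp add: A.Cod_Idn)
  then show ?thesis
    using F.map_Obj[of "(a, _)"] F.map_Arr[of "(Idn A a, _)"] F.map_Dom[of "(Idn A a, _)"] F.map_Cod[of "(Idn A a, _)"]
      F.map_Idn[of "(a, _)"] F.map_Cmp[of "(Idn A a, _)" "(Idn A a, _)"] a
    by unfold_locales (simp_all add: A.Idn_Arr A.Dom_Idn A.Cod_Idn)
qed

lemma cat_isomorphism_bij:
  assumes "cat_isomorphism C D F F'"
  shows "bij_betw F (Obj C) (Obj D)" "bij_betw F' (Arr C) (Arr D)"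
proof -
  obtain G G' where F: "cat_functor C D F F'" and G: "cat_functor D C G G'"
    and inv: "\<forall>x\<in>Obj C. G (F x) = x" "\<forall>t\<in>Arr C. G' (F' t) = t" "\<forall>u\<in>Obj D. F (G u) = u" "\<forall>v\<in>Arr D. F' (G' v) = v"
    using assms by (auto simp: cat_isomorphism_def)
  show "bij_betw F (Obj C) (Obj D)"
    using inv cat_functor.map_Obj[OF F] cat_functor.map_Obj[OF G] by (intro bij_betw_byWitness[where f' = G]) auto
  show "bij_betw F' (Arr C) (Arr D)"
    using inv cat_functor.map_Arr[OF F] cat_functor.map_Arr[OF G] by (intro bij_betw_byWitness[where f' = G']) auto
qed

text \<open>Each law for the inverse is verified by applying F and cancelling it by
  injectivity.\<close>

lemma cat_functor_inv:
  assumes F: "cat_functor C D F F'" and bij: "bij_betw F (Obj C) (Obj D)" "bij_betw F' (Arr C) (Arr D)"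
  shows "cat_functor D C (inv_into (Obj C) F) (inv_into (Arr C) F')"
proof -
  interpret cat_functor C D F F' by fact
  note inj = bij_betw_imp_inj_on[OF bij(1)] bij_betw_imp_inj_on[OF bij(2)]
  let ?G = "inv_into (Obj C) F" and ?G' = "inv_into (Arr C) F'"
  have G: "?G u \<in> Obj C" "F (?G u) = u" if "u \<in> Obj D" for u
    using that bij_betw_imp_surj_on[OF bij(1)] by (auto simp: inv_into_into f_inv_into_f)
  have G': "?G' v \<in> Arr C" "F' (?G' v) = v" if "v \<in> Arr D" for v
    using that bij_betw_imp_surj_on[OF bij(2)] by (auto simp: inv_into_into f_inv_into_f)
  show ?thesis
  proof unfold_locales
    fix v assume v: "v \<in> Arr D"
    show "Dom C (?G' v) = ?G (Dom D v)"
      using map_Dom[OF G'(1)[OF v]] G'[OF v] C.Dom_Obj[OF G'(1)[OF v]]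
      by (intro inv_into_f_eq[symmetric] inj) simp_all
    show "Cod C (?G' v) = ?G (Cod D v)"
      using map_Cod[OF G'(1)[OF v]] G'[OF v] C.Cod_Obj[OF G'(1)[OF v]]
      by (intro inv_into_f_eq[symmetric] inj) simp_all
  next
    fix u assume u: "u \<in> Obj D"
    show "?G' (Idn D u) = Idn C (?G u)"
      using G[OF u] map_Idn C.Idn_Arr by (intro inv_into_f_eq inj) simp_all
  next
    fix v w assume v: "v \<in> Arr D" and w: "w \<in> Arr D" and eq: "Dom D v = Cod D w"
    \<comment> \<open>A composable pair in D must come from a composable pair in C before
      \<open>map_Cmp\<close> can be applied; injectivity on objects ensures it.\<close>
    have "F (Dom C (?G' v)) = F (Cod C (?G' w))"
      using map_Dom[OF G'(1)[OF v]] map_Cod[OF G'(1)[OF w]] G'[OF v] G'[OF w] eq by simp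
    then have "Dom C (?G' v) = Cod C (?G' w)"
      using inj(1) C.Dom_Obj[OF G'(1)[OF v]] C.Cod_Obj[OF G'(1)[OF w]] by (auto dest: inj_onD)
    then show "?G' (Cmp D v w) = Cmp C (?G' v) (?G' w)"
      using G'[OF v] G'[OF w] map_Cmp C.Cmp_Arr by (intro inv_into_f_eq inj) simp_all
  qed (simp_all add: G G')
qed

lemma cat_isomorphismI:
  assumes F: "cat_functor C D F F'" and bij: "bij_betw F (Obj C) (Obj D)" "bij_betw F' (Arr C) (Arr D)"
  shows "cat_isomorphism C D F F'"
  unfolding cat_isomorphism_def
  using F cat_functor_inv[OF assms] bij_betw_inv_into_left[OF bij(1)] bij_betw_inv_into_right[OF bij(1)]
    bij_betw_inv_into_left[OF bij(2)] bij_betw_inv_into_right[OF bij(2)]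
  by blast

text \<open>Universality is strict, an isomorphism of hom categories and not an equivalence. The
  object values \<open>L0\<close> are prescribed and not chosen, so that the adjoint takes exactly
  these values.\<close>

locale universal_arrows = R: two_functor D C R
  for C :: "('a, 'f, 't) two_cat" and D :: "('b, 'g, 's) two_cat" and R :: "('b, 'g, 's, 'a, 'f, 't) two_fun" +
  fixes L0 :: "'a \<Rightarrow> 'b" and \<eta> :: "'a \<Rightarrow> 'f"
  assumes L0: "x \<in> Obj0 C \<Longrightarrow> L0 x \<in> Obj0 D"
    and \<eta>: "x \<in> Obj0 C \<Longrightarrow> \<eta> x \<in> Obj (Hom C x (on0 R (L0 x)))"
    and universal: "x \<in> Obj0 C \<Longrightarrow> y \<in> Obj0 D \<Longrightarrow> cat_isomorphism (Hom D (L0 x) y) (Hom C x (on0 R y))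
      (\<lambda>h. Comp1 C x (on0 R (L0 x)) (on0 R y) (on1 R (L0 x) y h) (\<eta> x))
      (\<lambda>t. Comp2 C x (on0 R (L0 x)) (on0 R y) (on2 R (L0 x) y t) (Idn (Hom C x (on0 R (L0 x))) (\<eta> x)))"
begin

abbreviation RL where "RL x \<equiv> on0 R (L0 x)"

abbreviation i\<eta> where "i\<eta> x \<equiv> Idn (Hom C x (RL x)) (\<eta> x)"

definition \<Phi> where "\<Phi> x y h = Comp1 C x (RL x) (on0 R y) (on1 R (L0 x) y h) (\<eta> x)"

definition \<Phi>' where "\<Phi>' x y t = Comp2 C x (RL x) (on0 R y) (on2 R (L0 x) y t) (i\<eta> x)"

text \<open>The value on u is the unique solution h of R(h) \<circ> \<eta> x = \<eta> x' \<circ> u,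
  which makes \<eta> natural; similarly on 2-cells, with the identity of \<eta>.\<close>

definition L :: "('a, 'f, 't, 'b, 'g, 's) two_fun" where
  "L = \<lparr>on0 = L0,
     on1 = (\<lambda>x x' u. inv_into (Obj (Hom D (L0 x) (L0 x'))) (\<Phi> x (L0 x')) (Comp1 C x x' (RL x') (\<eta> x') u)),
     on2 = (\<lambda>x x' t. inv_into (Arr (Hom D (L0 x) (L0 x'))) (\<Phi>' x (L0 x')) (Comp2 C x x' (RL x') (i\<eta> x') t))\<rparr>"

lemma L_on0 [simp]: "on0 L = L0"
  by (simp add: L_def)

lemma \<Phi>_iso: "x \<in> Obj0 C \<Longrightarrow> y \<in> Obj0 D \<Longrightarrow> cat_isomorphism (Hom D (L0 x) y) (Hom C x (on0 R y)) (\<Phi> x y) (\<Phi>' x y)"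
  using universal unfolding \<Phi>_def[abs_def] \<Phi>'_def[abs_def] .

lemmas \<Phi>_bij = cat_isomorphism_bij[OF \<Phi>_iso]

lemma i\<eta>: "x \<in> Obj0 C \<Longrightarrow> i\<eta> x \<in> Arr (Hom C x (RL x))"
  using category.Idn_Arr[OF R.D.Hom_category \<eta>] by (simp add: L0 R.on0_Obj)

lemma Comp1_Obj:
  "x \<in> Obj0 C \<Longrightarrow> y \<in> Obj0 C \<Longrightarrow> z \<in> Obj0 C \<Longrightarrow> g \<in> Obj (Hom C y z) \<Longrightarrow> f \<in> Obj (Hom C x y) \<Longrightarrow>
    Comp1 C x y z g f \<in> Obj (Hom C x z)"
  using cat_functor.map_Obj[OF R.D.Comp_functor, of x y z "(g, f)"] by simp

lemma Comp2_Arr: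
  "x \<in> Obj0 C \<Longrightarrow> y \<in> Obj0 C \<Longrightarrow> z \<in> Obj0 C \<Longrightarrow> s \<in> Arr (Hom C y z) \<Longrightarrow> t \<in> Arr (Hom C x y) \<Longrightarrow>
    Comp2 C x y z s t \<in> Arr (Hom C x z)"
  using cat_functor.map_Arr[OF R.D.Comp_functor, of x y z "(s, t)"] by simp

lemma Comp1_Obj_D:
  "x \<in> Obj0 D \<Longrightarrow> y \<in> Obj0 D \<Longrightarrow> z \<in> Obj0 D \<Longrightarrow> g \<in> Obj (Hom D y z) \<Longrightarrow> f \<in> Obj (Hom D x y) \<Longrightarrow>
    Comp1 D x y z g f \<in> Obj (Hom D x z)"
  using cat_functor.map_Obj[OF R.C.Comp_functor, of x y z "(g, f)"] by simp

lemma Comp2_Arr_D: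
  "x \<in> Obj0 D \<Longrightarrow> y \<in> Obj0 D \<Longrightarrow> z \<in> Obj0 D \<Longrightarrow> s \<in> Arr (Hom D y z) \<Longrightarrow> t \<in> Arr (Hom D x y) \<Longrightarrow>
    Comp2 D x y z s t \<in> Arr (Hom D x z)"
  using cat_functor.map_Arr[OF R.C.Comp_functor, of x y z "(s, t)"] by simp

lemma on1_Obj: "x \<in> Obj0 D \<Longrightarrow> y \<in> Obj0 D \<Longrightarrow> f \<in> Obj (Hom D x y) \<Longrightarrow> on1 R x y f \<in> Obj (Hom C (on0 R x) (on0 R y))"
  by (rule cat_functor.map_Obj[OF R.Hom_functor])

lemma on2_Arr: "x \<in> Obj0 D \<Longrightarrow> y \<in> Obj0 D \<Longrightarrow> t \<in> Arr (Hom D x y) \<Longrightarrow> on2 R x y t \<in> Arr (Hom C (on0 R x) (on0 R y))"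
  by (rule cat_functor.map_Arr[OF R.Hom_functor])

lemma L1:
  assumes "x \<in> Obj0 C" "x' \<in> Obj0 C" "u \<in> Obj (Hom C x x')"
  shows "on1 L x x' u \<in> Obj (Hom D (L0 x) (L0 x'))"
    "Comp1 C x (RL x) (RL x') (on1 R (L0 x) (L0 x') (on1 L x x' u)) (\<eta> x) = Comp1 C x x' (RL x') (\<eta> x') u"
proof -
  have "Comp1 C x x' (RL x') (\<eta> x') u \<in> \<Phi> x (L0 x') ` Obj (Hom D (L0 x) (L0 x'))"
    using assms bij_betw_imp_surj_on[OF \<Phi>_bij(1)[of x "L0 x'"]] by (simp add: Comp1_Obj L0 \<eta> R.on0_Obj)
  from inv_into_into[OF this] f_inv_into_f[OF this]
  show "on1 L x x' u \<in> Obj (Hom D (L0 x) (L0 x'))"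
    "Comp1 C x (RL x) (RL x') (on1 R (L0 x) (L0 x') (on1 L x x' u)) (\<eta> x) = Comp1 C x x' (RL x') (\<eta> x') u"
    by (simp_all add: L_def \<Phi>_def)
qed

lemma L2:
  assumes "x \<in> Obj0 C" "x' \<in> Obj0 C" "t \<in> Arr (Hom C x x')"
  shows "on2 L x x' t \<in> Arr (Hom D (L0 x) (L0 x'))"
    "Comp2 C x (RL x) (RL x') (on2 R (L0 x) (L0 x') (on2 L x x' t)) (i\<eta> x) = Comp2 C x x' (RL x') (i\<eta> x') t"
proof -
  have "Comp2 C x x' (RL x') (i\<eta> x') t \<in> \<Phi>' x (L0 x') ` Arr (Hom D (L0 x) (L0 x'))"
    using assms bij_betw_imp_surj_on[OF \<Phi>_bij(2)[of x "L0 x'"]] by (simp add: Comp2_Arr L0 i\<eta> R.on0_Obj)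
  from inv_into_into[OF this] f_inv_into_f[OF this]
  show "on2 L x x' t \<in> Arr (Hom D (L0 x) (L0 x'))"
    "Comp2 C x (RL x) (RL x') (on2 R (L0 x) (L0 x') (on2 L x x' t)) (i\<eta> x) = Comp2 C x x' (RL x') (i\<eta> x') t"
    by (simp_all add: L_def \<Phi>'_def)
qed

lemma \<Phi>_eqD:
  assumes "x \<in> Obj0 C" "y \<in> Obj0 D" "h \<in> Obj (Hom D (L0 x) y)" "k \<in> Obj (Hom D (L0 x) y)" "\<Phi> x y h = \<Phi> x y k"
  shows "h = k"
  using inj_onD[OF bij_betw_imp_inj_on[OF \<Phi>_bij(1)]] assms by blast

lemma \<Phi>'_eqD:
  assumes "x \<in> Obj0 C" "y \<in> Obj0 D" "s \<in> Arr (Hom D (L0 x) y)" "t \<in> Arr (Hom D (L0 x) y)" "\<Phi>' x y s = \<Phi>' x y t"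
  shows "s = t"
  using inj_onD[OF bij_betw_imp_inj_on[OF \<Phi>_bij(2)]] assms by blast

text \<open>Both sides are R(h) \<circ> \<eta> x \<circ> u, by functoriality of R and the defining
  equation of L u.\<close>

lemma \<Phi>_natural_source:
  assumes "x \<in> Obj0 C" "x' \<in> Obj0 C" "y \<in> Obj0 D" "u \<in> Obj (Hom C x' x)" "h \<in> Obj (Hom D (L0 x) y)"
  shows "\<Phi> x' y (Comp1 D (L0 x') (L0 x) y h (on1 L x' x u)) = Comp1 C x' x (on0 R y) (\<Phi> x y h) u"
  using assms
  by (simp add: \<Phi>_def R.on1_Comp L0 L1 on1_Obj \<eta> R.on0_Obj R.D.Comp1_assoc)

lemma \<Phi>'_natural_source:
  assumes "x \<in> Obj0 C" "x' \<in> Obj0 C" "y \<in> Obj0 D" "u \<in> Arr (Hom C x' x)" "h \<in> Arr (Hom D (L0 x) y)"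
  shows "\<Phi>' x' y (Comp2 D (L0 x') (L0 x) y h (on2 L x' x u)) = Comp2 C x' x (on0 R y) (\<Phi>' x y h) u"
  using assms
  by (simp add: \<Phi>'_def R.on2_Comp L0 L2 on2_Arr i\<eta> R.on0_Obj R.D.Comp2_assoc)

lemma \<Phi>_natural_target:
  assumes "x \<in> Obj0 C" "y \<in> Obj0 D" "y' \<in> Obj0 D" "v \<in> Obj (Hom D y y')" "h \<in> Obj (Hom D (L0 x) y)"
  shows "\<Phi> x y' (Comp1 D (L0 x) y y' v h) = Comp1 C x (on0 R y) (on0 R y') (on1 R y y' v) (\<Phi> x y h)"
  using assms
  by (simp add: \<Phi>_def R.on1_Comp L0 on1_Obj \<eta> R.on0_Obj R.D.Comp1_assoc)

lemma \<Phi>'_natural_target: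
  assumes "x \<in> Obj0 C" "y \<in> Obj0 D" "y' \<in> Obj0 D" "v \<in> Arr (Hom D y y')" "h \<in> Arr (Hom D (L0 x) y)"
  shows "\<Phi>' x y' (Comp2 D (L0 x) y y' v h) = Comp2 C x (on0 R y) (on0 R y') (on2 R y y' v) (\<Phi>' x y h)"
  using assms
  by (simp add: \<Phi>'_def R.on2_Comp L0 on2_Arr i\<eta> R.on0_Obj R.D.Comp2_assoc)

text \<open>Units and composites are compared after applying \<Phi>, which is injective; there both
  sides are computed from the defining equation of L.\<close>

lemma two_functor_L: "two_functor C D L"
proof (intro two_functor.intro two_functor_axioms.intro R.C.two_category_axioms R.D.two_category_axioms)
  show "on0 L x \<in> Obj0 D" if "x \<in> Obj0 C" for x using that by (simp add: L0)
next
  fix x y assume x: "x \<in> Obj0 C" and y: "y \<in> Obj0 C"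
  \<comment> \<open>On hom categories L is composition with \<eta> y followed by the inverse of the
    isomorphism \<Phi>, hence functorial as a composite of functors.\<close>
  have "cat_functor (Hom C x y) (Hom C x (RL y)) (Comp1 C x y (RL y) (\<eta> y)) (Comp2 C x y (RL y) (i\<eta> y))"
    using cat_functor_fix_left[OF R.D.Comp_functor[of x y "RL y"] R.D.Hom_category R.D.Hom_category \<eta>] x y
    by (simp add: L0 R.on0_Obj)
  moreover have "cat_functor (Hom C x (RL y)) (Hom D (L0 x) (L0 y))
      (inv_into (Obj (Hom D (L0 x) (L0 y))) (\<Phi> x (L0 y))) (inv_into (Arr (Hom D (L0 x) (L0 y))) (\<Phi>' x (L0 y)))"
    using \<Phi>_iso[of x "L0 y"] \<Phi>_bij[of x "L0 y"] x y by (intro cat_functor_inv) (simp_all add: L0 cat_isomorphism_def)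
  ultimately show "cat_functor (Hom C x y) (Hom D (on0 L x) (on0 L y)) (on1 L x y) (on2 L x y)"
    using cat_functor_comp[of _ _ _ _ "Hom D (L0 x) (L0 y)"] by (simp add: L_def)
next
  fix x assume x: "x \<in> Obj0 C"
  note o = x L0[OF x] R.on0_Obj[OF L0[OF x]] \<eta>[OF x] R.D.Unit1_Hom[OF x] R.C.Unit1_Hom[OF L0[OF x]]
  have "\<Phi> x (L0 x) (on1 L x x (Unit1 C x)) = \<Phi> x (L0 x) (Unit1 D (L0 x))"
    using o by (simp add: \<Phi>_def L1 R.on1_Unit R.D.Comp1_unit_left R.D.Comp1_unit_right)
  then show "on1 L x x (Unit1 C x) = Unit1 D (on0 L x)"
    using \<Phi>_eqD[of x "L0 x"] o by (simp add: L1)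
next
  fix x y z f g
  assume o: "x \<in> Obj0 C" "y \<in> Obj0 C" "z \<in> Obj0 C" and f: "f \<in> Obj (Hom C x y)" and g: "g \<in> Obj (Hom C y z)"
  have "\<Phi> x (L0 z) (Comp1 D (L0 x) (L0 y) (L0 z) (on1 L y z g) (on1 L x y f))
      = Comp1 C x y (RL z) (Comp1 C y z (RL z) (\<eta> z) g) f"
    using o f g by (simp add: \<Phi>_natural_source L0 L1) (simp add: \<Phi>_def L1)
  also have "\<dots> = \<Phi> x (L0 z) (on1 L x z (Comp1 C x y z g f))"
    using o f g by (simp add: \<Phi>_def L1 Comp1_Obj R.D.Comp1_assoc \<eta> L0 R.on0_Obj)
  finally have "\<Phi> x (L0 z) (on1 L x z (Comp1 C x y z g f))
      = \<Phi> x (L0 z) (Comp1 D (L0 x) (L0 y) (L0 z) (on1 L y z g) (on1 L x y f))" by simp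
  then show "on1 L x z (Comp1 C x y z g f) = Comp1 D (on0 L x) (on0 L y) (on0 L z) (on1 L y z g) (on1 L x y f)"
    using \<Phi>_eqD[of x "L0 z"] o f g by (simp add: L0 L1 Comp1_Obj Comp1_Obj_D)
next
  fix x y z f g
  assume o: "x \<in> Obj0 C" "y \<in> Obj0 C" "z \<in> Obj0 C" and f: "f \<in> Arr (Hom C x y)" and g: "g \<in> Arr (Hom C y z)"
  have "\<Phi>' x (L0 z) (Comp2 D (L0 x) (L0 y) (L0 z) (on2 L y z g) (on2 L x y f))
      = Comp2 C x y (RL z) (Comp2 C y z (RL z) (i\<eta> z) g) f"
    using o f g by (simp add: \<Phi>'_natural_source L0 L2) (simp add: \<Phi>'_def L2)
  also have "\<dots> = \<Phi>' x (L0 z) (on2 L x z (Comp2 C x y z g f))"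
    using o f g by (simp add: \<Phi>'_def L2 Comp2_Arr R.D.Comp2_assoc i\<eta> L0 R.on0_Obj)
  finally have "\<Phi>' x (L0 z) (on2 L x z (Comp2 C x y z g f))
      = \<Phi>' x (L0 z) (Comp2 D (L0 x) (L0 y) (L0 z) (on2 L y z g) (on2 L x y f))" by simp
  then show "on2 L x z (Comp2 C x y z g f) = Comp2 D (on0 L x) (on0 L y) (on0 L z) (on2 L y z g) (on2 L x y f)"
    using \<Phi>'_eqD[of x "L0 z"] o f g by (simp add: L0 L2 Comp2_Arr Comp2_Arr_D)
qed

lemma left_two_adjoint_L: "left_two_adjoint C D L R"
  unfolding left_two_adjoint_def
proof (intro conjI two_functor_L R.two_functor_axioms exI[of _ \<Phi>] exI[of _ \<Phi>'] ballI)
  show "cat_isomorphism (Hom D (on0 L x) y) (Hom C x (on0 R y)) (\<Phi> x y) (\<Phi>' x y)"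
    if "x \<in> Obj0 C" "y \<in> Obj0 D" for x y
    using \<Phi>_iso that by simp
qed (simp_all add: \<Phi>_natural_target \<Phi>_natural_source[symmetric] \<Phi>'_natural_target \<Phi>'_natural_source[symmetric]
    L0 L1 L2 Comp1_Obj_D Comp2_Arr_D)

end

section \<open>The universal pseudo symmetric multifunctor\<close>

lemma block_perm_ids: "block_perm id ks (map (\<lambda>_. id) ks) = id"
  using block_perm_id[of ks] by (simp add: map_replicate_const)

context cat_multicategory
begin

abbreviation P :: "('o \<times> unit, 'm \<times> perm1, 'c \<times> perm1 \<times> perm1) multicat" where
  "P \<equiv> prod_multicat M ES"

lemma cat_multicategory_P: "cat_multicategory P"
  by (intro cat_multicategory_prod cat_multicategory_axioms cat_multicategory_ES)

definition eta :: "('o, 'm, 'c, 'o \<times> unit, 'm \<times> perm1, 'c \<times> perm1 \<times> perm1) psfun" where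
  "eta = \<lparr>fob = (\<lambda>a\<in>Ob M. (a, ())), fc1 = (\<lambda>f\<in>Cell1 M. (f, (arity M f, id))),
     fc2 = (\<lambda>\<alpha>\<in>Cell2 M. (\<alpha>, ((arity M (dom2 M \<alpha>), id), (arity M (dom2 M \<alpha>), id)))),
     fsym = (\<lambda>\<sigma> f. if f \<in> Cell1 M \<and> \<sigma> permutes {..<arity M f}
       then (id2 M (act1 M f \<sigma>), ((arity M f, id), (arity M f, \<sigma>))) else undefined)\<rparr>"

lemma eta_simps [simp]:
  "a \<in> Ob M \<Longrightarrow> fob eta a = (a, ())"
  "f \<in> Cell1 M \<Longrightarrow> fc1 eta f = (f, (arity M f, id))"
  "\<alpha> \<in> Cell2 M \<Longrightarrow> fc2 eta \<alpha> = (\<alpha>, ((arity M (dom2 M \<alpha>), id), (arity M (dom2 M \<alpha>), id)))"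
  "f \<in> Cell1 M \<Longrightarrow> \<sigma> permutes {..<arity M f} \<Longrightarrow>
    fsym eta \<sigma> f = (id2 M (act1 M f \<sigma>), ((arity M f, id), (arity M f, \<sigma>)))"
  by (simp_all add: eta_def)

lemma map_eta:
  "set gs \<subseteq> Cell1 M \<Longrightarrow> map (fc1 eta) gs = map (\<lambda>f. (f, (arity M f, id))) gs"
  "set \<beta>s \<subseteq> Cell2 M \<Longrightarrow> map (fc2 eta) \<beta>s
    = map (\<lambda>\<alpha>. (\<alpha>, ((arity M (dom2 M \<alpha>), id), (arity M (dom2 M \<alpha>), id)))) \<beta>s"
  "set as \<subseteq> Ob M \<Longrightarrow> map (fob eta) as = zip as (replicate (length as) ())"
  by (auto simp: subset_iff list_eq_iff_nth_eq)

lemma nonsym_multifunctor_eta: "nonsym_multifunctor M P eta"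
proof (rule nonsym_multifunctorI)
  fix f gs assume c: "composable1 M f gs"
  then have gs: "set gs \<subseteq> Cell1 M" "f \<in> Cell1 M" by (simp_all add: composable1_def)
  show "fc1 eta (gamma1 M f gs) = gamma1 P (fc1 eta f) (map (fc1 eta) gs)"
    using c gs block_perm_ids[of "map (arity M) gs"]
    by (simp add: map_eta gamma1_cell ES_gamma_def length_concat o_def)
next
  fix \<alpha> \<beta>s assume c: "composable2 M \<alpha> \<beta>s"
  then have \<beta>s: "set \<beta>s \<subseteq> Cell2 M" "\<alpha> \<in> Cell2 M" by (simp_all add: composable2_def)
  show "fc2 eta (gamma2 M \<alpha> \<beta>s) = gamma2 P (fc2 eta \<alpha>) (map (fc2 eta) \<beta>s)"
    using c \<beta>s block_perm_ids[of "map (\<lambda>\<beta>. arity M (dom2 M \<beta>)) \<beta>s"] arity_gamma1[OF composable2_dom2[OF c]]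
    by (simp add: map_eta gamma2_cell ES_gamma_def o_def)
qed (auto simp: cat_multicategory_P cat_multicategory_axioms permutes_id tgt_Ob dom2_Cell1 cod2_cell id2_cell
    vcomp_cell unit1_cell map_eta src_Ob, auto simp: eta_def)

text \<open>In the factor \<open>ES\<close> a 2-cell is determined by its ends, and in the factor M
  all components of \<open>fsym eta\<close> are identities. Each axiom thus splits into a comparison
  of permutations and an equation of identities, the latter by equivariance in M.\<close>

lemma ps_multifunctor_eta: "ps_multifunctor M P eta"
proof (intro ps_multifunctor.intro ps_multifunctor_axioms.intro nonsym_multifunctor_eta)
  show "fsym eta \<sigma> f = undefined" if "\<not> (f \<in> Cell1 M \<and> \<sigma> permutes {..<arity M f})" for f \<sigma>
    using that by (auto simp: eta_def)
  show "fsym eta id f = id2 P (fc1 eta f)" if "f \<in> Cell1 M" for f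
    using that by (simp add: permutes_id act1_id)
next
  fix f \<sigma> assume f: "f \<in> Cell1 M" "\<sigma> permutes {..<arity M f}"
  \<comment> \<open>The inverse 2-cell exchanges the two ends in \<open>ES\<close>.\<close>
  let ?s = "(id2 M (act1 M f \<sigma>), ((arity M f, \<sigma>), (arity M f, id)))"
  have src: "zip (permute_list \<sigma> (src M f)) (replicate (arity M f) ()) = permute_list \<sigma> (map (fob eta) (src M f))"
    using f by (simp add: map_eta src_Ob permute_list_zip permute_list_replicate)
  show "iso_arr (hom_cat P (permute_list \<sigma> (map (fob eta) (src M f))) (fob eta (tgt M f)))
      (fc1 eta (act1 M f \<sigma>)) (act1 P (fc1 eta f) \<sigma>) (fsym eta \<sigma> f)"
    unfolding iso_arr_def
    using f src by (intro conjI bexI[of _ ?s]) (simp_all add: act1_cell id2_cell permutes_id tgt_Ob vcomp_id2_id2)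
next
  fix \<alpha> \<sigma> assume \<alpha>: "\<alpha> \<in> Cell2 M" "\<sigma> permutes {..<arity M (dom2 M \<alpha>)}"
  then show "vcomp P (act2 P (fc2 eta \<alpha>) \<sigma>) (fsym eta \<sigma> (dom2 M \<alpha>)) = vcomp P (fsym eta \<sigma> (cod2 M \<alpha>)) (fc2 eta (act2 M \<alpha> \<sigma>))"
    using vcomp_id2[of "act2 M \<alpha> \<sigma>"] by (simp add: cell_simps)
next
  fix f \<sigma> \<tau> assume f: "f \<in> Cell1 M" "\<sigma> permutes {..<arity M f}" "\<tau> permutes {..<arity M f}"
  then show "fsym eta (\<sigma> \<circ> \<tau>) f = vcomp P (act2 P (fsym eta \<sigma> f) \<tau>) (fsym eta \<tau> (act1 M f \<sigma>))"
    by (simp add: permutes_compose act1_cell act1_comp act2_id2 vcomp_id2_id2)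
next
  fix f gs \<sigma> assume c: "composable1 M f gs" and \<sigma>: "\<sigma> permutes {..<length gs}"
  then have gs: "set gs \<subseteq> Cell1 M" "f \<in> Cell1 M" "set (permute_list \<sigma> gs) \<subseteq> Cell1 M" by (simp_all add: composable1_def)
  note len = composable1_length[OF c]
  have p: "outer_perm \<sigma> (map (arity M) gs) permutes {..<arity M (gamma1 M f gs)}"
    using \<sigma> outer_perm_permutes[of \<sigma> "map (arity M) gs"] by (simp add: arity_gamma1[OF c])
  have ids: "map (\<lambda>g. id2 P (fc1 eta g)) (permute_list \<sigma> gs)
      = map (\<lambda>g. (id2 M g, ((arity M g, id), (arity M g, id)))) (permute_list \<sigma> gs)"
    using gs by (auto simp: subset_iff simp del: set_permute_list)
  have ks: "map (arity M) (permute_list \<sigma> gs) = permute_list \<sigma> (map (arity M) gs)"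
    using \<sigma> by (simp add: permute_list_map)
  have sum: "sum_list (map (arity M) (permute_list \<sigma> gs)) = sum_list (map (arity M) gs)"
    using \<sigma> by (simp add: ks sum_list_permute_list)
  have "gamma2 M (id2 M (act1 M f \<sigma>)) (map (id2 M) (permute_list \<sigma> gs))
      = id2 M (act1 M (gamma1 M f gs) (outer_perm \<sigma> (map (arity M) gs)))"
    using gamma2_id2[OF composable1_permute_act[OF c \<sigma>]] gamma1_top[OF c \<sigma>] by simp
  then show "fsym eta (outer_perm \<sigma> (map (arity M) gs)) (gamma1 M f gs)
      = gamma2 P (fsym eta \<sigma> f) (map (\<lambda>g. id2 P (fc1 eta g)) (permute_list \<sigma> gs))"
    unfolding ids
    using p c gs len \<sigma> sum block_perm_ids[of "map (arity M) (permute_list \<sigma> gs)"] ks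
    by (simp add: gamma1_cell(1) ES_gamma_def o_def arity_gamma1 outer_perm_def map_replicate_const)
next
  fix f gs \<tau>s assume c: "composable1 M f gs" and \<tau>s: "list_all2 (\<lambda>g \<tau>. \<tau> permutes {..<arity M g}) gs \<tau>s"
  then have gs: "set gs \<subseteq> Cell1 M" "f \<in> Cell1 M" by (simp_all add: composable1_def)
  note len = list_all2_lengthD[OF \<tau>s]
  have p: "inner_perm (map (arity M) gs) \<tau>s permutes {..<arity M (gamma1 M f gs)}"
    using \<tau>s by (simp add: arity_gamma1[OF c] inner_perm_permutes list_all2_map1)
  have fsyms: "map2 (\<lambda>g \<tau>. fsym eta \<tau> g) gs \<tau>s
      = map2 (\<lambda>g \<tau>. (id2 M (act1 M g \<tau>), ((arity M g, id), (arity M g, \<tau>)))) gs \<tau>s"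
    using \<tau>s gs by (auto simp: list_eq_iff_nth_eq list_all2_conv_all_nth subset_iff)
  have parts: "map fst (map2 (\<lambda>g \<tau>. (id2 M (act1 M g \<tau>), ((arity M g, id), (arity M g, \<tau>)))) gs \<tau>s) = map (id2 M) (map2 (act1 M) gs \<tau>s)"
    "map fst (map snd (map2 (\<lambda>g \<tau>. (id2 M (act1 M g \<tau>), ((arity M g, id), (arity M g, \<tau>)))) gs \<tau>s)) = map (\<lambda>g. (arity M g, id)) gs"
    "map snd (map snd (map2 (\<lambda>g \<tau>. (id2 M (act1 M g \<tau>), ((arity M g, id), (arity M g, \<tau>)))) gs \<tau>s)) = zip (map (arity M) gs) \<tau>s"
    using len by (auto intro!: nth_equalityI)
  have "gamma2 M (id2 M f) (map (id2 M) (map2 (act1 M) gs \<tau>s)) = id2 M (act1 M (gamma1 M f gs) (inner_perm (map (arity M) gs) \<tau>s))"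
    using gamma2_id2[OF composable1_map2_act[OF c \<tau>s]] gamma1_bottom[OF c \<tau>s] by simp
  then show "fsym eta (inner_perm (map (arity M) gs) \<tau>s) (gamma1 M f gs)
      = gamma2 P (id2 P (fc1 eta f)) (map2 (\<lambda>g \<tau>. fsym eta \<tau> g) gs \<tau>s)"
    unfolding fsyms
    using p c gs len block_perm_ids[of "map (arity M) gs"]
    by (simp add: parts gamma1_cell(1) arity_gamma1 del: map_map)
      (simp add: ES_gamma_def inner_perm_def o_def)
qed

abbreviation base :: "'m \<times> perm1 \<Rightarrow> 'm" where
  "base x \<equiv> act1 M (fst x) (inv (snd (snd x)))"

lemma act1_inv:
  "f \<in> Cell1 M \<Longrightarrow> \<sigma> permutes {..<arity M f} \<Longrightarrow> act1 M (act1 M f (inv \<sigma>)) \<sigma> = f"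
  "f \<in> Cell1 M \<Longrightarrow> \<sigma> permutes {..<arity M f} \<Longrightarrow> act1 M (act1 M f \<sigma>) (inv \<sigma>) = f"
  by (simp_all add: act1_comp permutes_inv permutes_inv_o act1_id)

lemma act2_inv:
  "\<alpha> \<in> Cell2 M \<Longrightarrow> \<sigma> permutes {..<arity M (dom2 M \<alpha>)} \<Longrightarrow> act2 M (act2 M \<alpha> (inv \<sigma>)) \<sigma> = \<alpha>"
  "\<alpha> \<in> Cell2 M \<Longrightarrow> \<sigma> permutes {..<arity M (dom2 M \<alpha>)} \<Longrightarrow> act2 M (act2 M \<alpha> \<sigma>) (inv \<sigma>) = \<alpha>"
  by (simp_all add: act2_comp permutes_inv permutes_inv_o act2_id)

lemma P_Cell1_decomp:
  assumes "x \<in> Cell1 P"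
  shows "act1 P (fc1 eta (base x)) (snd (snd x)) = x" "base x \<in> Cell1 M" "arity M (base x) = arity M (fst x)"
    "snd (snd x) permutes {..<arity M (fst x)}"
  using assms by (auto simp: act1_inv act1_cell permutes_inv)

lemma P_Cell2_decomp:
  assumes "\<delta> \<in> Cell2 P"
  defines "\<sigma> \<equiv> snd (fst (snd \<delta>))" and "\<tau> \<equiv> snd (snd (snd \<delta>))"
  shows "\<delta> = vcomp P (act2 P (fsym eta (\<tau> \<circ> inv \<sigma>) (act1 M (cod2 M (fst \<delta>)) (inv \<tau>))) \<sigma>)
      (act2 P (fc2 eta (act2 M (fst \<delta>) (inv \<sigma>))) \<sigma>)"
    "fst \<delta> \<in> Cell2 M" "\<sigma> permutes {..<arity M (dom2 M (fst \<delta>))}" "\<tau> permutes {..<arity M (dom2 M (fst \<delta>))}"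
proof -
  obtain \<alpha> n \<sigma>' m \<tau>' where \<delta>: "\<delta> = (\<alpha>, ((n, \<sigma>'), (m, \<tau>')))" by (metis surj_pair)
  have [simp]: "\<sigma>' = \<sigma>" "\<tau>' = \<tau>" by (simp_all add: \<sigma>_def \<tau>_def \<delta>)
  have c: "\<alpha> \<in> Cell2 M" "\<sigma> permutes {..<arity M (dom2 M \<alpha>)}" "\<tau> permutes {..<arity M (dom2 M \<alpha>)}"
    and [simp]: "n = arity M (dom2 M \<alpha>)" "m = arity M (dom2 M \<alpha>)"
    using assms(1) by (auto simp: \<delta>)
  show "fst \<delta> \<in> Cell2 M" "\<sigma> permutes {..<arity M (dom2 M (fst \<delta>))}" "\<tau> permutes {..<arity M (dom2 M (fst \<delta>))}"
    using c by (simp_all add: \<delta>)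
  let ?\<rho> = "\<tau> \<circ> inv \<sigma>"
  have \<rho>: "?\<rho> permutes {..<arity M (dom2 M \<alpha>)}"
    using c by (simp add: permutes_compose permutes_inv)
  \<comment> \<open>With g the target of \<alpha>, the component at g\<tau>' starts over
    g\<tau>'?\<rho> = g\<sigma>'. Acting by \<sigma> turns its ends into (g, \<sigma>) and (g,
    ?\<rho>\<sigma>) = (g, \<tau>).\<close>
  have "inv \<tau> \<circ> ?\<rho> = inv \<sigma>" "?\<rho> \<circ> \<sigma> = \<tau>"
    using c by (simp_all add: permutes_inv_o comp_assoc flip: comp_assoc[of "inv \<tau>"]) 
  then show "\<delta> = vcomp P (act2 P (fsym eta ?\<rho> (act1 M (cod2 M (fst \<delta>)) (inv \<tau>))) \<sigma>)
      (act2 P (fc2 eta (act2 M (fst \<delta>) (inv \<sigma>))) \<sigma>)"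
    using c \<rho> vcomp_id2[of \<alpha>]
    by (simp add: \<delta> cell_simps permutes_inv act1_comp act2_inv act1_id act2_id2 permutes_inv_o)
qed

end

section \<open>Extending pseudo symmetric multifunctors\<close>

lemma map2_permute_list:
  assumes "\<sigma> permutes {..<length xs}" "length ys = length xs"
  shows "map2 f (permute_list \<sigma> xs) (permute_list \<sigma> ys) = permute_list \<sigma> (map2 f xs ys)"
  using assms by (intro nth_equalityI) (simp_all add: permute_list_nth permutes_lt)

lemma permutes_div: "\<sigma> permutes S \<Longrightarrow> \<tau> permutes S \<Longrightarrow> \<tau> \<circ> inv \<sigma> permutes S"
  by (simp add: permutes_compose permutes_inv)

lemma inv_comp_cancel:
  "\<sigma> permutes S \<Longrightarrow> inv \<sigma> \<circ> (\<sigma> \<circ> \<tau>) = \<tau>" "\<sigma> permutes S \<Longrightarrow> \<sigma> \<circ> (inv \<sigma> \<circ> \<tau>) = \<tau>"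
  by (simp_all add: permutes_inv_o flip: comp_assoc)

lemma inv_comp_permutes: "\<sigma> permutes S \<Longrightarrow> \<rho> permutes S \<Longrightarrow> inv (\<sigma> \<circ> \<rho>) = inv \<rho> \<circ> inv \<sigma>"
  by (simp add: o_inv_distrib permutes_bij)

section \<open>Removing symmetries from composites\<close>

context cat_multicategory
begin

text \<open>Equivariance applied to the cells with their permutations removed, and cancelled by the
  inverse. In terms of M \<times> E\<Sigma> it says that the base of a composite is the composite of
  the bases, which is how formulas written on bases become compatible with \<gamma>.\<close>

lemma unact1:
  assumes c: "composable1 M f gs" and \<sigma>: "\<sigma> permutes {..<length gs}" and \<rho>s: "perms (map (arity M) gs) \<rho>s"
  defines "gs' \<equiv> map2 (act1 M) gs (map inv \<rho>s)"
  shows "composable1 M (act1 M f (inv \<sigma>)) (permute_list (inv \<sigma>) gs')" "length gs' = length gs" "set gs' \<subseteq> Cell1 M"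
    "map (arity M) gs' = map (arity M) gs"
    "act1 M (gamma1 M f gs) (inv (block_perm \<sigma> (map (arity M) gs) \<rho>s)) = gamma1 M (act1 M f (inv \<sigma>)) (permute_list (inv \<sigma>) gs')"
proof -
  have f: "f \<in> Cell1 M" "\<sigma> permutes {..<arity M f}" and gs: "set gs \<subseteq> Cell1 M"
    using c \<sigma> composable1_length[OF c] by (simp_all add: composable1_def)
  have len: "length \<rho>s = length gs" using list_all2_lengthD[OF \<rho>s] by simp
  have \<rho>: "(\<rho>s ! i) permutes {..<arity M (gs ! i)}" if "i < length gs" for i
    using perms_nth[OF \<rho>s] that by simp
  have g: "gs ! i \<in> Cell1 M" if "i < length gs" for i using gs that by auto
  have "composable1 M f gs'"
    unfolding gs'_def using perms_inv[OF \<rho>s] by (intro composable1_map2_act c) (simp add: perms_list_all2)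
  then show gs': "length gs' = length gs" "set gs' \<subseteq> Cell1 M"
    and c': "composable1 M (act1 M f (inv \<sigma>)) (permute_list (inv \<sigma>) gs')"
    using \<sigma> composable1_permute_act[of f gs' "inv \<sigma>"] len
    by (simp_all add: permutes_inv gs'_def composable1_def)
  show ar: "map (arity M) gs' = map (arity M) gs"
    using len \<rho> g by (auto simp: gs'_def list_eq_iff_nth_eq act1_cell permutes_inv)
  have "map2 (act1 M) gs' \<rho>s = gs"
    using len \<rho> g by (auto simp: gs'_def list_eq_iff_nth_eq act1_inv)
  then have "gamma1 M f gs = act1 M (gamma1 M (act1 M f (inv \<sigma>)) (permute_list (inv \<sigma>) gs')) (block_perm \<sigma> (map (arity M) gs) \<rho>s)"
    using gamma1_equivariant[OF c', of \<rho>s] \<sigma> \<rho>s gs' f by (simp add: ar act1_inv)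
  moreover have "block_perm \<sigma> (map (arity M) gs) \<rho>s permutes {..<arity M (gamma1 M (act1 M f (inv \<sigma>)) (permute_list (inv \<sigma>) gs'))}"
    using block_perm_permutes[of \<sigma> "map (arity M) gs" \<rho>s] \<sigma> \<rho>s gs' ar arity_gamma1[OF c']
    by (simp add: permute_list_map permutes_inv sum_list_permute_list flip: permute_list_map)
  ultimately show "act1 M (gamma1 M f gs) (inv (block_perm \<sigma> (map (arity M) gs) \<rho>s)) = gamma1 M (act1 M f (inv \<sigma>)) (permute_list (inv \<sigma>) gs')"
    using gamma1_cell(1)[OF c'] by (simp add: act1_inv)
qed

lemma unact2:
  assumes c: "composable2 M \<alpha> \<beta>s" and \<sigma>: "\<sigma> permutes {..<length \<beta>s}" and \<rho>s: "perms (map (\<lambda>\<beta>. arity M (dom2 M \<beta>)) \<beta>s) \<rho>s"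
  defines "\<beta>s' \<equiv> map2 (act2 M) \<beta>s (map inv \<rho>s)"
  shows "composable2 M (act2 M \<alpha> (inv \<sigma>)) (permute_list (inv \<sigma>) \<beta>s')" "length \<beta>s' = length \<beta>s" "set \<beta>s' \<subseteq> Cell2 M"
    "map (\<lambda>\<beta>. arity M (dom2 M \<beta>)) \<beta>s' = map (\<lambda>\<beta>. arity M (dom2 M \<beta>)) \<beta>s"
    "act2 M (gamma2 M \<alpha> \<beta>s) (inv (block_perm \<sigma> (map (\<lambda>\<beta>. arity M (dom2 M \<beta>)) \<beta>s) \<rho>s))
      = gamma2 M (act2 M \<alpha> (inv \<sigma>)) (permute_list (inv \<sigma>) \<beta>s')"
proof -
  let ?ks = "map (\<lambda>\<beta>. arity M (dom2 M \<beta>)) \<beta>s"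
  have f: "\<alpha> \<in> Cell2 M" "\<sigma> permutes {..<arity M (dom2 M \<alpha>)}" and \<beta>s: "set \<beta>s \<subseteq> Cell2 M"
    using c \<sigma> composable2_length[OF c] by (simp_all add: composable2_def)
  have len: "length \<rho>s = length \<beta>s" using list_all2_lengthD[OF \<rho>s] by simp
  have \<rho>: "(\<rho>s ! i) permutes {..<arity M (dom2 M (\<beta>s ! i))}" if "i < length \<beta>s" for i
    using perms_nth[OF \<rho>s] that by simp
  have g: "\<beta>s ! i \<in> Cell2 M" if "i < length \<beta>s" for i using \<beta>s that by auto
  have "composable2 M \<alpha> \<beta>s'"
    unfolding \<beta>s'_def using perms_inv[OF \<rho>s] by (intro composable2_map2_act c) (simp add: perms_list_all2)
  then show \<beta>s': "length \<beta>s' = length \<beta>s" "set \<beta>s' \<subseteq> Cell2 M"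
    and c': "composable2 M (act2 M \<alpha> (inv \<sigma>)) (permute_list (inv \<sigma>) \<beta>s')"
    using \<sigma> composable2_permute_act[of \<alpha> \<beta>s' "inv \<sigma>"] len
    by (simp_all add: permutes_inv \<beta>s'_def composable2_def)
  show ar: "map (\<lambda>\<beta>. arity M (dom2 M \<beta>)) \<beta>s' = ?ks"
    using len \<rho> g by (auto simp: \<beta>s'_def list_eq_iff_nth_eq act1_cell act2_cell dom2_Cell1 permutes_inv)
  have "map2 (act2 M) \<beta>s' \<rho>s = \<beta>s"
    using len \<rho> g by (auto simp: \<beta>s'_def list_eq_iff_nth_eq act2_inv)
  then have "gamma2 M \<alpha> \<beta>s = act2 M (gamma2 M (act2 M \<alpha> (inv \<sigma>)) (permute_list (inv \<sigma>) \<beta>s')) (block_perm \<sigma> ?ks \<rho>s)"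
    using gamma2_equivariant[OF c', of \<rho>s] \<sigma> \<rho>s \<beta>s' f by (simp add: ar act2_inv)
  moreover have "block_perm \<sigma> ?ks \<rho>s permutes {..<arity M (dom2 M (gamma2 M (act2 M \<alpha> (inv \<sigma>)) (permute_list (inv \<sigma>) \<beta>s')))}"
  proof -
    have "arity M (dom2 M (gamma2 M (act2 M \<alpha> (inv \<sigma>)) (permute_list (inv \<sigma>) \<beta>s')))
      = sum_list (map (\<lambda>\<beta>. arity M (dom2 M \<beta>)) (permute_list (inv \<sigma>) \<beta>s'))"
      using arity_gamma1[OF composable2_dom2[OF c']] by (simp add: gamma2_cell[OF c'] o_def)
    also have "\<dots> = sum_list ?ks"
      using \<sigma> \<beta>s' by (simp add: permute_list_map permutes_inv sum_list_permute_list ar flip: permute_list_map)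
    finally show ?thesis
      using block_perm_permutes[of \<sigma> ?ks \<rho>s] \<sigma> \<rho>s by simp
  qed
  ultimately show "act2 M (gamma2 M \<alpha> \<beta>s) (inv (block_perm \<sigma> ?ks \<rho>s)) = gamma2 M (act2 M \<alpha> (inv \<sigma>)) (permute_list (inv \<sigma>) \<beta>s')"
    using gamma2_cell(1)[OF c'] by (simp add: act2_inv)
qed

end

context ps_multifunctor
begin

lemma composable2_fsym_block:
  assumes c: "composable1 M f (permute_list (inv \<sigma>) gs)" and \<sigma>: "\<sigma> permutes {..<length gs}"
    and \<tau>s: "perms (map (arity M) gs) \<tau>s"
  shows "composable2 N (fsym F \<sigma> f) (map2 (\<lambda>g \<tau>. fsym F \<tau> g) gs \<tau>s)"
proof -
  have f: "f \<in> Cell1 M" "\<sigma> permutes {..<arity M f}" and gs: "set gs \<subseteq> Cell1 M"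
    using c \<sigma> composable1_length[OF c] by (simp_all add: composable1_def permutes_inv)
  have "permute_list \<sigma> (map (tgt M) (permute_list (inv \<sigma>) gs)) = map (tgt M) gs"
    using \<sigma> by (simp add: permute_list_map permutes_inv)
  then have "map (tgt M) gs = permute_list \<sigma> (src M f)"
    using c by (simp add: composable1_def)
  then show ?thesis
    using fsym_cells[OF \<tau>s[unfolded M.perms_list_all2] gs] f
    by (simp add: composable2_def fsym_cell M.act1_cell fc1_cell del: map_map set_map)
qed

text \<open>The axioms \<open>fsym_top\<close> and \<open>fsym_bottom\<close> in one, because \<open>\<sigma>\<langle>\<tau>s\<rangle> = \<sigma>\<langle>id, \<dots>, id\<rangle> \<circ> id\<langle>\<tau>s\<rangle>\<close>.\<close>

lemma fsym_block:
  assumes c: "composable1 M f (permute_list (inv \<sigma>) gs)" and \<sigma>: "\<sigma> permutes {..<length gs}"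
    and \<tau>s: "perms (map (arity M) gs) \<tau>s"
  shows "fsym F (block_perm \<sigma> (map (arity M) gs) \<tau>s) (gamma1 M f (permute_list (inv \<sigma>) gs))
    = gamma2 N (fsym F \<sigma> f) (map2 (\<lambda>g \<tau>. fsym F \<tau> g) gs \<tau>s)"
proof -
  let ?ks = "map (arity M) gs" and ?h = "permute_list (inv \<sigma>) gs"
  let ?o = "outer_perm \<sigma> (permute_list (inv \<sigma>) ?ks)" and ?i = "inner_perm ?ks \<tau>s"
  let ?ids = "map (\<lambda>g. id2 N (fc1 F g)) gs" and ?Fs = "map2 (\<lambda>g \<tau>. fsym F \<tau> g) gs \<tau>s"
  have f: "f \<in> Cell1 M" "\<sigma> permutes {..<arity M f}" and gs: "set gs \<subseteq> Cell1 M"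
    using c \<sigma> composable1_length[OF c] by (simp_all add: composable1_def permutes_inv)
  note \<tau>s' = \<tau>s[unfolded M.perms_list_all2]
  have ks: "map (arity M) ?h = permute_list (inv \<sigma>) ?ks"
    using \<sigma> by (simp add: permute_list_map permutes_inv)
  have ar: "arity M (gamma1 M f ?h) = sum_list ?ks"
    using \<sigma> by (simp only: M.arity_gamma1[OF c] ks) (simp add: sum_list_permute_list permutes_inv)
  have o: "?o permutes {..<arity M (gamma1 M f ?h)}"
    using outer_perm_permutes[of \<sigma> "permute_list (inv \<sigma>) ?ks"] \<sigma> by (simp add: ar sum_list_permute_list permutes_inv)
  have i: "?i permutes {..<arity M (gamma1 M f ?h)}"
    using \<tau>s by (simp add: ar inner_perm_permutes)
  note c\<sigma> = M.composable1_act_top[OF c \<sigma>]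
  have top: "fsym F ?o (gamma1 M f ?h) = gamma2 N (fsym F \<sigma> f) ?ids"
    using fsym_top[OF c, of \<sigma>] \<sigma> by (simp add: ks)
  have c1: "composable2 N (fsym F \<sigma> f) ?ids"
    using composable2_fsym_top[OF c, of \<sigma>] \<sigma> by simp
  have "act1 M (gamma1 M f ?h) ?o = gamma1 M (act1 M f \<sigma>) gs"
    using M.gamma1_top[OF c, of \<sigma>] \<sigma> by (simp add: ks)
  then have bottom: "fsym F ?i (act1 M (gamma1 M f ?h) ?o) = gamma2 N (id2 N (fc1 F (act1 M f \<sigma>))) ?Fs"
    using fsym_bottom[OF c\<sigma> \<tau>s'] by simp
  have c2: "composable2 N (id2 N (fc1 F (act1 M f \<sigma>))) ?Fs"
    by (rule composable2_fsym_bottom[OF c\<sigma> \<tau>s'])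
  have ids_ar: "map (\<lambda>\<beta>. arity N (dom2 N \<beta>)) ?ids = ?ks"
    using gs by (auto simp: N.id2_cell fc1_cell)
  have \<tau>s'': "list_all2 (\<lambda>\<beta> \<tau>. \<tau> permutes {..<arity N (dom2 N \<beta>)}) ?ids \<tau>s"
    using \<tau>s unfolding ids_ar[symmetric] by (simp only: N.perms_list_all2)
  \<comment> \<open>The action by the inner permutation is moved onto the identity 2-cells, so that
    the outer factor takes the form of a \<gamma> that can be interchanged with the bottom
    factor.\<close>
  have inner: "act2 N (gamma2 N (fsym F \<sigma> f) ?ids) ?i = gamma2 N (fsym F \<sigma> f) (map2 (act2 N) ?ids \<tau>s)"
    using N.gamma2_bottom[OF c1 \<tau>s''] by (simp only: ids_ar)
  have c3: "composable2 N (fsym F \<sigma> f) (map2 (act2 N) ?ids \<tau>s)"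
    by (rule N.composable2_map2_act[OF c1 \<tau>s''])
  have nth: "gs ! j \<in> Cell1 M" "(\<tau>s ! j) permutes {..<arity M (gs ! j)}" if "j < length gs" for j
    using gs perms_nth[OF \<tau>s] that by auto
  have len: "length \<tau>s = length gs" using list_all2_lengthD[OF \<tau>s] by simp
  have doms: "map (dom2 N) (map2 (act2 N) ?ids \<tau>s) = map (cod2 N) ?Fs"
    using len nth by (auto simp: list_eq_iff_nth_eq N.act2_cell N.id2_cell fc1_cell fsym_cell)
  have comp: "map2 (vcomp N) (map2 (act2 N) ?ids \<tau>s) ?Fs = ?Fs"
  proof -
    have "vcomp N (act2 N (id2 N (fc1 F (gs ! j))) (\<tau>s ! j)) (fsym F (\<tau>s ! j) (gs ! j)) = fsym F (\<tau>s ! j) (gs ! j)"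
      if "j < length gs" for j
      using N.vcomp_id2(1)[of "fsym F (\<tau>s ! j) (gs ! j)"] nth[OF that] by (simp add: N.act2_id2 fc1_cell fsym_cell)
    then show ?thesis using len by (auto simp: list_eq_iff_nth_eq)
  qed
  have "fsym F (block_perm \<sigma> ?ks \<tau>s) (gamma1 M f ?h) = fsym F (?o \<circ> ?i) (gamma1 M f ?h)"
    using \<sigma> \<tau>s by (simp add: outer_perm_inner_perm)
  also have "\<dots> = vcomp N (act2 N (fsym F ?o (gamma1 M f ?h)) ?i) (fsym F ?i (act1 M (gamma1 M f ?h) ?o))"
    using M.gamma1_cell(1)[OF c] o i by (rule fsym_comp)
  also have "\<dots> = vcomp N (gamma2 N (fsym F \<sigma> f) (map2 (act2 N) ?ids \<tau>s)) (gamma2 N (id2 N (fc1 F (act1 M f \<sigma>))) ?Fs)"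
    by (simp only: top bottom inner)
  \<comment> \<open>Interchange of \<gamma> with vertical composition. Each pair now consists of an
    isomorphism and an identity, which is absorbed.\<close>
  also have "\<dots> = gamma2 N (vcomp N (fsym F \<sigma> f) (id2 N (fc1 F (act1 M f \<sigma>)))) (map2 (vcomp N) (map2 (act2 N) ?ids \<tau>s) ?Fs)"
    by (rule N.gamma2_vcomp[symmetric, OF c2 c3 _ doms]) (use f in \<open>simp add: fsym_cell N.id2_cell fc1_cell M.act1_cell\<close>)
  also have "vcomp N (fsym F \<sigma> f) (id2 N (fc1 F (act1 M f \<sigma>))) = fsym F \<sigma> f"
    using N.vcomp_id2(2)[of "fsym F \<sigma> f"] f by (simp add: fsym_cell)
  finally show ?thesis by (simp only: comp)
qed

text \<open>\<open>ext1 \<sigma> f\<close>, \<open>ext2 \<sigma> \<alpha>\<close> and \<open>kappa \<sigma> \<tau> g\<close> are the values that the extension of \<open>F\<close> must take at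
  \<open>(f, \<sigma>)\<close>, at \<open>(\<alpha>, \<sigma> \<rightarrow> \<sigma>)\<close> and at \<open>(1\<^sub>g, \<sigma> \<rightarrow> \<tau>)\<close>.\<close>

definition ext1 :: "(nat \<Rightarrow> nat) \<Rightarrow> 'm \<Rightarrow> 'n" where
  "ext1 \<sigma> f = act1 N (fc1 F (act1 M f (inv \<sigma>))) \<sigma>"

definition ext2 :: "(nat \<Rightarrow> nat) \<Rightarrow> 'c \<Rightarrow> 'd" where
  "ext2 \<sigma> \<alpha> = act2 N (fc2 F (act2 M \<alpha> (inv \<sigma>))) \<sigma>"

definition kappa :: "(nat \<Rightarrow> nat) \<Rightarrow> (nat \<Rightarrow> nat) \<Rightarrow> 'm \<Rightarrow> 'd" where
  "kappa \<sigma> \<tau> g = act2 N (fsym F (\<tau> \<circ> inv \<sigma>) (act1 M g (inv \<tau>))) \<sigma>"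

lemma ext1_cell:
  assumes "f \<in> Cell1 M" "\<sigma> permutes {..<arity M f}"
  shows "ext1 \<sigma> f \<in> Cell1 N" "src N (ext1 \<sigma> f) = map (fob F) (src M f)" "tgt N (ext1 \<sigma> f) = fob F (tgt M f)"
  using assms
  by (simp_all add: ext1_def N.act1_cell fc1_cell M.act1_cell permutes_inv permute_list_map)

lemma ext2_cell:
  assumes "\<alpha> \<in> Cell2 M" "\<sigma> permutes {..<arity M (dom2 M \<alpha>)}"
  shows "ext2 \<sigma> \<alpha> \<in> Cell2 N" "dom2 N (ext2 \<sigma> \<alpha>) = ext1 \<sigma> (dom2 M \<alpha>)" "cod2 N (ext2 \<sigma> \<alpha>) = ext1 \<sigma> (cod2 M \<alpha>)"
  using assms
  by (simp_all add: ext1_def ext2_def N.act2_cell fc2_cell fc1_cell M.cell_simps permutes_inv)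

lemma kappa_cell:
  assumes "g \<in> Cell1 M" "\<sigma> permutes {..<arity M g}" "\<tau> permutes {..<arity M g}"
  shows "kappa \<sigma> \<tau> g \<in> Cell2 N" "dom2 N (kappa \<sigma> \<tau> g) = ext1 \<sigma> g" "cod2 N (kappa \<sigma> \<tau> g) = ext1 \<tau> g"
  using assms permutes_div[OF assms(2,3)]
  by (simp_all add: kappa_def ext1_def N.act2_cell fsym_cell fc1_cell M.act1_cell N.act1_cell permutes_inv M.act1_comp
      N.act1_comp inv_comp_cancel comp_assoc permutes_inv_o)

lemma kappa_self:
  assumes "g \<in> Cell1 M" "\<sigma> permutes {..<arity M g}"
  shows "kappa \<sigma> \<sigma> g = id2 N (ext1 \<sigma> g)"
  using assms
  by (simp add: kappa_def ext1_def permutes_inv_o fsym_id M.act1_cell permutes_inv N.act2_id2 fc1_cell)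

text \<open>Since \<upsilon> \<circ> \<open>inv \<sigma>\<close> factors as (\<upsilon> \<circ>
  \<open>inv \<tau>\<close>) \<circ> (\<tau> \<circ> \<open>inv \<sigma>\<close>), this is the
  cocycle condition \<open>fsym_comp\<close> for F, acted on by \<sigma>.\<close>

lemma kappa_comp:
  assumes "g \<in> Cell1 M" "\<sigma> permutes {..<arity M g}" "\<tau> permutes {..<arity M g}" "\<upsilon> permutes {..<arity M g}"
  shows "vcomp N (kappa \<tau> \<upsilon> g) (kappa \<sigma> \<tau> g) = kappa \<sigma> \<upsilon> g"
proof -
  let ?a = "\<upsilon> \<circ> inv \<tau>" and ?b = "\<tau> \<circ> inv \<sigma>" and ?h = "act1 M g (inv \<upsilon>)"
  have ab: "?a permutes {..<arity M g}" "?b permutes {..<arity M g}" using assms by (simp_all add: permutes_div)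
  have h: "?h \<in> Cell1 M" "arity M ?h = arity M g" using assms by (simp_all add: M.act1_cell permutes_inv)
  have ha: "act1 M ?h ?a = act1 M g (inv \<tau>)"
    using assms ab by (simp add: M.act1_comp permutes_inv inv_comp_cancel)
  have e: "?a \<circ> ?b = \<upsilon> \<circ> inv \<sigma>" "?b \<circ> \<sigma> = \<tau>"
    using assms(2,3) by (simp_all add: comp_assoc inv_comp_cancel permutes_inv_o)
  note cs = fsym_cell fc1_cell M.act1_cell N.act1_cell N.act2_cell h ab assms(2-4)
  have "kappa \<sigma> \<upsilon> g = act2 N (fsym F (?a \<circ> ?b) ?h) \<sigma>" by (simp add: kappa_def e)
  also have "fsym F (?a \<circ> ?b) ?h = vcomp N (act2 N (fsym F ?a ?h) ?b) (fsym F ?b (act1 M ?h ?a))"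
    using ab h by (intro fsym_comp) simp_all
  also have "act2 N \<dots> \<sigma> = vcomp N (act2 N (act2 N (fsym F ?a ?h) ?b) \<sigma>) (act2 N (fsym F ?b (act1 M ?h ?a)) \<sigma>)"
    by (intro N.act2_vcomp) (simp_all add: cs)
  also have "act2 N (act2 N (fsym F ?a ?h) ?b) \<sigma> = act2 N (fsym F ?a ?h) (?b \<circ> \<sigma>)"
    by (intro N.act2_comp) (simp_all add: cs)
  finally show ?thesis by (simp only: kappa_def ha e)
qed

text \<open>Naturality of the isomorphism of F for \<tau> \<circ> \<open>inv \<sigma>\<close> at the
  2-cell \<open>act2 M \<alpha> (inv \<tau>)\<close>, acted on by \<sigma>.\<close>

lemma kappa_natural:
  assumes \<alpha>: "\<alpha> \<in> Cell2 M" and p: "\<sigma> permutes {..<arity M (dom2 M \<alpha>)}" "\<tau> permutes {..<arity M (dom2 M \<alpha>)}"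
  shows "vcomp N (kappa \<sigma> \<tau> (cod2 M \<alpha>)) (ext2 \<sigma> \<alpha>) = vcomp N (ext2 \<tau> \<alpha>) (kappa \<sigma> \<tau> (dom2 M \<alpha>))"
proof -
  let ?b = "\<tau> \<circ> inv \<sigma>" and ?\<beta> = "act2 M \<alpha> (inv \<tau>)"
  have b: "?b permutes {..<arity M (dom2 M \<alpha>)}" using p by (simp add: permutes_div)
  have e: "inv \<tau> \<circ> ?b = inv \<sigma>" "?b \<circ> \<sigma> = \<tau>"
    using p by (simp_all add: comp_assoc inv_comp_cancel permutes_inv_o)
  note cs = \<alpha> p b fsym_cell fc1_cell fc2_cell M.cell_simps N.act1_cell N.act2_cell permutes_inv M.act2_comp M.act1_comp e
  have "vcomp N (kappa \<sigma> \<tau> (cod2 M \<alpha>)) (ext2 \<sigma> \<alpha>)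
      = act2 N (vcomp N (fsym F ?b (cod2 M ?\<beta>)) (fc2 F (act2 M ?\<beta> ?b))) \<sigma>"
    by (subst N.act2_vcomp) (simp_all add: kappa_def ext2_def cs)
  also have "\<dots> = act2 N (vcomp N (act2 N (fc2 F ?\<beta>) ?b) (fsym F ?b (dom2 M ?\<beta>))) \<sigma>"
    using fsym_natural[of ?\<beta> ?b] by (simp add: cs)
  also have "\<dots> = vcomp N (act2 N (act2 N (fc2 F ?\<beta>) ?b) \<sigma>) (kappa \<sigma> \<tau> (dom2 M \<alpha>))"
    by (subst N.act2_vcomp) (simp_all add: kappa_def cs)
  also have "act2 N (act2 N (fc2 F ?\<beta>) ?b) \<sigma> = ext2 \<tau> \<alpha>"
    by (subst N.act2_comp) (simp_all add: ext2_def cs)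
  finally show ?thesis .
qed

end

section \<open>Compatibility of the extension with the operations\<close>

context ps_multifunctor
begin

text \<open>An action does not change the base: f\<rho> acted on by the inverse of \<sigma>\<rho> is
  f acted on by the inverse of \<sigma>. Only the final action in \<open>ext1\<close> sees \<rho>,
  which makes the extension strictly equivariant although F is not.\<close>

lemma ext1_act:
  assumes "f \<in> Cell1 M" "\<sigma> permutes {..<arity M f}" "\<rho> permutes {..<arity M f}"
  shows "ext1 (\<sigma> \<circ> \<rho>) (act1 M f \<rho>) = act1 N (ext1 \<sigma> f) \<rho>"
  using assms
  by (simp add: ext1_def inv_comp_permutes M.act1_comp permutes_compose permutes_inv inv_comp_cancel N.act1_comp
      fc1_cell M.act1_cell)

lemma ext2_act:
  assumes "\<alpha> \<in> Cell2 M" "\<sigma> permutes {..<arity M (dom2 M \<alpha>)}" "\<rho> permutes {..<arity M (dom2 M \<alpha>)}"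
  shows "ext2 (\<sigma> \<circ> \<rho>) (act2 M \<alpha> \<rho>) = act2 N (ext2 \<sigma> \<alpha>) \<rho>"
  using assms
  by (simp add: ext2_def inv_comp_permutes M.act2_comp permutes_compose permutes_inv inv_comp_cancel N.act2_comp
      fc1_cell fc2_cell M.act2_cell M.act1_cell M.dom2_Cell1)

lemma kappa_act:
  assumes "g \<in> Cell1 M" "\<sigma> permutes {..<arity M g}" "\<tau> permutes {..<arity M g}" "\<rho> permutes {..<arity M g}"
  shows "kappa (\<sigma> \<circ> \<rho>) (\<tau> \<circ> \<rho>) (act1 M g \<rho>) = act2 N (kappa \<sigma> \<tau> g) \<rho>"
  using assms permutes_div[OF assms(2,3)]
  by (simp add: kappa_def inv_comp_permutes M.act1_comp permutes_compose permutes_inv inv_comp_cancel N.act2_comp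
      fsym_cell fc1_cell M.act1_cell comp_assoc)

lemma ext2_id2: "f \<in> Cell1 M \<Longrightarrow> \<sigma> permutes {..<arity M f} \<Longrightarrow> ext2 \<sigma> (id2 M f) = id2 N (ext1 \<sigma> f)"
  by (simp add: ext1_def ext2_def M.act2_id2 permutes_inv M.act1_cell fc2_id2 fc1_cell N.act2_id2)

lemma ext2_vcomp:
  assumes "\<alpha> \<in> Cell2 M" "\<beta> \<in> Cell2 M" "dom2 M \<beta> = cod2 M \<alpha>" "\<sigma> permutes {..<arity M (dom2 M \<alpha>)}"
  shows "ext2 \<sigma> (vcomp M \<beta> \<alpha>) = vcomp N (ext2 \<sigma> \<beta>) (ext2 \<sigma> \<alpha>)"
  using assms
  by (simp add: ext2_def M.act2_vcomp permutes_inv fc2_vcomp M.cell_simps N.act2_vcomp fc2_cell fc1_cell)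

text \<open>Functoriality of the extension. After splitting both factors on the left, the factors in
  the middle are exchanged by \<open>kappa_natural\<close> at \<beta>.\<close>

lemma kappa_ext2_vcomp:
  assumes \<alpha>: "\<alpha> \<in> Cell2 M" and \<beta>: "\<beta> \<in> Cell2 M" and eq: "dom2 M \<beta> = cod2 M \<alpha>"
    and \<sigma>: "\<sigma> permutes {..<arity M (dom2 M \<alpha>)}" and \<tau>: "\<tau> permutes {..<arity M (dom2 M \<alpha>)}"
    and \<upsilon>: "\<upsilon> permutes {..<arity M (dom2 M \<alpha>)}"
  shows "vcomp N (kappa \<sigma> \<upsilon> (cod2 M \<beta>)) (ext2 \<sigma> (vcomp M \<beta> \<alpha>))
    = vcomp N (vcomp N (kappa \<tau> \<upsilon> (cod2 M \<beta>)) (ext2 \<tau> \<beta>)) (vcomp N (kappa \<sigma> \<tau> (cod2 M \<alpha>)) (ext2 \<sigma> \<alpha>))"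
proof -
  have ar: "arity M (dom2 M \<beta>) = arity M (dom2 M \<alpha>)" "arity M (cod2 M \<beta>) = arity M (dom2 M \<alpha>)"
    using \<alpha> \<beta> eq by (simp_all add: M.cod2_cell)
  define A B B' K0 K1 K2 where "A = ext2 \<sigma> \<alpha>" "B = ext2 \<sigma> \<beta>" "B' = ext2 \<tau> \<beta>" "K0 = kappa \<sigma> \<tau> (cod2 M \<alpha>)"
    "K1 = kappa \<sigma> \<tau> (cod2 M \<beta>)" "K2 = kappa \<tau> \<upsilon> (cod2 M \<beta>)"
  note defs = this
  have cells: "A \<in> Cell2 N" "B \<in> Cell2 N" "B' \<in> Cell2 N" "K0 \<in> Cell2 N" "K1 \<in> Cell2 N" "K2 \<in> Cell2 N"
    "dom2 N B = cod2 N A" "dom2 N K1 = cod2 N B" "dom2 N K2 = cod2 N K1" "dom2 N K0 = cod2 N A"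
    "dom2 N B' = cod2 N K0" "dom2 N K2 = cod2 N B'"
    using \<alpha> \<beta> eq \<sigma> \<tau> \<upsilon> ar by (simp_all add: defs ext2_cell kappa_cell M.cod2_cell)
  have "kappa \<sigma> \<upsilon> (cod2 M \<beta>) = vcomp N K2 K1"
    using kappa_comp[of "cod2 M \<beta>" \<sigma> \<tau> \<upsilon>] \<beta> \<sigma> \<tau> \<upsilon> ar by (simp add: defs M.cod2_cell)
  moreover have "ext2 \<sigma> (vcomp M \<beta> \<alpha>) = vcomp N B A"
    using ext2_vcomp[OF \<alpha> \<beta> eq \<sigma>] by (simp add: defs)
  moreover have nat: "vcomp N K1 B = vcomp N B' K0"
    using kappa_natural[OF \<beta>, of \<sigma> \<tau>] \<sigma> \<tau> ar eq by (simp add: defs)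
  moreover have "vcomp N (vcomp N K2 K1) (vcomp N B A) = vcomp N K2 (vcomp N (vcomp N K1 B) A)"
    using cells by (simp add: N.vcomp_assoc N.vcomp_cell)
  moreover have "vcomp N K2 (vcomp N (vcomp N B' K0) A) = vcomp N (vcomp N K2 B') (vcomp N K0 A)"
    using cells by (simp add: N.vcomp_assoc N.vcomp_cell)
  ultimately show ?thesis by (simp add: defs)
qed

text \<open>The base of the composite is the composite of the bases by \<open>unact1\<close>, F
  preserves it, and equivariance in N distributes the permutation back over the factors.\<close>

lemma ext1_gamma:
  assumes c: "composable1 M f gs" and \<sigma>: "\<sigma> permutes {..<length gs}" and \<rho>s: "perms (map (arity M) gs) \<rho>s"
  shows "ext1 (block_perm \<sigma> (map (arity M) gs) \<rho>s) (gamma1 M f gs)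
    = gamma1 N (ext1 \<sigma> f) (map2 (\<lambda>g \<rho>. ext1 \<rho> g) gs \<rho>s)"
proof -
  let ?f = "act1 M f (inv \<sigma>)" and ?gs = "map2 (act1 M) gs (map inv \<rho>s)"
  note u = M.unact1[OF c \<sigma> \<rho>s]
  have map: "map (fc1 F) (permute_list (inv \<sigma>) ?gs) = permute_list (inv \<sigma>) (map (fc1 F) ?gs)"
    using \<sigma> u(2) by (intro permute_list_map[symmetric]) (simp add: permutes_inv)
  have c': "composable1 N (fc1 F ?f) (permute_list (inv \<sigma>) (map (fc1 F) ?gs))"
    using composable1_map[OF u(1)] by (simp only: map)
  have ks: "map (arity N) (map (fc1 F) ?gs) = map (arity M) gs"
    unfolding u(4)[symmetric] using u(3) by (auto simp: fc1_cell subset_iff)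
  have "ext1 (block_perm \<sigma> (map (arity M) gs) \<rho>s) (gamma1 M f gs)
    = act1 N (gamma1 N (fc1 F ?f) (permute_list (inv \<sigma>) (map (fc1 F) ?gs))) (block_perm \<sigma> (map (arity M) gs) \<rho>s)"
    using map_gamma1[OF u(1)] by (simp only: ext1_def u(5) map)
  also have "\<dots> = gamma1 N (act1 N (fc1 F ?f) \<sigma>) (map2 (act1 N) (map (fc1 F) ?gs) \<rho>s)"
    using N.gamma1_equivariant[OF c', of \<rho>s] \<sigma> \<rho>s u(2) ks by (simp del: map_map)
  also have "map2 (act1 N) (map (fc1 F) ?gs) \<rho>s = map2 (\<lambda>g \<rho>. ext1 \<rho> g) gs \<rho>s"
    using list_all2_lengthD[OF \<rho>s] by (auto simp: list_eq_iff_nth_eq ext1_def)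
  finally show ?thesis by (simp add: ext1_def)
qed

lemma ext2_gamma:
  assumes c: "composable2 M \<alpha> \<beta>s" and \<sigma>: "\<sigma> permutes {..<length \<beta>s}"
    and \<rho>s: "perms (map (\<lambda>\<beta>. arity M (dom2 M \<beta>)) \<beta>s) \<rho>s"
  shows "ext2 (block_perm \<sigma> (map (\<lambda>\<beta>. arity M (dom2 M \<beta>)) \<beta>s) \<rho>s) (gamma2 M \<alpha> \<beta>s)
    = gamma2 N (ext2 \<sigma> \<alpha>) (map2 (\<lambda>\<beta> \<rho>. ext2 \<rho> \<beta>) \<beta>s \<rho>s)"
proof -
  let ?\<alpha> = "act2 M \<alpha> (inv \<sigma>)" and ?\<beta>s = "map2 (act2 M) \<beta>s (map inv \<rho>s)"
  let ?ks = "map (\<lambda>\<beta>. arity M (dom2 M \<beta>)) \<beta>s"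
  note u = M.unact2[OF c \<sigma> \<rho>s]
  have map: "map (fc2 F) (permute_list (inv \<sigma>) ?\<beta>s) = permute_list (inv \<sigma>) (map (fc2 F) ?\<beta>s)"
    using \<sigma> u(2) by (intro permute_list_map[symmetric]) (simp add: permutes_inv)
  have c': "composable2 N (fc2 F ?\<alpha>) (permute_list (inv \<sigma>) (map (fc2 F) ?\<beta>s))"
    using composable2_map[OF u(1)] by (simp only: map)
  have ks: "map (\<lambda>\<beta>. arity N (dom2 N \<beta>)) (map (fc2 F) ?\<beta>s) = ?ks"
    unfolding u(4)[symmetric] using u(3) by (auto simp: fc1_cell fc2_cell M.dom2_Cell1 subset_iff)
  have "ext2 (block_perm \<sigma> ?ks \<rho>s) (gamma2 M \<alpha> \<beta>s)
    = act2 N (gamma2 N (fc2 F ?\<alpha>) (permute_list (inv \<sigma>) (map (fc2 F) ?\<beta>s))) (block_perm \<sigma> ?ks \<rho>s)"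
    using map_gamma2[OF u(1)] by (simp only: ext2_def u(5) map)
  also have "\<dots> = gamma2 N (act2 N (fc2 F ?\<alpha>) \<sigma>) (map2 (act2 N) (map (fc2 F) ?\<beta>s) \<rho>s)"
    using N.gamma2_equivariant[OF c', of \<rho>s] \<sigma> \<rho>s u(2) ks by (simp del: map_map)
  also have "map2 (act2 N) (map (fc2 F) ?\<beta>s) \<rho>s = map2 (\<lambda>\<beta> \<rho>. ext2 \<rho> \<beta>) \<beta>s \<rho>s"
    using list_all2_lengthD[OF \<rho>s] by (auto simp: list_eq_iff_nth_eq ext2_def)
  finally show ?thesis by (simp add: ext2_def)
qed

text \<open>Let S and T be the two block permutations. By the composition law T \<circ>
  \<open>inv S\<close> is again a block permutation, with outer part \<tau> \<circ>
  \<open>inv \<sigma>\<close> and inner parts \<open>\<pi>s ! i \<circ> inv (\<rho>s ! i)\<close>.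
  So \<open>fsym_block\<close> evaluates the isomorphism of F there, and equivariance in N
  distributes the action by S.\<close>

lemma kappa_gamma:
  assumes c: "composable1 M g gs" and \<sigma>: "\<sigma> permutes {..<length gs}" and \<tau>: "\<tau> permutes {..<length gs}"
    and \<rho>s: "perms (map (arity M) gs) \<rho>s" and \<pi>s: "perms (map (arity M) gs) \<pi>s"
  shows "kappa (block_perm \<sigma> (map (arity M) gs) \<rho>s) (block_perm \<tau> (map (arity M) gs) \<pi>s) (gamma1 M g gs)
    = gamma2 N (kappa \<sigma> \<tau> g) (map2 (\<lambda>g (\<rho>, \<pi>). kappa \<rho> \<pi> g) gs (zip \<rho>s \<pi>s))"
proof -
  let ?ks = "map (arity M) gs"
  let ?S = "block_perm \<sigma> ?ks \<rho>s" and ?T = "block_perm \<tau> ?ks \<pi>s" and ?\<upsilon> = "\<tau> \<circ> inv \<sigma>"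
  let ?g = "act1 M g (inv \<tau>)" and ?gs = "map2 (act1 M) gs (map inv \<pi>s)"
  let ?\<omega>s = "map2 (\<circ>) \<pi>s (map inv \<rho>s)"
  \<comment> \<open>The source blocks of T \<circ> \<open>inv S\<close> are the target blocks of S,
    hence the reordering by \<open>inv \<sigma>\<close>.\<close>
  let ?hs = "permute_list (inv \<sigma>) ?gs" and ?\<omega>s' = "permute_list (inv \<sigma>) ?\<omega>s"
  let ?xs = "map2 (\<lambda>g \<tau>. fsym F \<tau> g) ?gs ?\<omega>s"
  note u = M.unact1[OF c \<tau> \<pi>s]
  have len: "length \<rho>s = length gs" "length \<pi>s = length gs"
    using list_all2_lengthD[OF \<rho>s] list_all2_lengthD[OF \<pi>s] by simp_all
  have g: "g \<in> Cell1 M" "arity M g = length gs" and gs: "set gs \<subseteq> Cell1 M"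
    using c composable1_length[OF c] by (simp_all add: composable1_def)
  have \<upsilon>: "?\<upsilon> permutes {..<length gs}" using \<sigma> \<tau> by (rule permutes_div)
  have \<omega>s: "perms ?ks ?\<omega>s" using \<rho>s \<pi>s by (intro perms_comp perms_inv)
  have ks': "map (arity M) ?hs = permute_list (inv \<sigma>) ?ks"
    using \<sigma> u(2,4) by (simp add: permutes_inv flip: permute_list_map)
  have \<omega>s': "perms (map (arity M) ?hs) ?\<omega>s'"
    unfolding ks' using \<omega>s \<sigma> by (intro perms_permute_list) (simp_all add: permutes_inv)
  have hs: "permute_list (inv ?\<upsilon>) ?hs = permute_list (inv \<tau>) ?gs"
  proof -
    have "permute_list (inv ?\<upsilon>) ?hs = permute_list (inv \<sigma> \<circ> inv ?\<upsilon>) ?gs"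
      using \<upsilon> u(2) by (intro permute_list_compose[symmetric]) (simp add: permutes_inv)
    also have "inv \<sigma> \<circ> inv ?\<upsilon> = inv \<tau>"
      using \<sigma> \<tau> inv_comp_permutes[OF \<tau> permutes_inv[OF \<sigma>]] by (simp add: inv_comp_cancel permutes_inv_inv)
    finally show ?thesis .
  qed
  have lhs: "length ?hs = length gs" using u(2) by simp
  have c': "composable1 M ?g (permute_list (inv ?\<upsilon>) ?hs)"
    using u(1) by (simp only: hs)
  \<comment> \<open>It is easier to multiply the expected quotient by S and obtain T than to compute
    the inverse of S as a block permutation.\<close>
  have "block_perm ?\<upsilon> (permute_list (inv \<sigma>) ?ks) ?\<omega>s' \<circ> ?S = block_perm (?\<upsilon> \<circ> \<sigma>) ?ks (map2 (\<circ>) ?\<omega>s \<rho>s)"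
    using \<upsilon> \<sigma> \<omega>s \<rho>s by (intro block_perm_comp) simp_all
  also have "map2 (\<circ>) ?\<omega>s \<rho>s = \<pi>s"
  proof -
    have "inv (\<rho>s ! i) \<circ> \<rho>s ! i = id" if "i < length gs" for i
      using permutes_inv_o(2)[OF perms_nth[OF \<rho>s]] that by simp
    then show ?thesis using len by (auto simp: list_eq_iff_nth_eq comp_assoc)
  qed
  also have "?\<upsilon> \<circ> \<sigma> = \<tau>"
    using \<sigma> by (simp add: comp_assoc permutes_inv_o)
  finally have "block_perm ?\<upsilon> (permute_list (inv \<sigma>) ?ks) ?\<omega>s' \<circ> (?S \<circ> inv ?S) = ?T \<circ> inv ?S"
    by (simp only: comp_assoc[symmetric])
  moreover have S: "?S permutes {..<sum_list ?ks}"
    using \<sigma> \<rho>s by (intro block_perm_permutes) simp_all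
  ultimately have TS: "?T \<circ> inv ?S = block_perm ?\<upsilon> (map (arity M) ?hs) ?\<omega>s'"
    by (simp add: permutes_inv_o ks')
  have xs: "map2 (\<lambda>g \<tau>. fsym F \<tau> g) ?hs ?\<omega>s' = permute_list (inv \<sigma>) ?xs"
    using \<sigma> u(2) len by (intro map2_permute_list) (simp_all add: permutes_inv)
  have lxs: "length ?xs = length gs" using u(2) len by simp
  have cxs: "composable2 N (fsym F ?\<upsilon> ?g) (permute_list (inv \<sigma>) ?xs)"
    using composable2_fsym_block[OF c' _ \<omega>s'] \<upsilon> lhs by (simp only: xs)
  have arx: "map (\<lambda>\<beta>. arity N (dom2 N \<beta>)) ?xs = ?ks"
  proof -
    have "\<omega>s ! j permutes {..<arity M (gs ! j)}" if "perms ?ks \<omega>s" "j < length gs" for \<omega>s j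
      using perms_nth[OF that(1)] that(2) by simp
    note p = this[OF \<omega>s] this[OF \<pi>s]
    have "gs ! j \<in> Cell1 M" if "j < length gs" for j using gs that by auto
    with p show ?thesis
      using len u(2) by (auto simp: list_eq_iff_nth_eq fsym_cell fc1_cell M.act1_cell permutes_inv)
  qed
  have "kappa ?S ?T (gamma1 M g gs) = act2 N (fsym F (block_perm ?\<upsilon> (map (arity M) ?hs) ?\<omega>s') (gamma1 M ?g (permute_list (inv ?\<upsilon>) ?hs))) ?S"
    by (simp only: kappa_def u(5) TS hs)
  also have "\<dots> = act2 N (gamma2 N (fsym F ?\<upsilon> ?g) (permute_list (inv \<sigma>) ?xs)) ?S"
    using fsym_block[OF c' _ \<omega>s'] \<upsilon> lhs by (simp only: xs)
  also have "\<dots> = gamma2 N (act2 N (fsym F ?\<upsilon> ?g) \<sigma>) (map2 (act2 N) ?xs \<rho>s)"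
    using N.gamma2_equivariant[OF cxs, of \<rho>s] \<sigma> \<rho>s lxs by (simp only: arx)
  also have "map2 (act2 N) ?xs \<rho>s = map2 (\<lambda>g (\<rho>, \<pi>). kappa \<rho> \<pi> g) gs (zip \<rho>s \<pi>s)"
    using len u(2) by (auto simp: list_eq_iff_nth_eq kappa_def)
  finally show ?thesis by (simp only: kappa_def)
qed

text \<open>A 2-cell (\<alpha>, \<sigma> \<rightarrow> \<tau>) is factored through the target of
  \<alpha> at \<sigma>: \<alpha> is applied at constant \<sigma>, followed by the change of
  permutation. By \<open>kappa_natural\<close> the other order would give the same value.\<close>

definition extension :: "('o \<times> unit, 'm \<times> perm1, 'c \<times> perm1 \<times> perm1, 'p, 'n, 'd) mfun" where
  "extension = \<lparr>fob = (\<lambda>a\<in>Ob M.P. fob F (fst a)), fc1 = (\<lambda>x\<in>Cell1 M.P. ext1 (snd (snd x)) (fst x)),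
     fc2 = (\<lambda>\<delta>\<in>Cell2 M.P. vcomp N (kappa (snd (fst (snd \<delta>))) (snd (snd (snd \<delta>))) (cod2 M (fst \<delta>)))
       (ext2 (snd (fst (snd \<delta>))) (fst \<delta>)))\<rparr>"

lemma extension_simps:
  "a \<in> Ob M.P \<Longrightarrow> fob extension a = fob F (fst a)"
  "x \<in> Cell1 M.P \<Longrightarrow> fc1 extension x = ext1 (snd (snd x)) (fst x)"
  "\<delta> \<in> Cell2 M.P \<Longrightarrow> fc2 extension \<delta> = vcomp N (kappa (snd (fst (snd \<delta>))) (snd (snd (snd \<delta>))) (cod2 M (fst \<delta>)))
     (ext2 (snd (fst (snd \<delta>))) (fst \<delta>))"
  by (simp_all only: extension_def mfun.simps restrict_apply if_True)

lemma extension_gamma1: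
  assumes c: "composable1 M.P x ys"
  shows "fc1 extension (gamma1 M.P x ys) = gamma1 N (fc1 extension x) (map (fc1 extension) ys)"
proof -
  interpret P: cat_multicategory M.P by (rule M.cat_multicategory_P)
  let ?gs = "map fst ys" and ?\<rho>s = "map snd (map snd ys)"
  have x: "x \<in> Cell1 M.P" and ys: "set ys \<subseteq> Cell1 M.P" and cM: "composable1 M (fst x) ?gs"
    using c by (simp_all only: composable1_prod)
  have len: "length ys = arity M (fst x)" using composable1_length[OF cM] by simp
  have nth: "ys ! i \<in> Cell1 M.P" if "i < length ys" for i by (rule subsetD[OF ys nth_mem[OF that]])
  have cells: "snd (snd (ys ! i)) permutes {..<arity M (fst (ys ! i))}" "fst (snd (ys ! i)) = arity M (fst (ys ! i))"
    if "i < length ys" for i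
    using nth[OF that] by (auto simp: prod_eq_iff)
  have ks: "map fst (map snd ys) = map (arity M) ?gs" using cells by (auto simp: list_eq_iff_nth_eq)
  have \<rho>s: "perms (map (arity M) ?gs) ?\<rho>s"
    using cells by (simp add: list_all2_conv_all_nth)
  have \<sigma>: "snd (snd x) permutes {..<length ?gs}" using x len by simp
  have "fc1 extension (gamma1 M.P x ys) = ext1 (block_perm (snd (snd x)) (map (arity M) ?gs) ?\<rho>s) (gamma1 M (fst x) ?gs)"
    using P.gamma1_cell(1)[OF c] by (simp only: extension_simps) (simp add: ES_gamma_def ks del: map_map)
  also have "\<dots> = gamma1 N (ext1 (snd (snd x)) (fst x)) (map2 (\<lambda>g \<rho>. ext1 \<rho> g) ?gs ?\<rho>s)"
    by (rule ext1_gamma[OF cM \<sigma> \<rho>s])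
  also have "map2 (\<lambda>g \<rho>. ext1 \<rho> g) ?gs ?\<rho>s = map (fc1 extension) ys"
    using nth by (auto simp: list_eq_iff_nth_eq extension_simps simp del: prod_multicat_simps)
  finally show ?thesis using x by (simp only: extension_simps)
qed

text \<open>Each of the two factors of the extension commutes with \<gamma>, by
  \<open>ext2_gamma\<close> and \<open>kappa_gamma\<close>; interchange joins them again.\<close>

lemma extension_gamma2:
  assumes c: "composable2 M.P \<delta> \<epsilon>s"
  shows "fc2 extension (gamma2 M.P \<delta> \<epsilon>s) = gamma2 N (fc2 extension \<delta>) (map (fc2 extension) \<epsilon>s)"
proof -
  interpret P: cat_multicategory M.P by (rule M.cat_multicategory_P)
  let ?\<alpha> = "fst \<delta>" and ?\<beta>s = "map fst \<epsilon>s" and ?\<sigma> = "snd (fst (snd \<delta>))" and ?\<tau> = "snd (snd (snd \<delta>))"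
  let ?\<rho>s = "map snd (map fst (map snd \<epsilon>s))" and ?\<pi>s = "map snd (map snd (map snd \<epsilon>s))"
  let ?ks = "map (\<lambda>\<beta>. arity M (dom2 M \<beta>)) ?\<beta>s" and ?gs = "map (cod2 M) ?\<beta>s"
  have \<delta>: "\<delta> \<in> Cell2 M.P" and \<epsilon>s: "set \<epsilon>s \<subseteq> Cell2 M.P" and cM: "composable2 M ?\<alpha> ?\<beta>s"
    using c by (simp_all only: composable2_prod)
  have len: "length \<epsilon>s = arity M (dom2 M ?\<alpha>)" using composable2_length[OF cM] by simp
  have nth: "\<epsilon>s ! i \<in> Cell2 M.P" if "i < length \<epsilon>s" for i by (rule subsetD[OF \<epsilon>s nth_mem[OF that]])
  have cells: "fst (\<epsilon>s ! i) \<in> Cell2 M" "snd (fst (snd (\<epsilon>s ! i))) permutes {..<arity M (dom2 M (fst (\<epsilon>s ! i)))}"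
    "snd (snd (snd (\<epsilon>s ! i))) permutes {..<arity M (dom2 M (fst (\<epsilon>s ! i)))}"
    "fst (fst (snd (\<epsilon>s ! i))) = arity M (dom2 M (fst (\<epsilon>s ! i)))" "fst (snd (snd (\<epsilon>s ! i))) = arity M (dom2 M (fst (\<epsilon>s ! i)))"
    if "i < length \<epsilon>s" for i
    using nth[OF that] by (auto simp: prod_eq_iff)
  have ks: "map fst (map fst (map snd \<epsilon>s)) = ?ks" "map fst (map snd (map snd \<epsilon>s)) = ?ks" "map (arity M) ?gs = ?ks"
    using cells by (auto simp: list_eq_iff_nth_eq M.cod2_cell)
  have \<rho>s: "perms ?ks ?\<rho>s" and \<pi>s: "perms ?ks ?\<pi>s"
    using cells by (simp_all add: list_all2_conv_all_nth)
  have \<alpha>: "?\<alpha> \<in> Cell2 M" "?\<sigma> permutes {..<arity M (dom2 M ?\<alpha>)}" "?\<tau> permutes {..<arity M (dom2 M ?\<alpha>)}"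
    using M.P_Cell2_decomp(2-4)[OF \<delta>] .
  have \<sigma>: "?\<sigma> permutes {..<length ?\<beta>s}" and \<tau>: "?\<tau> permutes {..<length ?\<beta>s}"
    using \<alpha> len by simp_all
  let ?Es = "map2 (\<lambda>\<beta> \<rho>. ext2 \<rho> \<beta>) ?\<beta>s ?\<rho>s" and ?Ks = "map2 (\<lambda>g (\<rho>, \<pi>). kappa \<rho> \<pi> g) ?gs (zip ?\<rho>s ?\<pi>s)"
  let ?S = "block_perm ?\<sigma> ?ks ?\<rho>s" and ?T = "block_perm ?\<tau> ?ks ?\<pi>s"
  have E: "ext2 ?S (gamma2 M ?\<alpha> ?\<beta>s) = gamma2 N (ext2 ?\<sigma> ?\<alpha>) ?Es"
    by (rule ext2_gamma[OF cM \<sigma> \<rho>s])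
  have K: "kappa ?S ?T (gamma1 M (cod2 M ?\<alpha>) ?gs) = gamma2 N (kappa ?\<sigma> ?\<tau> (cod2 M ?\<alpha>)) ?Ks"
    using kappa_gamma[OF M.composable2_cod2[OF cM], of ?\<sigma> ?\<tau> ?\<rho>s ?\<pi>s] \<sigma> \<tau> \<rho>s \<pi>s by (simp only: ks length_map)
  have cE: "composable2 N (ext2 ?\<sigma> ?\<alpha>) ?Es"
  proof -
    have "map (fob F) (map (\<lambda>\<beta>. tgt M (dom2 M \<beta>)) ?\<beta>s) = map (fob F) (src M (dom2 M ?\<alpha>))"
      using cM by (simp only: composable2_def)
    moreover have "map (\<lambda>\<beta>. tgt N (dom2 N \<beta>)) ?Es = map (fob F) (map (\<lambda>\<beta>. tgt M (dom2 M \<beta>)) ?\<beta>s)"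
      using cells by (auto simp: list_eq_iff_nth_eq ext2_cell ext1_cell M.dom2_Cell1)
    moreover have "set ?Es \<subseteq> Cell2 N"
      using cells by (auto simp: in_set_conv_nth ext2_cell)
    ultimately show ?thesis
      using \<alpha> by (simp add: composable2_def ext2_cell ext1_cell M.dom2_Cell1 del: map_map set_map)
  qed
  have Ks: "set ?Ks \<subseteq> Cell2 N" "map (dom2 N) ?Ks = map (cod2 N) ?Es"
    using cells by (auto simp: in_set_conv_nth list_eq_iff_nth_eq ext2_cell kappa_cell M.cod2_cell)
  have KE: "dom2 N (kappa ?\<sigma> ?\<tau> (cod2 M ?\<alpha>)) = cod2 N (ext2 ?\<sigma> ?\<alpha>)" "kappa ?\<sigma> ?\<tau> (cod2 M ?\<alpha>) \<in> Cell2 N"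
    using \<alpha> by (simp_all add: kappa_cell ext2_cell M.cod2_cell)
  have "fc2 extension (gamma2 M.P \<delta> \<epsilon>s) = vcomp N (kappa ?S ?T (gamma1 M (cod2 M ?\<alpha>) ?gs)) (ext2 ?S (gamma2 M ?\<alpha> ?\<beta>s))"
    using P.gamma2_cell(1)[OF c] M.gamma2_cell(3)[OF cM]
    by (simp only: extension_simps) (simp add: ES_gamma_def ks del: map_map)
  also have "\<dots> = gamma2 N (vcomp N (kappa ?\<sigma> ?\<tau> (cod2 M ?\<alpha>)) (ext2 ?\<sigma> ?\<alpha>)) (map2 (vcomp N) ?Ks ?Es)"
    unfolding E K
    by (rule N.gamma2_vcomp[symmetric, OF cE N.composable2_next[OF cE KE(2) Ks(1) KE(1) Ks(2)] KE(1) Ks(2)])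
  also have "map2 (vcomp N) ?Ks ?Es = map (fc2 extension) \<epsilon>s"
    using nth by (auto simp: list_eq_iff_nth_eq extension_simps simp del: prod_multicat_simps)
  finally show ?thesis using \<delta> by (simp only: extension_simps)
qed

lemma sym_multifunctor_extension: "sym_multifunctor M.P N extension"
proof -
  interpret P: cat_multicategory M.P by (rule M.cat_multicategory_P)
  have c1: "fst x \<in> Cell1 M" "snd (snd x) permutes {..<arity M (fst x)}" if "x \<in> Cell1 M.P" for x
    using that by auto
  note c2 = M.P_Cell2_decomp(2-4)
  have srcs: "map (fob extension) (src M.P x) = map (fob F) (src M (fst x))" if "x \<in> Cell1 M.P" for x
  proof -
    have "map (fob extension) (src M.P x) = map (\<lambda>a. fob F (fst a)) (src M.P x)"
      using P.src_Ob[OF that] by (auto simp: extension_simps subset_iff simp del: prod_multicat_simps)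
    also have "\<dots> = map (fob F) (map fst (src M.P x))" by simp
    also have "map fst (src M.P x) = src M (fst x)" using that by simp
    finally show ?thesis .
  qed
  have tgts: "fob extension (tgt M.P x) = fob F (tgt M (fst x))" if "x \<in> Cell1 M.P" for x
    using P.tgt_Ob[OF that] by (simp only: extension_simps) simp
  have ns: "nonsym_multifunctor M.P N extension"
  proof (rule nonsym_multifunctorI)
    show "fob extension \<in> Ob M.P \<rightarrow>\<^sub>E Ob N"
      by (auto simp: extension_def fob_Ob)
    show "fc1 extension \<in> extensional (Cell1 M.P)" "fc2 extension \<in> extensional (Cell2 M.P)"
      by (simp_all only: extension_def mfun.simps restrict_extensional)
  next
    fix x assume x: "x \<in> Cell1 M.P"
    show "fc1 extension x \<in> Cell1 N" "src N (fc1 extension x) = map (fob extension) (src M.P x)"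
      "tgt N (fc1 extension x) = fob extension (tgt M.P x)"
      using x c1[OF x] by (simp_all only: srcs tgts) (simp_all only: extension_simps ext1_cell)
    show "fc2 extension (id2 M.P x) = id2 N (fc1 extension x)"
      using c1[OF x] x P.id2_cell(1)[OF x]
      by (simp only: extension_simps)
        (simp add: ext2_id2 kappa_self M.id2_cell ext1_cell N.vcomp_id2_id2)
  next
    fix \<delta> assume \<delta>: "\<delta> \<in> Cell2 M.P"
    note c = c2[OF \<delta>] M.cod2_cell[OF c2(1)[OF \<delta>]]
    show "fc2 extension \<delta> \<in> Cell2 N" "dom2 N (fc2 extension \<delta>) = fc1 extension (dom2 M.P \<delta>)"
      "cod2 N (fc2 extension \<delta>) = fc1 extension (cod2 M.P \<delta>)"
      using \<delta> c P.dom2_Cell1[OF \<delta>] P.cod2_cell(1)[OF \<delta>]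
      by (simp_all only: extension_simps) (simp_all add: N.vcomp_cell kappa_cell ext2_cell)
  next
    fix \<delta> \<epsilon> assume \<delta>: "\<delta> \<in> Cell2 M.P" and \<epsilon>: "\<epsilon> \<in> Cell2 M.P" and eq: "dom2 M.P \<epsilon> = cod2 M.P \<delta>"
    let ?\<sigma> = "snd (fst (snd \<delta>))" and ?\<tau> = "snd (snd (snd \<delta>))" and ?\<upsilon> = "snd (snd (snd \<epsilon>))"
    let ?\<alpha> = "fst \<delta>" and ?\<beta> = "fst \<epsilon>"
    have e: "dom2 M ?\<beta> = cod2 M ?\<alpha>" "snd (fst (snd \<epsilon>)) = ?\<tau>" using eq by simp_all
    note c = c2[OF \<delta>] c2[OF \<epsilon>] M.cod2_cell[OF c2(1)[OF \<delta>]]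
    have "fc2 extension (vcomp M.P \<epsilon> \<delta>) = vcomp N (kappa ?\<sigma> ?\<upsilon> (cod2 M ?\<beta>)) (ext2 ?\<sigma> (vcomp M ?\<beta> ?\<alpha>))"
      using P.vcomp_cell(1)[OF \<delta> \<epsilon> eq] M.vcomp_cell(3)[OF c(1,4) e(1)] by (simp only: extension_simps) simp
    also have "\<dots> = vcomp N (vcomp N (kappa ?\<tau> ?\<upsilon> (cod2 M ?\<beta>)) (ext2 ?\<tau> ?\<beta>)) (vcomp N (kappa ?\<sigma> ?\<tau> (cod2 M ?\<alpha>)) (ext2 ?\<sigma> ?\<alpha>))"
      using c e by (intro kappa_ext2_vcomp) simp_all
    finally show "fc2 extension (vcomp M.P \<epsilon> \<delta>) = vcomp N (fc2 extension \<epsilon>) (fc2 extension \<delta>)"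
      using \<delta> \<epsilon> by (simp only: extension_simps e)
  next
    fix a assume a: "a \<in> Ob M.P"
    then have "fst a \<in> Ob M" by auto
    then show "fc1 extension (unit1 M.P a) = unit1 N (fob extension a)"
      using a P.unit1_cell(1)[OF a]
      by (simp only: extension_simps)
        (simp add: ext1_def M.act1_id M.unit1_cell map_unit1 N.act1_id N.unit1_cell fob_Ob)
  qed (simp_all only: M.cat_multicategory_P N.cat_multicategory_axioms extension_gamma1 extension_gamma2)
  show ?thesis
  proof (intro sym_multifunctor.intro sym_multifunctor_axioms.intro ns)
    fix x \<rho> assume x: "x \<in> Cell1 M.P" and \<rho>: "\<rho> permutes {..<arity M.P x}"
    then show "fc1 extension (act1 M.P x \<rho>) = act1 N (fc1 extension x) \<rho>"
      using P.act1_cell(1)[OF x \<rho>] ext1_act[of "fst x" "snd (snd x)" \<rho>]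
      by (simp only: extension_simps) simp
  next
    fix \<delta> \<rho> assume \<delta>: "\<delta> \<in> Cell2 M.P" and \<rho>: "\<rho> permutes {..<arity M.P (dom2 M.P \<delta>)}"
    let ?\<sigma> = "snd (fst (snd \<delta>))" and ?\<tau> = "snd (snd (snd \<delta>))"
    note c = c2[OF \<delta>] M.cod2_cell[OF c2(1)[OF \<delta>]]
    have \<rho>': "\<rho> permutes {..<arity M (dom2 M (fst \<delta>))}" using \<rho> \<delta> by simp
    have "fc2 extension (act2 M.P \<delta> \<rho>)
        = vcomp N (kappa (?\<sigma> \<circ> \<rho>) (?\<tau> \<circ> \<rho>) (act1 M (cod2 M (fst \<delta>)) \<rho>)) (ext2 (?\<sigma> \<circ> \<rho>) (act2 M (fst \<delta>) \<rho>))"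
      using P.act2_cell(1)[OF \<delta> \<rho>] c \<rho>' by (simp only: extension_simps) (simp add: M.act2_cell)
    also have "\<dots> = act2 N (vcomp N (kappa ?\<sigma> ?\<tau> (cod2 M (fst \<delta>))) (ext2 ?\<sigma> (fst \<delta>))) \<rho>"
      using c \<rho>' by (simp add: kappa_act ext2_act N.act2_vcomp kappa_cell ext2_cell ext1_cell M.dom2_Cell1)
    finally show "fc2 extension (act2 M.P \<delta> \<rho>) = act2 N (fc2 extension \<delta>) \<rho>"
      using \<delta> by (simp only: extension_simps)
  qed
qed

end

section \<open>Precomposition with the universal multifunctor\<close>

context cat_multicategory
begin

definition precomp1 :: "('p, 'n, 'd) multicat \<Rightarrow>
    ('o \<times> unit, 'm \<times> perm1, 'c \<times> perm1 \<times> perm1, 'p, 'n, 'd) mfun \<Rightarrow> ('o, 'm, 'c, 'p, 'n, 'd) psfun" where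
  "precomp1 N G = ps_comp M N (sym_to_ps P N G) eta"

definition precomp2 :: "('p, 'n, 'd) multicat \<Rightarrow>
    (('o \<times> unit, 'm \<times> perm1, 'c \<times> perm1 \<times> perm1, 'p, 'n, 'd) mfun, 'o \<times> unit, 'n) mtrans \<Rightarrow>
    (('o, 'm, 'c, 'p, 'n, 'd) psfun, 'o, 'n) mtrans" where
  "precomp2 N t = ps_hcomp M N (sym_to_ps_trans P N t) (trans_id M P eta)"

lemma ps_multifunctor_precomp1: "sym_multifunctor P N G \<Longrightarrow> ps_multifunctor M N (precomp1 N G)"
  unfolding precomp1_def by (rule ps_multifunctor_comp[OF ps_multifunctor_eta ps_multifunctor_sym_to_ps])

text \<open>As a pseudo symmetric multifunctor G has identity isomorphisms, so they drop out of the
  composite and G applied to \<open>fsym eta\<close> remains.\<close>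

lemma precomp1_simps:
  assumes G: "sym_multifunctor P N G"
  shows "a \<in> Ob M \<Longrightarrow> fob (precomp1 N G) a = fob G (a, ())"
    "f \<in> Cell1 M \<Longrightarrow> fc1 (precomp1 N G) f = fc1 G (fc1 eta f)"
    "\<alpha> \<in> Cell2 M \<Longrightarrow> fc2 (precomp1 N G) \<alpha> = fc2 G (fc2 eta \<alpha>)"
    "f \<in> Cell1 M \<Longrightarrow> \<sigma> permutes {..<arity M f} \<Longrightarrow> fsym (precomp1 N G) \<sigma> f = fc2 G (fsym eta \<sigma> f)"
proof -
  interpret G: sym_multifunctor P N G by fact
  interpret eta: ps_multifunctor M P eta by (rule ps_multifunctor_eta)
  note c = is_comp_simps[OF is_comp_ps_comp, of _ M N "sym_to_ps P N G" eta]
  show "a \<in> Ob M \<Longrightarrow> fob (precomp1 N G) a = fob G (a, ())" by (simp add: precomp1_def c)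
  show "f \<in> Cell1 M \<Longrightarrow> fc1 (precomp1 N G) f = fc1 G (fc1 eta f)"
    "\<alpha> \<in> Cell2 M \<Longrightarrow> fc2 (precomp1 N G) \<alpha> = fc2 G (fc2 eta \<alpha>)"
    by (simp_all only: precomp1_def c sym_to_ps_simps)
  show "fsym (precomp1 N G) \<sigma> f = fc2 G (fsym eta \<sigma> f)" if f: "f \<in> Cell1 M" "\<sigma> permutes {..<arity M f}"
  proof -
    have e: "fc1 eta f \<in> Cell1 P" "\<sigma> permutes {..<arity P (fc1 eta f)}"
      using eta.fc1_cell[OF f(1)] f(2) by simp_all
    have "fsym (precomp1 N G) \<sigma> f = vcomp N (id2 N (fc1 G (act1 P (fc1 eta f) \<sigma>))) (fc2 G (fsym eta \<sigma> f))"
      using f e by (simp only: precomp1_def fsym_ps_comp fsym_sym_to_ps sym_to_ps_simps)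
    then show ?thesis
      using G.N.vcomp_id2(1)[of "fc2 G (fsym eta \<sigma> f)"] G.fc2_cell[OF eta.fsym_cell(1)[OF f]] eta.fsym_cell(3)[OF f]
      by simp
  qed
qed

lemma fc1_from_precomp1:
  assumes G: "sym_multifunctor P N G" and x: "x \<in> Cell1 P"
  shows "fc1 G x = act1 N (fc1 (precomp1 N G) (base x)) (snd (snd x))"
proof -
  interpret G: sym_multifunctor P N G by fact
  interpret eta: ps_multifunctor M P eta by (rule ps_multifunctor_eta)
  note d = P_Cell1_decomp[OF x]
  have "fc1 G x = fc1 G (act1 P (fc1 eta (base x)) (snd (snd x)))" by (simp only: d)
  also have "\<dots> = act1 N (fc1 G (fc1 eta (base x))) (snd (snd x))"
    using eta.fc1_cell[OF d(2)] d(3,4) by (intro G.map_act1) simp_all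
  finally show ?thesis by (simp only: precomp1_simps[OF G] d(2))
qed

text \<open>The typing of the two factors of a 2-cell of the product, needed both for recovering G
  on 2-cells and for lifting transformations.\<close>

lemma P_Cell2_decomp_cells:
  assumes \<delta>: "\<delta> \<in> Cell2 P"
  defines "\<sigma> \<equiv> snd (fst (snd \<delta>))" and "\<tau> \<equiv> snd (snd (snd \<delta>))"
  defines "h \<equiv> act1 M (cod2 M (fst \<delta>)) (inv \<tau>)" and "\<beta> \<equiv> act2 M (fst \<delta>) (inv \<sigma>)"
  shows "h \<in> Cell1 M" "\<tau> \<circ> inv \<sigma> permutes {..<arity M h}" "\<beta> \<in> Cell2 M" "\<sigma> permutes {..<arity M (dom2 M \<beta>)}"
    "dom2 P (fsym eta (\<tau> \<circ> inv \<sigma>) h) = cod2 P (fc2 eta \<beta>)" "arity M h = arity M (dom2 M \<beta>)"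
  using P_Cell2_decomp(2-4)[OF \<delta>]
  by (simp_all add: h_def \<beta>_def flip: \<sigma>_def \<tau>_def)
    (simp_all add: cell_simps permutes_inv permutes_compose act1_comp permutes_inv_o flip: comp_assoc)

text \<open>G is applied to the decomposition of \<delta>. It preserves vertical composition and,
  being symmetric, the action by \<sigma> strictly, so only values on the image of
  \<open>eta\<close> and of \<open>fsym eta\<close> remain.\<close>

lemma fc2_from_precomp1:
  assumes G: "sym_multifunctor P N G" and \<delta>: "\<delta> \<in> Cell2 P"
  defines "\<sigma> \<equiv> snd (fst (snd \<delta>))" and "\<tau> \<equiv> snd (snd (snd \<delta>))"
  shows "fc2 G \<delta> = vcomp N (act2 N (fsym (precomp1 N G) (\<tau> \<circ> inv \<sigma>) (act1 M (cod2 M (fst \<delta>)) (inv \<tau>))) \<sigma>)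
    (act2 N (fc2 (precomp1 N G) (act2 M (fst \<delta>) (inv \<sigma>))) \<sigma>)"
proof -
  interpret G: sym_multifunctor P N G by fact
  interpret eta: ps_multifunctor M P eta by (rule ps_multifunctor_eta)
  let ?h = "act1 M (cod2 M (fst \<delta>)) (inv \<tau>)" and ?\<beta> = "act2 M (fst \<delta>) (inv \<sigma>)"
  note c = P_Cell2_decomp_cells[OF \<delta>, folded \<sigma>_def \<tau>_def]
  let ?s = "fsym eta (\<tau> \<circ> inv \<sigma>) ?h" and ?b = "fc2 eta ?\<beta>"
  have s: "?s \<in> Cell2 P" and b: "?b \<in> Cell2 P" "dom2 P ?b = fc1 eta (dom2 M ?\<beta>)" and eq: "dom2 P ?s = cod2 P ?b"
    by (rule eta.fsym_cell(1)[OF c(1,2)], rule eta.fc2_cell(1)[OF c(3)], rule eta.fc2_cell(2)[OF c(3)], rule c(5))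
  have \<sigma>b: "\<sigma> permutes {..<arity P (dom2 P ?b)}"
    using c(4) eta.fc1_cell(2)[OF dom2_Cell1[OF c(3)]] by (simp only: b(2) length_map)
  have \<sigma>s: "\<sigma> permutes {..<arity P (dom2 P ?s)}"
    using \<sigma>b G.M.cod2_cell(2)[OF b(1)] by (simp only: eq)
  have "fc2 G \<delta> = fc2 G (vcomp P (act2 P ?s \<sigma>) (act2 P ?b \<sigma>))"
    using P_Cell2_decomp(1)[OF \<delta>] by (simp only: \<sigma>_def \<tau>_def flip: P_Cell2_decomp(1))
  also have "\<dots> = vcomp N (fc2 G (act2 P ?s \<sigma>)) (fc2 G (act2 P ?b \<sigma>))"
    using s b(1) \<sigma>s \<sigma>b eq by (intro G.fc2_vcomp) (simp_all only: G.M.act2_cell)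
  also have "\<dots> = vcomp N (act2 N (fc2 G ?s) \<sigma>) (act2 N (fc2 G ?b) \<sigma>)"
    by (simp only: G.map_act2[OF s \<sigma>s] G.map_act2[OF b(1) \<sigma>b])
  finally show ?thesis
    by (simp only: precomp1_simps(4)[OF G c(1,2)] precomp1_simps(3)[OF G c(3)])
qed

lemma precomp1_inject:
  assumes G: "sym_multifunctor P N G" and H: "sym_multifunctor P N H" and eq: "precomp1 N G = precomp1 N H"
  shows "G = H"
proof -
  interpret G: sym_multifunctor P N G by fact
  interpret H: sym_multifunctor P N H by fact
  have "fob G a = fob H a" if "a \<in> Ob P" for a
    using that precomp1_simps(1)[OF G, of "fst a"] precomp1_simps(1)[OF H, of "fst a"] eq by (cases a) auto
  then have "fob G = fob H"
    using G.funcsets(4) H.funcsets(4) by (intro extensionalityI)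
  moreover have "fc1 G = fc1 H"
    using G.fc1_ext H.fc1_ext by (rule extensionalityI) (simp only: fc1_from_precomp1[OF G] fc1_from_precomp1[OF H] eq)
  moreover have "fc2 G = fc2 H"
    using G.fc2_ext H.fc2_ext by (rule extensionalityI) (simp only: fc2_from_precomp1[OF G] fc2_from_precomp1[OF H] eq)
  ultimately show ?thesis by simp
qed

text \<open>At the permutation \<open>id\<close> the functions \<open>ext1\<close> and
  \<open>ext2\<close> are F itself and \<open>kappa id id\<close> is an identity. At
  \<open>fsym eta \<sigma> f\<close> the extension takes the value \<open>kappa id \<sigma>\<close>
  over f\<sigma>, and removing \<sigma> from f\<sigma> leaves
  \<open>fsym F \<sigma> f\<close>.\<close>

lemma precomp1_extension:
  assumes F: "ps_multifunctor M N F"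
  shows "precomp1 N (ps_multifunctor.extension M N F) = F"
proof -
  interpret F: ps_multifunctor M N F by fact
  interpret eta: ps_multifunctor M P eta by (rule ps_multifunctor_eta)
  note G = F.sym_multifunctor_extension
  interpret T: ps_multifunctor M N "precomp1 N F.extension" by (rule ps_multifunctor_precomp1[OF G])
  have id: "F.ext1 id f = fc1 F f" if "f \<in> Cell1 M" for f
    using that by (simp add: F.ext1_def act1_id F.fc1_cell F.N.act1_id)
  have id': "F.ext2 id \<alpha> = fc2 F \<alpha>" if "\<alpha> \<in> Cell2 M" for \<alpha>
    using that by (simp add: F.ext2_def act2_id F.fc2_cell F.N.act2_id)
  show ?thesis
  proof (rule psfun_eqI[where M = M])
    show "fob (precomp1 N F.extension) = fob F"
      using T.funcsets(4) F.funcsets(4)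
      by (rule extensionalityI) (simp add: precomp1_simps[OF G] F.extension_simps)
    show "fc1 (precomp1 N F.extension) = fc1 F"
      using T.fc1_ext F.fc1_ext
    proof (rule extensionalityI)
      fix f assume f: "f \<in> Cell1 M"
      show "fc1 (precomp1 N F.extension) f = fc1 F f"
        using eta.fc1_cell(1)[OF f] f by (simp only: precomp1_simps[OF G] F.extension_simps) (simp add: id)
    qed
    show "fc2 (precomp1 N F.extension) = fc2 F"
      using T.fc2_ext F.fc2_ext
    proof (rule extensionalityI)
      fix \<alpha> assume \<alpha>: "\<alpha> \<in> Cell2 M"
      show "fc2 (precomp1 N F.extension) \<alpha> = fc2 F \<alpha>"
        using eta.fc2_cell(1)[OF \<alpha>] \<alpha> F.N.vcomp_id2(1)[of "fc2 F \<alpha>"]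
        by (simp only: precomp1_simps[OF G] F.extension_simps)
          (simp add: id id' F.kappa_self permutes_id cod2_cell F.fc2_cell)
    qed
  next
    fix \<sigma> f assume f: "f \<in> Cell1 M" and \<sigma>: "\<sigma> permutes {..<arity M f}"
    have "fc2 F.extension (fsym eta \<sigma> f) = vcomp N (F.kappa id \<sigma> (act1 M f \<sigma>)) (F.ext2 id (id2 M (act1 M f \<sigma>)))"
      using eta.fsym_cell(1)[OF f \<sigma>] f \<sigma> by (simp only: F.extension_simps) (simp add: id2_cell act1_cell)
    also have "F.ext2 id (id2 M (act1 M f \<sigma>)) = id2 N (fc1 F (act1 M f \<sigma>))"
      using f \<sigma> by (simp add: id' id2_cell act1_cell F.fc2_id2)
    also have "F.kappa id \<sigma> (act1 M f \<sigma>) = fsym F \<sigma> f"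
      using f \<sigma> by (simp add: F.kappa_def act1_inv F.fsym_cell F.N.act2_id)
    finally show "fsym (precomp1 N F.extension) \<sigma> f = fsym F \<sigma> f"
      using F.N.vcomp_id2(2)[of "fsym F \<sigma> f"] f \<sigma> by (simp only: precomp1_simps[OF G]) (simp add: F.fsym_cell)
  qed (erule T.fsym_ext, erule F.fsym_ext)
qed

text \<open>The component of the whiskered transformation is composed with the image of a unit,
  which is a unit because multifunctors preserve units.\<close>

lemma precomp2_simps:
  assumes t: "sym_multinatural P N t"
  shows "tdom (precomp2 N t) = precomp1 N (tdom t)" "tcod (precomp2 N t) = precomp1 N (tcod t)"
    "a \<in> Ob M \<Longrightarrow> tcomp (precomp2 N t) a = tcomp t (a, ())"
proof -
  interpret G: sym_multifunctor P N "tdom t" using t by (simp add: sym_multinatural_def)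
  show "tdom (precomp2 N t) = precomp1 N (tdom t)" "tcod (precomp2 N t) = precomp1 N (tcod t)"
    by (simp_all add: precomp2_def precomp1_def)
  show "tcomp (precomp2 N t) a = tcomp t (a, ())" if a: "a \<in> Ob M"
  proof -
    have a': "(a, ()) \<in> Ob P" using a by simp
    have u: "unit1 P (a, ()) \<in> Cell1 P" using G.M.unit1_cell(1)[OF a'] .
    have "tcomp (precomp2 N t) a = gamma1 N (tcomp t (a, ())) [fc1 (tdom t) (unit1 P (a, ()))]"
      using a by (simp add: precomp2_def hcomp_components_def)
    also have "\<dots> = tcomp t (a, ())"
      using G.N.gamma1_unit_right[of "tcomp t (a, ())"] transformation_cell[OF sym_multinatural_transformation[OF t] a']
      by (simp only: G.map_unit1[OF a'] list.map)
    finally show ?thesis .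
  qed
qed

text \<open>By \<open>fc2_from_precomp1\<close> the value at \<delta> is a vertical composite of two
  2-cells acted on by the same permutation. Naturality of \<theta> gives a square for one of them
  and \<open>respects_fsym\<close> for the other, and squares survive actions and vertical
  composition. This is where the additional condition on pseudo symmetric transformations
  enters.\<close>

lemma multinatural_lift:
  assumes G: "sym_multifunctor P N G" and H: "sym_multifunctor P N H"
    and \<theta>: "multinatural M N (precomp1 N G) (precomp1 N H) \<theta>"
    and \<theta>': "respects_fsym M N (precomp1 N G) (precomp1 N H) \<theta>"
  shows "multinatural P N G H (\<lambda>x\<in>Ob P. \<theta> (fst x))"
proof (rule multinaturalI[OF sym_multifunctor_nonsym[OF G] sym_multifunctor_nonsym[OF H]])
  interpret G: sym_multifunctor P N G by fact
  interpret \<theta>: multinatural M N "precomp1 N G" "precomp1 N H" \<theta> by fact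
  interpret TG: ps_multifunctor M N "precomp1 N G" by (rule ps_multifunctor_precomp1[OF G])
  interpret TH: ps_multifunctor M N "precomp1 N H" by (rule ps_multifunctor_precomp1[OF H])
  show "(\<lambda>x\<in>Ob P. \<theta> (fst x)) a \<in> Cell1 N" "src N ((\<lambda>x\<in>Ob P. \<theta> (fst x)) a) = [fob G a]"
    "tgt N ((\<lambda>x\<in>Ob P. \<theta> (fst x)) a) = fob H a" if "a \<in> Ob P" for a
    using that \<theta>.component_cell[of "fst a"] precomp1_simps(1)[OF G, of "fst a"] precomp1_simps(1)[OF H, of "fst a"]
    by (cases a; simp)+
  fix \<delta> assume \<delta>: "\<delta> \<in> Cell2 P"
  let ?\<sigma> = "snd (fst (snd \<delta>))" and ?\<tau> = "snd (snd (snd \<delta>))"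
  let ?h = "act1 M (cod2 M (fst \<delta>)) (inv ?\<tau>)" and ?\<beta> = "act2 M (fst \<delta>) (inv ?\<sigma>)" and ?\<rho> = "?\<tau> \<circ> inv ?\<sigma>"
  note c = P_Cell2_decomp_cells[OF \<delta>]
  note d = P_Cell2_decomp(2-4)[OF \<delta>]
  let ?as = "src M (dom2 M (fst \<delta>))" and ?b = "tgt M (dom2 M (fst \<delta>))"
  let ?as' = "permute_list (inv ?\<sigma>) ?as"
  have as: "set ?as \<subseteq> Ob M" "?b \<in> Ob M" using d by (simp_all add: src_Ob tgt_Ob dom2_Cell1)
  have \<beta>: "src M (dom2 M ?\<beta>) = ?as'" "tgt M (dom2 M ?\<beta>) = ?b"
    using d by (simp_all add: cell_simps permutes_inv)
  \<comment> \<open>Both cells are the target of \<open>fst \<delta>\<close> acted on by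
    \<open>inv ?\<sigma>\<close>; this gives the two squares the same inputs and makes them
    composable.\<close>
  have h\<rho>: "act1 M ?h ?\<rho> = cod2 M ?\<beta>"
    using d by (simp add: cell_simps permutes_inv act1_comp permutes_compose permutes_inv_o flip: comp_assoc)
  have h: "permute_list ?\<rho> (src M ?h) = ?as'" "tgt M ?h = ?b"
  proof -
    have "permute_list ?\<rho> (src M ?h) = src M (act1 M ?h ?\<rho>)" using c by (simp only: act1_cell)
    also note h\<rho>
    also have "src M (cod2 M ?\<beta>) = ?as'" using c(3) by (simp only: cod2_cell \<beta>)
    finally show "permute_list ?\<rho> (src M ?h) = ?as'" .
    show "tgt M ?h = ?b" using d by (simp add: cell_simps permutes_inv)
  qed
  have 1: "intertwines N (map \<theta> ?as') (\<theta> ?b) (fc2 (precomp1 N G) ?\<beta>) (fc2 (precomp1 N H) ?\<beta>)"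
    using multinatural_intertwines[OF TG.nonsym_multifunctor_axioms TH.nonsym_multifunctor_axioms \<theta> c(3)]
    by (simp only: \<beta>)
  have 2: "intertwines N (map \<theta> ?as') (\<theta> ?b) (fsym (precomp1 N G) ?\<rho> ?h) (fsym (precomp1 N H) ?\<rho> ?h)"
    using \<theta>'[unfolded respects_fsym_def, rule_format, OF c(1,2)] by (simp only: h)
  have len: "length (map \<theta> ?as') = arity M (dom2 M (fst \<delta>))" by simp
  have \<sigma>: "?\<sigma> permutes {..<length (map \<theta> ?as')}" using d by simp
  have unary: "arity N x = 1" if "x \<in> set (map \<theta> ?as')" for x
    using that d as by (auto simp: \<theta>.component_cell permutes_inv subset_iff)
  \<comment> \<open>Acting by \<open>?\<sigma>\<close> on the squares, whose inputs are in the order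
    of the bases, restores the inputs of \<delta>.\<close>
  have permute: "permute_list ?\<sigma> (map \<theta> ?as') = map \<theta> ?as"
    using d by (simp add: permute_list_map permutes_inv)
  have ar: "arity N (dom2 N (fsym T ?\<rho> ?h)) = length (map \<theta> ?as')"
    and eq: "dom2 N (act2 N (fsym T ?\<rho> ?h) ?\<sigma>) = cod2 N (act2 N (fc2 T ?\<beta>) ?\<sigma>)"
    if "ps_multifunctor M N T" for T
  proof -
    interpret T: ps_multifunctor M N T by fact
    have "dom2 N (fsym T ?\<rho> ?h) = fc1 T (cod2 M ?\<beta>)" using T.fsym_cell(2)[OF c(1,2)] by (simp only: h\<rho>)
    moreover from this show ar: "arity N (dom2 N (fsym T ?\<rho> ?h)) = length (map \<theta> ?as')"
      using c(3) by (simp add: T.fc1_cell cod2_cell \<beta>)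
    ultimately show "dom2 N (act2 N (fsym T ?\<rho> ?h) ?\<sigma>) = cod2 N (act2 N (fc2 T ?\<beta>) ?\<sigma>)"
      using c(3,4) T.fsym_cell(1)[OF c(1,2)] \<sigma>
      by (simp add: G.N.act2_cell T.fc2_cell T.fc1_cell dom2_Cell1 cod2_cell \<beta> del: length_map)
  qed
  have 3: "intertwines N (map \<theta> ?as) (\<theta> ?b) (act2 N (fc2 (precomp1 N G) ?\<beta>) ?\<sigma>) (act2 N (fc2 (precomp1 N H) ?\<beta>) ?\<sigma>)"
    using G.N.intertwines_act[OF 1 \<sigma> unary] c(3,4) d by (simp add: permute TG.fc2_cell TG.fc1_cell dom2_Cell1 \<beta>)
  have 4: "intertwines N (map \<theta> ?as) (\<theta> ?b) (act2 N (fsym (precomp1 N G) ?\<rho> ?h) ?\<sigma>) (act2 N (fsym (precomp1 N H) ?\<rho> ?h) ?\<sigma>)"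
    using G.N.intertwines_act[OF 2 \<sigma> unary ar[OF TG.ps_multifunctor_axioms]] by (simp only: permute)
  have "intertwines N (map \<theta> ?as) (\<theta> ?b) (fc2 G \<delta>) (fc2 H \<delta>)"
    unfolding fc2_from_precomp1[OF G \<delta>] fc2_from_precomp1[OF H \<delta>]
    by (rule G.N.intertwines_vcomp[OF 3 4 eq[OF TG.ps_multifunctor_axioms] eq[OF TH.ps_multifunctor_axioms]])
  moreover have "map (\<lambda>x\<in>Ob P. \<theta> (fst x)) (src P (dom2 P \<delta>)) = map \<theta> ?as"
  proof -
    have "set (src P (dom2 P \<delta>)) \<subseteq> Ob P" using \<delta> by (intro G.M.src_Ob G.M.dom2_Cell1)
    then have "map (\<lambda>x\<in>Ob P. \<theta> (fst x)) (src P (dom2 P \<delta>)) = map \<theta> (map fst (src P (dom2 P \<delta>)))"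
      by (simp only: map_restrict map_map o_def)
    also have "map fst (src P (dom2 P \<delta>)) = ?as" using \<delta> by simp
    finally show ?thesis .
  qed
  moreover have "(\<lambda>x\<in>Ob P. \<theta> (fst x)) (tgt P (dom2 P \<delta>)) = \<theta> ?b"
    using as by simp
  ultimately show "intertwines N (map (\<lambda>x\<in>Ob P. \<theta> (fst x)) (src P (dom2 P \<delta>)))
      ((\<lambda>x\<in>Ob P. \<theta> (fst x)) (tgt P (dom2 P \<delta>))) (fc2 G \<delta>) (fc2 H \<delta>)"
    by (simp only:)
qed (simp only: restrict_extensional)

text \<open>On objects, injectivity is recovery from the restriction and surjectivity is the
  extension. On arrows the components are unchanged up to the identification of a with (a, ()), so
  bijectivity reduces to that of the ends and to \<open>multinatural_lift\<close>.\<close>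

lemma precomp_isomorphism:
  assumes N: "cat_multicategory N"
  shows "cat_isomorphism (sym_hom P N) (ps_hom M N) (precomp1 N) (precomp2 N)"
proof (rule cat_isomorphismI)
  note P = cat_multicategory_P
  have "cat_functor (ps_hom P N) (ps_hom M N) (\<lambda>G. ps_comp M N G eta) (\<lambda>t. ps_hcomp M N t (Idn (ps_hom M P) eta))"
    by (rule cat_functor_fix_right[OF ps_comp_functor category_ps_hom category_ps_hom])
      (simp_all add: P N cat_multicategory_axioms ps_multifunctor_eta)
  from cat_functor_comp[OF sym_to_ps_functor[OF P N] this]
  show "cat_functor (sym_hom P N) (ps_hom M N) (precomp1 N) (precomp2 N)"
    by (simp add: precomp1_def[abs_def] precomp2_def[abs_def])
  show "bij_betw (precomp1 N) (Obj (sym_hom P N)) (Obj (ps_hom M N))"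
  proof (rule bij_betw_imageI)
    show "inj_on (precomp1 N) (Obj (sym_hom P N))"
      using precomp1_inject by (auto intro: inj_onI)
    show "precomp1 N ` Obj (sym_hom P N) = Obj (ps_hom M N)"
    proof (intro subset_antisym subsetI)
      fix F assume "F \<in> Obj (ps_hom M N)"
      then have F: "ps_multifunctor M N F" by simp
      show "F \<in> precomp1 N ` Obj (sym_hom P N)"
        using precomp1_extension[OF F] ps_multifunctor.sym_multifunctor_extension[OF F]
        by (intro image_eqI[of _ _ "ps_multifunctor.extension M N F"]) simp_all
    qed (auto simp: ps_multifunctor_precomp1)
  qed
  show "bij_betw (precomp2 N) (Arr (sym_hom P N)) (Arr (ps_hom M N))"
  proof (rule bij_betw_imageI)
    show "inj_on (precomp2 N) (Arr (sym_hom P N))"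
    proof (rule inj_onI)
      fix s t assume "s \<in> Arr (sym_hom P N)" "t \<in> Arr (sym_hom P N)" and eq: "precomp2 N s = precomp2 N t"
      then have s: "sym_multinatural P N s" and t: "sym_multinatural P N t" by simp_all
      note s' = s[unfolded sym_multinatural_def] and t' = t[unfolded sym_multinatural_def]
      show "s = t"
      proof (rule trans_eqI[where A = "Ob P"])
        show "tdom s = tdom t" "tcod s = tcod t"
          using s' t' eq precomp2_simps[OF s] precomp2_simps[OF t] by (auto intro: precomp1_inject)
        show "tcomp s \<in> extensional (Ob P)" "tcomp t \<in> extensional (Ob P)"
          using s' t' multinatural.comp_ext by blast+
        show "tcomp s a = tcomp t a" if "a \<in> Ob P" for a
          using that eq precomp2_simps(3)[OF s, of "fst a"] precomp2_simps(3)[OF t, of "fst a"] by (cases a) simp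
      qed
    qed
    show "precomp2 N ` Arr (sym_hom P N) = Arr (ps_hom M N)"
    proof (intro subset_antisym subsetI)
      fix \<theta> assume "\<theta> \<in> Arr (ps_hom M N)"
      then have \<theta>: "ps_multifunctor M N (tdom \<theta>)" "ps_multifunctor M N (tcod \<theta>)"
        "multinatural M N (tdom \<theta>) (tcod \<theta>) (tcomp \<theta>)" "respects_fsym M N (tdom \<theta>) (tcod \<theta>) (tcomp \<theta>)"
        by (simp_all add: ps_multinatural_iff)
      define G H where "G = ps_multifunctor.extension M N (tdom \<theta>)" "H = ps_multifunctor.extension M N (tcod \<theta>)"
      have G: "sym_multifunctor P N G" "precomp1 N G = tdom \<theta>" and H: "sym_multifunctor P N H" "precomp1 N H = tcod \<theta>"
        using \<theta> by (simp_all add: G_H_def ps_multifunctor.sym_multifunctor_extension precomp1_extension)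
      \<comment> \<open>The components of \<theta> are kept; only the ends are replaced by the
        extensions of its ends.\<close>
      let ?t = "\<lparr>tdom = G, tcod = H, tcomp = \<lambda>x\<in>Ob P. tcomp \<theta> (fst x)\<rparr>"
      have t: "sym_multinatural P N ?t"
        using multinatural_lift[OF G(1) H(1)] G H \<theta> by (simp add: sym_multinatural_def del: prod_multicat_simps)
      have "precomp2 N ?t = \<theta>"
      proof (rule trans_eqI[where A = "Ob M"])
        show "tcomp (precomp2 N ?t) \<in> extensional (Ob M)"
          by (simp add: precomp2_def)
        show "tcomp \<theta> \<in> extensional (Ob M)" using \<theta>(3) by (rule multinatural.comp_ext)
        show "tdom (precomp2 N ?t) = tdom \<theta>" "tcod (precomp2 N ?t) = tcod \<theta>"
          using precomp2_simps(1,2)[OF t] G H by simp_all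
        show "tcomp (precomp2 N ?t) a = tcomp \<theta> a" if "a \<in> Ob M" for a
          using precomp2_simps(3)[OF t that] that by simp
      qed
      then show "\<theta> \<in> precomp2 N ` Arr (sym_hom P N)"
        using t by (intro image_eqI[of _ _ ?t]) simp_all
    next
      fix \<theta> assume "\<theta> \<in> precomp2 N ` Arr (sym_hom P N)"
      then obtain t where t: "sym_multinatural P N t" "\<theta> = precomp2 N t" by auto
      have "ps_multinatural M P (trans_id M P eta)"
        using category.Idn_Arr[OF category_ps_hom[OF cat_multicategory_axioms P], of eta] ps_multifunctor_eta by simp
      with t show "\<theta> \<in> Arr (ps_hom M N)"
        by (simp add: precomp2_def ps_multinatural_hcomp ps_multinatural_sym_to_ps)
    qed
  qed
qed

end

section \<open>Renaming and the adjunction\<close>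

lemma cat_isomorphism_functor: "cat_isomorphism C D F F' \<Longrightarrow> cat_functor C D F F'"
  by (simp only: cat_isomorphism_def)

lemma cat_isomorphism_comp:
  assumes "cat_isomorphism C D F F'" "cat_isomorphism D E G G'"
  shows "cat_isomorphism C E (\<lambda>x. G (F x)) (\<lambda>t. G' (F' t))"
proof (rule cat_isomorphismI)
  show "cat_functor C E (\<lambda>x. G (F x)) (\<lambda>t. G' (F' t))"
    by (rule cat_functor_comp[of C D F F']) (use assms in \<open>simp_all only: cat_isomorphism_def\<close>)
  show "bij_betw (\<lambda>x. G (F x)) (Obj C) (Obj E)" "bij_betw (\<lambda>t. G' (F' t)) (Arr C) (Arr E)"
    using bij_betw_trans[OF cat_isomorphism_bij(1)[OF assms(1)] cat_isomorphism_bij(1)[OF assms(2)]]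
      bij_betw_trans[OF cat_isomorphism_bij(2)[OF assms(1)] cat_isomorphism_bij(2)[OF assms(2)]]
    by (simp_all add: o_def)
qed

lemma cat_functor_cong:
  assumes F: "cat_functor C D F F'" and eq: "\<And>x. x \<in> Obj C \<Longrightarrow> G x = F x" "\<And>t. t \<in> Arr C \<Longrightarrow> G' t = F' t"
  shows "cat_functor C D G G'"
proof -
  interpret cat_functor C D F F' by fact
  show ?thesis
    by unfold_locales
      (simp_all add: eq map_Obj map_Arr map_Dom map_Cod map_Idn map_Cmp C.Dom_Obj C.Cod_Obj C.Idn_Arr C.Cmp_Arr)
qed

lemma cat_isomorphism_cong:
  assumes F: "cat_isomorphism C D F F'" and eq: "\<And>x. x \<in> Obj C \<Longrightarrow> G x = F x" "\<And>t. t \<in> Arr C \<Longrightarrow> G' t = F' t"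
  shows "cat_isomorphism C D G G'"
proof (rule cat_isomorphismI)
  show "cat_functor C D G G'"
    using cat_isomorphism_functor[OF F] eq by (rule cat_functor_cong)
  show "bij_betw G (Obj C) (Obj D)"
    using bij_betw_cong[of "Obj C" G F "Obj D", OF eq(1)] cat_isomorphism_bij(1)[OF F] by simp
  show "bij_betw G' (Arr C) (Arr D)"
    using bij_betw_cong[of "Arr C" G' F' "Arr D", OF eq(2)] cat_isomorphism_bij(2)[OF F] by simp
qed

lemma cat_isomorphism_imp_isomorphic_cats:
  assumes F: "cat_isomorphism C D F F'"
  shows "isomorphic_cats D C"
  unfolding isomorphic_cats_def
  by (intro exI, rule cat_isomorphismI[OF cat_functor_inv[OF cat_isomorphism_functor[OF F] cat_isomorphism_bij[OF F]]
      cat_isomorphism_bij(1)[OF F, THEN bij_betw_inv_into] cat_isomorphism_bij(2)[OF F, THEN bij_betw_inv_into]])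

section \<open>Precomposition with an isomorphism of multicategories\<close>

lemma sym_precomp_functor:
  assumes "sym_multifunctor A B e" "cat_multicategory N"
  shows "cat_functor (sym_hom B N) (sym_hom A N) (\<lambda>G. sym_comp A G e) (\<lambda>t. sym_hcomp A N t (trans_id A B e))"
proof -
  interpret sym_multifunctor A B e by fact
  show ?thesis
    using cat_functor_fix_right[OF sym_comp_functor[of A B N] category_sym_hom category_sym_hom, of e] assms
      M.cat_multicategory_axioms N.cat_multicategory_axioms
    by simp
qed

lemma sym_multinatural_id: "sym_multifunctor M N F \<Longrightarrow> sym_multinatural M N (trans_id M N F)"
  by (simp add: sym_multinatural_def multinatural_id sym_multifunctor_nonsym)

lemma sym_hcomp_id:
  assumes F: "sym_multifunctor M N F" and G: "sym_multifunctor N Q G"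
  shows "sym_hcomp M Q (trans_id N Q G) (trans_id M N F) = trans_id M Q (sym_comp M G F)"
  by (rule trans_eqI[where A = "Ob M"])
    (simp_all add: hcomp_id[OF F[THEN sym_multifunctor_nonsym] G[THEN sym_multifunctor_nonsym]]
      is_comp_simps[OF is_comp_sym_comp])

lemma ps_hcomp_id:
  assumes F: "ps_multifunctor M N F" and G: "ps_multifunctor N Q G"
  shows "ps_hcomp M Q (trans_id N Q G) (trans_id M N F) = trans_id M Q (ps_comp M Q G F)"
  by (rule trans_eqI[where A = "Ob M"])
    (simp_all add: hcomp_id[OF F[THEN ps_multifunctor_nonsym] G[THEN ps_multifunctor_nonsym]]
      is_comp_simps[OF is_comp_ps_comp])

lemma ps_multinatural_id: "ps_multifunctor M N F \<Longrightarrow> ps_multinatural M N (trans_id M N F)"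
  by (simp add: ps_multinatural_iff multinatural_id ps_multifunctor_nonsym respects_fsym_id)

lemma sym_hcomp_unit_right:
  assumes "sym_multinatural M N t"
  shows "sym_hcomp M N t (trans_id M M (sym_id M)) = t"
  using assms sym_multinatural_transformation[OF assms]
  by (intro trans_eqI[where A = "Ob M"])
    (auto simp: sym_multinatural_def sym_comp_id multinatural.comp_ext sym_id_simps hcomp_unit_right)

text \<open>On 2-cells precomposition is whiskering, that is, horizontal composition with an
  identity transformation. Associativity and the composition of such identities reduce the inverse
  laws to those of e and d.\<close>

lemma sym_precomp_isomorphism:
  assumes e: "sym_multifunctor A B e" and d: "sym_multifunctor B A d"
    and de: "sym_comp A d e = sym_id A" and ed: "sym_comp B e d = sym_id B" and N: "cat_multicategory N"
  shows "cat_isomorphism (sym_hom B N) (sym_hom A N) (\<lambda>G. sym_comp A G e) (\<lambda>t. sym_hcomp A N t (trans_id A B e))"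
proof -
  have "sym_comp B (sym_comp A G e) d = G" if "sym_multifunctor B N G" for G
    using that by (simp add: sym_comp_assoc[OF d] ed sym_comp_id)
  moreover have "sym_comp A (sym_comp B G d) e = G" if "sym_multifunctor A N G" for G
    using that by (simp add: sym_comp_assoc[OF e] de sym_comp_id)
  moreover have "sym_hcomp B N (sym_hcomp A N t (trans_id A B e)) (trans_id B A d) = t" if t: "sym_multinatural B N t" for t
    using t by (simp add: sym_hcomp_assoc[OF sym_multinatural_id[OF d] sym_multinatural_id[OF e] t] sym_hcomp_id[OF d e] ed
        sym_hcomp_unit_right)
  moreover have "sym_hcomp A N (sym_hcomp B N t (trans_id B A d)) (trans_id A B e) = t" if t: "sym_multinatural A N t" for t
    using t by (simp add: sym_hcomp_assoc[OF sym_multinatural_id[OF e] sym_multinatural_id[OF d] t] sym_hcomp_id[OF e d] de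
        sym_hcomp_unit_right)
  ultimately show ?thesis
    unfolding cat_isomorphism_def
    using sym_precomp_functor[OF e N] sym_precomp_functor[OF d N]
    by (intro conjI exI[of _ "\<lambda>G. sym_comp B G d"] exI[of _ "\<lambda>t. sym_hcomp B N t (trans_id B A d)"]) simp_all
qed

section \<open>The renaming as an invertible symmetric multifunctor\<close>

context renaming
begin

definition encode :: "('o, 'm, 'c, 'p, 'n, 'd) mfun" where
  "encode = \<lparr>fob = (\<lambda>a\<in>Ob M. eo a), fc1 = (\<lambda>f\<in>Cell1 M. em f), fc2 = (\<lambda>\<alpha>\<in>Cell2 M. ec \<alpha>)\<rparr>"

definition decode :: "('p, 'n, 'd, 'o, 'm, 'c) mfun" where
  "decode = \<lparr>fob = (\<lambda>a\<in>Ob R. inv_into (Ob M) eo a), fc1 = (\<lambda>f\<in>Cell1 R. inv_into (Cell1 M) em f),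
     fc2 = (\<lambda>\<alpha>\<in>Cell2 R. inv_into (Cell2 M) ec \<alpha>)\<rparr>"

lemma encode_simps:
  "a \<in> Ob M \<Longrightarrow> fob encode a = eo a" "f \<in> Cell1 M \<Longrightarrow> fc1 encode f = em f" "\<alpha> \<in> Cell2 M \<Longrightarrow> fc2 encode \<alpha> = ec \<alpha>"
  "set as \<subseteq> Ob M \<Longrightarrow> map (fob encode) as = map eo as" "set gs \<subseteq> Cell1 M \<Longrightarrow> map (fc1 encode) gs = map em gs"
  "set \<beta>s \<subseteq> Cell2 M \<Longrightarrow> map (fc2 encode) \<beta>s = map ec \<beta>s"
  by (auto simp: encode_def subset_iff)

lemma decode_simps:
  "a \<in> Ob M \<Longrightarrow> fob decode (eo a) = a" "f \<in> Cell1 M \<Longrightarrow> fc1 decode (em f) = f" "\<alpha> \<in> Cell2 M \<Longrightarrow> fc2 decode (ec \<alpha>) = \<alpha>"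
  "set as \<subseteq> Ob M \<Longrightarrow> map (fob decode) (map eo as) = as" "set gs \<subseteq> Cell1 M \<Longrightarrow> map (fc1 decode) (map em gs) = gs"
  "set \<beta>s \<subseteq> Cell2 M \<Longrightarrow> map (fc2 decode) (map ec \<beta>s) = \<beta>s"
  using inj_eo inj_em inj_ec by (auto simp: decode_def R_carriers subset_iff intro!: map_idI)

lemma sym_multifunctor_encode: "sym_multifunctor M R encode"
proof (intro sym_multifunctor.intro sym_multifunctor_axioms.intro nonsym_multifunctorI)
  show "fc1 encode (gamma1 M f gs) = gamma1 R (fc1 encode f) (map (fc1 encode) gs)" if "composable1 M f gs" for f gs
    using that by (simp add: composable1_Cell1 encode_simps R_gamma gamma1_cell del: map_map)
  show "fc2 encode (gamma2 M \<alpha> \<beta>s) = gamma2 R (fc2 encode \<alpha>) (map (fc2 encode) \<beta>s)" if "composable2 M \<alpha> \<beta>s" for \<alpha> \<beta>s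
    using that by (simp add: composable2_Cell2 encode_simps R_gamma gamma2_cell del: map_map)
  show "fob encode \<in> Ob M \<rightarrow>\<^sub>E Ob R" "fc1 encode \<in> extensional (Cell1 M)" "fc2 encode \<in> extensional (Cell2 M)"
    by (auto simp: encode_def R_carriers)
qed (simp_all add: encode_simps R_simps R_carriers cell_simps src_Ob tgt_Ob cat_multicategory_R cat_multicategory_axioms)

lemma sym_multifunctor_decode: "sym_multifunctor R M decode"
proof (intro sym_multifunctor.intro sym_multifunctor_axioms.intro nonsym_multifunctorI)
  fix f' gs' assume "composable1 R f' gs'"
  then show "fc1 decode (gamma1 R f' gs') = gamma1 M (fc1 decode f') (map (fc1 decode) gs')"
    by (elim composable1_RE) (simp add: composable1_Cell1 decode_simps R_gamma gamma1_cell del: map_map)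
next
  fix \<alpha>' \<beta>s' assume "composable2 R \<alpha>' \<beta>s'"
  then show "fc2 decode (gamma2 R \<alpha>' \<beta>s') = gamma2 M (fc2 decode \<alpha>') (map (fc2 decode) \<beta>s')"
    by (elim composable2_RE) (simp add: composable2_Cell2 decode_simps R_gamma gamma2_cell del: map_map)
next
  show "fob decode \<in> Ob R \<rightarrow>\<^sub>E Ob M"
    using inj_eo by (auto simp: decode_def R_carriers)
  show "fc1 decode \<in> extensional (Cell1 R)" "fc2 decode \<in> extensional (Cell2 R)"
    by (simp_all add: decode_def)
qed (auto simp: decode_simps R_simps R_carriers cell_simps src_Ob tgt_Ob cat_multicategory_R cat_multicategory_axioms
    em_eq_iff simp del: map_map)

lemma decode_encode: "sym_comp M decode encode = sym_id M"
  using inj_eo inj_em inj_ec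
  by (auto simp: sym_comp_def sym_id_def encode_def decode_def compose_def R_carriers fun_eq_iff)

lemma encode_decode: "sym_comp R encode decode = sym_id R"
  using inj_eo inj_em inj_ec
  by (auto simp: sym_comp_def sym_id_def encode_def decode_def compose_def R_carriers fun_eq_iff)

end

text \<open>The conditions do not mention the cells of M: the same three maps serve every M of these
  types, as one 2-functor has to be defined on all of them at once.\<close>

locale Barratt_Eccles_renaming = cat_multicategory M for M :: "('o, 'm, 'c) multicat" +
  fixes eo :: "'o \<times> unit \<Rightarrow> 'p" and em :: "'m \<times> perm1 \<Rightarrow> 'n" and ec :: "'c \<times> perm1 \<times> perm1 \<Rightarrow> 'd"
  assumes inj_eo: "inj eo" and inj_em: "inj_on em (UNIV \<times> Cell1 ES)" and inj_ec: "inj_on ec (UNIV \<times> Cell2 ES)"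
begin

sublocale ren: renaming P eo em ec
proof (intro renaming.intro renaming_axioms.intro cat_multicategory_P)
  show "inj_on eo (Ob P)" using inj_eo by (rule inj_on_subset) simp
  show "inj_on em (Cell1 P)" using inj_em by (rule inj_on_subset) auto
  show "inj_on ec (Cell2 P)" using inj_ec by (rule inj_on_subset) auto
qed

definition unit_arrow :: "('o, 'm, 'c, 'p, 'n, 'd) psfun" where
  "unit_arrow = ps_comp M ren.R (sym_to_ps P ren.R ren.encode) eta"

lemma ps_multifunctor_unit_arrow: "ps_multifunctor M ren.R unit_arrow"
  unfolding unit_arrow_def
  by (rule ps_multifunctor_comp[OF ps_multifunctor_eta ps_multifunctor_sym_to_ps[OF ren.sym_multifunctor_encode]])

text \<open>Composition with the unit arrow factors as precomposition with the isomorphism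
  \<open>encode\<close> followed by precomposition with \<open>eta\<close>. Associativity of
  composition and strict functoriality of the inclusion identify the two descriptions.\<close>

lemma unit_arrow_universal:
  assumes N: "cat_multicategory N"
  shows "cat_isomorphism (sym_hom ren.R N) (ps_hom M N) (\<lambda>h. ps_comp M N (sym_to_ps ren.R N h) unit_arrow)
    (\<lambda>t. ps_hcomp M N (sym_to_ps_trans ren.R N t) (trans_id M ren.R unit_arrow))"
proof (rule cat_isomorphism_cong)
  note e = ren.sym_multifunctor_encode
  note e' = ps_multifunctor_sym_to_ps[OF e]
  show "cat_isomorphism (sym_hom ren.R N) (ps_hom M N) (\<lambda>G. precomp1 N (sym_comp P G ren.encode))
      (\<lambda>t. precomp2 N (sym_hcomp P N t (trans_id P ren.R ren.encode)))"
    by (rule cat_isomorphism_comp[OF sym_precomp_isomorphism[OF e ren.sym_multifunctor_decode ren.decode_encode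
            ren.encode_decode N] precomp_isomorphism[OF N]])
  show "ps_comp M N (sym_to_ps ren.R N h) unit_arrow = precomp1 N (sym_comp P h ren.encode)"
    if "h \<in> Obj (sym_hom ren.R N)" for h
  proof -
    have h: "sym_multifunctor ren.R N h" using that by simp
    show ?thesis
      by (simp only: unit_arrow_def precomp1_def sym_to_ps_comp[OF e h]
          ps_comp_assoc[OF ps_multifunctor_eta e' ps_multifunctor_sym_to_ps[OF h]])
  qed
  show "ps_hcomp M N (sym_to_ps_trans ren.R N t) (trans_id M ren.R unit_arrow)
      = precomp2 N (sym_hcomp P N t (trans_id P ren.R ren.encode))"
    if "t \<in> Arr (sym_hom ren.R N)" for t
  proof -
    have t: "sym_multinatural ren.R N t" using that by simp
    have id: "sym_to_ps_trans P ren.R (trans_id P ren.R ren.encode) = trans_id P ren.R (sym_to_ps P ren.R ren.encode)"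
      by (rule trans_eqI[where A = "Ob P"]) simp_all
    show ?thesis
      by (simp only: precomp2_def sym_to_ps_hcomp[OF sym_multinatural_id[OF e] t] id
          ps_hcomp_assoc[OF ps_multinatural_id[OF ps_multifunctor_eta] ps_multinatural_id[OF e']
            ps_multinatural_sym_to_ps[OF t]]
          ps_hcomp_id[OF ps_multifunctor_eta e'] unit_arrow_def)
  qed
qed

end

theorem theorem1p3:
  fixes eo :: "'o \<times> unit \<Rightarrow> 'o"
    and em :: "'m \<times> perm1 \<Rightarrow> 'm"
    and ec :: "'c \<times> (perm1 \<times> perm1) \<Rightarrow> 'c"
  assumes "inj eo"
    and "inj_on em (UNIV \<times> Cell1 ES)"
    and "inj_on ec (UNIV \<times> Cell2 ES)"
  shows "(\<exists>\<psi>. left_two_adjoint Cat_Multicat_ps Cat_Multicat \<psi> inclusion_j \<and>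
            (\<forall>M. cat_multicategory M \<longrightarrow>
               on0 \<psi> M = rename_multicat eo em ec (prod_multicat M ES)))
       \<and> (\<forall>(M :: ('o1, 'm1, 'c1) multicat) (N :: ('o2, 'm2, 'c2) multicat).
            cat_multicategory M \<longrightarrow> cat_multicategory N \<longrightarrow>
            isomorphic_cats (ps_hom M N) (sym_hom (prod_multicat M ES) N))"
proof
  have BE: "Barratt_Eccles_renaming M eo em ec" if "cat_multicategory M" for M
    using that assms by (simp add: Barratt_Eccles_renaming_def Barratt_Eccles_renaming_axioms_def)
  \<comment> \<open>The renamed product is prescribed as the object part, so the resulting adjoint
    has it as its value by definition.\<close>
  interpret U: universal_arrows Cat_Multicat_ps Cat_Multicat inclusion_j
    "\<lambda>M. rename_multicat eo em ec (prod_multicat M ES)" "\<lambda>M. Barratt_Eccles_renaming.unit_arrow M eo em ec"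
  proof (intro universal_arrows.intro universal_arrows_axioms.intro two_functor_inclusion_j)
    fix M :: "('o, 'm, 'c) multicat" assume "M \<in> Obj0 Cat_Multicat_ps"
    then interpret Barratt_Eccles_renaming M eo em ec by (intro BE) simp
    show "rename_multicat eo em ec (prod_multicat M ES) \<in> Obj0 Cat_Multicat"
      using ren.cat_multicategory_R by simp
    show "unit_arrow \<in> Obj (Hom Cat_Multicat_ps M (on0 inclusion_j (rename_multicat eo em ec (prod_multicat M ES))))"
      using ps_multifunctor_unit_arrow by simp
    fix N :: "('o, 'm, 'c) multicat" assume "N \<in> Obj0 Cat_Multicat"
    then show "cat_isomorphism (Hom Cat_Multicat (rename_multicat eo em ec (prod_multicat M ES)) N)
        (Hom Cat_Multicat_ps M (on0 inclusion_j N))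
        (\<lambda>h. Comp1 Cat_Multicat_ps M (on0 inclusion_j (rename_multicat eo em ec (prod_multicat M ES))) (on0 inclusion_j N)
          (on1 inclusion_j (rename_multicat eo em ec (prod_multicat M ES)) N h) unit_arrow)
        (\<lambda>t. Comp2 Cat_Multicat_ps M (on0 inclusion_j (rename_multicat eo em ec (prod_multicat M ES))) (on0 inclusion_j N)
          (on2 inclusion_j (rename_multicat eo em ec (prod_multicat M ES)) N t)
          (Idn (Hom Cat_Multicat_ps M (on0 inclusion_j (rename_multicat eo em ec (prod_multicat M ES)))) unit_arrow))"
      using unit_arrow_universal by simp
  qed
  show "\<exists>\<psi>. left_two_adjoint Cat_Multicat_ps Cat_Multicat \<psi> inclusion_j \<and>
      (\<forall>M. cat_multicategory M \<longrightarrow> on0 \<psi> M = rename_multicat eo em ec (prod_multicat M ES))"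
    using U.left_two_adjoint_L by (intro exI[of _ U.L]) simp
  show "\<forall>(M :: ('o1, 'm1, 'c1) multicat) (N :: ('o2, 'm2, 'c2) multicat).
      cat_multicategory M \<longrightarrow> cat_multicategory N \<longrightarrow>
      isomorphic_cats (ps_hom M N) (sym_hom (prod_multicat M ES) N)"
    \<comment> \<open>Here the product is not renamed, so the types of M and N are independent; the
      isomorphism is the inverse of precomposition with \<open>eta\<close>.\<close>
    using cat_isomorphism_imp_isomorphic_cats[OF cat_multicategory.precomp_isomorphism] by blast
qed

end
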